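(* For a given orthonormal basis $(\vec{\mathbf e}_1,\vec{\mathbf e}_2)$, we have the identity $$\omega_\star^{ac}=-2\exp(-2i\gamma_\star)\,\zeta_\star^{ac}=-2(\cos2\gamma_\star-i\sin2\gamma_\star)\,\zeta_\star^{ac},$$ where, for $x\in\mathfrak S_\star\setminus\mathfrak E_\star$, $\gamma_\star(x)\in[-\frac\pi2,\frac\pi2]$ denotes the angle between $\vec{\mathbf e}_1$ and $\vec e_x$.
   Context: $\Omega\subset\mathbb R^2$ is a smooth bounded domain. $V:\mathbb R^k\to\mathbb R$ ($k\ge1$) is smooth with $\inf V=0$ and satisfies: (1) the zero set $\Sigma=\{V=0\}$ is finite with at least two elements; (2) $\nabla^2V(\sigma)$ is positive definite at each $\sigma\in\Sigma$; (3) there are $\alpha_\infty,R_\infty>0$ with $y\cdot\nabla V(y)\ge\alpha_\infty|y|^2$ if $|y|>R_\infty$, and $V(y)\to+\infty$ as $|y|\to+\infty$. Set $e_\varepsilon(u)=\varepsilon\frac{|\nabla u|^2}{2}+\frac1\varepsilon V(u)$ and $E_\varepsilon(u)=\int_\Omega e_\varepsilon(u)dx$. $D^2(x,r)$ is the open disk of center $x$ and radius $r$. Let $M_0>0$, $\varepsilon_n\in(0,1]$, $\varepsilon_n\to0$, and let $u_{\varepsilon_n}\in H^1(\Omega,\mathbb R^k)$ be solutions of $-\Delta u_{\varepsilon_n}=-\varepsilon_n^{-2}\nabla_uV(u_{\varepsilon_n})$ in $\Omega$ with $E_{\varepsilon_n}(u_{\varepsilon_n})\le M_0$. Passing to a subsequence,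 weakly as measures on $\Omega$: $e_{\varepsilon_n}(u_{\varepsilon_n})dx\rightharpoonup\nu_\star$, $\frac{V(u_{\varepsilon_n})}{\varepsilon_n}dx\rightharpoonup\zeta_\star$ and, in coordinates relative to the orthonormal basis $(\vec{\mathbf e}_1,\vec{\mathbf e}_2)$, $\varepsilon_n\,\partial_{x_i}u_{\varepsilon_n}\cdot\partial_{x_j}u_{\varepsilon_n}\,dx\rightharpoonup\mu_{\star,i,j}$. Let $\eta_1>0$ be a constant depending only on $V$ with the clearing-out property (such a constant exists): for every sequence $\tilde\varepsilon_n\in(0,1]$ with $\tilde\varepsilon_n\to0$, all solutions $v_n\in H^1(\Omega,\mathbb R^k)$ of $-\Delta v_n=-\tilde\varepsilon_n^{-2}\nabla_uV(v_n)$ in $\Omega$ with $\sup_nE_{\tilde\varepsilon_n}(v_n)<+\infty$, and every measure $\nu$ on $\Omega$ such that $e_{\tilde\varepsilon_n}(v_n)dx\rightharpoonup\nu$ weakly as measures on $\Omega$, if $D^2(x_0,r)\subset\Omega$ and $\nu(\overline{D^2(x_0,r)})<\eta_1r$, then $\nu(\overline{D^2(x_0,r/2)})=0$. The concentration set is $\mathfrak S_\star=\{x\in\Omega:\liminf_{r\to0}\nu_\star(\overline{D^2(x,r)})/r\ge\eta_1\}$; it is closed in $\Omega$, $1$-rectifiable and of finite $\mathcal H^1$ measure, and $\nu_\star$ vanishes outside it. (Closed disks are understood intersected with $\Omega$.) Put $\lambda=\mathcal H^1\llcorner\mathfrak S_\star$. Superscripts $ac$ and $s$ denote the absolutely continuous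 and singular parts with respect to $\lambda$, and $\omega_\star^{ac}=(\mu_{\star,1,1}^{ac}-\mu_{\star,2,2}^{ac})-2i\,\mu_{\star,1,2}^{ac}$. Write $\nu_\star^{ac}=\mathbf e_\star\lambda$, $\zeta_\star^{ac}=\Theta_\star\lambda$, $\mu_{\star,i,j}^{ac}=m_{\star,i,j}\lambda$. $\mathfrak E_\star=\mathfrak A_\star\cup\mathfrak B_\star\cup\mathfrak C_\star$ is $\mathcal H^1$-null, where $\mathfrak A_\star\subset\mathfrak S_\star$ is an $\mathcal H^1$-null set such that at every $x\in\mathfrak S_\star\setminus\mathfrak A_\star$ the one-dimensional density $\lim_{r\to0}\mathcal H^1(\mathfrak S_\star\cap D^2(x,r))/(2r)$ equals $1$ and $\mathfrak S_\star$ has an approximate tangent line, spanned by a unit vector $\vec e_x$; $\mathfrak B_\star\subset\mathfrak S_\star$ is an $\mathcal H^1$-null set such that $\nu_\star^s,\zeta_\star^s,\mu_{\star,i,j}^s$ vanish on $\mathfrak S_\star\setminus\mathfrak B_\star$; $\mathfrak C_\star$ is the complement in $\mathfrak S_\star$ of the common Lebesgue points (with respect to $\lambda$) of $\Theta_\star,\mathbf e_\star,m_{\star,i,j}$. The sign of $\vec e_x$ is chosen so that $\vec e_x=\cos\gamma_\star(x)\,\vec{\mathbf e}_1+\sin\gamma_\star(x)\,\vec{\mathbf e}_2$ with $\gamma_\star(x)\in[-\frac\pi2,\frac\pi2]$. *)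

theory Defs
  imports "HOL-Analysis.Analysis"
begin

section \<open>Smooth functions, gradients and smooth domains\<close>

text \<open>The class $C^k$ on an open set, by recursion on $k$ through directional derivatives
  (these keep the codomain, unlike the full derivative).\<close>

primrec k_smooth_on :: "nat \<Rightarrow> 'a::euclidean_space set \<Rightarrow> ('a \<Rightarrow> 'b::real_normed_vector) \<Rightarrow> bool"
  where
    "k_smooth_on 0 U f \<longleftrightarrow> continuous_on U f"
  | "k_smooth_on (Suc k) U f \<longleftrightarrow>
       (\<forall>x\<in>U. f differentiable (at x)) \<and>
       (\<forall>v. k_smooth_on k U (\<lambda>x. frechet_derivative f (at x) v))"

definition smooth_on :: "'a::euclidean_space set \<Rightarrow> ('a \<Rightarrow> 'b::real_normed_vector) \<Rightarrow> bool"
  where "smooth_on U f \<longleftrightarrow> (\<forall>k. k_smooth_on k U f)"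

definition grad :: "('a::euclidean_space \<Rightarrow> real) \<Rightarrow> 'a \<Rightarrow> 'a"
  where "grad f x = (THE D. GDERIV f x :> D)"

text \<open>Smoothness of the boundary: near each boundary point the domain is the negativity set
  of a smooth submersion; in particular it lies on one side of its boundary.\<close>

definition smooth_bounded_domain :: "'a::euclidean_space set \<Rightarrow> bool"
  where "smooth_bounded_domain \<Omega> \<longleftrightarrow>
    \<Omega> \<noteq> {} \<and> open \<Omega> \<and> connected \<Omega> \<and> bounded \<Omega> \<and>
    (\<forall>p\<in>frontier \<Omega>. \<exists>U \<rho>. open U \<and> p \<in> U \<and> smooth_on U (\<rho> :: 'a \<Rightarrow> real) \<and>
       (\<forall>x\<in>U. grad \<rho> x \<noteq> 0) \<and> \<Omega> \<inter> U = {x\<in>U. \<rho> x < 0})"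

section \<open>The potential\<close>

definition multiwell_potential :: "(real ^ 'k \<Rightarrow> real) \<Rightarrow> bool"
  where "multiwell_potential V \<longleftrightarrow>
    smooth_on UNIV V \<and> bdd_below (range V) \<and> (INF y. V y) = 0 \<and>
    finite {y. V y = 0} \<and> card {y. V y = 0} \<ge> 2 \<and>
    (\<forall>\<sigma>. V \<sigma> = 0 \<longrightarrow>
       (\<forall>h. h \<noteq> 0 \<longrightarrow> frechet_derivative (grad V) (at \<sigma>) h \<bullet> h > 0)) \<and>
    (\<exists>\<alpha> R. \<alpha> > 0 \<and> R > 0 \<and> (\<forall>y. norm y > R \<longrightarrow> y \<bullet> grad V y \<ge> \<alpha> * (norm y)\<^sup>2)) \<and>
    filterlim V at_top at_infinity"

section \<open>Sobolev functions and weak solutions\<close>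

definition compactly_supported_in :: "'a::euclidean_space set \<Rightarrow> ('a \<Rightarrow> real) \<Rightarrow> bool"
  where "compactly_supported_in \<Omega> \<phi> \<longleftrightarrow>
    compact (closure {x. \<phi> x \<noteq> 0}) \<and> closure {x. \<phi> x \<noteq> 0} \<subseteq> \<Omega>"

definition test_function :: "'a::euclidean_space set \<Rightarrow> ('a \<Rightarrow> real) \<Rightarrow> bool"
  where "test_function \<Omega> \<phi> \<longleftrightarrow> smooth_on UNIV \<phi> \<and> compactly_supported_in \<Omega> \<phi>"

definition locally_integrable ::
    "'a::euclidean_space set \<Rightarrow> ('a \<Rightarrow> 'b::euclidean_space) \<Rightarrow> bool"
  where "locally_integrable \<Omega> f \<longleftrightarrow>
    (\<forall>K. compact K \<and> K \<subseteq> \<Omega> \<longrightarrow> set_integrable lebesgue K f)"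

definition square_integrable ::
    "'a::euclidean_space set \<Rightarrow> ('a \<Rightarrow> 'b::euclidean_space) \<Rightarrow> bool"
  where "square_integrable \<Omega> f \<longleftrightarrow>
    set_borel_measurable lebesgue \<Omega> f \<and> set_integrable lebesgue \<Omega> (\<lambda>x. (norm (f x))\<^sup>2)"

definition has_weak_deriv ::
    "'a::euclidean_space set \<Rightarrow> ('a \<Rightarrow> 'b::euclidean_space) \<Rightarrow> 'a \<Rightarrow> ('a \<Rightarrow> 'b) \<Rightarrow> bool"
  where "has_weak_deriv \<Omega> u v g \<longleftrightarrow>
    locally_integrable \<Omega> u \<and> locally_integrable \<Omega> g \<and>
    (\<forall>\<phi>. test_function \<Omega> \<phi> \<longrightarrow>
       (LINT x:\<Omega>|lebesgue. frechet_derivative \<phi> (at x) v *\<^sub>R u x) =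
       - (LINT x:\<Omega>|lebesgue. \<phi> x *\<^sub>R g x))"

text \<open>A weak derivative in the direction \<open>v\<close>; it is determined almost everywhere on \<open>\<Omega>\<close>,
  and it is only used under Lebesgue integrals over \<open>\<Omega>\<close>.\<close>

definition weak_deriv ::
    "'a::euclidean_space set \<Rightarrow> ('a \<Rightarrow> 'b::euclidean_space) \<Rightarrow> 'a \<Rightarrow> 'a \<Rightarrow> 'b"
  where "weak_deriv \<Omega> u v = (SOME g. has_weak_deriv \<Omega> u v g)"

definition sobolev_H1 :: "'a::euclidean_space set \<Rightarrow> ('a \<Rightarrow> 'b::euclidean_space) \<Rightarrow> bool"
  where "sobolev_H1 \<Omega> u \<longleftrightarrow>
    square_integrable \<Omega> u \<and>
    (\<forall>v. \<exists>g. has_weak_deriv \<Omega> u v g \<and> square_integrable \<Omega> g)"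

text \<open>Weak solutions of $-\Delta u = -\varepsilon^{-2}\nabla V(u)$ in \<open>\<Omega>\<close>. Testing the vector
  equation with scalar functions is testing it component by component. Since \<open>V\<close> has no growth
  bound from above, local integrability of the right-hand side is part of the notion.\<close>

definition H1_solution ::
    "(real ^ 2) set \<Rightarrow> (real ^ 'k \<Rightarrow> real) \<Rightarrow> real \<Rightarrow> (real ^ 2 \<Rightarrow> real ^ 'k) \<Rightarrow> bool"
  where "H1_solution \<Omega> V \<epsilon> u \<longleftrightarrow>
    sobolev_H1 \<Omega> u \<and> locally_integrable \<Omega> (\<lambda>x. grad V (u x)) \<and>
    (\<forall>\<phi>. test_function \<Omega> \<phi> \<longrightarrow>
       (LINT x:\<Omega>|lebesgue. \<Sum>b\<in>Basis. frechet_derivative \<phi> (at x) b *\<^sub>R weak_deriv \<Omega> u b x) =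
       - (1 / \<epsilon>\<^sup>2) *\<^sub>R (LINT x:\<Omega>|lebesgue. \<phi> x *\<^sub>R grad V (u x)))"

definition energy_density ::
    "(real ^ 2) set \<Rightarrow> (real ^ 'k \<Rightarrow> real) \<Rightarrow> real \<Rightarrow> (real ^ 2 \<Rightarrow> real ^ 'k) \<Rightarrow> real ^ 2 \<Rightarrow> real"
  where "energy_density \<Omega> V \<epsilon> u x =
    \<epsilon> * (\<Sum>b\<in>Basis. (norm (weak_deriv \<Omega> u b x))\<^sup>2) / 2 + V (u x) / \<epsilon>"

definition energy ::
    "(real ^ 2) set \<Rightarrow> (real ^ 'k \<Rightarrow> real) \<Rightarrow> real \<Rightarrow> (real ^ 2 \<Rightarrow> real ^ 'k) \<Rightarrow> ennreal"
  where "energy \<Omega> V \<epsilon> u = (\<integral>\<^sup>+x\<in>\<Omega>. ennreal (energy_density \<Omega> V \<epsilon> u x) \<partial>lebesgue)"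

section \<open>Measures and signed measures on a domain\<close>

text \<open>All measures below are weak limits of densities bounded in $L^1$, so they are finite;
  signed measures are therefore countably additive real-valued set functions.\<close>

definition finite_borel_measure_on :: "'a::euclidean_space set \<Rightarrow> 'a measure \<Rightarrow> bool"
  where "finite_borel_measure_on \<Omega> \<nu> \<longleftrightarrow>
    sets \<nu> = sets (restrict_space borel \<Omega>) \<and> finite_measure \<nu>"

definition signed_measure :: "'a measure \<Rightarrow> ('a set \<Rightarrow> real) \<Rightarrow> bool"
  where "signed_measure M \<mu> \<longleftrightarrow>
    \<mu> {} = 0 \<and>
    (\<forall>A. range A \<subseteq> sets M \<longrightarrow> disjoint_family A \<longrightarrow>
       (\<lambda>i::nat. \<mu> (A i)) sums \<mu> (\<Union>i. A i))"

text \<open>Positive part of the Jordan decomposition; the negative part is the positive part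
  of the opposite.\<close>

definition positive_variation :: "'a measure \<Rightarrow> ('a set \<Rightarrow> real) \<Rightarrow> 'a measure"
  where "positive_variation M \<mu> =
    measure_of (space M) (sets M) (\<lambda>A. SUP B\<in>{B\<in>sets M. B \<subseteq> A}. ennreal (\<mu> B))"

definition signed_integral :: "'a measure \<Rightarrow> ('a set \<Rightarrow> real) \<Rightarrow> ('a \<Rightarrow> real) \<Rightarrow> real"
  where "signed_integral M \<mu> f =
    integral\<^sup>L (positive_variation M \<mu>) f -
    integral\<^sup>L (positive_variation M (\<lambda>A. - \<mu> A)) f"

text \<open>Weak convergence on \<open>\<Omega>\<close> of the measures with Lebesgue densities \<open>f n\<close>, tested against
  continuous functions with compact support in \<open>\<Omega>\<close>.\<close>

definition converges_weakly_to ::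
    "'a::euclidean_space set \<Rightarrow> (nat \<Rightarrow> 'a \<Rightarrow> real) \<Rightarrow> 'a measure \<Rightarrow> bool"
  where "converges_weakly_to \<Omega> f \<nu> \<longleftrightarrow>
    (\<forall>\<phi>. continuous_on UNIV \<phi> \<longrightarrow> compactly_supported_in \<Omega> \<phi> \<longrightarrow>
       (\<lambda>n. LINT x:\<Omega>|lebesgue. \<phi> x * f n x) \<longlonglongrightarrow> integral\<^sup>L \<nu> \<phi>)"

definition converges_weakly_to_signed ::
    "'a::euclidean_space set \<Rightarrow> (nat \<Rightarrow> 'a \<Rightarrow> real) \<Rightarrow> ('a set \<Rightarrow> real) \<Rightarrow> bool"
  where "converges_weakly_to_signed \<Omega> f \<mu> \<longleftrightarrow>
    (\<forall>\<phi>. continuous_on UNIV \<phi> \<longrightarrow> compactly_supported_in \<Omega> \<phi> \<longrightarrow>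
       (\<lambda>n. LINT x:\<Omega>|lebesgue. \<phi> x * f n x)
         \<longlonglongrightarrow> signed_integral (restrict_space borel \<Omega>) \<mu> \<phi>)"

definition lebesgue_decomposition ::
    "'a measure \<Rightarrow> ('a set \<Rightarrow> real) \<Rightarrow> ('a set \<Rightarrow> real) \<Rightarrow> ('a set \<Rightarrow> real) \<Rightarrow> bool"
  where "lebesgue_decomposition L \<mu> ac s \<longleftrightarrow>
    signed_measure L ac \<and> signed_measure L s \<and>
    (\<forall>A\<in>sets L. \<mu> A = ac A + s A) \<and>
    (\<forall>A\<in>null_sets L. ac A = 0) \<and>
    (\<exists>N\<in>null_sets L. \<forall>A\<in>sets L. A \<inter> N = {} \<longrightarrow> s A = 0)"

text \<open>The identity \<open>\<mu> = f M\<close> between real or complex measures on the \<open>\<sigma>\<close>-algebra of \<open>M\<close>. The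
  completion makes the identity insensitive to the values of \<open>f\<close> on subsets of null sets.\<close>

definition has_density ::
    "'a measure \<Rightarrow> ('a \<Rightarrow> 'b::{banach, second_countable_topology}) \<Rightarrow> ('a set \<Rightarrow> 'b) \<Rightarrow> bool"
  where "has_density M f \<mu> \<longleftrightarrow>
    integrable (completion M) f \<and> (\<forall>A\<in>sets M. \<mu> A = (LINT x:A|completion M. f x))"

definition vanishes_on :: "'a measure \<Rightarrow> ('a set \<Rightarrow> real) \<Rightarrow> 'a set \<Rightarrow> bool"
  where "vanishes_on M \<mu> X \<longleftrightarrow> (\<forall>A\<in>sets M. A \<subseteq> X \<longrightarrow> \<mu> A = 0)"

definition lebesgue_point :: "'a::euclidean_space measure \<Rightarrow> ('a \<Rightarrow> real) \<Rightarrow> 'a \<Rightarrow> bool"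
  where "lebesgue_point L f x \<longleftrightarrow>
    ((\<lambda>r. (LINT y:ball x r \<inter> space L|completion L. \<bar>f y - f x\<bar>) / measure L (ball x r \<inter> space L))
      \<longlongrightarrow> 0) (at_right 0)"

section \<open>One-dimensional Hausdorff measure and approximate tangents\<close>

text \<open>The normalising constant is $1$ in dimension one. The explicit boundedness is needed
  because \<^const>\<open>diameter\<close> is meaningless on unbounded sets.\<close>

definition hausdorff1_premeasure :: "real \<Rightarrow> 'a::metric_space set \<Rightarrow> ennreal"
  where "hausdorff1_premeasure \<delta> A =
    (INF C\<in>{C :: nat \<Rightarrow> 'a set. A \<subseteq> (\<Union>i. C i) \<and> (\<forall>i. bounded (C i) \<and> diameter (C i) \<le> \<delta>)}.
       \<Sum>i. ennreal (diameter (C i)))"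

definition hausdorff1 :: "'a::metric_space set \<Rightarrow> ennreal"
  where "hausdorff1 A = (SUP \<delta>\<in>{0<..}. hausdorff1_premeasure \<delta> A)"

definition hausdorff1_restricted :: "'a::euclidean_space set \<Rightarrow> 'a set \<Rightarrow> 'a measure"
  where "hausdorff1_restricted \<Omega> S =
    measure_of \<Omega> (sets (restrict_space borel \<Omega>)) (\<lambda>A. hausdorff1 (A \<inter> S))"

definition rectifiable1 :: "'a::euclidean_space set \<Rightarrow> bool"
  where "rectifiable1 S \<longleftrightarrow>
    (\<exists>f :: nat \<Rightarrow> real \<Rightarrow> 'a. (\<forall>n. \<exists>L. L-lipschitz_on UNIV (f n)) \<and>
       hausdorff1 (S - (\<Union>n. range (f n))) = 0)"

definition has_density_one :: "'a::euclidean_space set \<Rightarrow> 'a \<Rightarrow> bool"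
  where "has_density_one S x \<longleftrightarrow>
    ((\<lambda>r. hausdorff1 (S \<inter> ball x r) / ennreal (2 * r)) \<longlongrightarrow> 1) (at_right 0)"

text \<open>The double cone of half-opening \<open>\<theta>\<close> around the line \<open>x + \<real> d\<close>, for a unit vector \<open>d\<close>.\<close>

definition double_cone :: "'a::euclidean_space \<Rightarrow> 'a \<Rightarrow> real \<Rightarrow> 'a set"
  where "double_cone x d \<theta> =
    {y. norm ((y - x) - ((y - x) \<bullet> d) *\<^sub>R d) \<le> tan \<theta> * \<bar>(y - x) \<bullet> d\<bar>}"

definition approx_tangent :: "'a::euclidean_space set \<Rightarrow> 'a \<Rightarrow> 'a \<Rightarrow> bool"
  where "approx_tangent S x d \<longleftrightarrow>
    norm d = 1 \<and>
    (\<forall>\<theta>\<in>{0<..<pi/2}.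
       ((\<lambda>r. hausdorff1 (S \<inter> ball x r - double_cone x d \<theta>) / ennreal r) \<longlongrightarrow> 0) (at_right 0))"

section \<open>Clearing-out and concentration\<close>

definition clearing_out :: "(real ^ 2) set \<Rightarrow> (real ^ 'k \<Rightarrow> real) \<Rightarrow> real \<Rightarrow> bool"
  where "clearing_out \<Omega> V \<eta> \<longleftrightarrow>
    (\<forall>(\<epsilon> :: nat \<Rightarrow> real) v \<nu>.
       (\<forall>n. 0 < \<epsilon> n \<and> \<epsilon> n \<le> 1) \<and> \<epsilon> \<longlonglongrightarrow> 0 \<and>
       (\<forall>n. H1_solution \<Omega> V (\<epsilon> n) (v n)) \<and>
       (SUP n. energy \<Omega> V (\<epsilon> n) (v n)) < \<infinity> \<and>
       finite_borel_measure_on \<Omega> \<nu> \<and>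
       converges_weakly_to \<Omega> (\<lambda>n. energy_density \<Omega> V (\<epsilon> n) (v n)) \<nu> \<longrightarrow>
       (\<forall>x r. 0 < r \<and> ball x r \<subseteq> \<Omega> \<and> emeasure \<nu> (cball x r \<inter> \<Omega>) < ennreal (\<eta> * r) \<longrightarrow>
          emeasure \<nu> (cball x (r / 2) \<inter> \<Omega>) = 0))"

definition concentration_set ::
    "'a::euclidean_space set \<Rightarrow> 'a measure \<Rightarrow> real \<Rightarrow> 'a set"
  where "concentration_set \<Omega> \<nu> \<eta> =
    {x\<in>\<Omega>. ennreal \<eta> \<le> Liminf (at_right 0) (\<lambda>r. emeasure \<nu> (cball x r \<inter> \<Omega>) / ennreal r)}"

end

theory Submission
  imports Defs "HOL-Computational_Algebra.Polynomial"
begin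

text \<open>Let $T_{ij}$ be the limit of the stress-energy tensors
  $e_\varepsilon(u)\,\delta_{ij}-\varepsilon\,\partial_i u\cdot\partial_j u$, that is
  $T_{ij}=\nu\,\delta_{ij}-\mu_{ij}$. Solutions satisfy $\partial_j T_{ij}=0$: they are locally bounded, since
  $\sqrt{1+|u|^2}$ has Laplacian bounded below by the growth condition on \<open>V\<close> (Kato's inequality)
  and so obeys a mean value inequality, and then the identity for mollifications of \<open>u\<close> passes to
  the limit. Both $\partial_j T_{ij}=0$ and the trace relation $\mu_{11}+\mu_{22}=2\nu-2\zeta$ survive the weak limit.
  At a typical point \<open>x\<close> of the concentration set, \<open>n\<close> normal to the approximate tangent, test
  $\partial_j T_{ij}=0$ with $\varphi_r(y)\,((y-x)\cdot n)$ where \<open>\<phi>\<^sub>r\<close> is a cutoff at scale \<open>r\<close>: derivatives falling on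
  \<open>\<phi>\<^sub>r\<close> are negligible because \<open>(y - x) \<bullet> n = o(r)\<close> on most of the set, so the density of
  \<open>T\<close> annihilates \<open>n\<close>. With the symmetry of \<open>T\<close> and the trace relation this determines the
  densities of $\mu_{11}-\mu_{22}$ and $\mu_{12}$ in terms of that of \<open>\<zeta>\<close>.\<close>

section \<open>Smooth functions and a smooth bump\<close>

abbreviation dir_deriv :: "('a::real_normed_vector \<Rightarrow> 'b::real_normed_vector) \<Rightarrow> 'a \<Rightarrow> 'a \<Rightarrow> 'b"
  where "dir_deriv f v \<equiv> \<lambda>x. frechet_derivative f (at x) v"

lemma dir_deriv_eq:
  assumes "\<And>x. (f has_derivative f' x) (at x)"
  shows "dir_deriv f v = (\<lambda>x. f' x v)"
  using frechet_derivative_at[OF assms] by (metis (no_types))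

lemma differentiable_has_dir_deriv:
  assumes "f differentiable (at x)"
  shows "(f has_derivative (\<lambda>v. dir_deriv f v x)) (at x)"
  using assms frechet_derivative_works by blast

lemma k_smooth_on_SucI:
  assumes "\<And>x. (f has_derivative f' x) (at x)" "\<And>v. k_smooth_on k UNIV (\<lambda>x. f' x v)"
  shows "k_smooth_on (Suc k) UNIV f"
  using assms by (auto simp: dir_deriv_eq[OF assms(1)] differentiable_def)

lemma k_smooth_on_const: "k_smooth_on k UNIV (\<lambda>x. c)"
proof (induction k arbitrary: c)
  case (Suc k)
  show ?case by (rule k_smooth_on_SucI[where f'="\<lambda>_ _. 0"]) (auto intro: Suc)
qed simp

lemma k_smooth_on_SucD: "k_smooth_on (Suc k) UNIV f \<Longrightarrow> k_smooth_on k UNIV f"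
proof (induction k arbitrary: f)
  case 0
  then show ?case
    by (auto intro!: continuous_at_imp_continuous_on differentiable_imp_continuous_within)
next
  case (Suc k)
  then show ?case by auto
qed

lemma k_smooth_on_add:
  "k_smooth_on k UNIV f \<Longrightarrow> k_smooth_on k UNIV g \<Longrightarrow> k_smooth_on k UNIV (\<lambda>x. f x + g x)"
proof (induction k arbitrary: f g)
  case 0
  then show ?case by (auto intro: continuous_intros)
next
  case (Suc k)
  show ?case
  proof (rule k_smooth_on_SucI)
    show "((\<lambda>x. f x + g x) has_derivative (\<lambda>v. dir_deriv f v x + dir_deriv g v x)) (at x)" for x
      using Suc.prems by (auto intro!: has_derivative_add differentiable_has_dir_deriv)
  qed (use Suc in auto)
qed

lemma k_smooth_on_scaleR:
  fixes f :: "'a::euclidean_space \<Rightarrow> real"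
  shows "k_smooth_on k UNIV f \<Longrightarrow> k_smooth_on k UNIV g \<Longrightarrow> k_smooth_on k UNIV (\<lambda>x. f x *\<^sub>R g x)"
proof (induction k arbitrary: f g)
  case 0
  then show ?case by (auto intro: continuous_intros)
next
  case (Suc k)
  show ?case
  proof (rule k_smooth_on_SucI)
    show "((\<lambda>x. f x *\<^sub>R g x) has_derivative
        (\<lambda>v. f x *\<^sub>R dir_deriv g v x + dir_deriv f v x *\<^sub>R g x)) (at x)" for x
      using Suc.prems by (auto intro!: has_derivative_scaleR differentiable_has_dir_deriv)
    show "k_smooth_on k UNIV (\<lambda>x. f x *\<^sub>R dir_deriv g v x + dir_deriv f v x *\<^sub>R g x)" for v
      using Suc by (intro k_smooth_on_add Suc.IH) (auto simp del: k_smooth_on.simps intro: k_smooth_on_SucD simp: k_smooth_on.simps(2))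
  qed
qed

lemma k_smooth_on_reflect:
  "k_smooth_on k UNIV f \<Longrightarrow> k_smooth_on k UNIV (\<lambda>y. f (x - y))"
proof (induction k arbitrary: f)
  case 0
  then show ?case by (auto intro!: continuous_intros continuous_on_compose2[of UNIV f])
next
  case (Suc k)
  show ?case
  proof (rule k_smooth_on_SucI)
    show "((\<lambda>y. f (x - y)) has_derivative (\<lambda>v. - dir_deriv f v (x - y))) (at y)" for y
    proof -
      have *: "f differentiable at (x - y)" using Suc.prems by auto
      have "((\<lambda>y. f (x - y)) has_derivative (\<lambda>v. dir_deriv f (0 - v) (x - y))) (at y)"
        by (rule has_derivative_compose[of "\<lambda>y. x - y" "\<lambda>v. 0 - v" y UNIV f])
          (auto intro!: derivative_eq_intros differentiable_has_dir_deriv *)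
      then show ?thesis
        by (simp add: linear_neg[OF linear_frechet_derivative[OF *]])
    qed
    have "k_smooth_on k UNIV (\<lambda>y. (-1::real) *\<^sub>R dir_deriv f v (x - y))" for v
      using Suc by (intro k_smooth_on_scaleR k_smooth_on_const Suc.IH) auto
    then show "k_smooth_on k UNIV (\<lambda>y. - dir_deriv f v (x - y))" for v by simp
  qed
qed

definition flat_exp :: "real poly \<Rightarrow> real \<Rightarrow> real"
  where "flat_exp p t = (if t > 0 then poly p (1 / t) * exp (- (1 / t)) else 0)"

lemma tendsto_poly_exp_at_top: "((\<lambda>s. poly p s * exp (- s)) \<longlongrightarrow> (0::real)) at_top"
proof -
  have "((\<lambda>s. \<Sum>i\<le>degree p. coeff p i * (s ^ i / exp s)) \<longlongrightarrow> (\<Sum>i\<le>degree p. coeff p i * 0)) at_top"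
    by (intro tendsto_intros tendsto_power_div_exp_0)
  then show ?thesis
    by (simp add: poly_altdef sum_distrib_right exp_minus divide_inverse mult.assoc)
qed

lemma flat_exp_has_derivative:
  "(flat_exp p has_real_derivative flat_exp (monom 1 2 * (p - pderiv p)) t) (at t)"
proof -
  consider "t < 0" | "t = 0" | "t > 0" by linarith
  then show ?thesis
  proof cases
    case 1
    have "(flat_exp p has_real_derivative 0) (at t)"
      by (rule DERIV_cong_ev[THEN iffD2, OF refl _ refl DERIV_const])
        (use 1 in \<open>auto intro!: eventually_nhds_in_open[of "{..<0}", THEN eventually_mono] simp: flat_exp_def\<close>)
    then show ?thesis using 1 by (simp add: flat_exp_def)
  next
    case 2
    have right: "((\<lambda>h. flat_exp p h / h) \<longlongrightarrow> 0) (at_right 0)"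
    proof -
      have "((\<lambda>h. poly (pCons 0 p) (inverse h) * exp (- inverse h)) \<longlongrightarrow> 0) (at_right (0::real))"
        by (rule filterlim_compose[OF tendsto_poly_exp_at_top filterlim_inverse_at_top_right])
      moreover have "eventually (\<lambda>h. poly (pCons 0 p) (inverse h) * exp (- inverse h) = flat_exp p h / h)
          (at_right (0::real))"
        by (auto simp: eventually_at_right_field flat_exp_def field_simps intro!: exI[of _ 1])
      ultimately show ?thesis by (simp cong: filterlim_cong)
    qed
    have left: "((\<lambda>h. flat_exp p h / h) \<longlongrightarrow> 0) (at_left 0)"
      by (rule tendsto_eventually) (auto simp: eventually_at_left_field flat_exp_def intro!: exI[of _ "-1"])
    have "((\<lambda>h. flat_exp p h / h) \<longlongrightarrow> 0) (at 0)"
      using left right by (simp add: filterlim_split_at)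
    then show ?thesis using 2 by (simp add: DERIV_def flat_exp_def)
  next
    case 3
    have "((\<lambda>t. poly p (1 / t) * exp (- (1 / t))) has_real_derivative
       flat_exp (monom 1 2 * (p - pderiv p)) t) (at t)"
      using 3 by (auto intro!: derivative_eq_intros DERIV_chain2[OF poly_DERIV]
          simp: flat_exp_def poly_monom field_simps power2_eq_square)
    then show ?thesis
      by (rule DERIV_cong_ev[THEN iffD2, OF refl _ refl, rotated])
        (use 3 in \<open>auto intro!: eventually_nhds_in_open[of "{0<..}", THEN eventually_mono] simp: flat_exp_def\<close>)
  qed
qed

lemma k_smooth_on_flat_exp:
  fixes f :: "'a::euclidean_space \<Rightarrow> real"
  assumes "smooth_on UNIV f"
  shows "k_smooth_on k UNIV (\<lambda>x. flat_exp p (f x))"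
proof (induction k arbitrary: p)
  have f: "k_smooth_on j UNIV f" for j using assms by (simp add: smooth_on_def)
  have df: "f differentiable (at x)" for x using f[of "Suc 0"] by auto
  case 0
  have "continuous_on UNIV (flat_exp p)"
    by (rule DERIV_continuous_on[OF has_field_derivative_at_within[OF flat_exp_has_derivative]])
  then show ?case using f[of 0] by (auto intro: continuous_on_compose2)
next
  have f: "k_smooth_on j UNIV f" for j using assms by (simp add: smooth_on_def)
  have df: "f differentiable (at x)" for x using f[of "Suc 0"] by auto
  case (Suc k)
  show ?case
  proof (rule k_smooth_on_SucI)
    show "((\<lambda>x. flat_exp p (f x)) has_derivative
        (\<lambda>v. flat_exp (monom 1 2 * (p - pderiv p)) (f x) * dir_deriv f v x)) (at x)" for x
      by (rule has_derivative_compose[OF differentiable_has_dir_deriv[OF df]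
            flat_exp_has_derivative[unfolded has_field_derivative_def]])
    show "k_smooth_on k UNIV (\<lambda>x. flat_exp (monom 1 2 * (p - pderiv p)) (f x) * dir_deriv f v x)" for v
      using k_smooth_on_scaleR[OF Suc, of "dir_deriv f v"] f[of "Suc k"] by simp
  qed
qed

lemma k_smooth_on_inner: "k_smooth_on k UNIV (\<lambda>x. x \<bullet> v)"
proof (cases k)
  case (Suc j)
  show ?thesis unfolding Suc
    by (rule k_smooth_on_SucI[where f'="\<lambda>_ w. w \<bullet> v"])
      (auto intro!: derivative_eq_intros k_smooth_on_const)
qed (auto intro: continuous_intros)

definition bump :: "real \<Rightarrow> 'a::euclidean_space \<Rightarrow> real"
  where "bump r z = flat_exp 1 (r\<^sup>2 - z \<bullet> z)"

text \<open>Explicit first and second derivatives of \<open>bump\<close>: the symmetry of the second derivative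
  is read off from the formula.\<close>

definition bump1 :: "real \<Rightarrow> 'a::euclidean_space \<Rightarrow> 'a \<Rightarrow> real"
  where "bump1 r v z = flat_exp (monom 1 2) (r\<^sup>2 - z \<bullet> z) * (- 2 * (z \<bullet> v))"

definition bump2 :: "real \<Rightarrow> 'a::euclidean_space \<Rightarrow> 'a \<Rightarrow> 'a \<Rightarrow> real"
  where "bump2 r v w z =
    flat_exp (monom 1 2 * (monom 1 2 - pderiv (monom 1 2))) (r\<^sup>2 - z \<bullet> z) * (4 * (z \<bullet> v) * (z \<bullet> w))
    - 2 * flat_exp (monom 1 2) (r\<^sup>2 - z \<bullet> z) * (v \<bullet> w)"

lemma bump2_commute: "bump2 r v w = bump2 r w v"
  by (auto simp: bump2_def fun_eq_iff inner_commute algebra_simps)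

lemma quadratic_has_derivative:
  "((\<lambda>z. r\<^sup>2 - z \<bullet> z) has_derivative (\<lambda>v. - 2 * (z \<bullet> v))) (at z)"
  by (auto intro!: derivative_eq_intros simp: inner_commute)

lemma bump_has_derivative: "(bump r has_derivative (\<lambda>v. bump1 r v z)) (at z)"
  using has_derivative_compose[OF quadratic_has_derivative[of r z]
      flat_exp_has_derivative[of 1, unfolded has_field_derivative_def]]
  by (simp add: bump_def[abs_def] bump1_def)

lemma bump1_has_derivative: "(bump1 r v has_derivative (\<lambda>w. bump2 r v w z)) (at z)"
  unfolding bump1_def[abs_def] bump2_def
  by (rule derivative_eq_intros refl has_derivative_compose[OF quadratic_has_derivative[of r z]
      flat_exp_has_derivative[of "monom 1 2", unfolded has_field_derivative_def]])+
    (auto simp: fun_eq_iff algebra_simps inner_commute)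

lemma smooth_on_quadratic: "smooth_on UNIV (\<lambda>z::'a::euclidean_space. r\<^sup>2 - z \<bullet> z)"
  unfolding smooth_on_def
proof
  fix k show "k_smooth_on k UNIV (\<lambda>z::'a. r\<^sup>2 - z \<bullet> z)"
  proof (cases k)
    case (Suc j)
    have "k_smooth_on j UNIV (\<lambda>z. (-2::real) *\<^sub>R (z \<bullet> v))" for v :: 'a
      by (intro k_smooth_on_scaleR k_smooth_on_const k_smooth_on_inner)
    then show ?thesis unfolding Suc
      by (intro k_smooth_on_SucI[OF quadratic_has_derivative]) simp
  qed (auto intro!: continuous_intros)
qed

lemma smooth_on_dir_deriv: "smooth_on UNIV f \<Longrightarrow> smooth_on UNIV (dir_deriv f v)"
  unfolding smooth_on_def by (metis k_smooth_on.simps(2))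

lemma smooth_on_bump: "smooth_on UNIV (bump r)"
  by (simp add: smooth_on_def bump_def[abs_def] k_smooth_on_flat_exp[OF smooth_on_quadratic])

lemma bump_eq_0:
  assumes "r \<le> norm z" "r > 0"
  shows "bump r z = 0" "bump1 r v z = 0" "bump2 r v w z = 0"
proof -
  have "r\<^sup>2 \<le> z \<bullet> z" using assms by (simp add: dot_square_norm power_mono)
  then show "bump r z = 0" "bump1 r v z = 0" "bump2 r v w z = 0"
    by (auto simp: bump_def bump1_def bump2_def flat_exp_def)
qed

lemma bump_nonneg: "0 \<le> bump r z"
  by (simp add: bump_def flat_exp_def)

lemma bump_pos: "norm z < r \<Longrightarrow> 0 < bump r z"
  by (simp add: bump_def flat_exp_def dot_square_norm power_strict_mono)

lemma continuous_on_smooth: "smooth_on UNIV f \<Longrightarrow> continuous_on X f"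
  unfolding smooth_on_def by (metis continuous_on_subset k_smooth_on.simps(1) subset_UNIV)

lemma smooth_on_differentiable: "smooth_on UNIV f \<Longrightarrow> f differentiable (at x)"
  unfolding smooth_on_def by (metis UNIV_I k_smooth_on.simps(2))

lemma test_function_reflect:
  assumes "smooth_on UNIV \<sigma>" "\<And>z. r < norm z \<Longrightarrow> \<sigma> z = 0" "cball x r \<subseteq> \<Omega>"
  shows "test_function \<Omega> (\<lambda>y. \<sigma> (x - y))"
proof -
  have "{y. \<sigma> (x - y) \<noteq> 0} \<subseteq> cball x r"
    using assms(2) by (auto simp: dist_norm not_less[symmetric])
  then have *: "closure {y. \<sigma> (x - y) \<noteq> 0} \<subseteq> cball x r"
    by (simp add: closure_minimal)
  then have "compact (closure {y. \<sigma> (x - y) \<noteq> 0})"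
    by (meson bounded_cball bounded_subset closed_closure compact_eq_bounded_closed)
  then show ?thesis
    using assms * k_smooth_on_reflect
    by (fastforce simp: test_function_def compactly_supported_in_def smooth_on_def)
qed

lemma dir_deriv_reflect:
  assumes "\<sigma> differentiable (at (x - y))"
  shows "dir_deriv (\<lambda>y. \<sigma> (x - y)) v y = - dir_deriv \<sigma> v (x - y)"
proof -
  have "((\<lambda>y. \<sigma> (x - y)) has_derivative (\<lambda>v. dir_deriv \<sigma> (0 - v) (x - y))) (at y)"
    by (rule has_derivative_compose[of "\<lambda>y. x - y" "\<lambda>v. 0 - v" y UNIV \<sigma>])
      (auto intro!: derivative_eq_intros differentiable_has_dir_deriv assms)
  from frechet_derivative_at[OF this] show ?thesis
    by (metis (no_types, lifting) assms diff_0 linear_frechet_derivative linear_neg)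
qed

section \<open>Convolution with smooth kernels\<close>

definition smooth_supp :: "real \<Rightarrow> ('a::euclidean_space \<Rightarrow> real) \<Rightarrow> bool"
  where "smooth_supp r \<sigma> \<longleftrightarrow> smooth_on UNIV \<sigma> \<and> (\<forall>z. r < norm z \<longrightarrow> \<sigma> z = 0)"

lemma smooth_supp_dir_deriv:
  assumes "smooth_supp r \<sigma>"
  shows "smooth_supp r (dir_deriv \<sigma> v)"
proof -
  have "dir_deriv \<sigma> v z = 0" if "r < norm z" for z
  proof -
    have "open {z::'a. r < norm z}"
      by (intro open_Collect_less continuous_intros)
    then have "((\<lambda>_. 0) has_derivative (\<lambda>_. 0)) (at z) \<Longrightarrow> (\<sigma> has_derivative (\<lambda>_. 0)) (at z)"
      using that assms
      by (intro has_derivative_transform_within_open[of "\<lambda>_. 0" "\<lambda>_. 0" z UNIV "{z. r < norm z}" \<sigma>])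
        (auto simp: smooth_supp_def)
    then have "(\<sigma> has_derivative (\<lambda>_. 0)) (at z)" by simp
    from frechet_derivative_at[OF this] show ?thesis by metis
  qed
  then show ?thesis using assms by (auto simp: smooth_supp_def smooth_on_dir_deriv)
qed

lemma smooth_supp_continuous: "smooth_supp r \<sigma> \<Longrightarrow> continuous_on X \<sigma>"
  by (simp add: smooth_supp_def continuous_on_smooth)

lemma smooth_supp_measurable: "smooth_supp r \<sigma> \<Longrightarrow> \<sigma> \<in> borel_measurable borel"
  by (intro borel_measurable_continuous_onI smooth_supp_continuous)

lemma smooth_supp_has_derivative:
  "smooth_supp r \<sigma> \<Longrightarrow> (\<sigma> has_derivative (\<lambda>v. dir_deriv \<sigma> v z)) (at z)"
  by (simp add: smooth_supp_def differentiable_has_dir_deriv smooth_on_differentiable)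

lemma compact_support_bounded:
  fixes f :: "'a::euclidean_space \<Rightarrow> real"
  assumes f: "continuous_on UNIV f" and K: "compact K" "\<And>y. y \<notin> K \<Longrightarrow> f y = 0"
  obtains B where "B \<ge> 0" "\<And>y. \<bar>f y\<bar> \<le> B"
proof -
  have "bounded (f ` K)" by (intro compact_imp_bounded compact_continuous_image continuous_on_subset[OF f] K) auto
  then obtain B where B: "\<And>y. y \<in> K \<Longrightarrow> \<bar>f y\<bar> \<le> B" unfolding bounded_iff by (metis imageI real_norm_def)
  have "\<bar>f y\<bar> \<le> max B 0" for y using B[of y] K(2)[of y] by (cases "y \<in> K") auto
  then show ?thesis by (intro that[of "max B 0"]) auto
qed

lemma smooth_supp_bounded:
  assumes "smooth_supp r \<sigma>"
  obtains B where "B \<ge> 0" "\<And>z. \<bar>\<sigma> z\<bar> \<le> B"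
  by (rule compact_support_bounded[OF smooth_supp_continuous[OF assms] compact_cball[of 0 r]])
    (use assms that in \<open>auto simp: smooth_supp_def\<close>)

lemma linear_Basis_bound:
  fixes f :: "'a::euclidean_space \<Rightarrow> 'b::real_normed_vector"
  assumes "linear f" "\<And>b. b \<in> Basis \<Longrightarrow> norm (f b) \<le> B"
  shows "norm (f v) \<le> real DIM('a) * B * norm v"
proof -
  have "norm (f v) = norm (\<Sum>b\<in>Basis. (v \<bullet> b) *\<^sub>R f b)"
    by (metis (no_types, lifting) assms(1) euclidean_representation linear_cmul linear_sum sum.cong)
  also have "\<dots> \<le> (\<Sum>b\<in>Basis. \<bar>v \<bullet> b\<bar> * norm (f b))"
    by (rule order_trans[OF norm_sum]) simp
  also have "\<dots> \<le> (\<Sum>b\<in>(Basis::'a set). norm v * B)"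
    by (intro sum_mono mult_mono assms Basis_le_norm) auto
  finally show ?thesis by (simp add: mult_ac)
qed

lemma smooth_supp_deriv_bounded:
  assumes "smooth_supp r (\<sigma> :: 'a::euclidean_space \<Rightarrow> real)"
  obtains B where "B \<ge> 0" "\<And>z v. \<bar>dir_deriv \<sigma> v z\<bar> \<le> B * norm v"
proof -
  have "\<forall>b. \<exists>B\<ge>0. \<forall>z. \<bar>dir_deriv \<sigma> b z\<bar> \<le> B"
    using smooth_supp_bounded[OF smooth_supp_dir_deriv[OF assms]] by metis
  then obtain B where B: "\<And>b. B b \<ge> 0" "\<And>b z. \<bar>dir_deriv \<sigma> b z\<bar> \<le> B b" by metis
  define C where "C = (\<Sum>b\<in>Basis. B b)"
  have C: "B b \<le> C" if "b \<in> Basis" for b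
    unfolding C_def by (rule member_le_sum) (use that B in auto)
  have "norm (dir_deriv \<sigma> v z) \<le> (DIM('a) * C) * norm v" for v z
  proof (rule linear_Basis_bound[where f="\<lambda>v. dir_deriv \<sigma> v z"])
    show "linear (\<lambda>v. dir_deriv \<sigma> v z)"
      using has_derivative_linear[OF smooth_supp_has_derivative[OF assms]] .
    show "norm (dir_deriv \<sigma> b z) \<le> C" if "b \<in> Basis" for b
      using B(2)[of z b] C[OF that] by simp
  qed
  moreover have "C \<ge> 0" unfolding C_def by (intro sum_nonneg B)
  ultimately show ?thesis by (intro that[of "DIM('a) * C"]) auto
qed

lemma smooth_supp_lipschitz:
  assumes "smooth_supp r (\<sigma> :: 'a::euclidean_space \<Rightarrow> real)"
  obtains L where "L \<ge> 0" "\<And>x y. \<bar>\<sigma> x - \<sigma> y\<bar> \<le> L * norm (x - y)"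
proof -
  obtain B where B: "B \<ge> 0" "\<And>z v. \<bar>dir_deriv \<sigma> v z\<bar> \<le> B * norm v"
    by (rule smooth_supp_deriv_bounded[OF assms]) (rule that)
  have "norm (\<sigma> x - \<sigma> y) \<le> B * norm (x - y)" for x y
    by (rule differentiable_bound[of UNIV \<sigma> "\<lambda>z v. dir_deriv \<sigma> v z"])
      (auto intro!: onorm_bound smooth_supp_has_derivative[OF assms] simp: B)
  then show ?thesis using B(1) by (intro that[of B]) auto
qed

lemma smooth_supp_taylor:
  assumes "smooth_supp r (\<sigma> :: 'a::euclidean_space \<Rightarrow> real)"
  obtains C where "C \<ge> 0" "\<And>z h. \<bar>\<sigma> (z + h) - \<sigma> z - dir_deriv \<sigma> h z\<bar> \<le> C * (norm h)\<^sup>2"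
proof -
  have "\<forall>b. \<exists>L\<ge>0. \<forall>x y. \<bar>dir_deriv \<sigma> b x - dir_deriv \<sigma> b y\<bar> \<le> L * norm (x - y)"
    using smooth_supp_lipschitz[OF smooth_supp_dir_deriv[OF assms]] by metis
  then obtain L where L: "\<And>b. L b \<ge> 0"
    "\<And>b x y. \<bar>dir_deriv \<sigma> b x - dir_deriv \<sigma> b y\<bar> \<le> L b * norm (x - y)" by metis
  define C where "C = (\<Sum>b\<in>Basis. L b)"
  have C: "L b \<le> C" if "b \<in> Basis" for b
    unfolding C_def by (rule member_le_sum) (use that L in auto)
  have C0: "C \<ge> 0" unfolding C_def by (intro sum_nonneg L)
  have lin: "linear (\<lambda>v. dir_deriv \<sigma> v x)" for x
    using has_derivative_linear[OF smooth_supp_has_derivative[OF assms]] .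
  have "norm (\<sigma> (z + h) - \<sigma> z - dir_deriv \<sigma> (z + h - z) z) \<le> norm (z + h - z) * (DIM('a) * (C * norm h))"
    for z h
  proof (rule differentiable_bound_linearization[where S="cball z (norm h)" and f'="\<lambda>x v. dir_deriv \<sigma> v x"])
    show "onorm ((\<lambda>v. dir_deriv \<sigma> v x) - (\<lambda>v. dir_deriv \<sigma> v z)) \<le> DIM('a) * (C * norm h)"
      if "x \<in> cball z (norm h)" for x
    proof (rule onorm_bound)
      show "0 \<le> DIM('a) * (C * norm h)" using C0 by simp
      fix v
      show "norm (((\<lambda>v. dir_deriv \<sigma> v x) - (\<lambda>v. dir_deriv \<sigma> v z)) v) \<le> DIM('a) * (C * norm h) * norm v"
        unfolding fun_diff_def
      proof (rule linear_Basis_bound[where f="\<lambda>v. dir_deriv \<sigma> v x - dir_deriv \<sigma> v z"])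
        show "linear (\<lambda>v. dir_deriv \<sigma> v x - dir_deriv \<sigma> v z)"
          using lin by (intro linear_compose_sub)
        fix b :: 'a assume b: "b \<in> Basis"
        have "L b * norm (x - z) \<le> C * norm h"
          using that C[OF b] C0 L(1)[of b] by (intro mult_mono) (auto simp: dist_norm norm_minus_commute)
        then show "norm (dir_deriv \<sigma> b x - dir_deriv \<sigma> b z) \<le> C * norm h"
          using L(2)[of x b z] by simp
      qed
    qed
    show "z + t *\<^sub>R (z + h - z) \<in> cball z (norm h)" if "t \<in> {0..1}" for t
      using that by (auto simp: dist_norm mult_left_le_one_le)
  qed (auto intro: has_derivative_at_withinI smooth_supp_has_derivative[OF assms])
  then have "\<bar>\<sigma> (z + h) - \<sigma> z - dir_deriv \<sigma> h z\<bar> \<le> (DIM('a) * C) * (norm h)\<^sup>2" for z h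
    by (simp add: power2_eq_square mult_ac)
  then show ?thesis using C0 by (intro that[of "DIM('a) * C"]) auto
qed

definition convolve :: "('a::euclidean_space \<Rightarrow> real) \<Rightarrow> ('a \<Rightarrow> 'b::euclidean_space) \<Rightarrow> 'a \<Rightarrow> 'b"
  where "convolve \<sigma> f x = (LINT y|lborel. \<sigma> (x - y) *\<^sub>R f y)"

lemma integrable_convolve:
  fixes f :: "'a::euclidean_space \<Rightarrow> 'b::euclidean_space"
  assumes "smooth_supp r \<sigma>" "integrable lborel f"
  shows "integrable lborel (\<lambda>y. \<sigma> (x - y) *\<^sub>R f y)"
proof -
  obtain B where B: "B \<ge> 0" "\<And>z. \<bar>\<sigma> z\<bar> \<le> B" by (rule smooth_supp_bounded[OF assms(1)]) (rule that)
  note [measurable] = smooth_supp_measurable[OF assms(1)] borel_measurable_integrable[OF assms(2)]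
  show ?thesis
  proof (rule Bochner_Integration.integrable_bound)
    show "integrable lborel (\<lambda>y. B * norm (f y))" using assms(2) by simp
    show "(\<lambda>y. \<sigma> (x - y) *\<^sub>R f y) \<in> borel_measurable lborel" by measurable
    show "AE y in lborel. norm (\<sigma> (x - y) *\<^sub>R f y) \<le> norm (B * norm (f y))"
      using B by (auto intro!: mult_right_mono)
  qed
qed

lemma convolve_taylor:
  fixes f :: "'a::euclidean_space \<Rightarrow> 'b::euclidean_space"
  assumes \<sigma>: "smooth_supp r \<sigma>" and f: "integrable lborel f"
  obtains A where "A \<ge> 0"
    "\<And>x h. norm (convolve \<sigma> f (x + h) - convolve \<sigma> f x - convolve (dir_deriv \<sigma> h) f x) \<le> A * (norm h)\<^sup>2"
proof -
  obtain C where C: "C \<ge> 0" "\<And>z h. \<bar>\<sigma> (z + h) - \<sigma> z - dir_deriv \<sigma> h z\<bar> \<le> C * (norm h)\<^sup>2"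
    by (rule smooth_supp_taylor[OF \<sigma>]) (rule that)
  note int = integrable_convolve[OF \<sigma> f] integrable_convolve[OF smooth_supp_dir_deriv[OF \<sigma>] f]
  define A where "A = C * (LINT y|lborel. norm (f y))"
  have "A \<ge> 0" unfolding A_def using C by simp
  have bound: "norm (convolve \<sigma> f (x + h) - convolve \<sigma> f x - convolve (dir_deriv \<sigma> h) f x) \<le> A * (norm h)\<^sup>2" for x h
  proof -
    have "convolve \<sigma> f (x + h) - convolve \<sigma> f x - convolve (dir_deriv \<sigma> h) f x =
        (LINT y|lborel. (\<sigma> (x - y + h) - \<sigma> (x - y) - dir_deriv \<sigma> h (x - y)) *\<^sub>R f y)"
      unfolding convolve_def using int(1)[of "x + h"] int(1)[of x] int(2)[of x h]
      by (simp add: scaleR_diff_left diff_add_eq)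
    also have "norm \<dots> \<le> (LINT y|lborel. (C * (norm h)\<^sup>2) * norm (f y))"
    proof (rule Bochner_Integration.integral_norm_bound_integral)
      show "integrable lborel (\<lambda>y. (\<sigma> (x - y + h) - \<sigma> (x - y) - dir_deriv \<sigma> h (x - y)) *\<^sub>R f y)"
        using int(1)[of "x + h"] int(1)[of x] int(2)[of x h]
        by (simp add: scaleR_diff_left diff_add_eq)
      show "norm ((\<sigma> (x - y + h) - \<sigma> (x - y) - dir_deriv \<sigma> h (x - y)) *\<^sub>R f y) \<le> (C * (norm h)\<^sup>2) * norm (f y)" for y
        using C(2)[of "x - y" h] by (auto intro!: mult_right_mono)
    qed (use f in auto)
    also have "\<dots> = A * (norm h)\<^sup>2" unfolding A_def by simp
    finally show ?thesis .
  qed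
  show ?thesis by (rule that[OF \<open>A \<ge> 0\<close> bound])
qed

lemma linear_convolve_dir_deriv:
  fixes f :: "'a::euclidean_space \<Rightarrow> 'b::euclidean_space"
  assumes \<sigma>: "smooth_supp r \<sigma>" and f: "integrable lborel f"
  shows "linear (\<lambda>v. convolve (dir_deriv \<sigma> v) f x)"
proof -
  have lin: "linear (\<lambda>v. dir_deriv \<sigma> v x)" for x
    using has_derivative_linear[OF smooth_supp_has_derivative[OF \<sigma>]] .
  note int = integrable_convolve[OF smooth_supp_dir_deriv[OF \<sigma>] f]
  show ?thesis
    unfolding convolve_def
    by (rule linearI)
      (simp_all add: linear_add[OF lin] linear_cmul[OF lin] scaleR_add_left int Bochner_Integration.integral_add
        flip: scaleR_scaleR)
qed

lemma convolve_has_derivative: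
  fixes f :: "'a::euclidean_space \<Rightarrow> 'b::euclidean_space"
  assumes \<sigma>: "smooth_supp r \<sigma>" and f: "integrable lborel f"
  shows "(convolve \<sigma> f has_derivative (\<lambda>v. convolve (dir_deriv \<sigma> v) f x)) (at x)"
proof -
  obtain A where A: "A \<ge> 0"
    "\<And>x h. norm (convolve \<sigma> f (x + h) - convolve \<sigma> f x - convolve (dir_deriv \<sigma> h) f x) \<le> A * (norm h)\<^sup>2"
    by (rule convolve_taylor[OF assms]) (rule that)
  show ?thesis
  proof (rule has_derivativeI_sandwich[where e=1 and H="\<lambda>y. A * norm (y - x)"])
    show "bounded_linear (\<lambda>v. convolve (dir_deriv \<sigma> v) f x)"
      using linear_convolve_dir_deriv[OF assms] by (simp add: linear_conv_bounded_linear)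
    show "((\<lambda>y. A * norm (y - x)) \<longlongrightarrow> 0) (at x)"
      by (auto intro!: tendsto_eq_intros)
    fix y assume "y \<in> UNIV" "y \<noteq> x"
    then have "norm (y - x) > 0" by simp
    then show "norm (convolve \<sigma> f y - convolve \<sigma> f x - convolve (dir_deriv \<sigma> (y - x)) f x) / norm (y - x) \<le> A * norm (y - x)"
      using A(2)[of x "y - x"] by (simp add: field_simps power2_eq_square)
  qed auto
qed

lemma continuous_on_convolve:
  assumes "smooth_supp r \<sigma>" "integrable lborel f"
  shows "continuous_on X (convolve \<sigma> f)"
  by (meson assms continuous_at_imp_continuous_on convolve_has_derivative has_derivative_continuous)

lemma convolve_measurable:
  assumes "smooth_supp r \<sigma>" "integrable lborel f"
  shows "convolve \<sigma> f \<in> borel_measurable borel"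
  by (rule borel_measurable_continuous_onI[OF continuous_on_convolve[OF assms]])

lemma convolve_diff:
  assumes "smooth_supp r \<sigma>" "integrable lborel f" "integrable lborel g"
  shows "convolve \<sigma> (\<lambda>x. f x - g x) x = convolve \<sigma> f x - convolve \<sigma> g x"
  unfolding convolve_def using integrable_convolve[OF assms(1,2)] integrable_convolve[OF assms(1,3)]
  by (simp add: scaleR_diff_right)

section \<open>Mollification\<close>

lemma lborel_translate_reflect:
  fixes f :: "'a::euclidean_space \<Rightarrow> 'b::{banach, second_countable_topology}"
  assumes "\<bar>c\<bar> = (1::real)"
  shows "integral\<^sup>L lborel (\<lambda>x. f (t + c *\<^sub>R x)) = integral\<^sup>L lborel f"
    and "integrable lborel (\<lambda>x. f (t + c *\<^sub>R x)) = integrable lborel f"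
proof -
  have c: "c \<noteq> 0" "\<bar>c\<bar> ^ DIM('a) = 1" using assms by auto
  have *: "distr lborel borel (\<lambda>x. t + c *\<^sub>R x) = (lborel :: 'a measure)" for t
    using lborel_affine[OF c(1), of t] c by (simp add: density_1)
  have inv: "f = (\<lambda>x. (\<lambda>x. f (t + c *\<^sub>R x)) ((- c *\<^sub>R t) + c *\<^sub>R x))"
  proof
    have "c * c = 1" using assms by (metis abs_mult_self_eq mult.right_neutral)
    then show "f x = f (t + c *\<^sub>R (- c *\<^sub>R t + c *\<^sub>R x))" for x by (simp add: scaleR_diff_right)
  qed
  have meas: "(\<lambda>x. f (t + c *\<^sub>R x)) \<in> borel_measurable borel \<longleftrightarrow> f \<in> borel_measurable borel"
  proof
    assume m: "(\<lambda>x. f (t + c *\<^sub>R x)) \<in> borel_measurable borel"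
    show "f \<in> borel_measurable borel" by (subst inv) (rule measurable_compose[OF _ m], measurable)
  next
    assume m: "f \<in> borel_measurable borel"
    show "(\<lambda>x. f (t + c *\<^sub>R x)) \<in> borel_measurable borel" by (rule measurable_compose[OF _ m], measurable)
  qed
  have i: "integrable lborel f \<Longrightarrow> integrable lborel (\<lambda>x. f (t + c *\<^sub>R x))" for f :: "'a \<Rightarrow> 'b" and t
    using integrable_distr_eq[of "\<lambda>x. t + c *\<^sub>R x" lborel borel f] *[of t] borel_measurable_integrable[of lborel f]
    by (auto simp: measurable_lborel1)
  show eq: "integrable lborel (\<lambda>x. f (t + c *\<^sub>R x)) = integrable lborel f"
    using i[of f t] i[of "\<lambda>x. f (t + c *\<^sub>R x)" "- c *\<^sub>R t"] inv by metis
  show "integral\<^sup>L lborel (\<lambda>x. f (t + c *\<^sub>R x)) = integral\<^sup>L lborel f"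
  proof (cases "integrable lborel f")
    case True
    then show ?thesis
      using integral_distr[of "\<lambda>x. t + c *\<^sub>R x" lborel borel f] *[of t] borel_measurable_integrable[of lborel f]
      by (auto simp: measurable_lborel1)
  next
    case False
    then show ?thesis using eq by (simp add: not_integrable_integral_eq)
  qed
qed

definition mollifier :: "real \<Rightarrow> 'a::euclidean_space \<Rightarrow> real"
  where "mollifier r z = bump r z / (LINT y|lborel. bump r (y::'a))"

lemma smooth_supp_bump: "r > 0 \<Longrightarrow> smooth_supp r (bump r)"
  by (auto simp: smooth_supp_def smooth_on_bump bump_eq_0(1))

lemma integrable_smooth_supp:
  assumes "smooth_supp r \<sigma>"
  shows "integrable lborel \<sigma>"
proof -
  obtain B where B: "B \<ge> 0" "\<And>z. \<bar>\<sigma> z\<bar> \<le> B" by (rule smooth_supp_bounded[OF assms(1)]) (rule that)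
  note [measurable] = smooth_supp_measurable[OF assms(1)]
  show ?thesis
  proof (rule Bochner_Integration.integrable_bound)
    show "integrable lborel (\<lambda>y. B * indicator (cball 0 r) y)"
      by (intro integrable_mult_right integrable_real_indicator) (auto intro: emeasure_lborel_cball_finite simp flip: infinity_ennreal_def)
    show "AE y in lborel. norm (\<sigma> y) \<le> norm (B * indicator (cball 0 r) y)"
      using B assms by (auto simp: indicator_def smooth_supp_def)
  qed measurable
qed

lemma integral_bump_pos:
  assumes "r > 0"
  shows "0 < (LINT y|lborel. bump r (y::'a::euclidean_space))"
proof -
  have int: "integrable lborel (bump r :: 'a \<Rightarrow> real)"
    using integrable_smooth_supp smooth_supp_bump assms by blast
  have "\<not> (AE y in lborel. bump r (y::'a) = 0)"
  proof
    assume "AE y in lborel. bump r (y::'a) = 0"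
    then have "AE y in lborel. y \<notin> ball (0::'a) r"
      by eventually_elim (use bump_pos in fastforce)
    then have "emeasure lborel (ball (0::'a) r) = 0"
      by (subst (asm) AE_iff_measurable[of "ball 0 r"]) auto
    then show False
      using negligible_iff_emeasure0 open_not_negligible[of "ball (0::'a) r"] assms
      by (metis ball_eq_empty emeasure_completion leD lmeasurable_ball fmeasurableD main_part open_ball sets_lborel borel_open)
  qed
  then show ?thesis
    using integral_nonneg_eq_0_iff_AE[OF int] bump_nonneg
    by (metis (mono_tags, lifting) AE_I2 integral_nonneg_AE less_eq_real_def)
qed

lemma smooth_supp_mollifier: "r > 0 \<Longrightarrow> smooth_supp r (mollifier r)"
  using k_smooth_on_scaleR[OF k_smooth_on_const, of _ "bump r" "1 / (LINT y|lborel. bump r y)"]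
    smooth_supp_bump[of r]
  by (auto simp: smooth_supp_def mollifier_def[abs_def] smooth_on_def)

lemma mollifier_nonneg: "r > 0 \<Longrightarrow> 0 \<le> mollifier r z"
  using integral_bump_pos[where 'a='a, of r] by (simp add: mollifier_def bump_nonneg)

lemma integral_mollifier:
  assumes "r > 0"
  shows "integral\<^sup>L lborel (mollifier r :: 'a::euclidean_space \<Rightarrow> real) = 1"
  using integral_bump_pos[OF assms, where 'a='a] by (simp add: mollifier_def[abs_def])

lemma dir_deriv_mollifier_commute:
  "dir_deriv (dir_deriv (mollifier r) v) w = dir_deriv (dir_deriv (mollifier r) w) v"
proof -
  have 1: "dir_deriv (mollifier r) v = (\<lambda>z. bump1 r v z / (LINT y|lborel. bump r (y::'a)))" for v :: 'a
    unfolding mollifier_def[abs_def]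
    by (rule dir_deriv_eq) (auto intro!: derivative_eq_intros bump_has_derivative simp: divide_inverse)
  have 2: "dir_deriv (\<lambda>z. bump1 r v z / c) w = (\<lambda>z. bump2 r v w z / c)" for c and v w :: 'a
    by (rule dir_deriv_eq) (auto intro!: derivative_eq_intros bump1_has_derivative simp: divide_inverse)
  show ?thesis unfolding 1 2 bump2_commute[of r v w] ..
qed

lemma mollifier_reflect:
  fixes x :: "'a::euclidean_space"
  assumes "r > 0"
  shows "integrable lborel (\<lambda>y. mollifier r (x - y))" "(LINT y|lborel. mollifier r (x - y)) = 1"
    "integrable lborel (\<lambda>y. mollifier r (y - x))" "(LINT y|lborel. mollifier r (y - x)) = 1"
proof -
  have i: "integrable lborel (mollifier r :: 'a \<Rightarrow> real)"
    by (rule integrable_smooth_supp[OF smooth_supp_mollifier[OF assms]])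
  show "integrable lborel (\<lambda>y. mollifier r (x - y))" "(LINT y|lborel. mollifier r (x - y)) = 1"
    using lborel_translate_reflect[of "-1" "mollifier r" x] i integral_mollifier[OF assms, where 'a='a] by auto
  show "integrable lborel (\<lambda>y. mollifier r (y - x))" "(LINT y|lborel. mollifier r (y - x)) = 1"
    using lborel_translate_reflect[of "1" "mollifier r" "-x"] i integral_mollifier[OF assms, where 'a='a] by auto
qed

lemma convolve_mollifier_nonneg:
  fixes g :: "'a::euclidean_space \<Rightarrow> real"
  assumes "r > 0" "\<And>y. 0 \<le> g y"
  shows "0 \<le> convolve (mollifier r) g x"
  unfolding convolve_def by (intro integral_nonneg_AE) (auto simp: assms mollifier_nonneg)

lemma integral_convolve_mollifier:
  fixes g :: "'a::euclidean_space \<Rightarrow> real"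
  assumes r: "r > 0" and g: "integrable lborel g" "\<And>y. 0 \<le> g y"
  shows "integrable lborel (convolve (mollifier r) g)" "integral\<^sup>L lborel (convolve (mollifier r) g) = integral\<^sup>L lborel g"
proof -
  let ?\<rho> = "mollifier r :: 'a \<Rightarrow> real"
  note \<rho> = smooth_supp_mollifier[OF r, where 'a='a]
  note [measurable] = smooth_supp_measurable[OF \<rho>] borel_measurable_integrable[OF g(1)]
  have "(\<integral>\<^sup>+x. ennreal (convolve ?\<rho> g x) \<partial>lborel) = (\<integral>\<^sup>+x. \<integral>\<^sup>+y. ennreal (?\<rho> (x - y) * g y) \<partial>lborel \<partial>lborel)"
  proof (intro nn_integral_cong)
    fix x :: 'a
    show "ennreal (convolve ?\<rho> g x) = (\<integral>\<^sup>+y. ennreal (?\<rho> (x - y) * g y) \<partial>lborel)"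
      unfolding convolve_def using integrable_convolve[OF \<rho> g(1), of x]
      by (subst nn_integral_eq_integral) (auto simp: g mollifier_nonneg[OF r])
  qed
  also have "\<dots> = (\<integral>\<^sup>+y. \<integral>\<^sup>+x. ennreal (?\<rho> (x - y) * g y) \<partial>lborel \<partial>lborel)"
    by (rule lborel_pair.Fubini'[symmetric]) measurable
  also have "\<dots> = (\<integral>\<^sup>+y. ennreal (g y) \<partial>lborel)"
  proof (intro nn_integral_cong)
    fix y :: 'a
    have "(\<integral>\<^sup>+x. ennreal (?\<rho> (x - y) * g y) \<partial>lborel) = (\<integral>\<^sup>+x. ennreal (?\<rho> (x - y)) * ennreal (g y) \<partial>lborel)"
      by (intro nn_integral_cong ennreal_mult g mollifier_nonneg[OF r])
    also have "\<dots> = (\<integral>\<^sup>+x. ennreal (?\<rho> (x - y)) \<partial>lborel) * ennreal (g y)"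
      by (intro nn_integral_multc) measurable
    also have "(\<integral>\<^sup>+x. ennreal (?\<rho> (x - y)) \<partial>lborel) = 1"
      by (subst nn_integral_eq_integral) (auto simp: mollifier_reflect[OF r] mollifier_nonneg[OF r])
    finally show "(\<integral>\<^sup>+x. ennreal (?\<rho> (x - y) * g y) \<partial>lborel) = ennreal (g y)" by simp
  qed
  also have "\<dots> = ennreal (integral\<^sup>L lborel g)"
    by (rule nn_integral_eq_integral) (auto simp: g)
  finally have *: "(\<integral>\<^sup>+x. ennreal (convolve ?\<rho> g x) \<partial>lborel) = ennreal (integral\<^sup>L lborel g)" .
  have m: "convolve ?\<rho> g \<in> borel_measurable lborel"
    using convolve_measurable[OF \<rho> g(1)] by simp
  have nn: "0 \<le> convolve ?\<rho> g x" for x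
    by (rule convolve_mollifier_nonneg[OF r g(2)])
  show "integrable lborel (convolve ?\<rho> g)"
    by (rule integrableI_nonneg[OF m]) (auto simp: nn *)
  show "integral\<^sup>L lborel (convolve (mollifier r) g) = integral\<^sup>L lborel g"
    using integral_eq_nn_integral[OF m] nn * g by simp
qed

lemma norm_convolve_le:
  fixes f :: "'a::euclidean_space \<Rightarrow> 'b::euclidean_space"
  assumes r: "r > 0" and f: "integrable lborel f"
  shows "norm (convolve (mollifier r) f x) \<le> convolve (mollifier r) (\<lambda>y. norm (f y)) x"
  unfolding convolve_def
proof (rule Bochner_Integration.integral_norm_bound_integral)
  note i = integrable_convolve[OF smooth_supp_mollifier[OF r]]
  show "integrable lborel (\<lambda>y. mollifier r (x - y) *\<^sub>R f y)" by (rule i[OF f])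
  show "integrable lborel (\<lambda>y. mollifier r (x - y) *\<^sub>R norm (f y))" by (rule i) (use f in simp)
qed (auto simp: mollifier_nonneg[OF r])

lemma norm_convolve_square_le:
  fixes f :: "'a::euclidean_space \<Rightarrow> 'b::euclidean_space"
  assumes r: "r > 0" and f: "integrable lborel f" "integrable lborel (\<lambda>x. (norm (f x))\<^sup>2)"
  shows "(norm (convolve (mollifier r) f x))\<^sup>2 \<le> convolve (mollifier r) (\<lambda>y. (norm (f y))\<^sup>2) x"
proof -
  note i = integrable_convolve[OF smooth_supp_mollifier[OF r]]
  define m where "m = convolve (mollifier r) (\<lambda>y. norm (f y)) x"
  have i1: "integrable lborel (\<lambda>y. mollifier r (x - y) * norm (f y))"
    using i[of "\<lambda>y. norm (f y)" x] f by simp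
  have i2: "integrable lborel (\<lambda>y. mollifier r (x - y) * (norm (f y))\<^sup>2)"
    using i[of "\<lambda>y. (norm (f y))\<^sup>2" x] f by simp
  have "0 \<le> (LINT y|lborel. mollifier r (x - y) * (norm (f y) - m)\<^sup>2)"
    by (intro integral_nonneg_AE) (auto simp: mollifier_nonneg[OF r])
  also have "\<dots> = (LINT y|lborel. mollifier r (x - y) * (norm (f y))\<^sup>2
      - 2 * m * (mollifier r (x - y) * norm (f y)) + m\<^sup>2 * mollifier r (x - y))"
    by (intro Bochner_Integration.integral_cong) (auto simp: power2_eq_square algebra_simps)
  also have "\<dots> = convolve (mollifier r) (\<lambda>y. (norm (f y))\<^sup>2) x - 2 * m * m + m\<^sup>2"
    using i1 i2 mollifier_reflect[OF r, of x] by (simp add: m_def convolve_def)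
  finally have "m\<^sup>2 \<le> convolve (mollifier r) (\<lambda>y. (norm (f y))\<^sup>2) x"
    by (simp add: power2_eq_square)
  moreover have "(norm (convolve (mollifier r) f x))\<^sup>2 \<le> m\<^sup>2"
    unfolding m_def by (intro power_mono norm_convolve_le r f) auto
  ultimately show ?thesis by simp
qed

lemma convolve_L1:
  fixes f :: "'a::euclidean_space \<Rightarrow> 'b::euclidean_space"
  assumes r: "r > 0" and f: "integrable lborel f"
  shows "integrable lborel (convolve (mollifier r) f)"
    "(LINT x|lborel. norm (convolve (mollifier r) f x)) \<le> (LINT x|lborel. norm (f x))"
proof -
  have g: "integrable lborel (\<lambda>x. norm (f x))" using f by simp
  note c = integral_convolve_mollifier[OF r g]
  have m: "convolve (mollifier r) f \<in> borel_measurable lborel"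
    using convolve_measurable[OF smooth_supp_mollifier[OF r] f] by simp
  show i: "integrable lborel (convolve (mollifier r) f)"
    by (rule Bochner_Integration.integrable_bound[OF c(1) m])
      (simp, intro AE_I2, simp, rule order_trans[OF norm_convolve_le[OF r f] abs_ge_self])
  show "(LINT x|lborel. norm (convolve (mollifier r) f x)) \<le> (LINT x|lborel. norm (f x))"
    unfolding c(2)[symmetric, simplified]
    by (intro integral_mono integrable_norm i c(1) norm_convolve_le r f) auto
qed

lemma convolve_L2:
  fixes f :: "'a::euclidean_space \<Rightarrow> 'b::euclidean_space"
  assumes r: "r > 0" and f: "integrable lborel f" "integrable lborel (\<lambda>x. (norm (f x))\<^sup>2)"
  shows "integrable lborel (\<lambda>x. (norm (convolve (mollifier r) f x))\<^sup>2)"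
    "(LINT x|lborel. (norm (convolve (mollifier r) f x))\<^sup>2) \<le> (LINT x|lborel. (norm (f x))\<^sup>2)"
proof -
  note c = integral_convolve_mollifier[OF r f(2)]
  have [measurable]: "convolve (mollifier r) f \<in> borel_measurable lborel"
    using convolve_measurable[OF smooth_supp_mollifier[OF r] f(1)] by simp
  show i: "integrable lborel (\<lambda>x. (norm (convolve (mollifier r) f x))\<^sup>2)"
  proof (rule Bochner_Integration.integrable_bound[OF c(1)])
    show "AE x in lborel. norm ((norm (convolve (mollifier r) f x))\<^sup>2)
        \<le> norm (convolve (mollifier r) (\<lambda>x. (norm (f x))\<^sup>2) x)"
      by (intro AE_I2, simp, rule order_trans[OF norm_convolve_square_le[OF r f] abs_ge_self])
  qed auto
  show "(LINT x|lborel. (norm (convolve (mollifier r) f x))\<^sup>2) \<le> (LINT x|lborel. (norm (f x))\<^sup>2)"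
    unfolding c(2)[symmetric, simplified]
    by (intro integral_mono i c(1) norm_convolve_square_le r f) auto
qed

lemma norm_add3_le:
  fixes a b c :: "'a::real_normed_vector"
  shows "norm (a + b - c) \<le> norm a + norm b + norm c"
  by norm

lemma norm_add3_square_le:
  fixes a b c :: "'a::real_normed_vector"
  shows "(norm (a + b - c))\<^sup>2 \<le> 3 * ((norm a)\<^sup>2 + (norm b)\<^sup>2 + (norm c)\<^sup>2)"
proof -
  have "(norm (a + b - c))\<^sup>2 \<le> (norm a + norm b + norm c)\<^sup>2" by (intro power_mono norm_add3_le) auto
  moreover have "(norm a - norm b)\<^sup>2 \<ge> 0" "(norm a - norm c)\<^sup>2 \<ge> 0" "(norm b - norm c)\<^sup>2 \<ge> 0" by auto
  ultimately show ?thesis unfolding power2_eq_square by (simp add: algebra_simps)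
qed

definition mollifies_L1 :: "(nat \<Rightarrow> real) \<Rightarrow> ('a::euclidean_space \<Rightarrow> 'b::euclidean_space) \<Rightarrow> bool"
  where "mollifies_L1 r f \<longleftrightarrow>
    (\<lambda>n. LINT x|lborel. norm (convolve (mollifier (r n)) f x - f x)) \<longlonglongrightarrow> 0"

lemma mollifies_L1_closure:
  fixes f :: "'a::euclidean_space \<Rightarrow> 'b::euclidean_space"
  assumes r: "\<And>n. r n > 0" and f: "integrable lborel f"
    and approx: "\<And>e. e > 0 \<Longrightarrow> \<exists>g. integrable lborel g \<and> (LINT x|lborel. norm (f x - g x)) < e \<and> mollifies_L1 r g"
  shows "mollifies_L1 r f"
  unfolding mollifies_L1_def
proof (rule LIMSEQ_I)
  fix e :: real assume "e > 0"
  then obtain g where g: "integrable lborel g" "(LINT x|lborel. norm (f x - g x)) < e / 3" "mollifies_L1 r g"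
    using approx[of "e / 3"] by auto
  let ?c = "\<lambda>n. convolve (mollifier (r n))"
  have "eventually (\<lambda>n. (LINT x|lborel. norm (?c n g x - g x)) < e / 3) sequentially"
    using g(3) \<open>e > 0\<close> unfolding mollifies_L1_def by (intro order_tendstoD) auto
  then obtain N where N: "\<And>n. n \<ge> N \<Longrightarrow> (LINT x|lborel. norm (?c n g x - g x)) < e / 3"
    unfolding eventually_sequentially by auto
  have "(LINT x|lborel. norm (?c n f x - f x)) < e" if "n \<ge> N" for n
  proof -
    have fg: "integrable lborel (\<lambda>x. f x - g x)" using f g by auto
    note ints = convolve_L1(1)[OF r fg, of n] convolve_L1(1)[OF r f, of n] convolve_L1(1)[OF r g(1), of n]
    have "norm (?c n f x - f x) \<le> norm (?c n (\<lambda>x. f x - g x) x) + norm (?c n g x - g x) + norm (f x - g x)" for x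
    proof -
      have "?c n f x - f x = ?c n (\<lambda>x. f x - g x) x + (?c n g x - g x) - (f x - g x)"
        by (simp add: convolve_diff[OF smooth_supp_mollifier[OF r] f g(1)])
      then show ?thesis by (simp only: norm_add3_le)
    qed
    then have "(LINT x|lborel. norm (?c n f x - f x)) \<le>
        (LINT x|lborel. norm (?c n (\<lambda>x. f x - g x) x) + norm (?c n g x - g x) + norm (f x - g x))"
      using ints f g fg by (intro integral_mono) auto
    also have "\<dots> = (LINT x|lborel. norm (?c n (\<lambda>x. f x - g x) x)) + (LINT x|lborel. norm (?c n g x - g x))
        + (LINT x|lborel. norm (f x - g x))"
      using ints f g fg by simp
    also have "\<dots> < e" using N[OF that] g(2) convolve_L1(2)[OF r fg, of n] by simp
    finally show ?thesis .
  qed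
  then show "\<exists>N. \<forall>n\<ge>N. norm ((LINT x|lborel. norm (?c n f x - f x)) - 0) < e"
    by (intro exI[of _ N]) (auto simp: integral_nonneg_AE)
qed

lemma mollifies_L1_indicator_open:
  fixes U :: "'a::euclidean_space set"
  assumes r: "\<And>n. r n > 0" "r \<longlonglongrightarrow> 0" and U: "open U" "emeasure lborel U < \<infinity>"
  shows "mollifies_L1 r (indicator U :: 'a \<Rightarrow> real)"
proof -
  let ?i = "indicator U :: 'a \<Rightarrow> real"
  let ?c = "\<lambda>n. convolve (mollifier (r n)) ?i"
  have iU: "integrable lborel ?i" using U by (intro integrable_real_indicator) auto
  have c: "integrable lborel (?c n)" "integral\<^sup>L lborel (?c n) = integral\<^sup>L lborel ?i" for n
    by (rule integral_convolve_mollifier[OF r(1) iU]; simp)+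
  have c0: "0 \<le> ?c n x" for n x by (intro convolve_mollifier_nonneg r) auto
  have ci: "integrable lborel (\<lambda>y. mollifier (r n) (x - y) * indicator U y)" for n x
    using integrable_convolve[OF smooth_supp_mollifier[OF r(1)] iU, of n x] by simp
  have c1: "?c n x \<le> 1" for n x
  proof -
    have "?c n x \<le> (LINT y|lborel. mollifier (r n) (x - y))"
      unfolding convolve_def real_scaleR_def
      by (rule integral_mono[OF ci mollifier_reflect(1)[OF r(1)]]) (auto simp: indicator_def mollifier_nonneg[OF r(1)])
    then show ?thesis by (simp add: mollifier_reflect[OF r(1)])
  qed
  have iUc: "integrable lborel (\<lambda>x. ?i x * (1 - ?c n x))" for n
  proof (rule Bochner_Integration.integrable_bound[OF iU])
    show "(\<lambda>x. ?i x * (1 - ?c n x)) \<in> borel_measurable lborel"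
      using borel_measurable_integrable[OF iU] borel_measurable_integrable[OF c(1)[of n]] by measurable
  qed (use c0 c1 in \<open>auto simp: indicator_def\<close>)
  have eq: "(LINT x|lborel. norm (?c n x - ?i x)) = 2 * (LINT x|lborel. ?i x * (1 - ?c n x))" for n
  proof -
    have "(LINT x|lborel. norm (?c n x - ?i x)) = (LINT x|lborel. ?c n x - ?i x + 2 * (?i x * (1 - ?c n x)))"
      using c0 c1 by (intro Bochner_Integration.integral_cong) (auto simp: indicator_def)
    also have "\<dots> = integral\<^sup>L lborel (?c n) - integral\<^sup>L lborel ?i + 2 * (LINT x|lborel. ?i x * (1 - ?c n x))"
      using c(1) iU iUc by simp
    finally show ?thesis by (simp add: c(2))
  qed
  have "(\<lambda>n. LINT x|lborel. ?i x * (1 - ?c n x)) \<longlonglongrightarrow> (LINT x|(lborel::'a measure). 0)"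
  proof (rule integral_dominated_convergence[OF _ _ iU])
    show "AE x in lborel. (\<lambda>n. ?i x * (1 - ?c n x)) \<longlonglongrightarrow> 0"
    proof (rule AE_I2)
      fix x :: 'a
      show "(\<lambda>n. ?i x * (1 - ?c n x)) \<longlonglongrightarrow> 0"
      proof (cases "x \<in> U")
        case True
        then obtain e where e: "e > 0" "ball x e \<subseteq> U" using U(1) openE by blast
        have "eventually (\<lambda>n. r n < e) sequentially" using r(2) e(1) by (rule order_tendstoD)
        then have "eventually (\<lambda>n. ?i x * (1 - ?c n x) = 0) sequentially"
        proof eventually_elim
          case (elim n)
          have *: "mollifier (r n) (x - y) * ?i y = mollifier (r n) (x - y)" for y
            using e elim smooth_supp_mollifier[OF r(1)[of n], where 'a='a]
            by (cases "dist x y < e") (auto simp: smooth_supp_def dist_norm indicator_def)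
          show ?case
            unfolding convolve_def real_scaleR_def * mollifier_reflect(2)[OF r(1)] by simp
        qed
        then show ?thesis by (rule tendsto_eventually)
      qed simp
    qed
    show "AE x in lborel. norm (?i x * (1 - ?c n x)) \<le> ?i x" for n
      using c0 c1 by (auto simp: indicator_def)
  qed (use borel_measurable_integrable[OF iUc] in auto)
  then show ?thesis
    unfolding mollifies_L1_def eq by (auto intro: tendsto_eq_intros)
qed

lemma mollify_L1:
  fixes f :: "'a::euclidean_space \<Rightarrow> 'b::euclidean_space"
  assumes r: "\<And>n. r n > 0" "r \<longlonglongrightarrow> 0" and f: "integrable lborel f"
  shows "mollifies_L1 r f"
  using f
proof (induction rule: integrable_induct)
  case (base A c)
  have A: "A \<in> sets borel" using base by simp
  have iA: "integrable lborel (indicator A :: 'a \<Rightarrow> real)"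
    using base by (intro integrable_real_indicator) auto
  have "mollifies_L1 r (indicator A :: 'a \<Rightarrow> real)"
  proof (rule mollifies_L1_closure[OF r(1) iA])
    fix e :: real assume "e > 0"
    then obtain U where U: "open U" "A \<subseteq> U" "emeasure lborel (U - A) < e"
      by (rule outer_regular_lborel[OF A])
    have "emeasure lborel U \<le> emeasure lborel A + emeasure lborel (U - A)"
      using U A by (metis Un_Diff_cancel borel_open emeasure_subadditive sets.Diff sets_lborel subset_Un_eq)
    also have "\<dots> < \<infinity>"
      using base(2) U(3) by (auto simp: less_top[symmetric])
    finally have fin: "emeasure lborel U < \<infinity>" .
    have "(LINT x|lborel. norm (indicator A x - indicator U x :: real)) = (LINT x|lborel. indicator (U - A) x)"
      using U(2) by (intro Bochner_Integration.integral_cong) (auto simp: indicator_def)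
    also have "\<dots> < e"
      using U A \<open>e > 0\<close> by (simp add: measure_def) (metis enn2real_less_iff ennreal_less_top order_less_trans less_top)
    finally show "\<exists>g. integrable lborel g \<and> (LINT x|lborel. norm (indicator A x - g x :: real)) < e \<and> mollifies_L1 r g"
      using mollifies_L1_indicator_open[OF r U(1) fin] U(1) fin
      by (intro exI[of _ "indicator U :: 'a \<Rightarrow> real"]) auto
  qed
  then have "(\<lambda>n. (LINT x|lborel. norm (convolve (mollifier (r n)) (indicator A) x - indicator A x :: real)) * norm c) \<longlonglongrightarrow> 0"
    unfolding mollifies_L1_def by (rule tendsto_mult_left_zero)
  moreover have "convolve (mollifier (r n)) (\<lambda>x. indicator A x *\<^sub>R c) x - indicator A x *\<^sub>R c
      = (convolve (mollifier (r n)) (indicator A) x - indicator A x) *\<^sub>R c" for n x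
    using integrable_convolve[OF smooth_supp_mollifier[OF r(1)] iA, of n x]
    by (simp add: convolve_def scaleR_diff_left)
  ultimately show ?case by (simp add: mollifies_L1_def)
next
  case (add f g)
  let ?c = "\<lambda>n. convolve (mollifier (r n))"
  have eq: "?c n (\<lambda>x. f x + g x) x = ?c n f x + ?c n g x" for n x
    unfolding convolve_def
    using integrable_convolve[OF smooth_supp_mollifier[OF r(1)[of n]] add(1)]
      integrable_convolve[OF smooth_supp_mollifier[OF r(1)[of n]] add(2)]
    by (simp add: scaleR_add_right)
  have ints: "integrable lborel (?c n f)" "integrable lborel (?c n g)" for n
    by (intro convolve_L1 r add)+
  show ?case unfolding mollifies_L1_def
  proof (rule tendsto_sandwich[OF _ _ tendsto_const])
    show "(\<lambda>n. (LINT x|lborel. norm (?c n f x - f x)) + (LINT x|lborel. norm (?c n g x - g x))) \<longlonglongrightarrow> 0"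
      using add unfolding mollifies_L1_def by (auto intro: tendsto_eq_intros)
    have "(LINT x|lborel. norm (?c n (\<lambda>x. f x + g x) x - (f x + g x)))
      \<le> (LINT x|lborel. norm (?c n f x - f x) + norm (?c n g x - g x))" for n
      unfolding eq using ints add by (intro integral_mono) (auto intro: norm_diff_triangle_ineq)
    then show "\<forall>\<^sub>F n in sequentially. (LINT x|lborel. norm (?c n (\<lambda>x. f x + g x) x - (f x + g x)))
      \<le> (LINT x|lborel. norm (?c n f x - f x)) + (LINT x|lborel. norm (?c n g x - g x))"
      using ints add by simp
  qed (auto intro!: always_eventually integral_nonneg_AE)
next
  case (lim f s)
  show ?case
  proof (rule mollifies_L1_closure[OF r(1) lim.hyps(4)])
    fix e :: real assume e: "e > 0"
    have "(\<lambda>i. LINT x|lborel. norm (f x - s i x)) \<longlonglongrightarrow> (LINT x|(lborel::'a measure). 0)"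
    proof (rule integral_dominated_convergence)
      show "integrable lborel (\<lambda>x. 3 * norm (f x))" using lim by simp
      show "AE x in lborel. (\<lambda>i. norm (f x - s i x)) \<longlonglongrightarrow> 0"
      proof (rule AE_I2)
        fix x show "(\<lambda>i. norm (f x - s i x)) \<longlonglongrightarrow> 0"
          using tendsto_norm[OF tendsto_diff[OF tendsto_const lim.hyps(2)[of x], of "f x"]] by simp
      qed
      show "AE x in lborel. norm (norm (f x - s i x)) \<le> 3 * norm (f x)" for i
      proof (rule AE_I2)
        fix x show "norm (norm (f x - s i x)) \<le> 3 * norm (f x)"
          using lim.hyps(3)[of x i] norm_triangle_ineq4[of "f x" "s i x"] by simp
      qed
    qed (use lim in auto)
    then have "eventually (\<lambda>i. (LINT x|lborel. norm (f x - s i x)) < e) sequentially"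
      using e by (intro order_tendstoD) auto
    then obtain i where "(LINT x|lborel. norm (f x - s i x)) < e"
      using eventually_happens trivial_limit_sequentially by blast
    then show "\<exists>g. integrable lborel g \<and> (LINT x|lborel. norm (f x - g x)) < e \<and> mollifies_L1 r g"
      using lim by blast
  qed
qed

lemma mollify_L2:
  fixes f :: "'a::euclidean_space \<Rightarrow> 'b::euclidean_space"
  assumes r: "\<And>n. r n > 0" "r \<longlonglongrightarrow> 0"
    and f: "integrable lborel f" "integrable lborel (\<lambda>x. (norm (f x))\<^sup>2)"
  shows "(\<lambda>n. LINT x|lborel. (norm (convolve (mollifier (r n)) f x - f x))\<^sup>2) \<longlonglongrightarrow> 0"
proof (rule LIMSEQ_I)
  fix e :: real assume e: "e > 0"
  let ?c = "\<lambda>n. convolve (mollifier (r n))"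
  define g where "g N x = (if norm (f x) \<le> real N then f x else 0)" for N :: nat and x
  note [measurable] = borel_measurable_integrable[OF f(1)]
  have gm [measurable]: "g N \<in> borel_measurable lborel" for N unfolding g_def by measurable
  have ig: "integrable lborel (g N)" for N
    by (rule Bochner_Integration.integrable_bound[OF f(1)]) (auto simp: g_def)
  have gN: "norm (g N x) \<le> N" for N x by (auto simp: g_def)
  have ifg: "integrable lborel (\<lambda>x. f x - g N x)" for N using f ig by simp
  have ifg2: "integrable lborel (\<lambda>x. (norm (f x - g N x))\<^sup>2)" for N
    by (rule Bochner_Integration.integrable_bound[OF f(2)]) (auto simp: g_def)
  have "(\<lambda>N. LINT x|lborel. (norm (f x - g N x))\<^sup>2) \<longlonglongrightarrow> (LINT x|(lborel::'a measure). 0)"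
  proof (rule integral_dominated_convergence[OF _ _ f(2)])
    show "AE x in lborel. (\<lambda>i. (norm (f x - g i x))\<^sup>2) \<longlonglongrightarrow> 0"
    proof (rule AE_I2)
      fix x
      obtain N0 :: nat where "norm (f x) \<le> N0" using real_arch_simple by blast
      then show "(\<lambda>i. (norm (f x - g i x))\<^sup>2) \<longlonglongrightarrow> 0"
        by (intro tendsto_eventually eventually_sequentiallyI[of N0]) (auto simp: g_def)
    qed
  qed (auto simp: g_def)
  then have "eventually (\<lambda>N. (LINT x|lborel. (norm (f x - g N x))\<^sup>2) < e / 9) sequentially"
    using e by (intro order_tendstoD) auto
  then obtain N where N: "(LINT x|lborel. (norm (f x - g N x))\<^sup>2) < e / 9"
    using eventually_happens trivial_limit_sequentially by blast
  have "(\<lambda>n. 2 * N * (LINT x|lborel. norm (?c n (g N) x - g N x))) \<longlonglongrightarrow> 0"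
    using mollify_L1[OF r ig, of N] unfolding mollifies_L1_def by (rule tendsto_mult_right_zero)
  then have "eventually (\<lambda>n. 2 * N * (LINT x|lborel. norm (?c n (g N) x - g N x)) < e / 9) sequentially"
    using e by (intro order_tendstoD) auto
  then obtain n0 where n0: "\<And>n. n \<ge> n0 \<Longrightarrow> 2 * N * (LINT x|lborel. norm (?c n (g N) x - g N x)) < e / 9"
    unfolding eventually_sequentially by auto
  have "(LINT x|lborel. (norm (?c n f x - f x))\<^sup>2) < e" if n: "n \<ge> n0" for n
  proof -
    have cg: "norm (?c n (g N) x) \<le> N" for x
    proof -
      have "norm (?c n (g N) x) \<le> (LINT y|lborel. mollifier (r n) (x - y) * real N)"
        unfolding convolve_def
      proof (rule Bochner_Integration.integral_norm_bound_integral)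
        show "integrable lborel (\<lambda>y. mollifier (r n) (x - y) *\<^sub>R g N y)"
          by (rule integrable_convolve[OF smooth_supp_mollifier[OF r(1)] ig])
        show "norm (mollifier (r n) (x - y) *\<^sub>R g N y) \<le> mollifier (r n) (x - y) * real N" for y
          by (simp add: mult_left_mono gN abs_of_nonneg mollifier_nonneg[OF r(1)])
      qed (use mollifier_reflect(1)[OF r(1)] in auto)
      then show ?thesis by (simp add: mollifier_reflect(2)[OF r(1)])
    qed
    have ci: "integrable lborel (\<lambda>x. norm (?c n (g N) x - g N x))"
      using convolve_L1(1)[OF r(1) ig] ig by auto
    have sq: "(norm (?c n (g N) x - g N x))\<^sup>2 \<le> 2 * N * norm (?c n (g N) x - g N x)" for x
    proof -
      have "norm (?c n (g N) x - g N x) \<le> 2 * N"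
        using norm_triangle_ineq4[of "?c n (g N) x" "g N x"] cg[of x] gN[of N x] by simp
      then show ?thesis unfolding power2_eq_square by (intro mult_right_mono) auto
    qed
    have cm: "?c n (g N) \<in> borel_measurable lborel" "?c n f \<in> borel_measurable lborel"
      using convolve_L1(1)[OF r(1) ig] convolve_L1(1)[OF r(1) f(1)] by auto
    have i1: "integrable lborel (\<lambda>x. (norm (?c n (g N) x - g N x))\<^sup>2)"
      by (rule Bochner_Integration.integrable_bound[OF integrable_mult_right[OF ci, of "2 * N"]])
        (use cm sq in auto)
    have I1: "(LINT x|lborel. (norm (?c n (g N) x - g N x))\<^sup>2) < e / 9"
    proof -
      have "(LINT x|lborel. (norm (?c n (g N) x - g N x))\<^sup>2) \<le> (LINT x|lborel. 2 * N * norm (?c n (g N) x - g N x))"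
        by (intro integral_mono i1 sq integrable_mult_right ci)
      then show ?thesis using n0[OF n] by simp
    qed
    note c2 = convolve_L2[OF r(1) ifg ifg2, of n N]
    let ?R = "\<lambda>x. 3 * ((norm (?c n (\<lambda>x. f x - g N x) x))\<^sup>2 + (norm (?c n (g N) x - g N x))\<^sup>2 + (norm (g N x - f x))\<^sup>2)"
    have le: "(norm (?c n f x - f x))\<^sup>2 \<le> ?R x" for x
    proof -
      have "?c n f x - f x = ?c n (\<lambda>x. f x - g N x) x + (?c n (g N) x - g N x) - (f x - g N x)"
        by (simp add: convolve_diff[OF smooth_supp_mollifier[OF r(1)] f(1) ig])
      then show ?thesis
        using norm_add3_square_le[of "?c n (\<lambda>x. f x - g N x) x" "?c n (g N) x - g N x" "f x - g N x"]
        by (simp add: norm_minus_commute)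
    qed
    have iR: "integrable lborel ?R"
      using c2(1) i1 ifg2[of N] by (auto simp: norm_minus_commute)
    have "(LINT x|lborel. (norm (?c n f x - f x))\<^sup>2) \<le> (LINT x|lborel. ?R x)"
      by (rule integral_mono[OF Bochner_Integration.integrable_bound[OF iR] iR]) (use le cm in auto)
    also have "\<dots> = 3 * ((LINT x|lborel. (norm (?c n (\<lambda>x. f x - g N x) x))\<^sup>2)
        + (LINT x|lborel. (norm (?c n (g N) x - g N x))\<^sup>2) + (LINT x|lborel. (norm (f x - g N x))\<^sup>2))"
      using c2(1) i1 ifg2[of N] by (simp add: norm_minus_commute)
    also have "\<dots> < e" using c2(2) I1 N by simp
    finally show ?thesis .
  qed
  then show "\<exists>n0. \<forall>n\<ge>n0. norm ((LINT x|lborel. (norm (?c n f x - f x))\<^sup>2) - 0) < e"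
    by (intro exI[of _ n0]) (auto simp: integral_nonneg_AE)
qed

section \<open>Integration by parts and mean values\<close>

lemma integrable_continuous_bounded_support:
  fixes f :: "'a::euclidean_space \<Rightarrow> 'b::euclidean_space"
  assumes "continuous_on UNIV f" "\<And>x. R < norm x \<Longrightarrow> f x = 0"
  shows "integrable lborel f"
proof -
  have "integrable lborel (\<lambda>x. indicator (cball 0 R) x *\<^sub>R f x)"
    by (rule borel_integrable_compact[OF compact_cball continuous_on_subset[OF assms(1)]]) simp
  moreover have "(\<lambda>x. indicator (cball 0 R) x *\<^sub>R f x) = f"
    using assms(2) by (auto simp: fun_eq_iff indicator_def not_le)
  ultimately show ?thesis by simp
qed

lemma has_derivative_zero_outside:
  fixes f :: "'a::real_normed_vector \<Rightarrow> 'b::real_normed_vector"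
  assumes "(f has_derivative f') (at x)" "open U" "x \<in> U" "\<And>x. x \<in> U \<Longrightarrow> f x = 0"
  shows "f' v = 0"
proof -
  have "((\<lambda>_. 0) has_derivative f') (at x)"
    using assms by (intro has_derivative_transform_within_open[OF assms(1-3)]) auto
  from has_derivative_unique[OF this has_derivative_const] show ?thesis by simp
qed

lemma integral_derivative_zero:
  fixes f :: "'a::euclidean_space \<Rightarrow> real"
  assumes f': "\<And>x. (f has_derivative f' x) (at x)" and cont: "continuous_on UNIV (\<lambda>x. f' x v)"
    and supp: "\<And>x. R < norm x \<Longrightarrow> f x = 0"
  shows "integrable lborel (\<lambda>x. f' x v)" "(LINT x|lborel. f' x v) = 0"
proof -
  define g where "g x = f' x v" for x
  have contf: "continuous_on UNIV f"
    using f' by (meson continuous_at_imp_continuous_on has_derivative_continuous)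
  have suppg: "g x = 0" if "R < norm x" for x
    unfolding g_def
    by (rule has_derivative_zero_outside[OF f', of "{z. R < norm z}"])
      (use that supp in \<open>auto intro!: open_Collect_less continuous_intros\<close>)
  have contg: "continuous_on UNIV g" using cont by (simp add: g_def[abs_def])
  show ig: "integrable lborel (\<lambda>x. f' x v)"
    using integrable_continuous_bounded_support[OF contg suppg] by (simp add: g_def)
  have if0: "integrable lborel f"
    by (rule integrable_continuous_bounded_support[OF contf supp])
  obtain C where "C \<ge> 0" and C: "\<And>x. \<bar>g x\<bar> \<le> C"
    by (rule compact_support_bounded[OF contg compact_cball[of 0 R]]) (use suppg in auto)
  define B where "B = C"
  have B': "\<bar>g x\<bar> \<le> max B 0" for x using C[of x] by (simp add: B_def max.coboundedI1)
  define h where "h n = 1 / real (Suc n)" for n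
  have h: "h n > 0" "h n \<le> 1" for n by (auto simp: h_def)
  have h0: "h \<longlonglongrightarrow> 0" unfolding h_def[abs_def] using LIMSEQ_inverse_real_of_nat by (simp add: inverse_eq_divide)
  define s where "s n x = (f (x + h n *\<^sub>R v) - f x) / h n" for n x
  have dline: "((\<lambda>t. f (x + t *\<^sub>R v)) has_real_derivative g (x + t *\<^sub>R v)) (at t)" for x t
  proof -
    have "((\<lambda>t. f (x + t *\<^sub>R v)) has_derivative (\<lambda>d. f' (x + t *\<^sub>R v) (d *\<^sub>R v))) (at t)"
      by (rule has_derivative_compose[OF _ f']) (auto intro!: derivative_eq_intros)
    moreover have "f' (x + t *\<^sub>R v) (d *\<^sub>R v) = g (x + t *\<^sub>R v) * d" for d
      using linear_cmul[OF has_derivative_linear[OF f'], of _ d v] by (simp add: g_def)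
    ultimately show ?thesis by (simp add: has_field_derivative_def mult_commute_abs)
  qed
  have lim: "(\<lambda>n. s n x) \<longlonglongrightarrow> g x" for x
  proof -
    have "((\<lambda>t. (f (x + t *\<^sub>R v) - f x) / t) \<longlongrightarrow> g x) (at 0)"
      using dline[of x 0] by (simp add: DERIV_def)
    moreover have "filterlim h (at 0) sequentially"
      using h0 h(1) by (intro filterlim_atI) (auto simp: less_imp_neq[symmetric] intro!: always_eventually)
    ultimately show ?thesis unfolding s_def by (rule filterlim_compose)
  qed
  have bound: "norm (s n x) \<le> max B 0 * indicator (cball 0 (R + norm v)) x" for n x
  proof (cases "norm x \<le> R + norm v")
    case True
    have "\<exists>z. 0 < z \<and> z < h n \<and> f (x + h n *\<^sub>R v) - f (x + 0 *\<^sub>R v) = (h n - 0) * g (x + z *\<^sub>R v)"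
      by (rule MVT2) (use h dline in auto)
    then obtain z where "f (x + h n *\<^sub>R v) - f x = h n * g (x + z *\<^sub>R v)" by auto
    then show ?thesis using B' True h(1)[of n] by (simp add: s_def)
  next
    case False
    have "norm (h n *\<^sub>R v) \<le> norm v" using h[of n] by (simp add: mult_left_le_one_le)
    moreover have "norm x \<le> norm (x + h n *\<^sub>R v) + norm (h n *\<^sub>R v)"
      using norm_triangle_ineq4[of "x + h n *\<^sub>R v" "h n *\<^sub>R v"] by simp
    ultimately have "R < norm (x + h n *\<^sub>R v)" using False by linarith
    moreover have "R < norm x" using False norm_ge_zero[of v] by linarith
    ultimately show ?thesis using supp by (simp add: s_def)
  qed
  have tr: "integrable lborel (\<lambda>x. f (x + h n *\<^sub>R v))" "(LINT x|lborel. f (x + h n *\<^sub>R v)) = integral\<^sup>L lborel f" for n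
    using lborel_translate_reflect[of 1 f "h n *\<^sub>R v"] if0 by (auto simp: add.commute)
  have "(LINT x|lborel. s n x) = 0" for n
    unfolding s_def using tr if0 by simp
  moreover have "(\<lambda>n. LINT x|lborel. s n x) \<longlonglongrightarrow> (LINT x|lborel. g x)"
  proof (rule integral_dominated_convergence)
    show "integrable lborel (\<lambda>x. max B 0 * indicator (cball (0::'a) (R + norm v)) x)"
      by (intro integrable_mult_right integrable_real_indicator) (auto intro: emeasure_lborel_cball_finite simp flip: infinity_ennreal_def)
    show "s n \<in> borel_measurable lborel" for n
      unfolding s_def using borel_measurable_integrable[OF tr(1)] borel_measurable_integrable[OF if0] by measurable
    show "g \<in> borel_measurable lborel"
      using contg by (simp add: borel_measurable_continuous_onI)
  qed (use lim bound in auto)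
  ultimately have "(LINT x|lborel. g x) = 0" by (simp add: LIMSEQ_const_iff)
  then show "(LINT x|lborel. f' x v) = 0" by (simp add: g_def)
qed

definition plus_part :: "real \<Rightarrow> real" where "plus_part t = max 0 t"

lemma plus_part_cube_has_derivative:
  "((\<lambda>t. plus_part t ^ 3) has_real_derivative 3 * (plus_part t)\<^sup>2) (at t)"
proof -
  consider "t < 0" | "t = 0" | "t > 0" by linarith
  then show ?thesis
  proof cases
    case 1
    show ?thesis
      by (rule DERIV_cong_ev[THEN iffD2, OF refl _ _ DERIV_const])
        (use 1 in \<open>auto intro!: eventually_nhds_in_open[of "{..<0}", THEN eventually_mono] simp: plus_part_def\<close>)
  next
    case 2
    have "((\<lambda>h. (plus_part (0 + h) ^ 3 - plus_part 0 ^ 3) / h) \<longlongrightarrow> 0) (at 0)"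
    proof (rule Lim_null_comparison)
      show "\<forall>\<^sub>F h in at 0. norm ((plus_part (0 + h) ^ 3 - plus_part 0 ^ 3) / h) \<le> h\<^sup>2"
        by (auto simp: plus_part_def eventually_at_filter power3_eq_cube power2_eq_square max_def)
      show "((\<lambda>h. h\<^sup>2) \<longlongrightarrow> (0::real)) (at 0)" by (auto intro!: tendsto_eq_intros)
    qed
    then show ?thesis using 2 by (simp add: DERIV_def plus_part_def)
  next
    case 3
    have "((\<lambda>t. t ^ 3) has_real_derivative 3 * t\<^sup>2) (at t)"
      by (auto intro!: derivative_eq_intros)
    then have "((\<lambda>t. t ^ 3) has_real_derivative 3 * (plus_part t)\<^sup>2) (at t)"
      using 3 by (simp add: plus_part_def)
    then show ?thesis
      by (rule DERIV_cong_ev[THEN iffD2, OF refl _ refl, rotated])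
        (use 3 in \<open>auto intro!: eventually_nhds_in_open[of "{0<..}", THEN eventually_mono] simp: plus_part_def\<close>)
  qed
qed

lemma continuous_on_plus_part [continuous_intros]:
  "continuous_on A f \<Longrightarrow> continuous_on A (\<lambda>x. plus_part (f x))"
  unfolding plus_part_def by (intro continuous_intros)

lemma plus_part_nonneg: "0 \<le> plus_part t"
  by (simp add: plus_part_def)

lemma plus_part_ball_eq_0: "0 \<le> d \<Longrightarrow> d < norm z \<Longrightarrow> plus_part (d\<^sup>2 - z \<bullet> z) = 0"
  by (simp add: plus_part_def dot_square_norm power_mono)

lemma plus_part_ball_le: "plus_part (d\<^sup>2 - z \<bullet> z) \<le> d\<^sup>2"
  by (simp add: plus_part_def)

text \<open>The average \<open>m s\<close> of \<open>q (x + s z)\<close> against the weight $(\delta^2-|z|^2)_+^2$ has derivative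
  $\frac s6\int (\delta^2-|z|^2)_+^3\,\Delta q(x+sz)\,dz$, because the weight times \<open>z\<close> is a gradient.\<close>

lemma mean_value_bound:
  fixes P :: "'a::euclidean_space \<Rightarrow> real"
  assumes \<sigma>: "smooth_supp r \<sigma>" and P: "integrable lborel P" and \<delta>: "\<delta> > 0" and C: "C \<ge> 0"
    and iq: "integrable lborel (convolve \<sigma> P)"
    and sub: "\<And>y. dist x y \<le> \<delta> \<Longrightarrow> - C \<le> (\<Sum>b\<in>Basis. convolve (dir_deriv (dir_deriv \<sigma> b) b) P y)"
  shows "convolve \<sigma> P x * (LINT z|lborel. (plus_part (\<delta>\<^sup>2 - (z::'a) \<bullet> z))\<^sup>2)
    \<le> \<delta>^4 * (LINT y|lborel. \<bar>convolve \<sigma> P y\<bar>) + C * (LINT z|lborel. plus_part (\<delta>\<^sup>2 - (z::'a) \<bullet> z) ^ 3)"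
proof -
  define q where "q = convolve \<sigma> P"
  define q1 where "q1 v = convolve (dir_deriv \<sigma> v) P" for v
  define q2 where "q2 v w = convolve (dir_deriv (dir_deriv \<sigma> v) w) P" for v w
  define \<eta> where "\<eta> z = (plus_part (\<delta>\<^sup>2 - z \<bullet> z))\<^sup>2" for z :: 'a
  define Q where "Q z = plus_part (\<delta>\<^sup>2 - z \<bullet> z) ^ 3" for z :: 'a
  note \<sigma>1 = smooth_supp_dir_deriv[OF \<sigma>]
  have dq: "(q has_derivative (\<lambda>v. q1 v y)) (at y)" for y
    unfolding q_def q1_def by (rule convolve_has_derivative[OF \<sigma> P])
  have dq1: "(q1 v has_derivative (\<lambda>w. q2 v w y)) (at y)" for y v
    unfolding q1_def q2_def by (rule convolve_has_derivative[OF \<sigma>1 P])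
  have cq: "continuous_on X q" "continuous_on X (q1 v)" "continuous_on X (q2 v w)" for X v w
    unfolding q_def q1_def q2_def
    by (rule continuous_on_convolve[OF \<sigma> P] continuous_on_convolve[OF \<sigma>1 P]
        continuous_on_convolve[OF smooth_supp_dir_deriv[OF \<sigma>1] P])+
  have c\<eta>: "continuous_on X \<eta>" "continuous_on X Q" for X
    unfolding \<eta>_def Q_def by (intro continuous_intros)+
  have s\<eta>: "\<eta> z = 0" "Q z = 0" if "\<delta> < norm z" for z
    using plus_part_ball_eq_0[of \<delta> z] that \<delta> by (auto simp: \<eta>_def Q_def)
  have nn: "0 \<le> \<eta> z" "0 \<le> Q z" for z by (auto simp: \<eta>_def Q_def plus_part_nonneg)
  have dQ: "(Q has_derivative (\<lambda>v. - 6 * (z \<bullet> v) * \<eta> z)) (at z)" for z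
    using has_derivative_compose[OF quadratic_has_derivative[of \<delta> z]
        plus_part_cube_has_derivative[unfolded has_field_derivative_def]]
    by (simp add: Q_def[abs_def] \<eta>_def mult_ac)
  have int: "integrable lborel (\<lambda>z. \<eta> z * g z)" "integrable lborel (\<lambda>z. Q z * g z)"
    if "continuous_on UNIV g" for g
    by (rule integrable_continuous_bounded_support[of _ \<delta>]; use that s\<eta> c\<eta> in \<open>auto intro!: continuous_intros\<close>)+
  have cs: "continuous_on UNIV (\<lambda>z. q (x + s *\<^sub>R z))" "continuous_on UNIV (\<lambda>z. q1 b (x + s *\<^sub>R z))"
      "continuous_on UNIV (\<lambda>z. q2 b c (x + s *\<^sub>R z))" for s b c
    by (rule continuous_on_compose2[OF cq(1)[of UNIV]] continuous_on_compose2[OF cq(2)[of UNIV]]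
        continuous_on_compose2[OF cq(3)[of UNIV]]; auto intro!: continuous_intros)+
  define m where "m s = (LINT z|lborel. \<eta> z * q (x + s *\<^sub>R z))" for s
  define m' where "m' s = (\<Sum>b\<in>Basis. LINT z|lborel. \<eta> z * ((z \<bullet> b) * q1 b (x + s *\<^sub>R z)))" for s
  have q1_sum: "q1 z y = (\<Sum>b\<in>Basis. (z \<bullet> b) * q1 b y)" for z y
  proof -
    have lin: "linear (\<lambda>v. q1 v y)" unfolding q1_def by (rule linear_convolve_dir_deriv[OF \<sigma> P])
    have "q1 z y = q1 (\<Sum>b\<in>Basis. (z \<bullet> b) *\<^sub>R b) y" by (simp add: euclidean_representation)
    also have "\<dots> = (\<Sum>b\<in>Basis. (z \<bullet> b) * q1 b y)"
      by (simp only: linear_sum[OF lin] linear_cmul[OF lin] real_scaleR_def)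
    finally show ?thesis .
  qed
  have intm': "integrable lborel (\<lambda>z. \<eta> z * ((z \<bullet> b) * q1 b (x + s *\<^sub>R z)))" for s b
    by (intro int continuous_intros cs)
  have \<eta>q1: "\<eta> z * q1 z (x + s *\<^sub>R z) = (\<Sum>b\<in>Basis. \<eta> z * ((z \<bullet> b) * q1 b (x + s *\<^sub>R z)))" for z s
    by (subst q1_sum) (rule sum_distrib_left)
  have m'_eq: "m' s = (LINT z|lborel. \<eta> z * q1 z (x + s *\<^sub>R z))" for s
    unfolding m'_def \<eta>q1
    by (rule Bochner_Integration.integral_sum[symmetric]) (rule intm')
  have intq1: "integrable lborel (\<lambda>z. \<eta> z * q1 z (x + s *\<^sub>R z))" for s
    unfolding \<eta>q1 by (intro Bochner_Integration.integrable_sum intm')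
  obtain A where A: "A \<ge> 0" "\<And>y h. \<bar>q (y + h) - q y - q1 h y\<bar> \<le> A * (norm h)\<^sup>2"
    by (rule convolve_taylor[OF \<sigma> P]) (auto simp: q_def q1_def intro: that)
  define I where "I = A * (LINT z|lborel. \<eta> z * (norm z)\<^sup>2)"
  have m_deriv: "(m has_real_derivative m' s) (at s)" for s
    unfolding has_field_derivative_def
  proof (rule has_derivativeI_sandwich[where e=1 and H="\<lambda>t. I * \<bar>t - s\<bar>"])
    show "bounded_linear ((*) (m' s))" by (rule bounded_linear_mult_right)
    show "((\<lambda>t. I * \<bar>t - s\<bar>) \<longlongrightarrow> 0) (at s)" by (auto intro!: tendsto_eq_intros)
    fix t assume "t \<noteq> s"
    have "m t - m s - m' s * (t - s) = (LINT z|lborel. \<eta> z * (q (x + t *\<^sub>R z) - q (x + s *\<^sub>R z) - q1 ((t - s) *\<^sub>R z) (x + s *\<^sub>R z)))"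
    proof -
      have "q1 ((t - s) *\<^sub>R z) y = (t - s) * q1 z y" for z y
        unfolding q1_def using linear_cmul[OF linear_convolve_dir_deriv[OF \<sigma> P]] by simp
      then have "\<eta> z * (q (x + t *\<^sub>R z) - q (x + s *\<^sub>R z) - q1 ((t - s) *\<^sub>R z) (x + s *\<^sub>R z)) =
          \<eta> z * q (x + t *\<^sub>R z) - \<eta> z * q (x + s *\<^sub>R z) - \<eta> z * q1 z (x + s *\<^sub>R z) * (t - s)" for z
        by (simp add: right_diff_distrib mult_ac)
      then show ?thesis
        unfolding m_def m'_eq using int(1)[OF cs(1)] intq1 by simp
    qed
    also have "norm \<dots> \<le> (LINT z|lborel. (A * (t - s)\<^sup>2) * (\<eta> z * (norm z)\<^sup>2))"
    proof (rule Bochner_Integration.integral_norm_bound_integral)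
      have "continuous_on UNIV (\<lambda>z. q1 ((t - s) *\<^sub>R z) (x + s *\<^sub>R z))"
        by (subst q1_sum) (intro continuous_intros cs)
      then show "integrable lborel (\<lambda>z. \<eta> z * (q (x + t *\<^sub>R z) - q (x + s *\<^sub>R z) - q1 ((t - s) *\<^sub>R z) (x + s *\<^sub>R z)))"
        by (intro int continuous_intros cs)
      show "integrable lborel (\<lambda>z. (A * (t - s)\<^sup>2) * (\<eta> z * (norm z)\<^sup>2))"
        by (intro integrable_mult_right int continuous_intros)
      fix z
      have "\<bar>q (x + s *\<^sub>R z + (t - s) *\<^sub>R z) - q (x + s *\<^sub>R z) - q1 ((t - s) *\<^sub>R z) (x + s *\<^sub>R z)\<bar> \<le> A * (norm ((t - s) *\<^sub>R z))\<^sup>2"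
        by (rule A(2))
      moreover have "x + s *\<^sub>R z + (t - s) *\<^sub>R z = x + t *\<^sub>R z" by (simp add: algebra_simps)
      ultimately have "\<bar>q (x + t *\<^sub>R z) - q (x + s *\<^sub>R z) - q1 ((t - s) *\<^sub>R z) (x + s *\<^sub>R z)\<bar> \<le> A * ((t - s)\<^sup>2 * (norm z)\<^sup>2)"
        by (simp add: power_mult_distrib)
      from mult_left_mono[OF this nn(1)[of z]]
      show "norm (\<eta> z * (q (x + t *\<^sub>R z) - q (x + s *\<^sub>R z) - q1 ((t - s) *\<^sub>R z) (x + s *\<^sub>R z))) \<le> (A * (t - s)\<^sup>2) * (\<eta> z * (norm z)\<^sup>2)"
        using nn(1)[of z] by (simp add: abs_mult mult_ac)
    qed
    also have "\<dots> = I * (t - s)\<^sup>2" by (simp add: I_def)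
    finally show "norm (m t - m s - m' s * (t - s)) / norm (t - s) \<le> I * \<bar>t - s\<bar>"
      using \<open>t \<noteq> s\<close> by (simp add: field_simps power2_eq_square)
  qed simp
  have m'_eq2: "6 * m' s = s * (LINT z|lborel. Q z * (\<Sum>b\<in>Basis. q2 b b (x + s *\<^sub>R z)))" for s
  proof -
    have "6 * (LINT z|lborel. \<eta> z * ((z \<bullet> b) * q1 b (x + s *\<^sub>R z))) = s * (LINT z|lborel. Q z * q2 b b (x + s *\<^sub>R z))"
      if "b \<in> Basis" for b
    proof -
      have d: "((\<lambda>z. Q z * q1 b (x + s *\<^sub>R z)) has_derivative
          (\<lambda>v. Q z * q2 b (s *\<^sub>R v) (x + s *\<^sub>R z) + (- 6 * (z \<bullet> v) * \<eta> z) * q1 b (x + s *\<^sub>R z))) (at z)" for z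
        by (rule has_derivative_mult[OF dQ has_derivative_compose[OF _ dq1]]) (auto intro!: derivative_eq_intros)
      have e: "Q z * q2 b (s *\<^sub>R b) (x + s *\<^sub>R z) + (- 6 * (z \<bullet> b) * \<eta> z) * q1 b (x + s *\<^sub>R z)
          = s * (Q z * q2 b b (x + s *\<^sub>R z)) - 6 * (\<eta> z * ((z \<bullet> b) * q1 b (x + s *\<^sub>R z)))" for z
        unfolding q2_def using linear_cmul[OF linear_convolve_dir_deriv[OF \<sigma>1 P]] by (simp add: algebra_simps)
      have "(LINT z|lborel. Q z * q2 b (s *\<^sub>R b) (x + s *\<^sub>R z) + (- 6 * (z \<bullet> b) * \<eta> z) * q1 b (x + s *\<^sub>R z)) = 0"
      proof (rule integral_derivative_zero(2)[OF d, of b \<delta>])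
        show "continuous_on UNIV (\<lambda>z. Q z * q2 b (s *\<^sub>R b) (x + s *\<^sub>R z) + (- 6 * (z \<bullet> b) * \<eta> z) * q1 b (x + s *\<^sub>R z))"
          by (intro continuous_intros cs c\<eta>)
      qed (use s\<eta> in auto)
      then show ?thesis unfolding e using intm'[of b s] int(2)[OF cs(3)[of b b s]] by simp
    qed
    then show ?thesis
      unfolding m'_def sum_distrib_left
      by (simp add: Bochner_Integration.integral_sum int(2)[OF cs(3)] sum_distrib_left)
  qed
  have "\<exists>z. 0 < z \<and> z < 1 \<and> m 1 - m 0 = (1 - 0) * m' z"
    by (rule MVT2) (use m_deriv in auto)
  then obtain s where s: "0 < s" "s < 1" "m 1 - m 0 = m' s" by auto
  have iQ: "integrable lborel Q" using int(2)[of "\<lambda>_. 1"] by simp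
  have Qnn: "0 \<le> integral\<^sup>L lborel Q" by (intro integral_nonneg_AE) (auto simp: nn)
  have "(LINT z|lborel. - C * Q z) \<le> (LINT z|lborel. Q z * (\<Sum>b\<in>Basis. q2 b b (x + s *\<^sub>R z)))"
  proof (rule integral_mono)
    show "integrable lborel (\<lambda>z. - C * Q z)" using iQ by simp
    show "integrable lborel (\<lambda>z. Q z * (\<Sum>b\<in>Basis. q2 b b (x + s *\<^sub>R z)))"
      by (intro int continuous_intros cs)
    fix z
    show "- C * Q z \<le> Q z * (\<Sum>b\<in>Basis. q2 b b (x + s *\<^sub>R z))"
    proof (cases "norm z \<le> \<delta>")
      case True
      have "s * norm z \<le> norm z" using s by (simp add: mult_left_le_one_le)
      then have "dist x (x + s *\<^sub>R z) \<le> \<delta>" using s True by (simp add: dist_norm)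
      from mult_left_mono[OF sub[OF this] nn(2)[of z]]
      show ?thesis by (simp add: q2_def mult.commute)
    qed (use s\<eta> in auto)
  qed
  then have "- C * integral\<^sup>L lborel Q \<le> (LINT z|lborel. Q z * (\<Sum>b\<in>Basis. q2 b b (x + s *\<^sub>R z)))" by simp
  from mult_left_mono[OF this, of s] have "s * (- C * integral\<^sup>L lborel Q) \<le> 6 * m' s"
    using s(1) m'_eq2[of s] by simp
  moreover have "s * (C * integral\<^sup>L lborel Q) \<le> 1 * (C * integral\<^sup>L lborel Q)"
    using s C Qnn by (intro mult_right_mono) auto
  moreover have "0 \<le> C * integral\<^sup>L lborel Q" using C Qnn by simp
  ultimately have "m 0 \<le> m 1 + C * integral\<^sup>L lborel Q" using s(3) by simp
  moreover have "m 0 = q x * integral\<^sup>L lborel \<eta>" by (simp add: m_def mult.commute)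
  moreover have "m 1 \<le> \<delta>^4 * (LINT y|lborel. \<bar>q y\<bar>)"
  proof -
    have i: "integrable lborel (\<lambda>z. \<bar>q (x + 1 *\<^sub>R z)\<bar>)"
      "(LINT z|lborel. \<bar>q (x + 1 *\<^sub>R z)\<bar>) = (LINT y|lborel. \<bar>q y\<bar>)"
      using lborel_translate_reflect[of 1 "\<lambda>y. \<bar>q y\<bar>" x] iq by (auto simp: q_def)
    have "m 1 \<le> (LINT z|lborel. \<delta>^4 * \<bar>q (x + 1 *\<^sub>R z)\<bar>)"
      unfolding m_def
    proof (rule integral_mono)
      show "integrable lborel (\<lambda>z. \<eta> z * q (x + 1 *\<^sub>R z))" by (intro int cs)
      show "integrable lborel (\<lambda>z. \<delta>^4 * \<bar>q (x + 1 *\<^sub>R z)\<bar>)" using i by simp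
      fix z
      have "\<eta> z \<le> (\<delta>\<^sup>2)\<^sup>2"
        unfolding \<eta>_def by (intro power_mono plus_part_ball_le plus_part_nonneg)
      then have "\<eta> z * \<bar>q (x + 1 *\<^sub>R z)\<bar> \<le> \<delta>^4 * \<bar>q (x + 1 *\<^sub>R z)\<bar>"
        by (intro mult_right_mono) auto
      moreover have "\<eta> z * q (x + 1 *\<^sub>R z) \<le> \<eta> z * \<bar>q (x + 1 *\<^sub>R z)\<bar>"
        by (intro mult_left_mono nn) auto
      ultimately show "\<eta> z * q (x + 1 *\<^sub>R z) \<le> \<delta>^4 * \<bar>q (x + 1 *\<^sub>R z)\<bar>" by linarith
    qed
    then show ?thesis using i by simp
  qed
  ultimately show ?thesis by (simp add: q_def \<eta>_def[abs_def] Q_def[abs_def])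
qed

section \<open>Convergence in the mean square\<close>

lemma Cauchy_Schwarz_integral:
  fixes f g :: "'a \<Rightarrow> 'b::euclidean_space"
  assumes [measurable]: "f \<in> borel_measurable M" "g \<in> borel_measurable M"
    and f: "integrable M (\<lambda>x. (norm (f x))\<^sup>2)" and g: "integrable M (\<lambda>x. (norm (g x))\<^sup>2)"
  shows "integrable M (\<lambda>x. norm (f x) * norm (g x))"
    "(LINT x|M. norm (f x) * norm (g x)) \<le> sqrt (LINT x|M. (norm (f x))\<^sup>2) * sqrt (LINT x|M. (norm (g x))\<^sup>2)"
proof -
  show i: "integrable M (\<lambda>x. norm (f x) * norm (g x))"
  proof (rule Bochner_Integration.integrable_bound)
    show "integrable M (\<lambda>x. (norm (f x))\<^sup>2 + (norm (g x))\<^sup>2)" using f g by simp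
    have "norm (f x) * norm (g x) \<le> (norm (f x))\<^sup>2 + (norm (g x))\<^sup>2" for x
    proof -
      have "0 \<le> (norm (f x) - norm (g x))\<^sup>2 + ((norm (f x))\<^sup>2 + (norm (g x))\<^sup>2)" by simp
      then show ?thesis by (simp add: power2_eq_square algebra_simps)
    qed
    then show "AE x in M. norm (norm (f x) * norm (g x)) \<le> norm ((norm (f x))\<^sup>2 + (norm (g x))\<^sup>2)" by auto
  qed measurable
  define I where "I = (LINT x|M. norm (f x) * norm (g x))"
  have I0: "I \<ge> 0" unfolding I_def by simp
  have "ennreal (I\<^sup>2) = (\<integral>\<^sup>+x. ennreal (norm (f x)) * ennreal (norm (g x)) \<partial>M)\<^sup>2"
    using nn_integral_eq_integral[OF i] I0 by (simp add: I_def ennreal_mult ennreal_power)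
  also have "\<dots> \<le> (\<integral>\<^sup>+x. (ennreal (norm (f x)))\<^sup>2 \<partial>M) * (\<integral>\<^sup>+x. (ennreal (norm (g x)))\<^sup>2 \<partial>M)"
    by (intro Cauchy_Schwarz_nn_integral) measurable
  also have "\<dots> = ennreal ((LINT x|M. (norm (f x))\<^sup>2) * (LINT x|M. (norm (g x))\<^sup>2))"
    using nn_integral_eq_integral[OF f] nn_integral_eq_integral[OF g]
    by (simp add: ennreal_mult ennreal_power)
  finally have "I\<^sup>2 \<le> (LINT x|M. (norm (f x))\<^sup>2) * (LINT x|M. (norm (g x))\<^sup>2)"
    by (subst (asm) ennreal_le_iff) auto
  then have "sqrt (I\<^sup>2) \<le> sqrt ((LINT x|M. (norm (f x))\<^sup>2) * (LINT x|M. (norm (g x))\<^sup>2))"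
    by (rule real_sqrt_le_mono)
  then show "(LINT x|M. norm (f x) * norm (g x)) \<le> sqrt (LINT x|M. (norm (f x))\<^sup>2) * sqrt (LINT x|M. (norm (g x))\<^sup>2)"
    using I0 by (simp add: I_def real_sqrt_mult)
qed

lemma tendsto_integral_inner_L2:
  fixes f g :: "'a \<Rightarrow> 'b::euclidean_space" and \<phi> :: "'a \<Rightarrow> real"
  assumes [measurable]: "\<And>n. fn n \<in> borel_measurable M" "f \<in> borel_measurable M"
      "\<And>n. gn n \<in> borel_measurable M" "g \<in> borel_measurable M" "\<phi> \<in> borel_measurable M"
    and f: "integrable M (\<lambda>x. (norm (f x))\<^sup>2)" and g: "integrable M (\<lambda>x. (norm (g x))\<^sup>2)"
    and df: "\<And>n. integrable M (\<lambda>x. (norm (fn n x - f x))\<^sup>2)" "(\<lambda>n. LINT x|M. (norm (fn n x - f x))\<^sup>2) \<longlonglongrightarrow> 0"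
    and dg: "\<And>n. integrable M (\<lambda>x. (norm (gn n x - g x))\<^sup>2)" "(\<lambda>n. LINT x|M. (norm (gn n x - g x))\<^sup>2) \<longlonglongrightarrow> 0"
    and B: "\<And>x. \<bar>\<phi> x\<bar> \<le> B"
  shows "\<And>n. integrable M (\<lambda>x. \<phi> x * (fn n x \<bullet> gn n x))" "integrable M (\<lambda>x. \<phi> x * (f x \<bullet> g x))"
    "(\<lambda>n. LINT x|M. \<phi> x * (fn n x \<bullet> gn n x)) \<longlonglongrightarrow> (LINT x|M. \<phi> x * (f x \<bullet> g x))"
proof -
  let ?F = "LINT x|M. (norm (f x))\<^sup>2" and ?G = "LINT x|M. (norm (g x))\<^sup>2"
  let ?df = "\<lambda>n. LINT x|M. (norm (fn n x - f x))\<^sup>2" and ?dg = "\<lambda>n. LINT x|M. (norm (gn n x - g x))\<^sup>2"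
  have B0: "B \<ge> 0" using B[of undefined] by linarith
  have inner_int: "integrable M (\<lambda>x. \<phi> x * (a x \<bullet> b x))"
    and inner_le: "\<bar>LINT x|M. \<phi> x * (a x \<bullet> b x)\<bar> \<le> B * (sqrt (LINT x|M. (norm (a x))\<^sup>2) * sqrt (LINT x|M. (norm (b x))\<^sup>2))"
    if [measurable]: "a \<in> borel_measurable M" "b \<in> borel_measurable M"
      and "integrable M (\<lambda>x. (norm (a x))\<^sup>2)" "integrable M (\<lambda>x. (norm (b x))\<^sup>2)" for a b :: "'a \<Rightarrow> 'b"
  proof -
    note cs = Cauchy_Schwarz_integral[OF that]
    have le: "\<bar>\<phi> x * (a x \<bullet> b x)\<bar> \<le> B * (norm (a x) * norm (b x))" for x
      unfolding abs_mult by (intro mult_mono B Cauchy_Schwarz_ineq2 B0) auto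
    have i: "integrable M (\<lambda>x. B * (norm (a x) * norm (b x)))" using cs(1) by simp
    show i': "integrable M (\<lambda>x. \<phi> x * (a x \<bullet> b x))"
      by (rule Bochner_Integration.integrable_bound[OF i]) (use le in \<open>auto intro: order_trans[OF _ abs_ge_self]\<close>)
    have "\<bar>LINT x|M. \<phi> x * (a x \<bullet> b x)\<bar> \<le> (LINT x|M. \<bar>\<phi> x * (a x \<bullet> b x)\<bar>)" by (rule integral_abs_bound)
    also have "\<dots> \<le> (LINT x|M. B * (norm (a x) * norm (b x)))"
      using i i' le by (intro integral_mono) auto
    also have "\<dots> \<le> B * (sqrt (LINT x|M. (norm (a x))\<^sup>2) * sqrt (LINT x|M. (norm (b x))\<^sup>2))"
      using cs(2) B0 by (simp add: mult_left_mono)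
    finally show "\<bar>LINT x|M. \<phi> x * (a x \<bullet> b x)\<bar> \<le> B * (sqrt (LINT x|M. (norm (a x))\<^sup>2) * sqrt (LINT x|M. (norm (b x))\<^sup>2))" .
  qed
  have m: "(\<lambda>x. fn n x - f x) \<in> borel_measurable M" "(\<lambda>x. gn n x - g x) \<in> borel_measurable M" for n by measurable
  have i1: "integrable M (\<lambda>x. \<phi> x * ((fn n x - f x) \<bullet> (gn n x - g x)))"
   and i2: "integrable M (\<lambda>x. \<phi> x * (f x \<bullet> (gn n x - g x)))"
   and i3: "integrable M (\<lambda>x. \<phi> x * ((fn n x - f x) \<bullet> g x))" for n
    by (intro inner_int m df dg f g assms)+
  show i0: "integrable M (\<lambda>x. \<phi> x * (f x \<bullet> g x))" by (intro inner_int f g assms)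
  have split: "\<phi> x * (fn n x \<bullet> gn n x) = \<phi> x * ((fn n x - f x) \<bullet> (gn n x - g x)) + \<phi> x * (f x \<bullet> (gn n x - g x))
      + \<phi> x * ((fn n x - f x) \<bullet> g x) + \<phi> x * (f x \<bullet> g x)" for n x
    by (simp add: inner_diff algebra_simps)
  show "integrable M (\<lambda>x. \<phi> x * (fn n x \<bullet> gn n x))" for n
    unfolding split using i0 i1 i2 i3 by simp
  have lim0: "(\<lambda>n. LINT x|M. \<phi> x * (a n x \<bullet> b n x)) \<longlonglongrightarrow> 0"
    if "\<And>n. \<bar>LINT x|M. \<phi> x * (a n x \<bullet> b n x)\<bar> \<le> c n" "c \<longlonglongrightarrow> 0" for a b :: "nat \<Rightarrow> 'a \<Rightarrow> 'b" and c
    by (rule Lim_null_comparison[OF _ that(2)]) (use that(1) in auto)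
  have l1: "(\<lambda>n. LINT x|M. \<phi> x * ((fn n x - f x) \<bullet> (gn n x - g x))) \<longlonglongrightarrow> 0"
    by (rule lim0, rule inner_le[OF m df(1) dg(1)]) (auto intro!: tendsto_eq_intros df(2) dg(2))
  have l2: "(\<lambda>n. LINT x|M. \<phi> x * (f x \<bullet> (gn n x - g x))) \<longlonglongrightarrow> 0"
    by (rule lim0, rule inner_le[OF assms(2) m(2) f dg(1)]) (auto intro!: tendsto_eq_intros dg(2))
  have l3: "(\<lambda>n. LINT x|M. \<phi> x * ((fn n x - f x) \<bullet> g x)) \<longlonglongrightarrow> 0"
    by (rule lim0, rule inner_le[OF m(1) assms(4) df(1) g]) (auto intro!: tendsto_eq_intros df(2))
  have "(\<lambda>n. (LINT x|M. \<phi> x * ((fn n x - f x) \<bullet> (gn n x - g x))) + (LINT x|M. \<phi> x * (f x \<bullet> (gn n x - g x)))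
      + (LINT x|M. \<phi> x * ((fn n x - f x) \<bullet> g x)) + (LINT x|M. \<phi> x * (f x \<bullet> g x)))
    \<longlonglongrightarrow> 0 + 0 + 0 + (LINT x|M. \<phi> x * (f x \<bullet> g x))"
    by (intro tendsto_intros l1 l2 l3)
  then show "(\<lambda>n. LINT x|M. \<phi> x * (fn n x \<bullet> gn n x)) \<longlonglongrightarrow> (LINT x|M. \<phi> x * (f x \<bullet> g x))"
    unfolding split using i0 i1 i2 i3 by simp
qed

section \<open>Weak solutions and their mollifications\<close>

lemma borel_representative:
  fixes f :: "'a::euclidean_space \<Rightarrow> 'b::euclidean_space"
  assumes "integrable lebesgue f"
  obtains g where "integrable lborel g" "AE x in lebesgue. f x = g x"
proof -
  have "\<forall>b. \<exists>g\<in>borel_measurable lborel. AE x in lborel. f x \<bullet> b = g x"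
    using completion_ex_borel_measurable_real[of "\<lambda>x. f x \<bullet> b" lborel for b] assms by auto
  then obtain g where g: "\<And>b. g b \<in> borel_measurable lborel" "\<And>b. AE x in lborel. f x \<bullet> b = g b x"
    by metis
  define h where "h x = (\<Sum>b\<in>Basis. g b x *\<^sub>R b)" for x
  have [measurable]: "h \<in> borel_measurable lborel"
    unfolding h_def using g(1) by measurable
  have "AE x in lborel. \<forall>b\<in>Basis. f x \<bullet> b = g b x"
    using g(2) by (subst AE_finite_all) auto
  then have "AE x in lborel. f x = h x"
  proof eventually_elim
    case (elim x)
    have "f x = (\<Sum>b\<in>Basis. (f x \<bullet> b) *\<^sub>R b)" by (simp add: euclidean_representation)
    also have "\<dots> = h x" unfolding h_def using elim by (intro sum.cong) auto
    finally show ?case .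
  qed
  then have ae: "AE x in lebesgue. f x = h x" by (rule AE_completion)
  have "integrable lebesgue h"
    using assms by (rule integrable_cong_AE_imp) (use ae in \<open>auto intro: measurable_completion\<close>)
  then have "integrable lborel h" by (simp add: integrable_completion)
  then show ?thesis using ae by (rule that)
qed

definition local_rep :: "'a::euclidean_space set \<Rightarrow> ('a \<Rightarrow> 'b::euclidean_space) \<Rightarrow> ('a \<Rightarrow> 'b) \<Rightarrow> bool"
  where "local_rep K f F \<longleftrightarrow> set_integrable lebesgue K f \<and> integrable lborel F \<and>
    (AE x in lebesgue. indicator K x *\<^sub>R f x = F x)"

lemma local_rep_exists:
  assumes "locally_integrable \<Omega> f" "compact K" "K \<subseteq> \<Omega>"
  obtains F where "local_rep K f F"
proof -
  have "integrable lebesgue (\<lambda>x. indicator K x *\<^sub>R f x)"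
    using assms by (simp add: locally_integrable_def set_integrable_def)
  from borel_representative[OF this] obtain F where
    "integrable lborel F" "AE x in lebesgue. indicator K x *\<^sub>R f x = F x" .
  then show ?thesis using assms by (intro that[of F]) (auto simp: local_rep_def locally_integrable_def)
qed

lemma local_rep_AE:
  assumes "local_rep K f F"
  shows "AE x in lebesgue. (x \<in> K \<longrightarrow> F x = f x) \<and> (x \<notin> K \<longrightarrow> F x = 0)"
proof -
  have "AE x in lebesgue. indicator K x *\<^sub>R f x = F x" using assms by (simp add: local_rep_def)
  then show ?thesis by eventually_elim (auto simp: indicator_def split: if_splits)
qed

lemma integral_local_rep:
  fixes f :: "'a::euclidean_space \<Rightarrow> 'b::euclidean_space" and \<phi> :: "'a \<Rightarrow> real"
  assumes F: "local_rep K f F" and K: "K \<subseteq> \<Omega>"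
    and \<phi>: "\<phi> \<in> borel_measurable borel" "\<And>y. y \<notin> K \<Longrightarrow> \<phi> y = 0" "integrable lborel (\<lambda>y. \<phi> y *\<^sub>R F y)"
  shows "set_integrable lebesgue \<Omega> (\<lambda>y. \<phi> y *\<^sub>R f y)"
    "(LINT y:\<Omega>|lebesgue. \<phi> y *\<^sub>R f y) = (LINT y|lborel. \<phi> y *\<^sub>R F y)"
proof -
  have eq: "(\<lambda>y. indicator \<Omega> y *\<^sub>R (\<phi> y *\<^sub>R f y)) = (\<lambda>y. \<phi> y *\<^sub>R (indicator K y *\<^sub>R f y))"
    using K \<phi>(2) by (auto simp: indicator_def fun_eq_iff)
  have m1: "(\<lambda>y. indicator K y *\<^sub>R f y) \<in> borel_measurable lebesgue"
    using F by (auto simp: local_rep_def set_integrable_def dest: borel_measurable_integrable)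
  have m2: "\<phi> \<in> borel_measurable lebesgue" using \<phi>(1) by (auto intro: measurable_completion)
  have m: "(\<lambda>y. \<phi> y *\<^sub>R (indicator K y *\<^sub>R f y)) \<in> borel_measurable lebesgue"
    using m1 m2 by (rule borel_measurable_scaleR[rotated])
  have mF: "(\<lambda>y. \<phi> y *\<^sub>R F y) \<in> borel_measurable lborel" using \<phi>(3) by auto
  have ae: "AE y in lebesgue. \<phi> y *\<^sub>R F y = \<phi> y *\<^sub>R (indicator K y *\<^sub>R f y)"
  proof -
    have "AE y in lebesgue. indicator K y *\<^sub>R f y = F y" using F by (simp add: local_rep_def)
    then show ?thesis by eventually_elim (simp only:)
  qed
  have i: "integrable lebesgue (\<lambda>y. \<phi> y *\<^sub>R F y)"
    using \<phi>(3) mF by (simp add: integrable_completion)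
  show "set_integrable lebesgue \<Omega> (\<lambda>y. \<phi> y *\<^sub>R f y)"
    unfolding set_integrable_def eq by (rule integrable_cong_AE_imp[OF i m ae])
  have "(LINT y|lebesgue. \<phi> y *\<^sub>R F y) = (LINT y|lebesgue. \<phi> y *\<^sub>R (indicator K y *\<^sub>R f y))"
    by (rule integral_cong_AE[OF _ m ae]) (use i in auto)
  then show "(LINT y:\<Omega>|lebesgue. \<phi> y *\<^sub>R f y) = (LINT y|lborel. \<phi> y *\<^sub>R F y)"
    unfolding set_lebesgue_integral_def eq using mF by (simp add: integral_completion)
qed

lemma local_rep_convolve:
  fixes f :: "'a::euclidean_space \<Rightarrow> 'b::euclidean_space"
  assumes F: "local_rep K f F" and \<sigma>: "smooth_supp r \<sigma>" and K: "cball x r \<subseteq> K" "K \<subseteq> \<Omega>"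
  shows "set_integrable lebesgue \<Omega> (\<lambda>y. \<sigma> (x - y) *\<^sub>R f y)"
    "(LINT y:\<Omega>|lebesgue. \<sigma> (x - y) *\<^sub>R f y) = convolve \<sigma> F x"
proof -
  have [measurable]: "\<sigma> \<in> borel_measurable borel" by (rule smooth_supp_measurable[OF \<sigma>])
  have 0: "\<sigma> (x - y) = 0" if "y \<notin> K" for y
  proof -
    have "y \<notin> cball x r" using that K(1) by blast
    then show ?thesis using \<sigma> by (auto simp: smooth_supp_def dist_norm)
  qed
  have i: "integrable lborel (\<lambda>y. \<sigma> (x - y) *\<^sub>R F y)"
    using F by (intro integrable_convolve[OF \<sigma>]) (simp add: local_rep_def)
  have m: "(\<lambda>y. \<sigma> (x - y)) \<in> borel_measurable borel" by measurable
  show "set_integrable lebesgue \<Omega> (\<lambda>y. \<sigma> (x - y) *\<^sub>R f y)"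
    "(LINT y:\<Omega>|lebesgue. \<sigma> (x - y) *\<^sub>R f y) = convolve \<sigma> F x"
    unfolding convolve_def by (rule integral_local_rep[OF F K(2) m 0 i]; assumption)+
qed

lemma smooth_supp_reflect_test:
  assumes "smooth_supp r \<sigma>" "cball x r \<subseteq> \<Omega>"
  shows "test_function \<Omega> (\<lambda>y. \<sigma> (x - y))"
  using assms by (intro test_function_reflect[of \<sigma> r]) (auto simp: smooth_supp_def)

lemma weak_deriv_convolve:
  assumes g: "has_weak_deriv \<Omega> u v g" and U: "local_rep K u U" and G: "local_rep K g G"
    and \<sigma>: "smooth_supp r \<sigma>" and K: "cball x r \<subseteq> K" "K \<subseteq> \<Omega>"
  shows "convolve (dir_deriv \<sigma> v) U x = convolve \<sigma> G x"
proof -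
  have D: "frechet_derivative (\<lambda>y. \<sigma> (x - y)) (at y) v = - dir_deriv \<sigma> v (x - y)" for y
    using smooth_supp_has_derivative[OF \<sigma>] by (intro dir_deriv_reflect) (auto simp: differentiable_def)
  have "(LINT y:\<Omega>|lebesgue. frechet_derivative (\<lambda>y. \<sigma> (x - y)) (at y) v *\<^sub>R u y) =
      - (LINT y:\<Omega>|lebesgue. \<sigma> (x - y) *\<^sub>R g y)"
    using g smooth_supp_reflect_test[OF \<sigma>, of x \<Omega>] K unfolding has_weak_deriv_def by blast
  then show ?thesis
    unfolding D
    using local_rep_convolve(2)[OF U smooth_supp_dir_deriv[OF \<sigma>] K] local_rep_convolve(2)[OF G \<sigma> K]
    by (simp add: set_lebesgue_integral_def)
qed

lemma thicken_compact:
  fixes K :: "'a::euclidean_space set"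
  assumes "compact K" "open \<Omega>" "K \<subseteq> \<Omega>"
  obtains \<delta> K' where "\<delta> > 0" "compact K'" "K' \<subseteq> \<Omega>" "K \<subseteq> K'" "\<And>x. x \<in> K \<Longrightarrow> cball x \<delta> \<subseteq> K'"
proof -
  obtain \<delta> where \<delta>: "\<delta> > 0" "(\<Union>x\<in>K. cball x \<delta>) \<subseteq> \<Omega>"
    by (rule compact_subset_open_imp_cball_epsilon_subset[OF assms])
  have eq: "(\<Union>x\<in>K. cball x \<delta>) = {x + y | x y. x \<in> K \<and> y \<in> cball 0 \<delta>}"
  proof (intro set_eqI iffI)
    fix z assume "z \<in> (\<Union>x\<in>K. cball x \<delta>)"
    then obtain x where "x \<in> K" "dist x z \<le> \<delta>" by auto
    then show "z \<in> {x + y | x y. x \<in> K \<and> y \<in> cball 0 \<delta>}"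
      by (intro CollectI exI[of _ x] exI[of _ "z - x"]) (auto simp: dist_norm norm_minus_commute)
  next
    fix z assume "z \<in> {x + y | x y. x \<in> K \<and> y \<in> cball 0 \<delta>}"
    then obtain x y where "z = x + y" "x \<in> K" "norm y \<le> \<delta>" by auto
    then show "z \<in> (\<Union>x\<in>K. cball x \<delta>)" by (intro UN_I[of x]) (auto simp: dist_norm)
  qed
  have "compact (\<Union>x\<in>K. cball x \<delta>)"
    unfolding eq by (intro compact_sums assms compact_cball)
  then show ?thesis using \<delta> by (intro that[of \<delta> "\<Union>x\<in>K. cball x \<delta>"]) (auto simp: less_imp_le)
qed

lemma AE_eq_of_convolve_eq:
  fixes F G :: "'a::euclidean_space \<Rightarrow> 'b::euclidean_space"
  assumes F: "integrable lborel F" and G: "integrable lborel G" and K: "K \<in> sets borel" and \<delta>: "\<delta> > 0"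
    and eq: "\<And>x r. x \<in> K \<Longrightarrow> 0 < r \<Longrightarrow> r \<le> \<delta> \<Longrightarrow> convolve (mollifier r) F x = convolve (mollifier r) G x"
  shows "AE x in lborel. x \<in> K \<longrightarrow> F x = G x"
proof -
  define H where "H x = F x - G x" for x
  have H: "integrable lborel H" unfolding H_def using F G by simp
  define r where "r n = \<delta> / real (Suc n)" for n
  have r: "r n > 0" "r n \<le> \<delta>" for n using \<delta> by (auto simp: r_def field_simps)
  have r0: "r \<longlonglongrightarrow> 0" unfolding r_def
    using tendsto_mult_right_zero[OF LIMSEQ_inverse_real_of_nat, of \<delta>] by (simp add: divide_inverse)
  have cH: "convolve (mollifier (r n)) H x = 0" if "x \<in> K" for x n
    unfolding H_def using eq[OF that r] by (simp add: convolve_diff[OF smooth_supp_mollifier[OF r(1)] F G])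
  have iK: "integrable lborel (\<lambda>x. indicator K x * norm (H x))"
    using integrable_mult_indicator[of K lborel "\<lambda>x. norm (H x)"] H K by simp
  have "(LINT x|lborel. indicator K x * norm (H x)) \<le> (LINT x|lborel. norm (convolve (mollifier (r n)) H x - H x))" for n
  proof (rule integral_mono[OF iK])
    show "integrable lborel (\<lambda>x. norm (convolve (mollifier (r n)) H x - H x))"
      using convolve_L1(1)[OF r(1) H] H by auto
    show "indicator K x * norm (H x) \<le> norm (convolve (mollifier (r n)) H x - H x)" for x
      using cH[of x n] by (auto simp: indicator_def)
  qed
  then have "(LINT x|lborel. indicator K x * norm (H x)) \<le> 0"
    by (intro LIMSEQ_le_const[OF mollify_L1[OF r(1) r0 H, unfolded mollifies_L1_def]]) auto
  then have "(LINT x|lborel. indicator K x * norm (H x)) = 0"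
    by (intro antisym) (auto intro!: integral_nonneg_AE)
  then have "AE x in lborel. indicator K x * norm (H x) = 0"
    by (subst (asm) integral_nonneg_eq_0_iff_AE[OF iK]) auto
  then show ?thesis by eventually_elim (auto simp: H_def)
qed

lemma has_weak_deriv_unique:
  assumes "open \<Omega>" "has_weak_deriv \<Omega> u v g" "has_weak_deriv \<Omega> u v g'" "compact K" "K \<subseteq> \<Omega>"
  shows "AE x in lebesgue. x \<in> K \<longrightarrow> g x = g' x"
proof -
  obtain \<delta> K' where K': "\<delta> > 0" "compact K'" "K' \<subseteq> \<Omega>" "K \<subseteq> K'" "\<And>x. x \<in> K \<Longrightarrow> cball x \<delta> \<subseteq> K'"
    by (rule thicken_compact[OF assms(4,1,5)]) (rule that)
  obtain U where U: "local_rep K' u U"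
    using assms K' by (auto simp: has_weak_deriv_def intro: local_rep_exists)
  obtain G where G: "local_rep K' g G"
    using assms K' by (auto simp: has_weak_deriv_def intro: local_rep_exists)
  obtain G' where G': "local_rep K' g' G'"
    using assms K' by (auto simp: has_weak_deriv_def intro: local_rep_exists)
  have "AE x in lborel. x \<in> K \<longrightarrow> G x = G' x"
  proof (rule AE_eq_of_convolve_eq[OF _ _ _ K'(1)])
    show "K \<in> sets borel" using assms(4) by (simp add: borel_compact)
    fix x r assume "x \<in> K" "0 < r" "r \<le> \<delta>"
    then have r: "smooth_supp r (mollifier r)" "cball x r \<subseteq> K'"
      using smooth_supp_mollifier K'(5)[of x] by (auto simp: subset_iff)
    show "convolve (mollifier r) G x = convolve (mollifier r) G' x"
      using weak_deriv_convolve[OF assms(2) U G r K'(3)] weak_deriv_convolve[OF assms(3) U G' r K'(3)] by simp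
  qed (use G G' in \<open>auto simp: local_rep_def\<close>)
  then have "AE x in lebesgue. x \<in> K \<longrightarrow> G x = G' x" by (rule AE_completion)
  with local_rep_AE[OF G] local_rep_AE[OF G'] show ?thesis
    by eventually_elim (use K'(4) in auto)
qed

lemma weak_deriv_square_integrable:
  assumes \<Omega>: "open \<Omega>" and u: "sobolev_H1 \<Omega> u" and K: "compact K" "K \<subseteq> \<Omega>"
    and G: "local_rep K (weak_deriv \<Omega> u v) G"
  shows "integrable lborel (\<lambda>x. (norm (G x))\<^sup>2)"
proof -
  obtain g where g: "has_weak_deriv \<Omega> u v g" "square_integrable \<Omega> g"
    using u unfolding sobolev_H1_def by blast
  have "has_weak_deriv \<Omega> u v (weak_deriv \<Omega> u v)"
    unfolding weak_deriv_def using g(1) by (rule someI[where P="has_weak_deriv \<Omega> u v"])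
  from has_weak_deriv_unique[OF \<Omega> this g(1) K]
  have ae: "AE x in lebesgue. x \<in> K \<longrightarrow> weak_deriv \<Omega> u v x = g x" .
  have Gm: "(\<lambda>x. (norm (G x))\<^sup>2) \<in> borel_measurable lborel"
    using G by (auto simp: local_rep_def dest!: borel_measurable_integrable)
  have "integrable lebesgue (\<lambda>x. (norm (G x))\<^sup>2)"
  proof (rule Bochner_Integration.integrable_bound)
    show "integrable lebesgue (\<lambda>x. indicator \<Omega> x *\<^sub>R (norm (g x))\<^sup>2)"
      using g(2) by (simp add: square_integrable_def set_integrable_def)
    show "AE x in lebesgue. norm ((norm (G x))\<^sup>2) \<le> norm (indicator \<Omega> x *\<^sub>R (norm (g x))\<^sup>2)"
      using ae local_rep_AE[OF G] by eventually_elim (use K in \<open>auto simp: indicator_def\<close>)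
  qed (use Gm in \<open>auto intro: measurable_completion\<close>)
  then show ?thesis using Gm by (simp add: integrable_completion)
qed

lemma smooth_on_grad:
  fixes V :: "'b::euclidean_space \<Rightarrow> real"
  assumes "smooth_on UNIV V"
  shows "(V has_derivative (\<lambda>h. grad V y \<bullet> h)) (at y)" "continuous_on X (grad V)"
proof -
  define D where "D y = (\<Sum>b\<in>Basis. dir_deriv V b y *\<^sub>R b)" for y
  have d: "(V has_derivative (\<lambda>h. dir_deriv V h y)) (at y)" for y
    using assms by (intro differentiable_has_dir_deriv smooth_on_differentiable)
  have Dh: "dir_deriv V h y = h \<bullet> D y" for h y
  proof -
    have lin: "linear (\<lambda>h. dir_deriv V h y)" using has_derivative_linear[OF d] .
    have "dir_deriv V h y = dir_deriv V (\<Sum>b\<in>Basis. (h \<bullet> b) *\<^sub>R b) y" by (simp add: euclidean_representation)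
    also have "\<dots> = (\<Sum>b\<in>Basis. (h \<bullet> b) * dir_deriv V b y)"
      by (simp only: linear_sum[OF lin] linear_cmul[OF lin] real_scaleR_def)
    finally show ?thesis by (simp add: D_def inner_sum_right mult.commute)
  qed
  have G: "GDERIV V y :> D y" for y
    using d unfolding gderiv_def Dh .
  have grad: "grad V y = D y" for y
    unfolding grad_def
  proof (rule the_equality[where P="\<lambda>D. GDERIV V y :> D", OF G])
    fix E assume "GDERIV V y :> E"
    then have "(\<lambda>h. h \<bullet> E) = (\<lambda>h. h \<bullet> D y)"
      using G[of y] unfolding gderiv_def by (rule has_derivative_unique)
    then have "\<And>h. h \<bullet> (E - D y) = 0" by (simp add: fun_eq_iff inner_diff_right)
    from this[of "E - D y"] show "E = D y" by simp
  qed
  show "(V has_derivative (\<lambda>h. grad V y \<bullet> h)) (at y)"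
    using d unfolding Dh grad by (simp add: inner_commute)
  show "continuous_on X (grad V)"
    unfolding grad[abs_def] D_def
    by (intro continuous_intros continuous_on_smooth smooth_on_dir_deriv assms)
qed

locale local_solution =
  fixes \<Omega> :: "(real ^ 2) set" and V :: "real ^ 'k \<Rightarrow> real" and \<epsilon> :: real and u :: "real ^ 2 \<Rightarrow> real ^ 'k"
    and K :: "(real ^ 2) set" and U :: "real ^ 2 \<Rightarrow> real ^ 'k" and G :: "real ^ 2 \<Rightarrow> real ^ 2 \<Rightarrow> real ^ 'k"
    and F :: "real ^ 2 \<Rightarrow> real ^ 'k"
  assumes \<Omega>: "open \<Omega>" and V: "smooth_on UNIV V" and sol: "H1_solution \<Omega> V \<epsilon> u" and \<epsilon>: "\<epsilon> > 0"
    and K: "compact K" "K \<subseteq> \<Omega>"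
    and U: "local_rep K u U" and G: "\<And>v. local_rep K (weak_deriv \<Omega> u v) (G v)"
    and F: "local_rep K (\<lambda>x. grad V (u x)) F"
begin

lemma weak_deriv: "has_weak_deriv \<Omega> u v (weak_deriv \<Omega> u v)"
proof -
  obtain g where "has_weak_deriv \<Omega> u v g"
    using sol unfolding H1_solution_def sobolev_H1_def by blast
  then show ?thesis unfolding weak_deriv_def by (rule someI[where P="has_weak_deriv \<Omega> u v"])
qed

lemma ints: "integrable lborel U" "integrable lborel (G v)" "integrable lborel F"
  using U G F by (auto simp: local_rep_def)

lemma G_square: "integrable lborel (\<lambda>x. (norm (G v x))\<^sup>2)"
  using sol by (intro weak_deriv_square_integrable[OF \<Omega> _ K G]) (simp add: H1_solution_def)

lemma convolve_deriv:
  assumes "smooth_supp r \<sigma>" "cball x r \<subseteq> K"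
  shows "convolve (dir_deriv \<sigma> v) U x = convolve \<sigma> (G v) x"
  by (rule weak_deriv_convolve[OF weak_deriv U G assms K(2)])

lemma convolve_laplacian:
  assumes \<sigma>: "smooth_supp r \<sigma>" and x: "cball x r \<subseteq> K"
  shows "(\<Sum>b\<in>Basis. convolve (dir_deriv (dir_deriv \<sigma> b) b) U x) = (1 / \<epsilon>\<^sup>2) *\<^sub>R convolve \<sigma> F x"
proof -
  have D: "frechet_derivative (\<lambda>y. \<sigma> (x - y)) (at y) b = - dir_deriv \<sigma> b (x - y)" for y b
    using smooth_supp_has_derivative[OF \<sigma>] by (intro dir_deriv_reflect) (auto simp: differentiable_def)
  have "(LINT y:\<Omega>|lebesgue. \<Sum>b\<in>Basis. frechet_derivative (\<lambda>y. \<sigma> (x - y)) (at y) b *\<^sub>R weak_deriv \<Omega> u b y) =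
       - (1 / \<epsilon>\<^sup>2) *\<^sub>R (LINT y:\<Omega>|lebesgue. \<sigma> (x - y) *\<^sub>R grad V (u y))"
    using sol smooth_supp_reflect_test[OF \<sigma>, of x \<Omega>] x K unfolding H1_solution_def by blast
  then have *: "(LINT y:\<Omega>|lebesgue. \<Sum>b\<in>Basis. - (dir_deriv \<sigma> b (x - y) *\<^sub>R weak_deriv \<Omega> u b y)) =
      - (1 / \<epsilon>\<^sup>2) *\<^sub>R convolve \<sigma> F x"
    unfolding D using local_rep_convolve(2)[OF F \<sigma> x K(2)] by simp
  note rep = local_rep_convolve[OF G smooth_supp_dir_deriv[OF \<sigma>] x K(2)]
  have "(LINT y:\<Omega>|lebesgue. \<Sum>b\<in>Basis. - (dir_deriv \<sigma> b (x - y) *\<^sub>R weak_deriv \<Omega> u b y))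
      = (\<Sum>b\<in>Basis. - (LINT y:\<Omega>|lebesgue. dir_deriv \<sigma> b (x - y) *\<^sub>R weak_deriv \<Omega> u b y))"
    using rep(1) unfolding set_lebesgue_integral_def set_integrable_def
    by (simp add: scaleR_sum_right sum_negf)
  also have "\<dots> = - (\<Sum>b\<in>Basis. convolve (dir_deriv \<sigma> b) (G b) x)"
    by (simp add: rep(2) sum_negf)
  also have "\<dots> = - (\<Sum>b\<in>Basis. convolve (dir_deriv (dir_deriv \<sigma> b) b) U x)"
    using convolve_deriv[OF smooth_supp_dir_deriv[OF \<sigma>] x] by simp
  finally show ?thesis using * by simp
qed

end

lemma local_solution_exists:
  fixes u :: "real ^ 2 \<Rightarrow> real ^ 'k"
  assumes "open \<Omega>" "smooth_on UNIV V" "H1_solution \<Omega> V \<epsilon> u" "\<epsilon> > 0" "compact K" "K \<subseteq> \<Omega>"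
  obtains U G F where "local_solution \<Omega> V \<epsilon> u K U G F"
proof -
  have wd: "has_weak_deriv \<Omega> u v (weak_deriv \<Omega> u v)" for v
  proof -
    obtain g where "has_weak_deriv \<Omega> u v g"
      using assms(3) unfolding H1_solution_def sobolev_H1_def by blast
    then show ?thesis unfolding weak_deriv_def by (rule someI[where P="has_weak_deriv \<Omega> u v"])
  qed
  obtain U where U: "local_rep K u U"
    using wd[of 0] assms by (auto simp: has_weak_deriv_def intro: local_rep_exists)
  have "\<exists>G. local_rep K (weak_deriv \<Omega> u v) G" for v
    using wd[of v] assms by (auto simp: has_weak_deriv_def intro: local_rep_exists)
  then obtain G where G: "\<And>v. local_rep K (weak_deriv \<Omega> u v) (G v)" by metis
  obtain F where F: "local_rep K (\<lambda>x. grad V (u x)) F"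
    using assms by (auto simp: H1_solution_def intro: local_rep_exists)
  show ?thesis
    by (rule that[of U G F], unfold_locales) (use assms U G F in auto)
qed

section \<open>Local boundedness of solutions\<close>

definition bracket :: "'b::real_inner \<Rightarrow> real" where "bracket z = norm (1::real, z)"

lemma bracket_eq: "bracket z = sqrt (1 + z \<bullet> z)"
  by (simp add: bracket_def norm_Pair dot_square_norm)

lemma bracket_bounds: "1 \<le> bracket z" "norm z \<le> bracket z" "bracket z \<le> 1 + norm z"
  using norm_fst_le[of "1::real" z] norm_snd_le[of z "1::real"] norm_Pair_le[of "1::real" z]
  by (auto simp: bracket_def)

lemma bracket_pos: "0 < bracket z"
  using bracket_bounds(1)[of z] by linarith

lemma bracket_lipschitz: "\<bar>bracket z - bracket w\<bar> \<le> norm (z - w)"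
  using norm_triangle_ineq3[of "(1::real, z)" "(1, w)"] by (simp add: bracket_def norm_Pair)

lemma continuous_on_jap [continuous_intros]: "continuous_on A f \<Longrightarrow> continuous_on A (\<lambda>x. bracket (f x))"
  unfolding bracket_def by (intro continuous_intros)

lemma bracket_measurable [measurable]: "bracket \<in> borel_measurable (borel :: 'b::{real_inner, second_countable_topology} measure)"
  by (intro borel_measurable_continuous_onI continuous_intros)

lemma bracket_has_derivative:
  assumes "(w has_derivative w') (at y)"
  shows "((\<lambda>y. bracket (w y)) has_derivative (\<lambda>v. (w y \<bullet> w' v) / bracket (w y))) (at y)"
proof -
  have "((\<lambda>y. sqrt (1 + w y \<bullet> w y)) has_derivative (\<lambda>v. (w y \<bullet> w' v) / bracket (w y))) (at y)"
  proof (rule has_derivative_eq_rhs[OF has_derivative_real_sqrt])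
    show "((\<lambda>y. 1 + w y \<bullet> w y) has_derivative (\<lambda>v. 0 + (w y \<bullet> w' v + w' v \<bullet> w y))) (at y)"
      by (intro has_derivative_add has_derivative_const has_derivative_inner assms)
    show "0 < 1 + w y \<bullet> w y" using inner_ge_zero[of "w y"] by linarith
  qed (auto simp: fun_eq_iff bracket_eq inner_commute field_simps)
  then show ?thesis by (simp add: bracket_eq)
qed

text \<open>The second derivative of a convex function of \<open>W\<close> is at least its gradient
  applied to the second derivative of \<open>W\<close>.\<close>

lemma kato_step:
  fixes W :: "'a::euclidean_space \<Rightarrow> 'b::euclidean_space" and \<kappa> :: "'a \<Rightarrow> real"
  assumes dW: "\<And>y. (W has_derivative W' y) (at y)" "\<And>y. ((\<lambda>y. W' y b) has_derivative W'' y) (at y)"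
    and cW: "continuous_on UNIV (\<lambda>y. W'' y b)"
    and d\<kappa>: "\<And>y. (\<kappa> has_derivative \<kappa>' y) (at y)" "\<And>y. ((\<lambda>y. \<kappa>' y b) has_derivative \<kappa>'' y) (at y)"
    and c\<kappa>: "continuous_on UNIV (\<lambda>y. \<kappa>'' y b)"
    and \<kappa>0: "\<And>y. 0 \<le> \<kappa> y" and supp: "\<And>y. R < norm y \<Longrightarrow> \<kappa> y = 0"
  shows "integrable lborel (\<lambda>y. \<kappa> y * ((W y \<bullet> W'' y b) / bracket (W y)))"
    "(LINT y|lborel. \<kappa> y * ((W y \<bullet> W'' y b) / bracket (W y))) \<le> (LINT y|lborel. \<kappa>'' y b * bracket (W y))"
proof -
  let ?p = "\<lambda>y. bracket (W y)"
  let ?a = "\<lambda>y. W y \<bullet> W' y b"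
  have cont: "continuous_on UNIV W" "continuous_on UNIV (\<lambda>y. W' y b)" "continuous_on UNIV \<kappa>" "continuous_on UNIV (\<lambda>y. \<kappa>' y b)"
    using dW d\<kappa> by (meson continuous_at_imp_continuous_on has_derivative_continuous)+
  have p0: "?p y \<noteq> 0" for y using bracket_pos[of "W y"] by simp
  have o: "open {z::'a. R < norm z}" by (intro open_Collect_less continuous_intros)
  have s1: "\<kappa>' y b = 0" if "R < norm y" for y
    by (rule has_derivative_zero_outside[OF d\<kappa>(1) o]) (use that supp in auto)
  have s2: "\<kappa>'' y b = 0" if "R < norm y" for y
    by (rule has_derivative_zero_outside[OF d\<kappa>(2) o]) (use that s1 in auto)
  have dp: "(?p has_derivative (\<lambda>v. (W y \<bullet> W' y v) / ?p y)) (at y)" for y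
    by (rule bracket_has_derivative[OF dW(1)])
  have da: "(?a has_derivative (\<lambda>v. W y \<bullet> W'' y v + W' y v \<bullet> W' y b)) (at y)" for y
    by (rule has_derivative_inner[OF dW])
  define q where "q y v = ((W y \<bullet> W'' y v + W' y v \<bullet> W' y b) * ?p y - ?a y * ((W y \<bullet> W' y v) / ?p y)) / (?p y * ?p y)" for y v
  have dq: "((\<lambda>y. ?a y / ?p y) has_derivative q y) (at y)" for y
    unfolding q_def[abs_def] by (rule has_derivative_divide'[OF da dp p0])
  have cq: "continuous_on UNIV (\<lambda>y. q y b)"
    unfolding q_def using p0 by (intro continuous_intros cont cW) auto
  have ca: "continuous_on UNIV (\<lambda>y. ?a y / ?p y)" using p0 by (intro continuous_intros cont) auto
  have e1: "(LINT y|lborel. (?a y / ?p y) * \<kappa>' y b + q y b * \<kappa> y) = 0"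
    by (rule integral_derivative_zero(2)[OF has_derivative_mult[OF dq d\<kappa>(1)], of b R])
      (use supp p0 in \<open>auto intro!: continuous_intros cont cq\<close>)
  have e2: "(LINT y|lborel. ?p y * \<kappa>'' y b + (W y \<bullet> W' y b) / ?p y * \<kappa>' y b) = 0"
    by (rule integral_derivative_zero(2)[OF has_derivative_mult[OF dp d\<kappa>(2)], of b R])
      (use s1 p0 in \<open>auto intro!: continuous_intros cont c\<kappa>\<close>)
  have i1: "integrable lborel (\<lambda>y. (?a y / ?p y) * \<kappa>' y b)"
    by (rule integrable_continuous_bounded_support[of _ R]) (use s1 p0 in \<open>auto intro!: continuous_intros cont\<close>)
  have i2: "integrable lborel (\<lambda>y. q y b * \<kappa> y)"
    by (rule integrable_continuous_bounded_support[of _ R]) (use supp in \<open>auto intro!: continuous_on_mult cq cont\<close>)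
  have i3: "integrable lborel (\<lambda>y. ?p y * \<kappa>'' y b)"
    by (rule integrable_continuous_bounded_support[of _ R]) (use s2 in \<open>auto intro!: continuous_intros cont c\<kappa>\<close>)
  show i4: "integrable lborel (\<lambda>y. \<kappa> y * ((W y \<bullet> W'' y b) / ?p y))"
    by (rule integrable_continuous_bounded_support[of _ R]) (use supp p0 in \<open>auto intro!: continuous_intros cont cW\<close>)
  have le: "\<kappa> y * ((W y \<bullet> W'' y b) / ?p y) \<le> q y b * \<kappa> y" for y
  proof -
    have "(?a y)\<^sup>2 \<le> (W y \<bullet> W y) * (W' y b \<bullet> W' y b)" by (rule Cauchy_Schwarz_ineq)
    also have "\<dots> \<le> (?p y)\<^sup>2 * (W' y b \<bullet> W' y b)"
      by (intro mult_right_mono) (auto simp: bracket_eq)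
    finally have "0 \<le> ((W' y b \<bullet> W' y b) * (?p y)\<^sup>2 - (?a y)\<^sup>2) / (?p y)^3"
      using bracket_pos[of "W y"] by (simp add: mult.commute)
    also have "\<dots> = q y b - (W y \<bullet> W'' y b) / ?p y"
      using p0[of y] by (simp add: q_def field_simps power2_eq_square power3_eq_cube)
    finally have "(W y \<bullet> W'' y b) / ?p y \<le> q y b" by simp
    from mult_left_mono[OF this \<kappa>0[of y]] show ?thesis by (simp only: mult.commute[of "q y b"])
  qed
  have "(LINT y|lborel. \<kappa> y * ((W y \<bullet> W'' y b) / ?p y)) \<le> (LINT y|lborel. q y b * \<kappa> y)"
    by (rule integral_mono[OF i4 i2 le])
  also have "\<dots> = (LINT y|lborel. \<kappa>'' y b * ?p y)"
    using e1 e2 i1 i2 i3 by (simp add: mult.commute)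
  finally show "(LINT y|lborel. \<kappa> y * ((W y \<bullet> W'' y b) / ?p y)) \<le> (LINT y|lborel. \<kappa>'' y b * ?p y)" .
qed

definition radius :: "real \<Rightarrow> nat \<Rightarrow> real" where "radius s n = s / real (Suc n)"

lemma radius: "s > 0 \<Longrightarrow> radius s n > 0" "s > 0 \<Longrightarrow> radius s n \<le> s" "radius s \<longlonglongrightarrow> 0"
proof -
  show "radius s \<longlonglongrightarrow> 0" unfolding radius_def[abs_def]
    using tendsto_mult_right_zero[OF LIMSEQ_inverse_real_of_nat, of s] by (simp add: divide_inverse)
qed (auto simp: radius_def field_simps)

lemma reflect_has_derivative:
  assumes "smooth_supp r \<sigma>"
  shows "((\<lambda>y. \<sigma> (x - y)) has_derivative (\<lambda>v. - dir_deriv \<sigma> v (x - y))) (at y)"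
proof -
  have d: "\<sigma> differentiable (at (x - y))"
    using smooth_supp_has_derivative[OF assms] by (auto simp: differentiable_def)
  have "((\<lambda>y. \<sigma> (x - y)) has_derivative (\<lambda>v. dir_deriv \<sigma> (0 - v) (x - y))) (at y)"
    by (rule has_derivative_compose[of "\<lambda>y. x - y" "\<lambda>v. 0 - v" y UNIV \<sigma>])
      (auto intro!: derivative_eq_intros differentiable_has_dir_deriv d)
  then show ?thesis by (simp add: linear_neg[OF linear_frechet_derivative[OF d]])
qed

lemma tendsto_integral_bounded_mult_L1:
  fixes f :: "'a::euclidean_space \<Rightarrow> 'b::euclidean_space"
  assumes k: "\<And>n. kn n \<in> borel_measurable lborel" "k \<in> borel_measurable lborel"
      "\<And>n y. norm (kn n y) \<le> B" "\<And>y. norm (k y) \<le> B" "AE y in lborel. (\<lambda>n. kn n y) \<longlonglongrightarrow> k y"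
    and f: "\<And>n. integrable lborel (fn n)" "integrable lborel f" "(\<lambda>n. LINT y|lborel. norm (fn n y - f y)) \<longlonglongrightarrow> 0"
  shows "(\<lambda>n. LINT y|lborel. kn n y \<bullet> fn n y) \<longlonglongrightarrow> (LINT y|lborel. k y \<bullet> f y)"
proof -
  note [measurable] = k(1,2) borel_measurable_integrable[OF f(1)] borel_measurable_integrable[OF f(2)]
  have B: "B \<ge> 0" using k(4)[of 0] norm_ge_zero[of "k 0"] by linarith
  have int: "integrable lborel (\<lambda>y. h y \<bullet> g y)" and le: "\<bar>LINT y|lborel. h y \<bullet> g y\<bar> \<le> B * (LINT y|lborel. norm (g y))"
    if [measurable]: "h \<in> borel_measurable lborel" and hB: "\<And>y. norm (h y) \<le> B" and g: "integrable lborel g"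
    for h g :: "'a \<Rightarrow> 'b"
  proof -
    note [measurable] = borel_measurable_integrable[OF g]
    have i: "integrable lborel (\<lambda>y. B * norm (g y))" using g by simp
    have b: "norm (h y \<bullet> g y) \<le> B * norm (g y)" for y
      using Cauchy_Schwarz_ineq2[of "h y" "g y"] mult_right_mono[OF hB[of y] norm_ge_zero[of "g y"]] by simp
    show i': "integrable lborel (\<lambda>y. h y \<bullet> g y)"
      by (rule Bochner_Integration.integrable_bound[OF i]) (use b in \<open>auto intro: order_trans[OF _ abs_ge_self]\<close>)
    have "norm (LINT y|lborel. h y \<bullet> g y) \<le> (LINT y|lborel. B * norm (g y))"
      by (rule Bochner_Integration.integral_norm_bound_integral[OF i' i b])
    then show "\<bar>LINT y|lborel. h y \<bullet> g y\<bar> \<le> B * (LINT y|lborel. norm (g y))" by simp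
  qed
  have l1: "(\<lambda>n. LINT y|lborel. kn n y \<bullet> (fn n y - f y)) \<longlonglongrightarrow> 0"
  proof (rule Lim_null_comparison)
    show "\<forall>\<^sub>F n in sequentially. norm (LINT y|lborel. kn n y \<bullet> (fn n y - f y)) \<le> B * (LINT y|lborel. norm (fn n y - f y))"
      using le[OF k(1) k(3), of "\<lambda>y. fn n y - f y" for n] f by auto
    show "(\<lambda>n. B * (LINT y|lborel. norm (fn n y - f y))) \<longlonglongrightarrow> 0" by (rule tendsto_mult_right_zero[OF f(3)])
  qed
  have l2: "(\<lambda>n. LINT y|lborel. kn n y \<bullet> f y) \<longlonglongrightarrow> (LINT y|lborel. k y \<bullet> f y)"
  proof (rule integral_dominated_convergence)
    show "integrable lborel (\<lambda>y. B * norm (f y))" using f by simp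
    show "AE y in lborel. (\<lambda>n. kn n y \<bullet> f y) \<longlonglongrightarrow> k y \<bullet> f y"
      using k(5) by eventually_elim (intro tendsto_intros)
    show "AE y in lborel. norm (kn n y \<bullet> f y) \<le> B * norm (f y)" for n
    proof (rule AE_I2)
      show "norm (kn n y \<bullet> f y) \<le> B * norm (f y)" for y
        using Cauchy_Schwarz_ineq2[of "kn n y" "f y"] mult_right_mono[OF k(3)[of n y] norm_ge_zero[of "f y"]] by simp
    qed
  qed measurable
  have "(\<lambda>n. (LINT y|lborel. kn n y \<bullet> (fn n y - f y)) + (LINT y|lborel. kn n y \<bullet> f y)) \<longlonglongrightarrow> 0 + (LINT y|lborel. k y \<bullet> f y)"
    by (intro tendsto_intros l1 l2)
  moreover have "(LINT y|lborel. kn n y \<bullet> (fn n y - f y)) + (LINT y|lborel. kn n y \<bullet> f y) = (LINT y|lborel. kn n y \<bullet> fn n y)" for n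
    using int[OF k(1) k(3) f(1), of n n] int[OF k(1) k(3) f(2), of n] by (simp add: inner_diff_right)
  ultimately show ?thesis by simp
qed

lemma mollify_AE_subseq:
  fixes f :: "'a::euclidean_space \<Rightarrow> 'b::euclidean_space"
  assumes "\<And>n. r n > 0" "r \<longlonglongrightarrow> 0" "integrable lborel f"
  obtains t :: "nat \<Rightarrow> nat" where "strict_mono t"
    "AE x in lborel. (\<lambda>n. convolve (mollifier (r (t n))) f x) \<longlonglongrightarrow> f x"
proof -
  have "\<exists>t::nat\<Rightarrow>nat. strict_mono t \<and> (AE x in lborel. (\<lambda>n. convolve (mollifier (r (t n))) f x - f x) \<longlonglongrightarrow> 0)"
  proof (rule tendsto_L1_AE_subseq)
    show "integrable lborel (\<lambda>x. convolve (mollifier (r n)) f x - f x)" for n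
      using convolve_L1(1)[OF assms(1,3)] assms(3) by auto
    show "(\<lambda>n. LINT x|lborel. norm (convolve (mollifier (r n)) f x - f x)) \<longlonglongrightarrow> 0"
      using mollify_L1[OF assms] by (simp add: mollifies_L1_def)
  qed
  then obtain t :: "nat \<Rightarrow> nat" where t: "strict_mono t"
    "AE x in lborel. (\<lambda>n. convolve (mollifier (r (t n))) f x - f x) \<longlonglongrightarrow> 0" by auto
  have "AE x in lborel. (\<lambda>n. convolve (mollifier (r (t n))) f x) \<longlonglongrightarrow> f x"
    using t(2) by eventually_elim (simp add: LIM_zero_iff)
  then show ?thesis using t(1) that by blast
qed

context local_solution
begin

lemma kato:
  assumes s: "s > 0" "cball x (2 * s) \<subseteq> K" and \<sigma>: "smooth_supp s \<sigma>" "\<And>z. 0 \<le> \<sigma> z"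
  shows "(1 / \<epsilon>\<^sup>2) * (LINT y|lborel. \<sigma> (x - y) * ((U y \<bullet> F y) / bracket (U y)))
    \<le> (\<Sum>b\<in>Basis. LINT y|lborel. dir_deriv (dir_deriv \<sigma> b) b (x - y) * bracket (U y))"
proof -
  obtain t :: "nat \<Rightarrow> nat" where t: "strict_mono t"
    "AE x in lborel. (\<lambda>n. convolve (mollifier (radius s (t n))) U x) \<longlonglongrightarrow> U x"
    by (rule mollify_AE_subseq[OF radius(1)[OF s(1)] radius(3) ints(1)]) (rule that)
  define r where "r n = radius s (t n)" for n
  have r: "r n > 0" "r n \<le> s" for n using radius s(1) by (auto simp: r_def)
  have r0: "r \<longlonglongrightarrow> 0"
    unfolding r_def using LIMSEQ_subseq_LIMSEQ[OF radius(3) t(1)] by (simp add: comp_def)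
  note \<rho> = smooth_supp_mollifier[OF r(1)]
  define W where "W n = convolve (mollifier (r n)) U" for n
  define Fn where "Fn n = convolve (mollifier (r n)) F" for n
  have AEW: "AE x in lborel. (\<lambda>n. W n x) \<longlonglongrightarrow> U x" using t(2) by (simp add: W_def r_def)
  note \<sigma>1 = smooth_supp_dir_deriv[OF \<sigma>(1)]
  let ?\<kappa> = "\<lambda>y. \<sigma> (x - y)"
  let ?\<kappa>2 = "\<lambda>b y. dir_deriv (dir_deriv \<sigma> b) b (x - y)"
  have [measurable]: "\<sigma> \<in> borel_measurable borel" "dir_deriv (dir_deriv \<sigma> b) b \<in> borel_measurable borel" for b
    by (rule smooth_supp_measurable[OF \<sigma>(1)] smooth_supp_measurable[OF smooth_supp_dir_deriv[OF \<sigma>1]])+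
  have [measurable]: "U \<in> borel_measurable borel" "W n \<in> borel_measurable borel" for n
    using ints convolve_measurable[OF \<rho> ints(1)] by (auto simp: W_def)
  obtain B where B: "B \<ge> 0" "\<And>z. \<bar>\<sigma> z\<bar> \<le> B" by (rule smooth_supp_bounded[OF \<sigma>(1)]) (rule that)
  have step: "integrable lborel (\<lambda>y. ?\<kappa> y * ((W n y \<bullet> convolve (dir_deriv (dir_deriv (mollifier (r n)) b) b) U y) / bracket (W n y)))"
    "(LINT y|lborel. ?\<kappa> y * ((W n y \<bullet> convolve (dir_deriv (dir_deriv (mollifier (r n)) b) b) U y) / bracket (W n y)))
      \<le> (LINT y|lborel. ?\<kappa>2 b y * bracket (W n y))" for n b
  proof -
    note \<rho>1 = smooth_supp_dir_deriv[OF \<rho>]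
    have c: "continuous_on UNIV (\<lambda>y. ?\<kappa>2 b y)"
      by (rule continuous_on_compose2[OF smooth_supp_continuous[OF smooth_supp_dir_deriv[OF \<sigma>1], of UNIV]])
        (auto intro!: continuous_intros)
    have d2: "((\<lambda>y. - dir_deriv \<sigma> b (x - y)) has_derivative (\<lambda>v. dir_deriv (dir_deriv \<sigma> b) v (x - y))) (at y)" for y
      using has_derivative_minus[OF reflect_has_derivative[OF \<sigma>1, of x b y]] by simp
    have supp: "?\<kappa> y = 0" if "norm x + s < norm y" for y
    proof -
      have "s < norm (x - y)" using that norm_triangle_ineq2[of y x] by (simp add: norm_minus_commute)
      then show ?thesis using \<sigma>(1) by (simp add: smooth_supp_def)
    qed
    note k = kato_step[where W="W n" and W'="\<lambda>y v. convolve (dir_deriv (mollifier (r n)) v) U y"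
        and W''="\<lambda>y v. convolve (dir_deriv (dir_deriv (mollifier (r n)) b) v) U y" and b=b
        and \<kappa>="?\<kappa>" and \<kappa>'="\<lambda>y v. - dir_deriv \<sigma> v (x - y)" and \<kappa>''="\<lambda>y v. dir_deriv (dir_deriv \<sigma> b) v (x - y)" and R="norm x + s"]
    show "integrable lborel (\<lambda>y. ?\<kappa> y * ((W n y \<bullet> convolve (dir_deriv (dir_deriv (mollifier (r n)) b) b) U y) / bracket (W n y)))"
      "(LINT y|lborel. ?\<kappa> y * ((W n y \<bullet> convolve (dir_deriv (dir_deriv (mollifier (r n)) b) b) U y) / bracket (W n y)))
      \<le> (LINT y|lborel. ?\<kappa>2 b y * bracket (W n y))"
      using k[OF convolve_has_derivative[OF \<rho> ints(1), of n, folded W_def] convolve_has_derivative[OF \<rho>1 ints(1)]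
          continuous_on_convolve[OF smooth_supp_dir_deriv[OF \<rho>1] ints(1)]
          reflect_has_derivative[OF \<sigma>(1)] d2 c \<sigma>(2) supp] by auto
  qed
  have lap: "?\<kappa> y * ((W n y \<bullet> (1 / \<epsilon>\<^sup>2) *\<^sub>R Fn n y) / bracket (W n y)) =
      (\<Sum>b\<in>Basis. ?\<kappa> y * ((W n y \<bullet> convolve (dir_deriv (dir_deriv (mollifier (r n)) b) b) U y) / bracket (W n y)))" for n y
  proof (cases "dist x y \<le> s")
    case True
    have "dist x z \<le> 2 * s" if "dist y z \<le> r n" for z
      using dist_triangle[of x z y] True that r(2)[of n] by linarith
    then have "cball y (r n) \<subseteq> K" using s(2) by (auto simp: subset_iff)
    have "(1 / \<epsilon>\<^sup>2) *\<^sub>R Fn n y = (\<Sum>b\<in>Basis. convolve (dir_deriv (dir_deriv (mollifier (r n)) b) b) U y)"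
      unfolding Fn_def by (rule convolve_laplacian[OF \<rho> \<open>cball y (r n) \<subseteq> K\<close>, symmetric])
    then show ?thesis
      by (simp only: inner_sum_right sum_divide_distrib sum_distrib_left)
  next
    case False
    then have "?\<kappa> y = 0" using \<sigma>(1) by (simp add: smooth_supp_def dist_norm)
    then show ?thesis by simp
  qed
  have main: "(1 / \<epsilon>\<^sup>2) * (LINT y|lborel. ((?\<kappa> y / bracket (W n y)) *\<^sub>R W n y) \<bullet> Fn n y) \<le> (\<Sum>b\<in>Basis. LINT y|lborel. ?\<kappa>2 b y * bracket (W n y))" for n
  proof -
    have "(1 / \<epsilon>\<^sup>2) * (LINT y|lborel. ((?\<kappa> y / bracket (W n y)) *\<^sub>R W n y) \<bullet> Fn n y) =
       (LINT y|lborel. ?\<kappa> y * ((W n y \<bullet> (1 / \<epsilon>\<^sup>2) *\<^sub>R Fn n y) / bracket (W n y)))"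
      by (subst integral_mult_right_zero[symmetric], intro Bochner_Integration.integral_cong) (auto simp: field_simps)
    also have "\<dots> = (\<Sum>b\<in>Basis. LINT y|lborel. ?\<kappa> y * ((W n y \<bullet> convolve (dir_deriv (dir_deriv (mollifier (r n)) b) b) U y) / bracket (W n y)))"
      unfolding lap by (rule Bochner_Integration.integral_sum) (rule step(1))
    also have "\<dots> \<le> (\<Sum>b\<in>Basis. LINT y|lborel. ?\<kappa>2 b y * bracket (W n y))"
      by (intro sum_mono step(2))
    finally show ?thesis .
  qed
  have le_B: "norm ((\<sigma> (x - y) / bracket w) *\<^sub>R w) \<le> B" for y and w :: "real ^ 'k"
  proof -
    have "\<bar>\<sigma> (x - y)\<bar> * (norm w / bracket w) \<le> B * 1"
      using bracket_bounds(2)[of w] bracket_pos[of w] B by (intro mult_mono) (auto simp: divide_le_eq)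
    then show ?thesis using bracket_pos[of w] by (simp add: abs_mult)
  qed
  have lim1: "(\<lambda>n. LINT y|lborel. ((?\<kappa> y / bracket (W n y)) *\<^sub>R W n y) \<bullet> Fn n y) \<longlonglongrightarrow>
      (LINT y|lborel. ((?\<kappa> y / bracket (U y)) *\<^sub>R U y) \<bullet> F y)"
  proof (rule tendsto_integral_bounded_mult_L1[where B=B])
    have cj: "isCont bracket w" for w :: "real ^ 'k"
      using continuous_on_jap[OF continuous_on_id, of "UNIV :: (real ^ 'k) set"] by (simp add: continuous_on_eq_continuous_at)
    show "AE y in lborel. (\<lambda>n. (?\<kappa> y / bracket (W n y)) *\<^sub>R W n y) \<longlonglongrightarrow> (?\<kappa> y / bracket (U y)) *\<^sub>R U y"
      using AEW
    proof eventually_elim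
      case (elim y)
      show ?case using bracket_pos[of "U y"]
        by (intro tendsto_intros elim isCont_tendsto_compose[OF cj elim]) auto
    qed
    show "integrable lborel (Fn n)" for n unfolding Fn_def by (rule convolve_L1(1)[OF r(1) ints(3)])
    show "(\<lambda>n. LINT y|lborel. norm (Fn n y - F y)) \<longlonglongrightarrow> 0"
      using mollify_L1[OF r(1) r0 ints(3)] by (simp add: mollifies_L1_def Fn_def)
  qed (auto simp: le_B ints simp del: norm_scaleR)
  have lim2: "(\<lambda>n. LINT y|lborel. ?\<kappa>2 b y * bracket (W n y)) \<longlonglongrightarrow> (LINT y|lborel. ?\<kappa>2 b y * bracket (U y))" for b
  proof -
    obtain B2 where B2: "B2 \<ge> 0" "\<And>z. \<bar>dir_deriv (dir_deriv \<sigma> b) b z\<bar> \<le> B2"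
      by (rule smooth_supp_bounded[OF smooth_supp_dir_deriv[OF \<sigma>1]]) (rule that)
    have iK: "integrable lborel (\<lambda>y. \<bar>?\<kappa>2 b y\<bar>)"
      using lborel_translate_reflect(2)[of "-1" "dir_deriv (dir_deriv \<sigma> b) b" x]
        integrable_smooth_supp[OF smooth_supp_dir_deriv[OF \<sigma>1]] by auto
    have int: "integrable lborel (\<lambda>y. ?\<kappa>2 b y * bracket (f y))" if f: "integrable lborel f" for f :: "real ^ 2 \<Rightarrow> real ^ 'k"
    proof (rule Bochner_Integration.integrable_bound)
      note [measurable] = borel_measurable_integrable[OF f]
      show "integrable lborel (\<lambda>y. \<bar>?\<kappa>2 b y\<bar> + B2 * norm (f y))" using iK f by simp
      show "(\<lambda>y. ?\<kappa>2 b y * bracket (f y)) \<in> borel_measurable lborel" by measurable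
      have "\<bar>?\<kappa>2 b y * bracket (f y)\<bar> \<le> \<bar>?\<kappa>2 b y\<bar> + B2 * norm (f y)" for y
      proof -
        have "\<bar>?\<kappa>2 b y * bracket (f y)\<bar> \<le> \<bar>?\<kappa>2 b y\<bar> * (1 + norm (f y))"
          using bracket_pos[of "f y"] bracket_bounds(3)[of "f y"] by (simp add: abs_mult mult_left_mono)
        also have "\<dots> \<le> \<bar>?\<kappa>2 b y\<bar> + B2 * norm (f y)"
          using mult_right_mono[OF B2(2)[of "x - y"] norm_ge_zero[of "f y"]] by (simp add: algebra_simps)
        finally show ?thesis .
      qed
      then show "AE y in lborel. norm (?\<kappa>2 b y * bracket (f y)) \<le> norm (\<bar>?\<kappa>2 b y\<bar> + B2 * norm (f y))"
        by (auto intro: order_trans[OF _ abs_ge_self])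
    qed
    have iW: "integrable lborel (W n)" for n unfolding W_def by (rule convolve_L1(1)[OF r(1) ints(1)])
    show ?thesis
    proof (rule Lim_transform2[OF tendsto_const], rule Lim_null_comparison)
      show "\<forall>\<^sub>F n in sequentially. norm ((LINT y|lborel. ?\<kappa>2 b y * bracket (U y)) - (LINT y|lborel. ?\<kappa>2 b y * bracket (W n y)))
          \<le> B2 * (LINT y|lborel. norm (W n y - U y))"
      proof (intro always_eventually allI)
        fix n
        have "norm ((LINT y|lborel. ?\<kappa>2 b y * bracket (U y)) - (LINT y|lborel. ?\<kappa>2 b y * bracket (W n y)))
          = norm (LINT y|lborel. ?\<kappa>2 b y * bracket (U y) - ?\<kappa>2 b y * bracket (W n y))"
          using int[OF ints(1)] int[OF iW] by simp
        also have "\<dots> \<le> (LINT y|lborel. B2 * norm (W n y - U y))"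
        proof (rule Bochner_Integration.integral_norm_bound_integral)
          show "integrable lborel (\<lambda>y. ?\<kappa>2 b y * bracket (U y) - ?\<kappa>2 b y * bracket (W n y))" using int[OF ints(1)] int[OF iW] by simp
          show "integrable lborel (\<lambda>y. B2 * norm (W n y - U y))" using ints(1) iW[of n] by simp
          fix y
          have "\<bar>?\<kappa>2 b y\<bar> * \<bar>bracket (U y) - bracket (W n y)\<bar> \<le> B2 * norm (W n y - U y)"
            using B2 bracket_lipschitz[of "U y" "W n y"] by (intro mult_mono) (auto simp: norm_minus_commute)
          then show "norm (?\<kappa>2 b y * bracket (U y) - ?\<kappa>2 b y * bracket (W n y)) \<le> B2 * norm (W n y - U y)"
            by (simp add: abs_mult flip: right_diff_distrib)
        qed
        finally show "norm ((LINT y|lborel. ?\<kappa>2 b y * bracket (U y)) - (LINT y|lborel. ?\<kappa>2 b y * bracket (W n y)))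
          \<le> B2 * (LINT y|lborel. norm (W n y - U y))" by simp
      qed
      show "(\<lambda>n. B2 * (LINT y|lborel. norm (W n y - U y))) \<longlonglongrightarrow> 0"
        using mollify_L1[OF r(1) r0 ints(1)] by (intro tendsto_mult_right_zero) (simp add: mollifies_L1_def W_def)
    qed
  qed
  have "(1 / \<epsilon>\<^sup>2) * (LINT y|lborel. ((?\<kappa> y / bracket (U y)) *\<^sub>R U y) \<bullet> F y) \<le> (\<Sum>b\<in>Basis. LINT y|lborel. ?\<kappa>2 b y * bracket (U y))"
    by (rule LIMSEQ_le[OF tendsto_mult_left[OF lim1] tendsto_sum[OF lim2]]) (use main in auto)
  then show ?thesis by simp
qed

lemma subsolution:
  assumes C: "C \<ge> 0" "\<And>y. - C \<le> (y \<bullet> grad V y) / bracket y" and s: "s > 0" "cball x (2 * s) \<subseteq> K"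
  shows "- (C / \<epsilon>\<^sup>2) \<le> (\<Sum>b\<in>Basis. convolve (dir_deriv (dir_deriv (mollifier s) b) b) (\<lambda>y. indicator K y * bracket (U y)) x)"
proof -
  note \<rho> = smooth_supp_mollifier[OF s(1), where 'a="real ^ 2"]
  have [measurable]: "mollifier s \<in> borel_measurable (borel :: (real ^ 2) measure)" by (rule smooth_supp_measurable[OF \<rho>])
  have [measurable]: "U \<in> borel_measurable lborel" "F \<in> borel_measurable lborel" using ints by auto
  have "AE y in lebesgue. - C \<le> (U y \<bullet> F y) / bracket (U y)"
    using local_rep_AE[OF U] local_rep_AE[OF F]
  proof eventually_elim
    case (elim y)
    show ?case using C elim by (cases "y \<in> K") auto
  qed
  then have ae: "AE y in lborel. - C \<le> (U y \<bullet> F y) / bracket (U y)" by (simp add: AE_completion_iff)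
  have i0: "integrable lborel (\<lambda>y. mollifier s (x - y) * norm (F y))"
    using integrable_convolve[OF \<rho>, of "\<lambda>y. norm (F y)" x] ints(3) by simp
  have i: "integrable lborel (\<lambda>y. mollifier s (x - y) * ((U y \<bullet> F y) / bracket (U y)))"
  proof (rule Bochner_Integration.integrable_bound[OF i0])
    have "\<bar>(U y \<bullet> F y) / bracket (U y)\<bar> \<le> norm (F y)" for y
      using Cauchy_Schwarz_ineq2[of "U y" "F y"] mult_right_mono[OF bracket_bounds(2)[of "U y"] norm_ge_zero[of "F y"]] bracket_pos[of "U y"]
      by (simp add: divide_le_eq mult.commute abs_of_pos)
    from mult_left_mono[OF this] show "AE y in lborel. norm (mollifier s (x - y) * ((U y \<bullet> F y) / bracket (U y))) \<le> norm (mollifier s (x - y) * norm (F y))"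
      by (intro AE_I2) (simp only: real_norm_def abs_mult abs_norm_cancel abs_ge_zero)
  qed measurable
  have "- C = (LINT y|lborel. mollifier s (x - y) * (- C))"
    by (simp add: mollifier_reflect[OF s(1)])
  also have "\<dots> \<le> (LINT y|lborel. mollifier s (x - y) * ((U y \<bullet> F y) / bracket (U y)))"
  proof (rule integral_mono_AE[OF _ i])
    show "integrable lborel (\<lambda>y. mollifier s (x - y) * (- C))"
      by (intro integrable_mult_left mollifier_reflect s)
    show "AE y in lborel. mollifier s (x - y) * (- C) \<le> mollifier s (x - y) * ((U y \<bullet> F y) / bracket (U y))"
      using ae by eventually_elim (intro mult_left_mono mollifier_nonneg s)
  qed
  finally have "(1 / \<epsilon>\<^sup>2) * (- C) \<le> (1 / \<epsilon>\<^sup>2) * (LINT y|lborel. mollifier s (x - y) * ((U y \<bullet> F y) / bracket (U y)))"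
    by (intro mult_left_mono) auto
  also have "\<dots> \<le> (\<Sum>b\<in>Basis. LINT y|lborel. dir_deriv (dir_deriv (mollifier s) b) b (x - y) * bracket (U y))"
    by (rule kato[OF s \<rho> mollifier_nonneg[OF s(1)]])
  also have "\<dots> = (\<Sum>b\<in>Basis. convolve (dir_deriv (dir_deriv (mollifier s) b) b) (\<lambda>y. indicator K y * bracket (U y)) x)"
  proof (intro sum.cong refl, unfold convolve_def, intro Bochner_Integration.integral_cong refl)
    fix b y
    show "dir_deriv (dir_deriv (mollifier s) b) b (x - y) * bracket (U y) =
      dir_deriv (dir_deriv (mollifier s) b) b (x - y) *\<^sub>R (indicator K y * bracket (U y))"
    proof (cases "y \<in> K")
      case False
      then have "y \<notin> cball x s" using s by (auto simp: subset_iff)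
      then show ?thesis
        using smooth_supp_dir_deriv[OF smooth_supp_dir_deriv[OF \<rho>, of b], of b] by (simp add: smooth_supp_def dist_norm)
    qed simp
  qed
  finally show ?thesis by simp
qed

end

lemma multiwell_radial_bound:
  assumes "multiwell_potential V"
  obtains C where "C \<ge> 0" "\<And>y. - C \<le> (y \<bullet> grad V y) / bracket y"
proof -
  have V: "smooth_on UNIV V" using assms by (simp add: multiwell_potential_def)
  obtain \<alpha> R where R: "\<alpha> > 0" "R > 0" "\<And>y. norm y > R \<Longrightarrow> y \<bullet> grad V y \<ge> \<alpha> * (norm y)\<^sup>2"
    using assms unfolding multiwell_potential_def by blast
  have "bounded (grad V ` cball 0 R)"
    by (intro compact_imp_bounded compact_continuous_image smooth_on_grad(2)[OF V]) auto
  then obtain C where C: "\<And>y. norm y \<le> R \<Longrightarrow> norm (grad V y) \<le> C"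
    unfolding bounded_iff by (metis imageI mem_cball_0)
  have "- max C 0 \<le> (y \<bullet> grad V y) / bracket y" for y
  proof (cases "norm y > R")
    case True
    then have "0 \<le> y \<bullet> grad V y" using R(3)[of y] R(1) by (meson dual_order.trans less_eq_real_def zero_le_mult_iff zero_le_power2)
    then have "0 \<le> (y \<bullet> grad V y) / bracket y" using bracket_pos[of y] by simp
    then show ?thesis by linarith
  next
    case False
    have "\<bar>y \<bullet> grad V y\<bar> \<le> norm y * norm (grad V y)" by (rule Cauchy_Schwarz_ineq2)
    also have "\<dots> \<le> bracket y * max C 0"
      using False C[of y] bracket_bounds(2)[of y] by (intro mult_mono) (auto intro: less_imp_le bracket_pos)
    finally have "- (bracket y * max C 0) \<le> y \<bullet> grad V y" by linarith
    then show ?thesis using bracket_pos[of y] by (simp add: le_divide_eq mult.commute)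
  qed
  then show ?thesis by (intro that[of "max C 0"]) auto
qed

lemma H1_solution_locally_bounded:
  fixes u :: "real ^ 2 \<Rightarrow> real ^ 'k"
  assumes \<Omega>: "open \<Omega>" and MV: "multiwell_potential V" and sol: "H1_solution \<Omega> V \<epsilon> u" and \<epsilon>: "\<epsilon> > 0"
    and K0: "compact K0" "K0 \<subseteq> \<Omega>"
  obtains M where "AE x in lebesgue. x \<in> K0 \<longrightarrow> norm (u x) \<le> M"
proof -
  have sV: "smooth_on UNIV V" using MV by (simp add: multiwell_potential_def)
  obtain \<delta>' K where KK: "\<delta>' > 0" "compact K" "K \<subseteq> \<Omega>" "K0 \<subseteq> K" "\<And>x. x \<in> K0 \<Longrightarrow> cball x \<delta>' \<subseteq> K"
    by (rule thicken_compact[OF K0(1) \<Omega> K0(2)]) (rule that)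
  define \<delta> where "\<delta> = \<delta>' / 3"
  have \<delta>: "\<delta> > 0" using KK by (simp add: \<delta>_def)
  obtain U G F where "local_solution \<Omega> V \<epsilon> u K U G F"
    by (rule local_solution_exists[OF \<Omega> sV sol \<epsilon> KK(2,3)]) (rule that)
  then interpret local_solution \<Omega> V \<epsilon> u K U G F .
  obtain C where C: "C \<ge> 0" "\<And>y. - C \<le> (y \<bullet> grad V y) / bracket y"
    by (rule multiwell_radial_bound[OF MV]) (rule that)
  define P where "P y = indicator K y * bracket (U y)" for y
  have [measurable]: "U \<in> borel_measurable lborel" "K \<in> sets borel" using ints KK by (auto simp: borel_compact)
  have P: "integrable lborel P"
  proof (rule Bochner_Integration.integrable_bound)
    show "integrable lborel (\<lambda>y. indicator K y + norm (U y))"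
      using ints(1) emeasure_compact_finite[OF KK(2)] KK(2)
      by (intro Bochner_Integration.integrable_add integrable_real_indicator integrable_norm) auto
    show "AE y in lborel. norm (P y) \<le> norm (indicator K y + norm (U y))"
      by (intro AE_I2) (simp add: P_def indicator_def abs_of_pos bracket_pos bracket_bounds(3))
  qed (simp add: P_def[abs_def])
  have P0: "0 \<le> P y" for y using bracket_pos[of "U y"] by (simp add: P_def)
  define E where "E = (LINT z|lborel. (plus_part (\<delta>\<^sup>2 - z \<bullet> (z::real^2)))\<^sup>2)"
  define D where "D = \<delta>^4 * integral\<^sup>L lborel P + C / \<epsilon>\<^sup>2 * (LINT z|lborel. plus_part (\<delta>\<^sup>2 - z \<bullet> (z::real^2)) ^ 3)"
  have E: "E > 0"
  proof -
    have i: "integrable lborel (\<lambda>z::real^2. (plus_part (\<delta>\<^sup>2 - z \<bullet> z))\<^sup>2)"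
      by (rule integrable_continuous_bounded_support[of _ \<delta>])
        (use \<delta> in \<open>auto intro!: continuous_intros plus_part_ball_eq_0\<close>)
    have "\<not> (AE z in lborel. (plus_part (\<delta>\<^sup>2 - z \<bullet> (z::real^2)))\<^sup>2 = 0)"
    proof
      assume "AE z in lborel. (plus_part (\<delta>\<^sup>2 - z \<bullet> (z::real^2)))\<^sup>2 = 0"
      then have "AE z in lborel. bump \<delta> (z::real^2) = 0"
        by eventually_elim (auto simp: plus_part_def bump_def flat_exp_def)
      then have "(LINT z|lborel. bump \<delta> (z::real^2)) = 0" by (rule integral_eq_zero_AE)
      then show False using integral_bump_pos[OF \<delta>, where 'a="real^2"] by simp
    qed
    then show ?thesis
      unfolding E_def using integral_nonneg_eq_0_iff_AE[OF i]
      by (metis (mono_tags, lifting) AE_I2 integral_nonneg_AE less_eq_real_def zero_le_power2)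
  qed
  have q: "convolve (mollifier s) P x \<le> D / E" if x: "x \<in> K0" and s: "s > 0" "s \<le> \<delta>" for x s
  proof -
    note \<rho> = smooth_supp_mollifier[OF s(1), where 'a="real ^ 2"]
    note cP = integral_convolve_mollifier[OF s(1) P P0]
    have "convolve (mollifier s) P x * E \<le> \<delta>^4 * (LINT y|lborel. \<bar>convolve (mollifier s) P y\<bar>)
        + C / \<epsilon>\<^sup>2 * (LINT z|lborel. plus_part (\<delta>\<^sup>2 - z \<bullet> (z::real^2)) ^ 3)"
      unfolding E_def
    proof (rule mean_value_bound[OF \<rho> P \<delta> _ cP(1)])
      show "0 \<le> C / \<epsilon>\<^sup>2" using C by simp
      fix y assume y: "dist x y \<le> \<delta>"
      have "dist x z \<le> \<delta>'" if "dist y z \<le> 2 * s" for z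
        using dist_triangle[of x z y] y that s by (simp add: \<delta>_def)
      then have "cball y (2 * s) \<subseteq> K" using KK(5)[OF x] by (auto simp: subset_iff)
      from subsolution[OF C s(1) this]
      show "- (C / \<epsilon>\<^sup>2) \<le> (\<Sum>b\<in>Basis. convolve (dir_deriv (dir_deriv (mollifier s) b) b) P y)"
        by (simp add: P_def[abs_def])
    qed
    also have "(LINT y|lborel. \<bar>convolve (mollifier s) P y\<bar>) = integral\<^sup>L lborel P"
      using cP(2) by (simp add: convolve_mollifier_nonneg[OF s(1) P0])
    finally show ?thesis using E by (simp add: D_def le_divide_eq)
  qed
  obtain t :: "nat \<Rightarrow> nat" where t: "strict_mono t"
    "AE x in lborel. (\<lambda>n. convolve (mollifier (radius \<delta> (t n))) P x) \<longlonglongrightarrow> P x"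
    by (rule mollify_AE_subseq[OF radius(1)[OF \<delta>] radius(3) P]) (rule that)
  from t(2) have "AE x in lborel. x \<in> K0 \<longrightarrow> norm (U x) \<le> D / E"
  proof eventually_elim
    case (elim x)
    show ?case
    proof
      assume x: "x \<in> K0"
      have "P x \<le> D / E"
        by (rule LIMSEQ_le_const2[OF elim]) (use q[OF x] radius \<delta> in auto)
      moreover have "norm (U x) \<le> P x" using x KK(4) bracket_bounds(2)[of "U x"] by (auto simp: P_def indicator_def)
      ultimately show "norm (U x) \<le> D / E" by linarith
    qed
  qed
  then have "AE x in lebesgue. x \<in> K0 \<longrightarrow> norm (U x) \<le> D / E" by (rule AE_completion)
  with local_rep_AE[OF U] have "AE x in lebesgue. x \<in> K0 \<longrightarrow> norm (u x) \<le> D / E"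
    by eventually_elim (use KK(4) in auto)
  then show ?thesis by (rule that)
qed

section \<open>The stress identity\<close>

lemma orthonormal_frame_expand:
  fixes e :: "'n::finite \<Rightarrow> real ^ 'n"
  assumes "\<And>i j. e i \<bullet> e j = (if i = j then 1 else 0)"
  shows "x = (\<Sum>j\<in>UNIV. (x \<bullet> e j) *\<^sub>R e j)"
proof -
  define A where "A = (\<chi> i. e i)"
  have "A ** transpose A = mat 1"
    using assms by (simp add: A_def matrix_matrix_mult_def transpose_def mat_def vec_eq_iff inner_vec_def)
  then have "transpose A ** A = mat 1" by (simp add: matrix_left_right_inverse)
  then have "x = transpose A *v (A *v x)" by (simp add: matrix_vector_mul_assoc)
  also have "\<dots> = (\<Sum>j\<in>UNIV. (x \<bullet> e j) *\<^sub>R e j)"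
    by (simp add: vec_eq_iff matrix_vector_mult_def transpose_def A_def inner_vec_def mult.commute)
  finally show ?thesis .
qed

lemma bilinear_frame_sum:
  fixes e :: "'n::finite \<Rightarrow> real ^ 'n" and B :: "real ^ 'n \<Rightarrow> real ^ 'n \<Rightarrow> real"
  assumes e: "\<And>i j. e i \<bullet> e j = (if i = j then 1 else 0)"
    and lin: "\<And>w. linear (\<lambda>v. B v w)" "\<And>v. linear (B v)"
  shows "(\<Sum>b\<in>Basis. B b b) = (\<Sum>j\<in>UNIV. B (e j) (e j))"
proof -
  have "(\<Sum>b\<in>Basis. B b b) = (\<Sum>b\<in>Basis. \<Sum>j\<in>UNIV. (b \<bullet> e j) * B (e j) b)"
  proof (intro sum.cong refl)
    fix b
    have "B b b = B (\<Sum>j\<in>UNIV. (b \<bullet> e j) *\<^sub>R e j) b" using orthonormal_frame_expand[OF e, of b] by simp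
    also have "\<dots> = (\<Sum>j\<in>UNIV. (b \<bullet> e j) * B (e j) b)"
      by (simp only: linear_sum[OF lin(1)] linear_cmul[OF lin(1)] real_scaleR_def)
    finally show "B b b = (\<Sum>j\<in>UNIV. (b \<bullet> e j) * B (e j) b)" .
  qed
  also have "\<dots> = (\<Sum>j\<in>UNIV. \<Sum>b\<in>Basis. (e j \<bullet> b) * B (e j) b)"
    by (subst sum.swap) (simp add: inner_commute)
  also have "\<dots> = (\<Sum>j\<in>UNIV. B (e j) (e j))"
  proof (intro sum.cong refl)
    fix j
    have "B (e j) (e j) = B (e j) (\<Sum>b\<in>Basis. (e j \<bullet> b) *\<^sub>R b)" by (simp add: euclidean_representation)
    also have "\<dots> = (\<Sum>b\<in>Basis. (e j \<bullet> b) * B (e j) b)"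
      by (simp only: linear_sum[OF lin(2)] linear_cmul[OF lin(2)] real_scaleR_def)
    finally show "(\<Sum>b\<in>Basis. (e j \<bullet> b) * B (e j) b) = B (e j) (e j)" by simp
  qed
  finally show ?thesis .
qed

lemma norm_convolve_mollifier_le:
  fixes f :: "'a::euclidean_space \<Rightarrow> 'b::euclidean_space"
  assumes r: "r > 0" and f: "integrable lborel f" "AE y in lborel. norm (f y) \<le> M"
  shows "norm (convolve (mollifier r) f x) \<le> M"
proof -
  have "norm (convolve (mollifier r) f x) \<le> (LINT y|lborel. norm (mollifier r (x - y) *\<^sub>R f y))"
    unfolding convolve_def by (rule integral_norm_bound)
  also have "\<dots> \<le> (LINT y|lborel. mollifier r (x - y) * M)"
  proof (rule integral_mono_AE)
    show "integrable lborel (\<lambda>y. norm (mollifier r (x - y) *\<^sub>R f y))"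
      by (rule integrable_norm[OF integrable_convolve[OF smooth_supp_mollifier[OF r] f(1)]])
    show "integrable lborel (\<lambda>y. mollifier r (x - y) * M)"
      by (intro integrable_mult_left mollifier_reflect r)
    show "AE y in lborel. norm (mollifier r (x - y) *\<^sub>R f y) \<le> mollifier r (x - y) * M"
      using f(2) by eventually_elim (simp add: mollifier_nonneg[OF r] mult_left_mono abs_of_nonneg)
  qed
  also have "\<dots> = M" by (simp add: mollifier_reflect[OF r])
  finally show ?thesis .
qed

text \<open>Conservation law for smooth \<open>W\<close>, obtained by integrating the divergence of
  $\varphi\,(\partial_b W\cdot\partial_c W)$ and the derivatives $\partial_c(\varphi|\partial_bW|^2/2)$,
  $\partial_c(\varphi V(W))$.\<close>

lemma smooth_stress_identity:
  fixes W :: "'a::euclidean_space \<Rightarrow> 'b::euclidean_space" and \<phi> :: "'a \<Rightarrow> real" and V :: "'b \<Rightarrow> real"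
  assumes dW: "\<And>y. (W has_derivative (\<lambda>v. D v y)) (at y)"
    and dD: "\<And>v y. (D v has_derivative (\<lambda>w. DD v w y)) (at y)"
    and cDD: "\<And>v w. continuous_on UNIV (DD v w)" and sym: "\<And>v w. DD v w = DD w v"
    and V: "smooth_on UNIV V"
    and d\<phi>: "\<And>y. (\<phi> has_derivative \<phi>' y) (at y)" and c\<phi>: "\<And>v. continuous_on UNIV (\<lambda>y. \<phi>' y v)"
    and supp: "\<And>y. R < norm y \<Longrightarrow> \<phi> y = 0"
  shows "(LINT y|lborel. \<phi> y * (((\<Sum>b\<in>Basis. DD b b y) - k *\<^sub>R grad V (W y)) \<bullet> D c y))
      + (\<Sum>b\<in>Basis. LINT y|lborel. \<phi>' y b * (D b y \<bullet> D c y))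
      = (\<Sum>b\<in>Basis. LINT y|lborel. \<phi>' y c * (D b y \<bullet> D b y)) / 2 + k * (LINT y|lborel. \<phi>' y c * V (W y))"
proof -
  have cont: "continuous_on UNIV W" "continuous_on UNIV (D v)" "continuous_on UNIV \<phi>" for v
    using dW dD d\<phi> by (meson continuous_at_imp_continuous_on has_derivative_continuous)+
  have o: "open {z::'a. R < norm z}" by (intro open_Collect_less continuous_intros)
  have s1: "\<phi>' y v = 0" if "R < norm y" for y v
    by (rule has_derivative_zero_outside[OF d\<phi> o]) (use that supp in auto)
  have cV: "continuous_on UNIV (\<lambda>y. V (W y))" "continuous_on UNIV (\<lambda>y. grad V (W y))"
    by (rule continuous_on_compose2[OF continuous_on_smooth[OF V, of UNIV] cont(1)]; simp)
      (rule continuous_on_compose2[OF smooth_on_grad(2)[OF V, of UNIV] cont(1)]; simp)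
  have int: "integrable lborel (\<lambda>y. \<phi> y * g y)" "integrable lborel (\<lambda>y. \<phi>' y v * g y)"
    if "continuous_on UNIV g" for g :: "'a \<Rightarrow> real" and v
    by (rule integrable_continuous_bounded_support[of _ R]; use that supp s1 cont c\<phi> in \<open>auto intro!: continuous_intros\<close>)+
  have c2: "continuous_on UNIV (\<lambda>y. f y \<bullet> g y)" if "continuous_on UNIV f" "continuous_on UNIV g" for f g :: "'a \<Rightarrow> 'b"
    using that by (intro continuous_intros)
  have A: "(LINT y|lborel. \<phi> y * (D b y \<bullet> DD c b y)) + (LINT y|lborel. \<phi> y * (DD b b y \<bullet> D c y)) + (LINT y|lborel. \<phi>' y b * (D b y \<bullet> D c y)) = 0" for b
  proof -
    have "(LINT y|lborel. \<phi> y * (D b y \<bullet> DD c b y + DD b b y \<bullet> D c y) + \<phi>' y b * (D b y \<bullet> D c y)) = 0"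
      by (rule integral_derivative_zero(2)[OF has_derivative_mult[OF d\<phi> has_derivative_inner[OF dD dD]], where v=b and R=R])
        (use supp in \<open>auto intro!: continuous_intros cont c\<phi> cDD\<close>)
    then show ?thesis
      by (simp add: distrib_left int c2 cont cDD)
  qed
  have H: "(LINT y|lborel. \<phi> y * (D b y \<bullet> DD c b y)) + (LINT y|lborel. \<phi>' y c * (D b y \<bullet> D b y)) / 2 = 0" for b
  proof -
    have "(LINT y|lborel. \<phi> y * (D b y \<bullet> DD b c y + DD b c y \<bullet> D b y) + \<phi>' y c * (D b y \<bullet> D b y)) = 0"
      by (rule integral_derivative_zero(2)[OF has_derivative_mult[OF d\<phi> has_derivative_inner[OF dD dD]], where v=c and R=R])
        (use supp in \<open>auto intro!: continuous_intros cont c\<phi> cDD\<close>)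
    moreover have "\<phi> y * (D b y \<bullet> DD b c y + DD b c y \<bullet> D b y) = 2 * (\<phi> y * (D b y \<bullet> DD c b y))" for y
      by (simp add: inner_commute sym[of c b])
    ultimately show ?thesis by (simp add: int c2 cont cDD)
  qed
  have P: "(LINT y|lborel. \<phi> y * (grad V (W y) \<bullet> D c y)) + (LINT y|lborel. \<phi>' y c * V (W y)) = 0"
  proof -
    have "(LINT y|lborel. \<phi> y * (grad V (W y) \<bullet> D c y) + \<phi>' y c * V (W y)) = 0"
      by (rule integral_derivative_zero(2)[OF has_derivative_mult[OF d\<phi> has_derivative_compose[OF dW smooth_on_grad(1)[OF V]]], where v=c and R=R])
        (use supp in \<open>auto intro!: continuous_intros cont c\<phi> cV\<close>)
    then show ?thesis by (simp add: int c2 cont cV)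
  qed
  have "(LINT y|lborel. \<phi> y * (((\<Sum>b\<in>Basis. DD b b y) - k *\<^sub>R grad V (W y)) \<bullet> D c y))
     = (LINT y|lborel. (\<Sum>b\<in>Basis. \<phi> y * (DD b b y \<bullet> D c y)) - k * (\<phi> y * (grad V (W y) \<bullet> D c y)))"
    by (intro Bochner_Integration.integral_cong)
      (auto simp: inner_diff_left inner_sum_left sum_distrib_left right_diff_distrib)
  also have "\<dots> = (\<Sum>b\<in>Basis. LINT y|lborel. \<phi> y * (DD b b y \<bullet> D c y)) - k * (LINT y|lborel. \<phi> y * (grad V (W y) \<bullet> D c y))"
    by (simp add: int c2 cont cV cDD Bochner_Integration.integral_sum)
  also have "(\<Sum>b\<in>Basis. LINT y|lborel. \<phi> y * (DD b b y \<bullet> D c y)) =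
      (\<Sum>b\<in>Basis. (LINT y|lborel. \<phi>' y c * (D b y \<bullet> D b y)) / 2 - (LINT y|lborel. \<phi>' y b * (D b y \<bullet> D c y)))"
  proof (intro sum.cong refl)
    fix b
    show "(LINT y|lborel. \<phi> y * (DD b b y \<bullet> D c y)) =
      (LINT y|lborel. \<phi>' y c * (D b y \<bullet> D b y)) / 2 - (LINT y|lborel. \<phi>' y b * (D b y \<bullet> D c y))"
      using A[of b] H[of b] by linarith
  qed
  also have "\<dots> = (\<Sum>b\<in>Basis. LINT y|lborel. \<phi>' y c * (D b y \<bullet> D b y)) / 2 - (\<Sum>b\<in>Basis. LINT y|lborel. \<phi>' y b * (D b y \<bullet> D c y))"
    by (simp add: sum_subtractf sum_divide_distrib)
  also have "(LINT y|lborel. \<phi> y * (grad V (W y) \<bullet> D c y)) = - (LINT y|lborel. \<phi>' y c * V (W y))"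
    using P by simp
  finally show ?thesis by simp
qed

context local_solution
begin

lemma G_linear:
  assumes K0: "K0 \<in> sets borel" and \<delta>: "\<delta> > 0" "\<And>x. x \<in> K0 \<Longrightarrow> cball x \<delta> \<subseteq> K"
  shows "AE x in lborel. x \<in> K0 \<longrightarrow> G v x = (\<Sum>b\<in>Basis. (v \<bullet> b) *\<^sub>R G b x)"
proof (rule AE_eq_of_convolve_eq[OF ints(2) _ K0 \<delta>(1)])
  show "integrable lborel (\<lambda>x. \<Sum>b\<in>Basis. (v \<bullet> b) *\<^sub>R G b x)" using ints(2) by simp
  fix x r assume x: "x \<in> K0" and r: "0 < r" "r \<le> \<delta>"
  note \<rho> = smooth_supp_mollifier[OF r(1), where 'a="real ^ 2"]
  have sub: "cball x r \<subseteq> K" using \<delta>(2)[OF x] r by (auto simp: subset_iff)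
  have lin: "linear (\<lambda>v. convolve (dir_deriv (mollifier r) v) U x)" by (rule linear_convolve_dir_deriv[OF \<rho> ints(1)])
  have "convolve (mollifier r) (G v) x = convolve (dir_deriv (mollifier r) v) U x"
    by (simp add: convolve_deriv[OF \<rho> sub])
  also have "\<dots> = convolve (dir_deriv (mollifier r) (\<Sum>b\<in>Basis. (v \<bullet> b) *\<^sub>R b)) U x"
    by (simp add: euclidean_representation)
  also have "\<dots> = (\<Sum>b\<in>Basis. (v \<bullet> b) *\<^sub>R convolve (mollifier r) (G b) x)"
    by (simp only: linear_sum[OF lin] linear_cmul[OF lin] convolve_deriv[OF \<rho> sub])
  also have "\<dots> = convolve (mollifier r) (\<lambda>x. \<Sum>b\<in>Basis. (v \<bullet> b) *\<^sub>R G b x) x"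
  proof -
    have "mollifier r (x - y) *\<^sub>R (\<Sum>b\<in>Basis. (v \<bullet> b) *\<^sub>R G b y) =
        (\<Sum>b\<in>Basis. (v \<bullet> b) *\<^sub>R (mollifier r (x - y) *\<^sub>R G b y))" for y
      by (simp add: scaleR_sum_right mult.commute)
    then show ?thesis
      unfolding convolve_def using integrable_convolve[OF \<rho> ints(2)]
      by (simp del: scaleR_scaleR add: Bochner_Integration.integral_sum)
  qed
  finally show "convolve (mollifier r) (G v) x = convolve (mollifier r) (\<lambda>x. \<Sum>b\<in>Basis. (v \<bullet> b) *\<^sub>R G b x) x" .
qed

lemma stress:
  assumes K0: "compact K0" and \<delta>: "\<delta> > 0" "\<And>x. x \<in> K0 \<Longrightarrow> cball x \<delta> \<subseteq> K"
    and bdd: "AE x in lebesgue. x \<in> K \<longrightarrow> norm (u x) \<le> M"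
    and d\<phi>: "\<And>y. (\<phi> has_derivative \<phi>' y) (at y)" and c\<phi>: "\<And>v. continuous_on UNIV (\<lambda>y. \<phi>' y v)"
    and supp: "\<And>y. y \<notin> K0 \<Longrightarrow> \<phi> y = 0"
  shows "\<And>v b c. integrable lborel (\<lambda>y. \<phi>' y v * (G b y \<bullet> G c y))" "\<And>v. integrable lborel (\<lambda>y. \<phi>' y v * V (U y))"
    "(\<Sum>b\<in>Basis. LINT y|lborel. \<phi>' y b * (G b y \<bullet> G c y)) =
      (\<Sum>b\<in>Basis. LINT y|lborel. \<phi>' y c * (G b y \<bullet> G b y)) / 2 + 1 / \<epsilon>\<^sup>2 * (LINT y|lborel. \<phi>' y c * V (U y))"
proof -
  have K0K: "K0 \<subseteq> K" using \<delta> by (force simp: subset_iff)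
  obtain R where R: "\<And>y. y \<in> K0 \<Longrightarrow> norm y \<le> R" using compact_imp_bounded[OF K0] bounded_iff by metis
  have o: "open (- K0)" using K0 by (simp add: compact_imp_closed open_Compl)
  have s1: "\<phi>' y v = 0" if "y \<notin> K0" for y v
    by (rule has_derivative_zero_outside[OF d\<phi> o]) (use that supp in auto)
  have suppR: "\<phi> y = 0" if "R < norm y" for y using supp[of y] R[of y] that by force
  have s1R: "\<phi>' y v = 0" if "R < norm y" for y v using s1[of y] R[of y] that by force
  have cont\<phi>: "continuous_on UNIV \<phi>"
    using d\<phi> by (meson continuous_at_imp_continuous_on has_derivative_continuous)
  have bounded: "\<exists>B. \<forall>y. \<bar>f y\<bar> \<le> B" if "continuous_on UNIV f" "\<And>y. y \<notin> K0 \<Longrightarrow> f y = 0" for f :: "real ^ 2 \<Rightarrow> real"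
    using compact_support_bounded[OF that(1) K0 that(2)] by metis
  obtain B where B: "\<And>y. \<bar>\<phi> y\<bar> \<le> B" using bounded[OF cont\<phi> supp] by blast
  have "\<forall>v. \<exists>B. \<forall>y. \<bar>\<phi>' y v\<bar> \<le> B" using bounded[OF c\<phi> s1] by blast
  then obtain B' where B': "\<And>v y. \<bar>\<phi>' y v\<bar> \<le> B' v" by metis
  have [measurable]: "\<phi> \<in> borel_measurable borel" "(\<lambda>y. \<phi>' y v) \<in> borel_measurable borel" for v
    using cont\<phi> c\<phi> by (auto intro: borel_measurable_continuous_onI)
  have [measurable]: "K0 \<in> sets borel" using K0 by (simp add: borel_compact)

  define M' where "M' = max M 0"
  have U_bdd: "AE y in lborel. norm (U y) \<le> M'"
  proof -
    have "AE y in lebesgue. norm (U y) \<le> M'"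
      using bdd local_rep_AE[OF U] by eventually_elim (auto simp: M'_def)
    then show ?thesis by (simp add: AE_completion_iff)
  qed
  have F_eq: "AE y in lborel. (y \<in> K \<longrightarrow> F y = grad V (U y)) \<and> (y \<notin> K \<longrightarrow> F y = 0)"
  proof -
    have "AE y in lebesgue. (y \<in> K \<longrightarrow> F y = grad V (U y)) \<and> (y \<notin> K \<longrightarrow> F y = 0)"
      using local_rep_AE[OF F] local_rep_AE[OF U] by eventually_elim auto
    then show ?thesis by (simp add: AE_completion_iff)
  qed
  have "bounded (grad V ` cball 0 M')"
    by (intro compact_imp_bounded compact_continuous_image smooth_on_grad(2)[OF V]) auto
  then obtain C where C: "\<And>y. norm y \<le> M' \<Longrightarrow> norm (grad V y) \<le> C"
    unfolding bounded_iff by (metis imageI mem_cball_0)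
  have C0: "C \<ge> 0" using order_trans[OF norm_ge_zero C[of 0]] by (auto simp: M'_def)
  have "bounded (V ` cball 0 M')"
    by (intro compact_imp_bounded compact_continuous_image continuous_on_smooth[OF V]) auto
  then obtain CV where CV: "\<And>y. norm y \<le> M' \<Longrightarrow> \<bar>V y\<bar> \<le> CV"
    unfolding bounded_iff by (metis imageI mem_cball_0 real_norm_def)

  obtain t :: "nat \<Rightarrow> nat" where t: "strict_mono t"
    "AE x in lborel. (\<lambda>n. convolve (mollifier (radius \<delta> (t n))) U x) \<longlonglongrightarrow> U x"
    by (rule mollify_AE_subseq[OF radius(1)[OF \<delta>(1)] radius(3) ints(1)]) (rule that)
  define r where "r n = radius \<delta> (t n)" for n
  have r: "r n > 0" "r n \<le> \<delta>" for n using radius \<delta>(1) by (auto simp: r_def)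
  have r0: "r \<longlonglongrightarrow> 0"
    unfolding r_def using LIMSEQ_subseq_LIMSEQ[OF radius(3) t(1)] by (simp add: comp_def)
  note \<rho> = smooth_supp_mollifier[OF r(1), where 'a="real ^ 2"]
  note \<rho>1 = smooth_supp_dir_deriv[OF \<rho>]
  note \<rho>2 = smooth_supp_dir_deriv[OF \<rho>1]
  define W where "W n = convolve (mollifier (r n)) U" for n
  define D where "D n v = convolve (dir_deriv (mollifier (r n)) v) U" for n v
  define D2 where "D2 n v w = convolve (dir_deriv (dir_deriv (mollifier (r n)) v) w) U" for n v w
  define Gn where "Gn n v = convolve (mollifier (r n)) (G v)" for n v
  define Fn where "Fn n = convolve (mollifier (r n)) F" for n
  have AEW: "AE x in lborel. (\<lambda>n. W n x) \<longlonglongrightarrow> U x" using t(2) by (simp add: W_def r_def)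
  have W_bdd: "norm (W n y) \<le> M'" for n y
    unfolding W_def by (rule norm_convolve_mollifier_le[OF r(1) ints(1) U_bdd])
  have sub: "cball y (r n) \<subseteq> K" if "y \<in> K0" for y n
    using \<delta>(2)[OF that] r(2)[of n] by (auto simp: subset_iff)
  have DG: "D n v y = Gn n v y" if "y \<in> K0" for n v y
    unfolding D_def Gn_def by (rule convolve_deriv[OF \<rho> sub[OF that]])
  have lap: "(\<Sum>b\<in>Basis. D2 n b b y) = (1 / \<epsilon>\<^sup>2) *\<^sub>R Fn n y" if "y \<in> K0" for n y
    unfolding D2_def Fn_def by (rule convolve_laplacian[OF \<rho> sub[OF that]])
  have [measurable]: "U \<in> borel_measurable borel" "G v \<in> borel_measurable borel" "F \<in> borel_measurable borel"
    "W n \<in> borel_measurable borel" "Gn n v \<in> borel_measurable borel" "Fn n \<in> borel_measurable borel" for n v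
    using ints convolve_measurable[OF \<rho> ints(1)] convolve_measurable[OF \<rho> ints(2)] convolve_measurable[OF \<rho> ints(3)]
    by (auto simp: W_def Gn_def Fn_def)
  have mV [measurable]: "V \<in> borel_measurable borel" "grad V \<in> borel_measurable borel"
    using continuous_on_smooth[OF V, of UNIV] smooth_on_grad(2)[OF V, of UNIV] by (auto intro: borel_measurable_continuous_onI)

  define Hn where "Hn n y = indicator K0 y *\<^sub>R grad V (W n y)" for n y
  define F0 where "F0 y = indicator K0 y *\<^sub>R F y" for y
  have [measurable]: "Hn n \<in> borel_measurable borel" "F0 \<in> borel_measurable borel" for n
    unfolding Hn_def F0_def by measurable

  have identity: "1 / \<epsilon>\<^sup>2 * ((LINT y|lborel. \<phi> y * (Fn n y \<bullet> Gn n c y)) - (LINT y|lborel. \<phi> y * (Hn n y \<bullet> Gn n c y)))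
      + (\<Sum>b\<in>Basis. LINT y|lborel. \<phi>' y b * (Gn n b y \<bullet> Gn n c y))
      = (\<Sum>b\<in>Basis. LINT y|lborel. \<phi>' y c * (Gn n b y \<bullet> Gn n b y)) / 2 + 1 / \<epsilon>\<^sup>2 * (LINT y|lborel. \<phi>' y c * V (W n y))"
    if i: "\<And>n. integrable lborel (\<lambda>y. \<phi> y * (Fn n y \<bullet> Gn n c y))" "\<And>n. integrable lborel (\<lambda>y. \<phi> y * (Hn n y \<bullet> Gn n c y))" for n
  proof -
    have "(LINT y|lborel. \<phi> y * (((\<Sum>b\<in>Basis. D2 n b b y) - (1 / \<epsilon>\<^sup>2) *\<^sub>R grad V (W n y)) \<bullet> D n c y))
      + (\<Sum>b\<in>Basis. LINT y|lborel. \<phi>' y b * (D n b y \<bullet> D n c y))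
      = (\<Sum>b\<in>Basis. LINT y|lborel. \<phi>' y c * (D n b y \<bullet> D n b y)) / 2 + 1 / \<epsilon>\<^sup>2 * (LINT y|lborel. \<phi>' y c * V (W n y))"
    proof (rule smooth_stress_identity[where W="W n" and D="D n" and DD="D2 n", OF _ _ _ _ V d\<phi> c\<phi> suppR])
      show "(W n has_derivative (\<lambda>v. D n v y)) (at y)" for y
        unfolding W_def D_def by (rule convolve_has_derivative[OF \<rho> ints(1)])
      show "(D n v has_derivative (\<lambda>w. D2 n v w y)) (at y)" for v y
        unfolding D_def D2_def by (rule convolve_has_derivative[OF \<rho>1 ints(1)])
      show "continuous_on UNIV (D2 n v w)" for v w
        unfolding D2_def by (rule continuous_on_convolve[OF \<rho>2 ints(1)])
      show "D2 n v w = D2 n w v" for v w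
        unfolding D2_def by (simp add: dir_deriv_mollifier_commute[of "r n" v w])
    qed
    moreover have "\<phi>' y b * (D n b y \<bullet> D n c y) = \<phi>' y b * (Gn n b y \<bullet> Gn n c y)"
      "\<phi>' y c * (D n b y \<bullet> D n b y) = \<phi>' y c * (Gn n b y \<bullet> Gn n b y)" for y b
      using DG s1 by (cases "y \<in> K0"; simp)+
    moreover have "\<phi> y * (((\<Sum>b\<in>Basis. D2 n b b y) - (1 / \<epsilon>\<^sup>2) *\<^sub>R grad V (W n y)) \<bullet> D n c y)
        = 1 / \<epsilon>\<^sup>2 * (\<phi> y * (Fn n y \<bullet> Gn n c y) - \<phi> y * (Hn n y \<bullet> Gn n c y))" for y
      using DG lap supp by (cases "y \<in> K0") (simp_all add: Hn_def inner_diff_left algebra_simps)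
    ultimately show ?thesis using i[of n] by simp
  qed

  have G_L2: "integrable lborel (\<lambda>y. (norm (Gn n v y - G v y))\<^sup>2)" "(\<lambda>n. LINT y|lborel. (norm (Gn n v y - G v y))\<^sup>2) \<longlonglongrightarrow> 0" for n v
  proof -
    show "(\<lambda>n. LINT y|lborel. (norm (Gn n v y - G v y))\<^sup>2) \<longlonglongrightarrow> 0"
      unfolding Gn_def by (rule mollify_L2[OF r(1) r0 ints(2) G_square])
    have i: "integrable lborel (\<lambda>y. 3 * ((norm (Gn n v y))\<^sup>2 + (norm (0 :: real ^ 'k))\<^sup>2 + (norm (G v y))\<^sup>2))"
      using convolve_L2(1)[OF r(1) ints(2) G_square] G_square by (simp add: Gn_def)
    show "integrable lborel (\<lambda>y. (norm (Gn n v y - G v y))\<^sup>2)"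
      by (rule Bochner_Integration.integrable_bound[OF i])
        (use norm_add3_square_le[of "Gn n v _" 0 "G v _"] in \<open>auto simp: intro!: AE_I2 order_trans[OF _ abs_ge_self]\<close>)
  qed
  have iK: "integrable lborel (indicator K :: real ^ 2 \<Rightarrow> real)" "integrable lborel (indicator K0 :: real ^ 2 \<Rightarrow> real)"
    using emeasure_compact_finite[OF K(1)] emeasure_compact_finite[OF K0] K(1) K0
    by (auto intro!: integrable_real_indicator simp: borel_compact)
  have F_AE: "AE y in lborel. norm (F y) \<le> C * indicator K y"
    using F_eq U_bdd by eventually_elim (use C C0 in \<open>auto simp: indicator_def\<close>)
  have F_square: "integrable lborel (\<lambda>y. (norm (F y))\<^sup>2)"
  proof (rule Bochner_Integration.integrable_bound)
    show "integrable lborel (\<lambda>y. C\<^sup>2 * indicator K y :: real)" using iK by simp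
    show "AE y in lborel. norm ((norm (F y))\<^sup>2) \<le> norm (C\<^sup>2 * indicator K y :: real)"
      using F_AE
    proof eventually_elim
      case (elim y)
      then have "(norm (F y))\<^sup>2 \<le> (C * indicator K y)\<^sup>2" by (intro power_mono) auto
      then show ?case by (cases "y \<in> K") auto
    qed
  qed measurable
  have F_L2: "integrable lborel (\<lambda>y. (norm (Fn n y - F y))\<^sup>2)" "(\<lambda>n. LINT y|lborel. (norm (Fn n y - F y))\<^sup>2) \<longlonglongrightarrow> 0" for n
  proof -
    show "(\<lambda>n. LINT y|lborel. (norm (Fn n y - F y))\<^sup>2) \<longlonglongrightarrow> 0"
      unfolding Fn_def by (rule mollify_L2[OF r(1) r0 ints(3) F_square])
    have i: "integrable lborel (\<lambda>y. 3 * ((norm (Fn n y))\<^sup>2 + (norm (0 :: real ^ 'k))\<^sup>2 + (norm (F y))\<^sup>2))"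
      using convolve_L2(1)[OF r(1) ints(3) F_square] F_square by (simp add: Fn_def)
    show "integrable lborel (\<lambda>y. (norm (Fn n y - F y))\<^sup>2)"
      by (rule Bochner_Integration.integrable_bound[OF i])
        (use norm_add3_square_le[of "Fn n _" 0 "F _"] in \<open>auto simp: intro!: AE_I2 order_trans[OF _ abs_ge_self]\<close>)
  qed
  have F0_square: "integrable lborel (\<lambda>y. (norm (F0 y))\<^sup>2)"
    by (rule Bochner_Integration.integrable_bound[OF F_square]) (auto simp: F0_def indicator_def)
  have H_bound: "AE y in lborel. norm ((norm (Hn n y - F0 y))\<^sup>2) \<le> (2 * C)\<^sup>2 * indicator K0 y" for n
    using F_AE
  proof eventually_elim
    case (elim y)
    show ?case
    proof (cases "y \<in> K0")
      case True
      have "norm (Hn n y - F0 y) \<le> 2 * C"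
        using norm_triangle_ineq4[of "Hn n y" "F0 y"] elim C[OF W_bdd[of n y]] True K0K
        by (auto simp: Hn_def F0_def indicator_def split: if_splits)
      then have "(norm (Hn n y - F0 y))\<^sup>2 \<le> (2 * C)\<^sup>2" by (intro power_mono) auto
      then show ?thesis using True by simp
    qed (auto simp: Hn_def F0_def)
  qed
  have iH: "integrable lborel (\<lambda>y. (2 * C)\<^sup>2 * indicator K0 y :: real)" using iK by simp
  have H_lim: "AE y in lborel. (\<lambda>n. (norm (Hn n y - F0 y))\<^sup>2) \<longlonglongrightarrow> 0"
    using F_eq AEW
  proof eventually_elim
    case (elim y)
    have cg: "isCont (grad V) w" for w
      using smooth_on_grad(2)[OF V, of UNIV] by (simp add: continuous_on_eq_continuous_at)
    show ?case
    proof (cases "y \<in> K0")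
      case True
      then have "F0 y = grad V (U y)" using elim K0K by (auto simp: F0_def)
      moreover have "(\<lambda>n. Hn n y) \<longlonglongrightarrow> grad V (U y)"
        using True isCont_tendsto_compose[OF cg elim(2)] by (simp add: Hn_def)
      ultimately have "(\<lambda>n. (norm (Hn n y - F0 y))\<^sup>2) \<longlonglongrightarrow> (norm (F0 y - F0 y))\<^sup>2"
        by (intro tendsto_intros) simp
      then show ?thesis by simp
    qed (simp add: Hn_def F0_def)
  qed
  have H_L2: "integrable lborel (\<lambda>y. (norm (Hn n y - F0 y))\<^sup>2)" "(\<lambda>n. LINT y|lborel. (norm (Hn n y - F0 y))\<^sup>2) \<longlonglongrightarrow> 0" for n
  proof -
    show "integrable lborel (\<lambda>y. (norm (Hn n y - F0 y))\<^sup>2)"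
      by (rule Bochner_Integration.integrable_bound[OF iH])
        (use H_bound[of n] in \<open>auto elim!: eventually_mono simp: abs_mult\<close>)
    have "(\<lambda>n. LINT y|lborel. (norm (Hn n y - F0 y))\<^sup>2) \<longlonglongrightarrow> (LINT y|(lborel :: (real ^ 2) measure). 0)"
      by (rule integral_dominated_convergence[OF _ _ iH H_lim H_bound]) auto
    then show "(\<lambda>n. LINT y|lborel. (norm (Hn n y - F0 y))\<^sup>2) \<longlonglongrightarrow> 0" by simp
  qed
  have lG: "integrable lborel (\<lambda>y. \<phi>' y v * (G b y \<bullet> G c y))"
    "(\<lambda>n. LINT y|lborel. \<phi>' y v * (Gn n b y \<bullet> Gn n c y)) \<longlonglongrightarrow> (LINT y|lborel. \<phi>' y v * (G b y \<bullet> G c y))" for v b c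
    by (rule tendsto_integral_inner_L2[OF _ _ _ _ _ G_square G_square G_L2 G_L2 B'[of _ v]]; measurable)+
  have lF: "\<And>n. integrable lborel (\<lambda>y. \<phi> y * (Fn n y \<bullet> Gn n c y))"
    "(\<lambda>n. LINT y|lborel. \<phi> y * (Fn n y \<bullet> Gn n c y)) \<longlonglongrightarrow> (LINT y|lborel. \<phi> y * (F y \<bullet> G c y))"
    by (rule tendsto_integral_inner_L2[OF _ _ _ _ _ F_square G_square F_L2 G_L2 B]; measurable)+
  have lH: "\<And>n. integrable lborel (\<lambda>y. \<phi> y * (Hn n y \<bullet> Gn n c y))"
    "(\<lambda>n. LINT y|lborel. \<phi> y * (Hn n y \<bullet> Gn n c y)) \<longlonglongrightarrow> (LINT y|lborel. \<phi> y * (F0 y \<bullet> G c y))"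
    by (rule tendsto_integral_inner_L2[OF _ _ _ _ _ F0_square G_square H_L2 G_L2 B]; measurable)+
  have "(\<lambda>y. \<phi> y * (F0 y \<bullet> G c y)) = (\<lambda>y. \<phi> y * (F y \<bullet> G c y))"
  proof
    show "\<phi> y * (F0 y \<bullet> G c y) = \<phi> y * (F y \<bullet> G c y)" for y
      using supp[of y] by (cases "y \<in> K0") (auto simp: F0_def)
  qed
  then have lH': "(\<lambda>n. LINT y|lborel. \<phi> y * (Hn n y \<bullet> Gn n c y)) \<longlonglongrightarrow> (LINT y|lborel. \<phi> y * (F y \<bullet> G c y))"
    using lH(2) by simp
  have V_bound: "AE y in lborel. norm (\<phi>' y v * V (W n y)) \<le> CV * \<bar>\<phi>' y v\<bar>" for n v
    using mult_right_mono[OF CV[OF W_bdd] abs_ge_zero] by (intro AE_I2) (simp add: abs_mult mult.commute)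
  have i\<phi>': "integrable lborel (\<lambda>y. \<phi>' y v)" for v
    by (rule integrable_continuous_bounded_support[OF c\<phi> s1R])
  have iV: "integrable lborel (\<lambda>y. CV * \<bar>\<phi>' y v\<bar>)" for v
    using i\<phi>' by simp
  have V_lim: "AE y in lborel. (\<lambda>n. \<phi>' y v * V (W n y)) \<longlonglongrightarrow> \<phi>' y v * V (U y)" for v
    using AEW
  proof eventually_elim
    case (elim y)
    have "isCont V w" for w
      using continuous_on_smooth[OF V, of UNIV] by (simp add: continuous_on_eq_continuous_at)
    then show ?case by (intro tendsto_intros isCont_tendsto_compose[OF _ elim])
  qed
  have lV: "integrable lborel (\<lambda>y. \<phi>' y v * V (U y))"
      "(\<lambda>n. LINT y|lborel. \<phi>' y v * V (W n y)) \<longlonglongrightarrow> (LINT y|lborel. \<phi>' y v * V (U y))" for v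
    by (rule integrable_dominated_convergence[OF _ _ iV V_lim V_bound]; measurable)
      (rule integral_dominated_convergence[OF _ _ iV V_lim V_bound]; measurable)
  show "integrable lborel (\<lambda>y. \<phi>' y v * (G b y \<bullet> G c y))" for v b c by (rule lG(1))
  show "integrable lborel (\<lambda>y. \<phi>' y v * V (U y))" for v by (rule lV(1))
  have lhs: "(\<lambda>n. 1 / \<epsilon>\<^sup>2 * ((LINT y|lborel. \<phi> y * (Fn n y \<bullet> Gn n c y)) - (LINT y|lborel. \<phi> y * (Hn n y \<bullet> Gn n c y)))
      + (\<Sum>b\<in>Basis. LINT y|lborel. \<phi>' y b * (Gn n b y \<bullet> Gn n c y)))
    \<longlonglongrightarrow> 1 / \<epsilon>\<^sup>2 * ((LINT y|lborel. \<phi> y * (F y \<bullet> G c y)) - (LINT y|lborel. \<phi> y * (F y \<bullet> G c y)))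
      + (\<Sum>b\<in>Basis. LINT y|lborel. \<phi>' y b * (G b y \<bullet> G c y))"
    by (intro tendsto_add tendsto_mult tendsto_const tendsto_diff tendsto_sum lF lH' lG)
  have rhs: "(\<lambda>n. (\<Sum>b\<in>Basis. LINT y|lborel. \<phi>' y c * (Gn n b y \<bullet> Gn n b y)) / 2 + 1 / \<epsilon>\<^sup>2 * (LINT y|lborel. \<phi>' y c * V (W n y)))
    \<longlonglongrightarrow> (\<Sum>b\<in>Basis. LINT y|lborel. \<phi>' y c * (G b y \<bullet> G b y)) / 2 + 1 / \<epsilon>\<^sup>2 * (LINT y|lborel. \<phi>' y c * V (U y))"
    by (intro tendsto_add tendsto_mult tendsto_const tendsto_divide tendsto_sum lG lV) simp
  show "(\<Sum>b\<in>Basis. LINT y|lborel. \<phi>' y b * (G b y \<bullet> G c y)) =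
      (\<Sum>b\<in>Basis. LINT y|lborel. \<phi>' y c * (G b y \<bullet> G b y)) / 2 + 1 / \<epsilon>\<^sup>2 * (LINT y|lborel. \<phi>' y c * V (U y))"
    using LIMSEQ_unique[OF lhs[unfolded identity[OF lF(1) lH(1)]] rhs] by simp
qed

end

lemma integral_AE_transfer:
  fixes \<phi> f g :: "'a::euclidean_space \<Rightarrow> real"
  assumes ae: "AE x in lebesgue. x \<in> K \<longrightarrow> f x = g x" and K: "K \<subseteq> \<Omega>"
    and meas: "\<phi> \<in> borel_measurable borel" "g \<in> borel_measurable borel"
    and supp: "\<And>x. x \<notin> K \<Longrightarrow> \<phi> x = 0"
  shows "(LINT x:\<Omega>|lebesgue. \<phi> x * f x) = (LINT x|lborel. \<phi> x * g x)"
proof -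
  have m: "(\<lambda>x. \<phi> x * g x) \<in> borel_measurable lborel" using meas by measurable
  then have m': "(\<lambda>x. \<phi> x * g x) \<in> borel_measurable lebesgue" by (rule measurable_completion)
  have ae': "AE x in lebesgue. \<phi> x * g x = indicator \<Omega> x *\<^sub>R (\<phi> x * f x)"
    using ae by eventually_elim (use supp K in \<open>auto simp: indicator_def\<close>)
  have "(LINT x:\<Omega>|lebesgue. \<phi> x * f x) = (LINT x|lebesgue. \<phi> x * g x)"
    unfolding set_lebesgue_integral_def
    by (rule integral_cong_AE[OF borel_measurable_AE[OF m' ae'] m']) (use ae' in \<open>auto elim: eventually_mono\<close>)
  then show ?thesis using m by (simp add: integral_completion)
qed

context local_solution
begin

lemma integrable_weighted:
  assumes [measurable]: "\<phi> \<in> borel_measurable borel" and B: "\<And>x. \<bar>\<phi> x\<bar> \<le> B"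
  shows "integrable lborel (\<lambda>y. \<phi> y * (G b y \<bullet> G c y))"
proof (rule Bochner_Integration.integrable_bound)
  have [measurable]: "G v \<in> borel_measurable borel" for v using ints(2)[of v] by auto
  show "integrable lborel (\<lambda>y. B * (norm (G b y) * norm (G c y)))"
    by (intro integrable_mult_right Cauchy_Schwarz_integral(1) G_square) measurable
  show "(\<lambda>y. \<phi> y * (G b y \<bullet> G c y)) \<in> borel_measurable lborel" by measurable
  have "\<bar>\<phi> y * (G b y \<bullet> G c y)\<bar> \<le> B * (norm (G b y) * norm (G c y))" for y
    unfolding abs_mult using B[of y] by (intro mult_mono Cauchy_Schwarz_ineq2) auto
  then show "AE y in lborel. norm (\<phi> y * (G b y \<bullet> G c y)) \<le> norm (B * (norm (G b y) * norm (G c y)))"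
    by (auto intro!: AE_I2 order_trans[OF _ abs_ge_self])
qed

lemma integrable_potential:
  assumes \<phi>: "integrable lborel \<phi>" and bdd: "AE x in lebesgue. x \<in> K \<longrightarrow> norm (u x) \<le> M"
  shows "integrable lborel (\<lambda>y. \<phi> y * V (U y))"
proof -
  have "bounded (V ` cball 0 (max M 0))"
    by (intro compact_imp_bounded compact_continuous_image continuous_on_smooth[OF V]) auto
  then obtain C where C: "\<And>y. norm y \<le> max M 0 \<Longrightarrow> \<bar>V y\<bar> \<le> C"
    unfolding bounded_iff by (metis imageI mem_cball_0 real_norm_def)
  have "AE y in lebesgue. norm (U y) \<le> max M 0"
    using bdd local_rep_AE[OF U] by eventually_elim auto
  then have U_bdd: "AE y in lborel. norm (U y) \<le> max M 0" by (simp add: AE_completion_iff)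
  have [measurable]: "U \<in> borel_measurable borel" "V \<in> borel_measurable borel" "\<phi> \<in> borel_measurable borel"
    using ints(1) continuous_on_smooth[OF V, of UNIV] \<phi> by (auto intro: borel_measurable_continuous_onI)
  show ?thesis
  proof (rule Bochner_Integration.integrable_bound)
    show "integrable lborel (\<lambda>y. \<bar>\<phi> y\<bar> * C)" using \<phi> by simp
    show "AE y in lborel. norm (\<phi> y * V (U y)) \<le> norm (\<bar>\<phi> y\<bar> * C)"
      using U_bdd
    proof eventually_elim
      case (elim y)
      have "\<bar>\<phi> y\<bar> * \<bar>V (U y)\<bar> \<le> \<bar>\<phi> y\<bar> * C" by (intro mult_left_mono C elim) auto
      then show ?case
        unfolding real_norm_def abs_mult[of "\<phi> y"] by (rule order_trans[OF _ abs_ge_self])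
    qed
  qed measurable
qed

end

theorem stress_energy_identity:
  fixes \<Omega> :: "(real ^ 2) set" and u :: "real ^ 2 \<Rightarrow> real ^ 'k" and e :: "2 \<Rightarrow> real ^ 2"
  assumes \<Omega>: "open \<Omega>" and V: "multiwell_potential V" and sol: "H1_solution \<Omega> V \<epsilon> u" and \<epsilon>: "\<epsilon> > 0"
    and e: "\<And>i j. e i \<bullet> e j = (if i = j then 1 else 0)"
    and K0: "compact K0" "K0 \<subseteq> \<Omega>" and supp: "\<And>y. y \<notin> K0 \<Longrightarrow> \<phi> y = 0"
  shows "\<lbrakk>\<And>y. (\<phi> has_derivative \<phi>' y) (at y); \<And>v. continuous_on UNIV (\<lambda>y. \<phi>' y v)\<rbrakk> \<Longrightarrow>
      (LINT x:\<Omega>|lebesgue. \<phi>' x (e i) * energy_density \<Omega> V \<epsilon> u x) =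
      (\<Sum>j\<in>UNIV. LINT x:\<Omega>|lebesgue. \<phi>' x (e j) * (\<epsilon> * (weak_deriv \<Omega> u (e i) x \<bullet> weak_deriv \<Omega> u (e j) x)))"
    and "continuous_on UNIV \<phi> \<Longrightarrow>
      (\<Sum>j\<in>UNIV. LINT x:\<Omega>|lebesgue. \<phi> x * (\<epsilon> * (weak_deriv \<Omega> u (e j) x \<bullet> weak_deriv \<Omega> u (e j) x))) =
      2 * (LINT x:\<Omega>|lebesgue. \<phi> x * energy_density \<Omega> V \<epsilon> u x) - 2 * (LINT x:\<Omega>|lebesgue. \<phi> x * (V (u x) / \<epsilon>))"
proof -
  have sV: "smooth_on UNIV V" using V by (simp add: multiwell_potential_def)
  obtain \<delta> K where KK: "\<delta> > 0" "compact K" "K \<subseteq> \<Omega>" "K0 \<subseteq> K" "\<And>x. x \<in> K0 \<Longrightarrow> cball x \<delta> \<subseteq> K"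
    by (rule thicken_compact[OF K0(1) \<Omega> K0(2)]) (rule that)
  obtain U G F where "local_solution \<Omega> V \<epsilon> u K U G F"
    by (rule local_solution_exists[OF \<Omega> sV sol \<epsilon> KK(2,3)]) (rule that)
  then interpret local_solution \<Omega> V \<epsilon> u K U G F .
  obtain M where bdd: "AE x in lebesgue. x \<in> K \<longrightarrow> norm (u x) \<le> M"
    by (rule H1_solution_locally_bounded[OF \<Omega> \<open>multiwell_potential V\<close> sol \<epsilon> KK(2,3)]) (rule that)
  have bK0: "K0 \<in> sets borel" using K0 by (simp add: borel_compact)
  have [measurable]: "G v \<in> borel_measurable borel" "U \<in> borel_measurable borel" "V \<in> borel_measurable borel" for v
    using ints continuous_on_smooth[OF V, of UNIV] by (auto intro: borel_measurable_continuous_onI)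
  have AEG: "AE x in lebesgue. x \<in> K0 \<longrightarrow> weak_deriv \<Omega> u v x = G v x" for v
    using local_rep_AE[OF G[of v]] by eventually_elim (use KK(4) in auto)
  have AEd: "AE x in lebesgue. x \<in> K0 \<longrightarrow> energy_density \<Omega> V \<epsilon> u x = \<epsilon> / 2 * (\<Sum>b\<in>Basis. G b x \<bullet> G b x) + V (U x) / \<epsilon>"
  proof -
    have "AE x in lebesgue. \<forall>b\<in>Basis. x \<in> K0 \<longrightarrow> weak_deriv \<Omega> u b x = G b x"
      using AEG by (subst AE_finite_all) auto
    with local_rep_AE[OF U] show ?thesis
      by eventually_elim (use KK(4) in \<open>auto simp: energy_density_def dot_square_norm\<close>)
  qed
  have AEV: "AE x in lebesgue. x \<in> K0 \<longrightarrow> V (u x) / \<epsilon> = V (U x) / \<epsilon>"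
    using local_rep_AE[OF U] by eventually_elim (use KK(4) in auto)
  have AEprod: "AE x in lebesgue. x \<in> K0 \<longrightarrow>
      \<epsilon> * (weak_deriv \<Omega> u v x \<bullet> weak_deriv \<Omega> u w x) = \<epsilon> * (G v x \<bullet> G w x)" for v w
    using AEG[of v] AEG[of w] by eventually_elim auto
  have AEframe: "AE x in lborel. x \<in> K0 \<longrightarrow> (\<forall>j. G (e j) x = (\<Sum>b\<in>Basis. (e j \<bullet> b) *\<^sub>R G b x))"
  proof -
    have "AE x in lborel. \<forall>j. x \<in> K0 \<longrightarrow> G (e j) x = (\<Sum>b\<in>Basis. (e j \<bullet> b) *\<^sub>R G b x)"
      using G_linear[OF bK0 KK(1,5)] by (subst AE_all_countable) auto
    then show ?thesis by eventually_elim auto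
  qed
  define L where "L v x = (\<Sum>b\<in>Basis. (v \<bullet> b) *\<^sub>R G b x)" for v x
  have linL: "linear (\<lambda>v. L v x)" for x
    unfolding L_def by (rule linearI) (auto simp: inner_add_left scaleR_add_left sum.distrib scaleR_sum_right)
  have LB: "L b x = G b x" if "b \<in> Basis" for b x
    using that by (simp add: L_def inner_Basis if_distrib[of "\<lambda>t. t *\<^sub>R _"] sum.delta cong: if_cong)
  have bounded: "\<exists>B. \<forall>y. \<bar>f y\<bar> \<le> B" if "continuous_on UNIV f" "\<And>y. y \<notin> K0 \<Longrightarrow> f y = 0" for f :: "real ^ 2 \<Rightarrow> real"
    using compact_support_bounded[OF that(1) K0(1) that(2)] by metis
  obtain R where R: "\<And>y. y \<in> K0 \<Longrightarrow> norm y \<le> R" using compact_imp_bounded[OF K0(1)] bounded_iff by metis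
  have test: "(LINT x:\<Omega>|lebesgue. f x * energy_density \<Omega> V \<epsilon> u x) =
        \<epsilon> * ((\<Sum>b\<in>Basis. LINT x|lborel. f x * (G b x \<bullet> G b x)) / 2 + 1 / \<epsilon>\<^sup>2 * (LINT x|lborel. f x * V (U x)))"
      "(LINT x:\<Omega>|lebesgue. f x * (\<epsilon> * (weak_deriv \<Omega> u v x \<bullet> weak_deriv \<Omega> u w x))) = \<epsilon> * (LINT x|lborel. f x * (G v x \<bullet> G w x))"
      "(LINT x:\<Omega>|lebesgue. f x * (V (u x) / \<epsilon>)) = (LINT x|lborel. f x * V (U x)) / \<epsilon>"
      "integrable lborel (\<lambda>x. f x * (G v x \<bullet> G w x))"
    if f': "continuous_on UNIV f \<and> (\<forall>y. y \<notin> K0 \<longrightarrow> f y = 0)" for f v w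
  proof -
    have f: "continuous_on UNIV f" "\<And>y. y \<notin> K0 \<Longrightarrow> f y = 0" using f' by auto
    obtain B where B: "\<And>y. \<bar>f y\<bar> \<le> B" using bounded[OF f] by blast
    have m [measurable]: "f \<in> borel_measurable borel" using f by (auto intro: borel_measurable_continuous_onI)
    have int_f: "integrable lborel f"
      by (rule integrable_continuous_bounded_support[OF f(1), of R]) (use f(2) R in force)
    show iG: "integrable lborel (\<lambda>x. f x * (G v x \<bullet> G w x))" for v w by (rule integrable_weighted[OF m B])
    have iV: "integrable lborel (\<lambda>x. f x * V (U x))" by (rule integrable_potential[OF int_f bdd])
    have "(LINT x:\<Omega>|lebesgue. f x * energy_density \<Omega> V \<epsilon> u x) =
        (LINT x|lborel. f x * (\<epsilon> / 2 * (\<Sum>b\<in>Basis. G b x \<bullet> G b x) + V (U x) / \<epsilon>))"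
      by (rule integral_AE_transfer[OF AEd K0(2) m _ f(2)]) measurable
    also have "\<dots> = (LINT x|lborel. \<epsilon> / 2 * (\<Sum>b\<in>Basis. f x * (G b x \<bullet> G b x)) + f x * V (U x) / \<epsilon>)"
      by (intro Bochner_Integration.integral_cong) (auto simp: algebra_simps sum_distrib_left)
    also have "\<dots> = \<epsilon> / 2 * (\<Sum>b\<in>Basis. LINT x|lborel. f x * (G b x \<bullet> G b x)) + (LINT x|lborel. f x * V (U x)) / \<epsilon>"
      using iG iV by (simp add: Bochner_Integration.integral_sum)
    finally show "(LINT x:\<Omega>|lebesgue. f x * energy_density \<Omega> V \<epsilon> u x) =
        \<epsilon> * ((\<Sum>b\<in>Basis. LINT x|lborel. f x * (G b x \<bullet> G b x)) / 2 + 1 / \<epsilon>\<^sup>2 * (LINT x|lborel. f x * V (U x)))"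
      using \<open>\<epsilon> > 0\<close> by (simp add: field_simps power2_eq_square)
    have "(LINT x:\<Omega>|lebesgue. f x * (\<epsilon> * (weak_deriv \<Omega> u v x \<bullet> weak_deriv \<Omega> u w x))) = (LINT x|lborel. f x * (\<epsilon> * (G v x \<bullet> G w x)))"
      by (rule integral_AE_transfer[OF AEprod K0(2) m _ f(2)]) measurable
    then show "(LINT x:\<Omega>|lebesgue. f x * (\<epsilon> * (weak_deriv \<Omega> u v x \<bullet> weak_deriv \<Omega> u w x))) = \<epsilon> * (LINT x|lborel. f x * (G v x \<bullet> G w x))"
      by (simp add: mult.left_commute[of _ \<epsilon>])
    have "(LINT x:\<Omega>|lebesgue. f x * (V (u x) / \<epsilon>)) = (LINT x|lborel. f x * (V (U x) / \<epsilon>))"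
      by (rule integral_AE_transfer[OF AEV K0(2) m _ f(2)]) measurable
    then show "(LINT x:\<Omega>|lebesgue. f x * (V (u x) / \<epsilon>)) = (LINT x|lborel. f x * V (U x)) / \<epsilon>" by simp
  qed
  show "(LINT x:\<Omega>|lebesgue. \<phi>' x (e i) * energy_density \<Omega> V \<epsilon> u x) =
      (\<Sum>j\<in>UNIV. LINT x:\<Omega>|lebesgue. \<phi>' x (e j) * (\<epsilon> * (weak_deriv \<Omega> u (e i) x \<bullet> weak_deriv \<Omega> u (e j) x)))"
    if d\<phi>: "\<And>y. (\<phi> has_derivative \<phi>' y) (at y)" and c\<phi>: "\<And>v. continuous_on UNIV (\<lambda>y. \<phi>' y v)"
  proof -
    have o: "open (- K0)" using K0 by (simp add: compact_imp_closed open_Compl)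
    have s1: "\<phi>' y v = 0" if "y \<notin> K0" for y v
      by (rule has_derivative_zero_outside[OF d\<phi> o]) (use that supp in auto)
    have "continuous_on UNIV (\<lambda>y. \<phi>' y v) \<and> (\<forall>y. y \<notin> K0 \<longrightarrow> \<phi>' y v = 0)" for v
      using c\<phi> s1 by simp
    note T = test[OF this]
    have frame: "AE x in lborel. (\<Sum>b\<in>Basis. \<phi>' x b * (G b x \<bullet> G (e i) x)) = (\<Sum>j\<in>UNIV. \<phi>' x (e j) * (G (e i) x \<bullet> G (e j) x))"
      using AEframe
    proof eventually_elim
      case (elim x)
      show ?case
      proof (cases "x \<in> K0")
        case True
        have ld: "linear (\<phi>' x)" using has_derivative_linear[OF d\<phi>] .
        have "(\<Sum>b\<in>Basis. \<phi>' x b * (L b x \<bullet> G (e i) x)) = (\<Sum>j\<in>UNIV. \<phi>' x (e j) * (L (e j) x \<bullet> G (e i) x))"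
          by (rule bilinear_frame_sum[OF e, where B="\<lambda>v w. \<phi>' x v * (L w x \<bullet> G (e i) x)"])
            (auto intro!: linearI simp: linear_add[OF ld] linear_cmul[OF ld] linear_add[OF linL] linear_cmul[OF linL]
              inner_add_left algebra_simps)
        moreover have "L (e j) x = G (e j) x" for j using elim True by (simp add: L_def)
        ultimately show ?thesis by (simp add: LB inner_commute[of "G (e i) x"])
      qed (use s1 in simp)
    qed
    have "(LINT x:\<Omega>|lebesgue. \<phi>' x (e i) * energy_density \<Omega> V \<epsilon> u x) =
        \<epsilon> * (\<Sum>b\<in>Basis. LINT x|lborel. \<phi>' x b * (G b x \<bullet> G (e i) x))"
      unfolding T(1) using stress(3)[OF K0(1) KK(1,5) bdd d\<phi> c\<phi> supp, of "e i"] by simp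
    also have "\<dots> = \<epsilon> * (LINT x|lborel. (\<Sum>b\<in>Basis. \<phi>' x b * (G b x \<bullet> G (e i) x)))"
      using T(4) by (simp add: Bochner_Integration.integral_sum)
    also have "\<dots> = \<epsilon> * (LINT x|lborel. (\<Sum>j\<in>UNIV. \<phi>' x (e j) * (G (e i) x \<bullet> G (e j) x)))"
    proof -
      show ?thesis
        by (subst integral_cong_AE[OF _ _ frame])
          (intro borel_measurable_sum borel_measurable_integrable[OF T(4)] refl)+
    qed
    also have "\<dots> = (\<Sum>j\<in>UNIV. \<epsilon> * (LINT x|lborel. \<phi>' x (e j) * (G (e i) x \<bullet> G (e j) x)))"
      using T(4) by (simp add: Bochner_Integration.integral_sum sum_distrib_left)
    finally show ?thesis by (simp add: T(2))
  qed
  show "(\<Sum>j\<in>UNIV. LINT x:\<Omega>|lebesgue. \<phi> x * (\<epsilon> * (weak_deriv \<Omega> u (e j) x \<bullet> weak_deriv \<Omega> u (e j) x))) =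
      2 * (LINT x:\<Omega>|lebesgue. \<phi> x * energy_density \<Omega> V \<epsilon> u x) - 2 * (LINT x:\<Omega>|lebesgue. \<phi> x * (V (u x) / \<epsilon>))"
    if c\<phi>: "continuous_on UNIV \<phi>"
  proof -
    have "continuous_on UNIV \<phi> \<and> (\<forall>y. y \<notin> K0 \<longrightarrow> \<phi> y = 0)"
      using c\<phi> supp by simp
    note T = test[OF this]
    have frame: "AE x in lborel. (\<Sum>j\<in>UNIV. \<phi> x * (G (e j) x \<bullet> G (e j) x)) = (\<Sum>b\<in>Basis. \<phi> x * (G b x \<bullet> G b x))"
      using AEframe
    proof eventually_elim
      case (elim x)
      show ?case
      proof (cases "x \<in> K0")
        case True
        have "(\<Sum>b\<in>Basis. L b x \<bullet> L b x) = (\<Sum>j\<in>UNIV. L (e j) x \<bullet> L (e j) x)"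
          by (rule bilinear_frame_sum[OF e, where B="\<lambda>v w. L v x \<bullet> L w x"])
            (auto intro!: linearI simp: linear_add[OF linL] linear_cmul[OF linL] inner_add_left inner_add_right)
        then have "(\<Sum>j\<in>UNIV. G (e j) x \<bullet> G (e j) x) = (\<Sum>b\<in>Basis. G b x \<bullet> G b x)"
          using elim True by (simp add: LB L_def[symmetric])
        then show ?thesis by (simp flip: sum_distrib_left)
      qed (use supp in simp)
    qed
    have "(\<Sum>j\<in>UNIV. LINT x:\<Omega>|lebesgue. \<phi> x * (\<epsilon> * (weak_deriv \<Omega> u (e j) x \<bullet> weak_deriv \<Omega> u (e j) x)))
      = \<epsilon> * (LINT x|lborel. (\<Sum>j\<in>UNIV. \<phi> x * (G (e j) x \<bullet> G (e j) x)))"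
      using T(4) by (simp add: T(2) Bochner_Integration.integral_sum sum_distrib_left)
    also have "\<dots> = \<epsilon> * (LINT x|lborel. (\<Sum>b\<in>Basis. \<phi> x * (G b x \<bullet> G b x)))"
    proof -
      show ?thesis
        by (subst integral_cong_AE[OF _ _ frame])
          (intro borel_measurable_sum borel_measurable_integrable[OF T(4)] refl)+
    qed
    also have "\<dots> = \<epsilon> * (\<Sum>b\<in>Basis. LINT x|lborel. \<phi> x * (G b x \<bullet> G b x))"
      using T(4) by (simp add: Bochner_Integration.integral_sum)
    finally have "(\<Sum>j\<in>UNIV. LINT x:\<Omega>|lebesgue. \<phi> x * (\<epsilon> * (weak_deriv \<Omega> u (e j) x \<bullet> weak_deriv \<Omega> u (e j) x)))
      = \<epsilon> * (\<Sum>b\<in>Basis. LINT x|lborel. \<phi> x * (G b x \<bullet> G b x))" .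
    then show ?thesis
      unfolding T(1) T(3) using \<open>\<epsilon> > 0\<close> by (simp add: field_simps power2_eq_square)
  qed
qed

section \<open>Signed measures\<close>

lemma signed_measure_Un:
  assumes \<mu>: "signed_measure M \<mu>" and "A \<in> sets M" "B \<in> sets M" "A \<inter> B = {}"
  shows "\<mu> (A \<union> B) = \<mu> A + \<mu> B"
proof -
  have "range (binaryset A B) \<subseteq> sets M" using assms by (auto simp: binaryset_def)
  moreover have "disjoint_family (binaryset A B)"
    using assms(4) by (auto simp: disjoint_family_on_def binaryset_def)
  ultimately have "(\<lambda>i. \<mu> (binaryset A B i)) sums \<mu> (\<Union>i. binaryset A B i)"
    using \<mu> unfolding signed_measure_def by blast
  moreover have "(\<lambda>i. \<mu> (binaryset A B i)) sums (\<mu> A + \<mu> B)"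
    using \<mu> by (intro binaryset_sums) (simp add: signed_measure_def)
  ultimately show ?thesis by (simp add: UN_binaryset_eq sums_unique2)
qed

lemma signed_measure_Diff:
  assumes \<mu>: "signed_measure M \<mu>" and "A \<in> sets M" "B \<in> sets M" "B \<subseteq> A"
  shows "\<mu> (A - B) = \<mu> A - \<mu> B"
proof -
  have "(A - B) \<union> B = A" "(A - B) \<inter> B = {}" using assms(4) by auto
  then show ?thesis using signed_measure_Un[OF \<mu>, of "A - B" B] assms by simp
qed

lemma signed_measure_uminus: "signed_measure M \<mu> \<Longrightarrow> signed_measure M (\<lambda>A. - \<mu> A)"
  by (auto simp: signed_measure_def intro: sums_minus)

lemma (in finite_measure) signed_measure_measure: "signed_measure M (measure M)"
  by (auto simp: signed_measure_def intro: finite_measure_UNION)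

text \<open>If \<open>\<mu>\<close> were unbounded on \<open>X\<close>, one could split off disjoint pieces on which \<open>\<bar>\<mu>\<bar> > 1\<close>
  for ever, contradicting the convergence of the series of their measures.\<close>

lemma signed_measure_bounded:
  assumes \<mu>: "signed_measure M \<mu>"
  obtains K where "\<And>A. A \<in> sets M \<Longrightarrow> \<bar>\<mu> A\<bar> \<le> K"
proof (rule ccontr)
  assume "\<not> thesis"
  then have unb: "\<And>K. \<exists>A\<in>sets M. K < \<bar>\<mu> A\<bar>" using that by (meson not_le)
  define unbd where "unbd X \<longleftrightarrow> X \<in> sets M \<and> (\<forall>K. \<exists>B\<in>sets M. B \<subseteq> X \<and> K < \<bar>\<mu> B\<bar>)" for X
  have step: "\<exists>Y. unbd Y \<and> Y \<subseteq> X \<and> \<bar>\<mu> (X - Y)\<bar> > 1" if X: "unbd X" for X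
  proof -
    obtain B where B: "B \<in> sets M" "B \<subseteq> X" "\<bar>\<mu> X\<bar> + 1 < \<bar>\<mu> B\<bar>" using X unfolding unbd_def by blast
    have Xm: "X \<in> sets M" using X by (simp add: unbd_def)
    have d: "\<mu> (X - B) = \<mu> X - \<mu> B" by (rule signed_measure_Diff[OF \<mu> Xm B(1,2)])
    have "unbd B \<or> unbd (X - B)"
    proof (rule ccontr)
      assume "\<not> (unbd B \<or> unbd (X - B))"
      then obtain K1 K2 where K: "\<And>A. A \<in> sets M \<Longrightarrow> A \<subseteq> B \<Longrightarrow> \<bar>\<mu> A\<bar> \<le> K1" "\<And>A. A \<in> sets M \<Longrightarrow> A \<subseteq> X - B \<Longrightarrow> \<bar>\<mu> A\<bar> \<le> K2"
        using B(1) Xm unfolding unbd_def by (metis not_le sets.Diff)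
      obtain A where A: "A \<in> sets M" "A \<subseteq> X" "K1 + K2 < \<bar>\<mu> A\<bar>" using X unfolding unbd_def by blast
      have "\<mu> A = \<mu> (A \<inter> B) + \<mu> (A - B)"
        using signed_measure_Un[OF \<mu>, of "A \<inter> B" "A - B"] A B by (simp add: Int_Diff_Un Int_Diff_disjoint)
      moreover have "\<bar>\<mu> (A \<inter> B)\<bar> \<le> K1" "\<bar>\<mu> (A - B)\<bar> \<le> K2" using A B by (auto intro!: K)
      ultimately show False using A(3) by linarith
    qed
    then show ?thesis
    proof
      assume "unbd B"
      moreover have "\<bar>\<mu> (X - B)\<bar> > 1" using d B(3) by linarith
      ultimately show ?thesis using B(2) by blast
    next
      assume "unbd (X - B)"
      moreover have "X - (X - B) = B" using B(2) by blast
      moreover have "\<bar>\<mu> B\<bar> > 1" using B(3) by linarith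
      ultimately show ?thesis by (intro exI[of _ "X - B"]) auto
    qed
  qed
  have top: "unbd (space M)"
    unfolding unbd_def
  proof (intro conjI allI sets.top)
    fix K
    obtain A where "A \<in> sets M" "K < \<bar>\<mu> A\<bar>" using unb by blast
    then show "\<exists>B\<in>sets M. B \<subseteq> space M \<and> K < \<bar>\<mu> B\<bar>"
      using sets.sets_into_space by (intro bexI[of _ A]) auto
  qed
  have "\<exists>X. \<forall>n. unbd (X n) \<and> (X (Suc n) \<subseteq> X n \<and> \<bar>\<mu> (X n - X (Suc n))\<bar> > 1)"
    by (rule dependent_nat_choice[of "\<lambda>n. unbd" "\<lambda>n X Y. Y \<subseteq> X \<and> \<bar>\<mu> (X - Y)\<bar> > 1"])
      (rule exI[of _ "space M"], rule top, rule step)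
  then obtain X :: "nat \<Rightarrow> 'a set" where X0: "\<forall>n. unbd (X n) \<and> (X (Suc n) \<subseteq> X n \<and> \<bar>\<mu> (X n - X (Suc n))\<bar> > 1)"
    by (elim exE)
  have X: "\<And>n. unbd (X n)" "\<And>n. X (Suc n) \<subseteq> X n \<and> \<bar>\<mu> (X n - X (Suc n))\<bar> > 1"
    using X0 by auto
  define D where "D n = X n - X (Suc n)" for n
  have dec: "decseq X" using X(2) by (intro decseq_SucI) auto
  have "disjoint_family D"
    unfolding disjoint_family_on_def
  proof (intro ballI impI)
    fix m n :: nat assume "m \<noteq> n"
    have *: "D i \<inter> D j = {}" if "i < j" for i j
      using decseqD[OF dec, of "Suc i" j] that by (auto simp: D_def)
    show "D m \<inter> D n = {}" using *[of m n] *[of n m] \<open>m \<noteq> n\<close> by (cases "m < n") auto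
  qed
  moreover have "range D \<subseteq> sets M" using X(1) by (auto simp: D_def unbd_def)
  ultimately have "(\<lambda>n. \<mu> (D n)) sums \<mu> (\<Union>n. D n)" using \<mu> by (simp add: signed_measure_def)
  then have "(\<lambda>n. \<mu> (D n)) \<longlonglongrightarrow> 0" by (intro summable_LIMSEQ_zero sums_summable)
  then have "eventually (\<lambda>n. \<bar>\<mu> (D n)\<bar> < 1) sequentially"
    using order_tendstoD(2)[OF tendsto_rabs_zero, of "\<lambda>n. \<mu> (D n)" sequentially 1] by simp
  then obtain n where "\<bar>\<mu> (D n)\<bar> < 1" using eventually_happens trivial_limit_sequentially by blast
  then show False using X(2)[of n] by (simp add: D_def)
qed

lemma positive_variation:
  assumes \<mu>: "signed_measure M \<mu>"
  shows sets_positive_variation: "sets (positive_variation M \<mu>) = sets M"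
    and emeasure_positive_variation: "A \<in> sets M \<Longrightarrow>
      emeasure (positive_variation M \<mu>) A = (SUP B\<in>{B\<in>sets M. B \<subseteq> A}. ennreal (\<mu> B))"
    and finite_positive_variation: "finite_measure (positive_variation M \<mu>)"
proof -
  define P where "P A = (SUP B\<in>{B\<in>sets M. B \<subseteq> A}. ennreal (\<mu> B))" for A
  have \<mu>0: "\<mu> {} = 0" using \<mu> by (simp add: signed_measure_def)
  have P_upper: "ennreal (\<mu> B) \<le> P A" if "B \<in> sets M" "B \<subseteq> A" for A B
    unfolding P_def by (rule SUP_upper) (use that in auto)
  have P0: "P {} = 0"
    unfolding P_def by (rule antisym) (auto intro!: SUP_least simp: \<mu>0)
  have superadd: "P A + P A' \<le> P (A \<union> A')" if "A \<in> sets M" "A' \<in> sets M" "A \<inter> A' = {}" for A A'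
  proof -
    have ne: "{B \<in> sets M. B \<subseteq> A} \<noteq> {}" "{B \<in> sets M. B \<subseteq> A'} \<noteq> {}" by auto
    have "ennreal (\<mu> B) + ennreal (\<mu> B') \<le> P (A \<union> A')" if B: "B \<in> sets M" "B \<subseteq> A" "B' \<in> sets M" "B' \<subseteq> A'" for B B'
    proof -
      consider "\<mu> B \<le> 0" | "\<mu> B' \<le> 0" | "0 < \<mu> B" "0 < \<mu> B'" by linarith
      then show ?thesis
      proof cases
        case 1 then show ?thesis using P_upper[of B' "A \<union> A'"] B by (auto simp: ennreal_neg)
      next
        case 2 then show ?thesis using P_upper[of B "A \<union> A'"] B by (auto simp: ennreal_neg)
      next
        case 3
        have "\<mu> (B \<union> B') = \<mu> B + \<mu> B'"
          by (rule signed_measure_Un[OF \<mu>]) (use B that \<open>A \<inter> A' = {}\<close> in auto)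
        then show ?thesis using P_upper[of "B \<union> B'" "A \<union> A'"] B 3 by (auto simp: ennreal_plus[symmetric] simp del: ennreal_plus)
      qed
    qed
    then have "ennreal (\<mu> B) + P A' \<le> P (A \<union> A')" if "B \<in> sets M" "B \<subseteq> A" for B
      unfolding P_def[of A'] ennreal_SUP_add_right[OF ne(2)] using that by (intro SUP_least) auto
    then show ?thesis
      unfolding P_def[of A] ennreal_SUP_add_left[OF ne(1), symmetric] by (intro SUP_least) auto
  qed
  have mono: "P A \<le> P A'" if "A \<subseteq> A'" for A A'
    unfolding P_def by (rule SUP_subset_mono) (use that in auto)
  have ca: "countably_additive (sets M) P"
  proof (rule countably_additiveI)
    fix A :: "nat \<Rightarrow> 'a set"
    assume A: "range A \<subseteq> sets M" "disjoint_family A" "(\<Union>i. A i) \<in> sets M"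
    show "(\<Sum>i. P (A i)) = P (\<Union>i. A i)"
    proof (rule antisym)
      have "(\<Sum>i<n. P (A i)) \<le> P (\<Union>i<n. A i)" for n
      proof (induction n)
        case (Suc n)
        have "(\<Sum>i<Suc n. P (A i)) \<le> P (\<Union>i<n. A i) + P (A n)" using Suc by (simp add: add_right_mono)
        also have "\<dots> \<le> P ((\<Union>i<n. A i) \<union> A n)"
        proof (intro superadd)
          show "(\<Union>i<n. A i) \<inter> A n = {}" using A(2) by (auto dest: disjoint_family_onD[OF _ UNIV_I UNIV_I less_imp_neq])
        qed (use A in auto)
        also have "(\<Union>i<n. A i) \<union> A n = (\<Union>i<Suc n. A i)" by (auto simp: lessThan_Suc)
        finally show ?case .
      qed (simp add: P0)
      also have "P (\<Union>i<n. A i) \<le> P (\<Union>i. A i)" for n by (rule mono) auto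
      finally show "(\<Sum>i. P (A i)) \<le> P (\<Union>i. A i)"
        by (intro suminf_le_const) auto
      show "P (\<Union>i. A i) \<le> (\<Sum>i. P (A i))"
        unfolding P_def[of "\<Union>i. A i"]
      proof (rule SUP_least, clarify)
        fix B assume B: "B \<in> sets M" "B \<subseteq> (\<Union>i. A i)"
        have "range (\<lambda>i. B \<inter> A i) \<subseteq> sets M" "disjoint_family (\<lambda>i. B \<inter> A i)"
          using A B by (auto simp: disjoint_family_on_def)
        then have "(\<lambda>i. \<mu> (B \<inter> A i)) sums \<mu> (\<Union>i. B \<inter> A i)"
          using \<mu> unfolding signed_measure_def by blast
        moreover have "(\<Union>i. B \<inter> A i) = B" using B by auto
        ultimately have lim: "(\<lambda>n. ennreal (\<Sum>i<n. \<mu> (B \<inter> A i))) \<longlonglongrightarrow> ennreal (\<mu> B)"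
          by (intro tendsto_ennrealI) (simp add: sums_def)
        have "ennreal (\<Sum>i<n. \<mu> (B \<inter> A i)) \<le> (\<Sum>i. P (A i))" for n
        proof -
          have "ennreal (\<Sum>i<n. \<mu> (B \<inter> A i)) \<le> ennreal (\<Sum>i<n. max 0 (\<mu> (B \<inter> A i)))"
            by (intro ennreal_leI sum_mono) auto
          also have "\<dots> = (\<Sum>i<n. ennreal (max 0 (\<mu> (B \<inter> A i))))" by (rule sum_ennreal[symmetric]) auto
          also have "\<dots> \<le> (\<Sum>i<n. P (A i))"
            using A B by (intro sum_mono) (auto simp: max_def intro!: P_upper)
          also have "\<dots> \<le> (\<Sum>i. P (A i))" by (rule sum_le_suminf) auto
          finally show ?thesis .
        qed
        then show "ennreal (\<mu> B) \<le> (\<Sum>i. P (A i))" by (intro LIMSEQ_le_const2[OF lim]) auto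
      qed
    qed
  qed
  have pos: "positive (sets M) P" by (simp add: positive_def P0)
  have pv: "positive_variation M \<mu> = measure_of (space M) (sets M) P"
    unfolding positive_variation_def P_def[abs_def] ..
  show s: "sets (positive_variation M \<mu>) = sets M" unfolding pv by simp
  show em: "emeasure (positive_variation M \<mu>) A = (SUP B\<in>{B\<in>sets M. B \<subseteq> A}. ennreal (\<mu> B))" if "A \<in> sets M" for A
    using emeasure_measure_of[OF pv _ _ _ that[folded s]] pos ca s sets.space_closed[of M] by (simp add: P_def)
  obtain K where K: "\<And>A. A \<in> sets M \<Longrightarrow> \<bar>\<mu> A\<bar> \<le> K" by (rule signed_measure_bounded[OF \<mu>]) (rule that)
  have "emeasure (positive_variation M \<mu>) (space M) \<le> ennreal K"
    unfolding em[OF sets.top] using K by (intro SUP_least ennreal_leI) (auto simp: abs_le_iff)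
  then show "finite_measure (positive_variation M \<mu>)"
    using sets_eq_imp_space_eq[OF s] by (intro finite_measureI) (auto simp: top_unique)
qed

lemma Jordan_decomposition:
  assumes \<mu>: "signed_measure M \<mu>" and A: "A \<in> sets M"
  shows "\<mu> A = measure (positive_variation M \<mu>) A - measure (positive_variation M (\<lambda>A. - \<mu> A)) A"
proof -
  have le: "measure (positive_variation M \<mu>) A \<le> \<mu> A + measure (positive_variation M (\<lambda>A. - \<mu> A)) A"
    if \<mu>: "signed_measure M \<mu>" for \<mu>
  proof -
    note \<mu>' = signed_measure_uminus[OF \<mu>]
    interpret N: finite_measure "positive_variation M (\<lambda>A. - \<mu> A)" by (rule finite_positive_variation[OF \<mu>'])
    interpret P: finite_measure "positive_variation M \<mu>" by (rule finite_positive_variation[OF \<mu>])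
    have N: "- \<mu> B \<le> measure (positive_variation M (\<lambda>A. - \<mu> A)) A" if "B \<in> sets M" "B \<subseteq> A" for B
    proof -
      have "ennreal (- \<mu> B) \<le> emeasure (positive_variation M (\<lambda>A. - \<mu> A)) A"
        unfolding emeasure_positive_variation[OF \<mu>' A] by (rule SUP_upper) (use that in auto)
      then show ?thesis
        using measure_nonneg[of "positive_variation M (\<lambda>A. - \<mu> A)" A]
        by (auto simp: N.emeasure_eq_measure ennreal_le_iff2)
    qed
    have "emeasure (positive_variation M \<mu>) A \<le> ennreal (\<mu> A + measure (positive_variation M (\<lambda>A. - \<mu> A)) A)"
      unfolding emeasure_positive_variation[OF \<mu> A]
    proof (rule SUP_least, clarify, rule ennreal_leI)
      fix B assume B: "B \<in> sets M" "B \<subseteq> A"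
      show "\<mu> B \<le> \<mu> A + measure (positive_variation M (\<lambda>A. - \<mu> A)) A"
        using N[of "A - B"] signed_measure_Diff[OF \<mu> A B] A B by auto
    qed
    moreover have "0 \<le> \<mu> A + measure (positive_variation M (\<lambda>A. - \<mu> A)) A" using N[OF A] by simp
    ultimately show ?thesis by (simp add: P.emeasure_eq_measure)
  qed
  show ?thesis using le[OF \<mu>] le[OF signed_measure_uminus[OF \<mu>]] by simp
qed

lemma positive_variation_eq_0:
  assumes \<mu>: "signed_measure M \<mu>" and A: "A \<in> sets M" and 0: "\<And>B. B \<in> sets M \<Longrightarrow> B \<subseteq> A \<Longrightarrow> \<mu> B = 0"
  shows "emeasure (positive_variation M \<mu>) A = 0"
  unfolding emeasure_positive_variation[OF \<mu> A] using 0 by (auto intro!: antisym SUP_least)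

text \<open>Rounding \<open>f\<close> down to multiples of \<open>1/n\<close> reduces to functions with finitely many values.\<close>

lemma integral_linear_relation:
  fixes Q :: "'i \<Rightarrow> 'a measure" and c :: "'i \<Rightarrow> real" and f :: "'a \<Rightarrow> real"
  assumes I: "finite I" and Q: "\<And>i. i \<in> I \<Longrightarrow> finite_measure (Q i)" "\<And>i. i \<in> I \<Longrightarrow> sets (Q i) = sets M"
    and rel: "\<And>A. A \<in> sets M \<Longrightarrow> (\<Sum>i\<in>I. c i * measure (Q i) A) = 0"
    and f: "f \<in> borel_measurable M" and B: "\<And>x. \<bar>f x\<bar> \<le> B"
  shows "(\<Sum>i\<in>I. c i * integral\<^sup>L (Q i) f) = 0"
proof -
  define g where "g n x = real_of_int \<lfloor>real (Suc n) * f x\<rfloor> / real (Suc n)" for n x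
  have gf: "\<bar>g n x - f x\<bar> \<le> 1 / real (Suc n)" for n x
  proof -
    have "\<bar>real_of_int \<lfloor>real (Suc n) * f x\<rfloor> - real (Suc n) * f x\<bar> \<le> 1" by linarith
    then have "\<bar>real_of_int \<lfloor>real (Suc n) * f x\<rfloor> - real (Suc n) * f x\<bar> / real (Suc n) \<le> 1 / real (Suc n)"
      by (intro divide_right_mono) auto
    moreover have "g n x - f x = (real_of_int \<lfloor>real (Suc n) * f x\<rfloor> - real (Suc n) * f x) / real (Suc n)"
      by (simp add: g_def field_simps)
    ultimately show ?thesis by (simp add: abs_divide)
  qed
  have [measurable]: "f \<in> borel_measurable (Q i)" "g n \<in> borel_measurable (Q i)" if "i \<in> I" for n i
  proof -
    show [measurable]: "f \<in> borel_measurable (Q i)" using f measurable_cong_sets[OF Q(2)[OF that] refl] by blast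
    show "g n \<in> borel_measurable (Q i)" unfolding g_def by measurable
  qed
  have int: "integrable (Q i) f" "integrable (Q i) (g n)" if "i \<in> I" for i n
  proof -
    interpret finite_measure "Q i" by (rule Q(1)[OF that])
    show "integrable (Q i) f" by (rule integrable_const_bound[where B=B]) (use that B in auto)
    have "\<bar>g n x\<bar> \<le> B + 1" for x
    proof -
      have "1 / real (Suc n) \<le> 1" by simp
      then show ?thesis using gf[of n x] B[of x] by linarith
    qed
    then show "integrable (Q i) (g n)" by (intro integrable_const_bound[where B="B + 1"]) (use that in auto)
  qed
  have zero: "(\<Sum>i\<in>I. c i * integral\<^sup>L (Q i) (g n)) = 0" for n
  proof -
    define Z where "Z = {- \<lceil>real (Suc n) * B + 1\<rceil> .. \<lceil>real (Suc n) * B + 1\<rceil>}"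
    define A where "A k = {x \<in> space M. \<lfloor>real (Suc n) * f x\<rfloor> = k}" for k
    have A: "A k \<in> sets M" for k unfolding A_def using f by measurable
    have inZ: "\<lfloor>real (Suc n) * f x\<rfloor> \<in> Z" for x
    proof -
      have "\<bar>real (Suc n) * f x\<bar> \<le> real (Suc n) * B" using B[of x] by (simp add: abs_mult del: of_nat_Suc)
      then show ?thesis unfolding Z_def by (simp del: of_nat_Suc) linarith
    qed
    have gsum: "g n x = (\<Sum>k\<in>Z. (real_of_int k / real (Suc n)) * indicator (A k) x)" if "x \<in> space M" for x
    proof -
      have "(\<Sum>k\<in>Z. (real_of_int k / real (Suc n)) * indicator (A k) x)
          = (\<Sum>k\<in>Z. if k = \<lfloor>real (Suc n) * f x\<rfloor> then real_of_int k / real (Suc n) else 0)"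
        using that by (intro sum.cong) (auto simp: A_def indicator_def)
      also have "\<dots> = g n x" using inZ[of x] by (simp add: Z_def g_def sum.delta)
      finally show ?thesis by simp
    qed
    have "integral\<^sup>L (Q i) (g n) = (\<Sum>k\<in>Z. (real_of_int k / real (Suc n)) * measure (Q i) (A k))" if "i \<in> I" for i
    proof -
      interpret finite_measure "Q i" by (rule Q(1)[OF that])
      have Ai: "A k \<in> sets (Q i)" for k using A Q(2)[OF that] by simp
      have "integral\<^sup>L (Q i) (g n) = (LINT x|Q i. (\<Sum>k\<in>Z. (real_of_int k / real (Suc n)) * indicator (A k) x))"
        by (intro Bochner_Integration.integral_cong refl gsum) (simp add: sets_eq_imp_space_eq[OF Q(2)[OF that]])
      also have "\<dots> = (\<Sum>k\<in>Z. LINT x|Q i. (real_of_int k / real (Suc n)) * indicator (A k) x)"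
        by (intro Bochner_Integration.integral_sum integrable_mult_right integrable_real_indicator Ai) (simp add: emeasure_eq_measure)
      finally show ?thesis using Ai by simp
    qed
    then have "(\<Sum>i\<in>I. c i * integral\<^sup>L (Q i) (g n)) = (\<Sum>i\<in>I. \<Sum>k\<in>Z. (real_of_int k / real (Suc n)) * (c i * measure (Q i) (A k)))"
      by (simp add: sum_distrib_left mult.left_commute)
    also have "\<dots> = (\<Sum>k\<in>Z. (real_of_int k / real (Suc n)) * (\<Sum>i\<in>I. c i * measure (Q i) (A k)))"
      by (subst sum.swap) (simp add: sum_distrib_left)
    also have "\<dots> = 0" using rel[OF A] by simp
    finally show ?thesis .
  qed
  have lim: "(\<lambda>n. integral\<^sup>L (Q i) (g n)) \<longlonglongrightarrow> integral\<^sup>L (Q i) f" if "i \<in> I" for i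
  proof -
    interpret finite_measure "Q i" by (rule Q(1)[OF that])
    have "(\<lambda>n. integral\<^sup>L (Q i) (g n) - integral\<^sup>L (Q i) f) \<longlonglongrightarrow> 0"
    proof (rule Lim_null_comparison)
      show "\<forall>\<^sub>F n in sequentially. norm (integral\<^sup>L (Q i) (g n) - integral\<^sup>L (Q i) f) \<le> measure (Q i) (space (Q i)) * (1 / real (Suc n))"
      proof (intro always_eventually allI)
        fix n
        have "norm (integral\<^sup>L (Q i) (g n) - integral\<^sup>L (Q i) f) = \<bar>LINT x|Q i. g n x - f x\<bar>"
          using int[OF that] by simp
        also have "\<dots> \<le> (LINT x|Q i. \<bar>g n x - f x\<bar>)" by (rule integral_abs_bound)
        also have "\<dots> \<le> (LINT x|Q i. 1 / real (Suc n))"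
          using int[OF that] gf by (intro integral_mono) auto
        finally show "norm (integral\<^sup>L (Q i) (g n) - integral\<^sup>L (Q i) f) \<le> measure (Q i) (space (Q i)) * (1 / real (Suc n))"
          by simp
      qed
      show "(\<lambda>n. measure (Q i) (space (Q i)) * (1 / real (Suc n))) \<longlonglongrightarrow> 0"
        using tendsto_mult_right_zero[OF LIMSEQ_inverse_real_of_nat] by (simp add: inverse_eq_divide)
    qed
    then show ?thesis by (simp add: LIM_zero_iff)
  qed
  have "(\<lambda>n. \<Sum>i\<in>I. c i * integral\<^sup>L (Q i) (g n)) \<longlonglongrightarrow> (\<Sum>i\<in>I. c i * integral\<^sup>L (Q i) f)"
    by (intro tendsto_intros lim)
  then show ?thesis unfolding zero by (simp add: LIMSEQ_const_iff)
qed

section \<open>Null sets of the one-dimensional Hausdorff measure\<close>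

lemma hausdorff1_zero_cover:
  assumes "hausdorff1 Z = 0" "\<delta> > 0" "e > 0"
  obtains C :: "nat \<Rightarrow> 'a::metric_space set" where "Z \<subseteq> (\<Union>i. C i)" "\<And>i. bounded (C i)" "\<And>i. diameter (C i) \<le> \<delta>"
    "(\<Sum>i. ennreal (diameter (C i))) < ennreal e"
proof -
  have "hausdorff1_premeasure \<delta> Z \<le> hausdorff1 Z"
    unfolding hausdorff1_def by (rule SUP_upper) (use assms in simp)
  then have "hausdorff1_premeasure \<delta> Z < ennreal e" using assms by simp
  then show ?thesis unfolding hausdorff1_premeasure_def INF_less_iff using that by blast
qed

lemma hausdorff1_zeroI:
  assumes "\<And>\<delta> e :: real. \<delta> > 0 \<Longrightarrow> e > 0 \<Longrightarrow>
    \<exists>C :: nat \<Rightarrow> 'a::metric_space set. Z \<subseteq> (\<Union>i. C i) \<and> (\<forall>i. bounded (C i) \<and> diameter (C i) \<le> \<delta>) \<and>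
      (\<Sum>i. ennreal (diameter (C i))) \<le> ennreal e"
  shows "hausdorff1 Z = 0"
proof -
  have "hausdorff1_premeasure \<delta> Z \<le> 0" if \<delta>: "\<delta> > 0" for \<delta>
  proof (rule ennreal_le_epsilon)
    fix e :: real assume "e > 0"
    then obtain C :: "nat \<Rightarrow> 'a set" where C: "Z \<subseteq> (\<Union>i. C i) \<and> (\<forall>i. bounded (C i) \<and> diameter (C i) \<le> \<delta>)"
      "(\<Sum>i. ennreal (diameter (C i))) \<le> ennreal e"
      using assms[OF \<delta>, of e] by auto
    have "hausdorff1_premeasure \<delta> Z \<le> (\<Sum>i. ennreal (diameter (C i)))"
      unfolding hausdorff1_premeasure_def by (rule INF_lower) (use C(1) in blast)
    then show "hausdorff1_premeasure \<delta> Z \<le> 0 + ennreal e" using C(2) by simp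
  qed
  then show ?thesis unfolding hausdorff1_def by (intro antisym SUP_least) auto
qed

lemma hausdorff1_mono: "A \<subseteq> B \<Longrightarrow> hausdorff1 A \<le> hausdorff1 B"
  unfolding hausdorff1_def hausdorff1_premeasure_def by (intro SUP_mono' INF_superset_mono) auto

lemma hausdorff1_empty: "hausdorff1 {} = 0"
  by (rule hausdorff1_zeroI) (auto intro!: exI[of _ "\<lambda>_. {}"])

lemma hausdorff1_null_borel_hull:
  fixes Z :: "'a::euclidean_space set"
  assumes "hausdorff1 Z = 0"
  obtains B where "B \<in> sets borel" "Z \<subseteq> B" "hausdorff1 B = 0"
proof -
  have "\<forall>n. \<exists>C :: nat \<Rightarrow> 'a set. Z \<subseteq> (\<Union>i. C i) \<and> (\<forall>i. bounded (C i) \<and> diameter (C i) \<le> 1 / real (Suc n)) \<and>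
      (\<Sum>i. ennreal (diameter (C i))) < ennreal (1 / real (Suc n))"
  proof
    fix n
    show "\<exists>C :: nat \<Rightarrow> 'a set. Z \<subseteq> (\<Union>i. C i) \<and> (\<forall>i. bounded (C i) \<and> diameter (C i) \<le> 1 / real (Suc n)) \<and>
      (\<Sum>i. ennreal (diameter (C i))) < ennreal (1 / real (Suc n))"
      by (rule hausdorff1_zero_cover[OF assms, of "1 / real (Suc n)" "1 / real (Suc n)"]) auto
  qed
  then obtain C :: "nat \<Rightarrow> nat \<Rightarrow> 'a set" where C: "\<And>n. Z \<subseteq> (\<Union>i. C n i)" "\<And>n i. bounded (C n i)"
    "\<And>n i. diameter (C n i) \<le> 1 / real (Suc n)" "\<And>n. (\<Sum>i. ennreal (diameter (C n i))) < ennreal (1 / real (Suc n))"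
    by metis
  define B where "B = (\<Inter>n. \<Union>i. closure (C n i))"
  show ?thesis
  proof
    show "B \<in> sets borel" unfolding B_def by measurable
    show "Z \<subseteq> B" unfolding B_def 
    proof (intro INT_greatest subsetI)
      fix n x assume "x \<in> Z"
      then obtain i where "x \<in> C n i" using C(1)[of n] by blast
      then show "x \<in> (\<Union>i. closure (C n i))" using closure_subset[of "C n i"] by blast
    qed
    show "hausdorff1 B = 0"
    proof (rule hausdorff1_zeroI)
      fix \<delta> e :: real assume "\<delta> > 0" "e > 0"
      then obtain n where n: "1 / real (Suc n) < min \<delta> e" using nat_approx_posE[of "min \<delta> e"] by auto
      have d: "diameter (closure (C n i)) = diameter (C n i)" for i by (rule diameter_closure[OF C(2)])
      have "(\<Sum>i. ennreal (diameter (closure (C n i)))) \<le> ennreal e"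
        unfolding d using C(4)[of n] n by (intro order.trans[OF less_imp_le[OF C(4)]] ennreal_leI) simp
      moreover have "diameter (closure (C n i)) \<le> \<delta>" for i unfolding d using C(3)[of n i] n by simp
      moreover have "B \<subseteq> (\<Union>i. closure (C n i))" unfolding B_def by auto
      ultimately show "\<exists>C. B \<subseteq> (\<Union>i. C i) \<and> (\<forall>i. bounded (C i) \<and> diameter (C i) \<le> \<delta>) \<and>
          (\<Sum>i. ennreal (diameter (C i))) \<le> ennreal e"
        using C(2) bounded_closure by (intro exI[of _ "\<lambda>i. closure (C n i)"]) auto
    qed
  qed
qed

text \<open>If the set function is not countably additive, \<^const>\<open>measure_of\<close> silently returns the
  zero measure; this case is kept, so that no measurability theorem for Hausdorff measure is needed.\<close>

lemma hausdorff1_restricted: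
  fixes \<Omega> S :: "'a::euclidean_space set"
  shows sets_hausdorff1_restricted: "sets (hausdorff1_restricted \<Omega> S) = sets (restrict_space borel \<Omega>)"
    and emeasure_hausdorff1_restricted_cases:
      "(\<forall>A\<in>sets (restrict_space borel \<Omega>). emeasure (hausdorff1_restricted \<Omega> S) A = hausdorff1 (A \<inter> S)) \<or>
       (\<forall>A. emeasure (hausdorff1_restricted \<Omega> S) A = 0)"
proof -
  have sp: "space (restrict_space borel \<Omega>) = \<Omega>" by (simp add: space_restrict_space)
  have pow: "sets (restrict_space borel \<Omega>) \<subseteq> Pow \<Omega>" using sets.space_closed[of "restrict_space borel \<Omega>"] sp by simp
  have sig: "sigma_sets \<Omega> (sets (restrict_space borel \<Omega>)) = sets (restrict_space borel \<Omega>)"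
    using sets.sigma_sets_eq[of "restrict_space borel \<Omega>"] sp by simp
  show "sets (hausdorff1_restricted \<Omega> S) = sets (restrict_space borel \<Omega>)"
    unfolding hausdorff1_restricted_def using pow sig by (simp add: sets_measure_of)
  show "(\<forall>A\<in>sets (restrict_space borel \<Omega>). emeasure (hausdorff1_restricted \<Omega> S) A = hausdorff1 (A \<inter> S)) \<or>
       (\<forall>A. emeasure (hausdorff1_restricted \<Omega> S) A = 0)"
    unfolding hausdorff1_restricted_def using pow sig by (auto simp: emeasure_measure_of_conv)
qed

text \<open>Vitali covering: where a measure vanishing off \<open>N\<close> has positive upper density outside
  \<open>N\<close>, arbitrarily thin neighbourhoods of the complement of \<open>N\<close> already carry the covering balls.\<close>

lemma hausdorff1_upper_density_null:
  fixes \<sigma> :: "'a::euclidean_space measure"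
  assumes fin: "finite_measure \<sigma>" and sets: "sets \<sigma> = sets borel" and N: "N \<in> sets borel" "emeasure \<sigma> (- N) = 0"
    and c: "c > 0"
  shows "hausdorff1 {x. x \<notin> N \<and> (\<forall>d>0. \<exists>r>0. r < d \<and> c * r < measure \<sigma> (cball x r))} = 0" (is "hausdorff1 ?G = 0")
proof (rule hausdorff1_zeroI)
  interpret finite_measure \<sigma> by (rule fin)
  fix \<delta> e :: real assume \<delta>: "\<delta> > 0" and e: "e > 0"
  have "(INF U\<in>{U. - N \<subseteq> U \<and> open U}. emeasure \<sigma> U) < ennreal (e * c / 10)"
    using outer_regular[OF sets _ , of "- N"] N c e by (simp add: emeasure_eq_measure)
  then obtain U where U: "- N \<subseteq> U" "open U" "emeasure \<sigma> U < ennreal (e * c / 10)"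
    unfolding INF_less_iff by blast
  have "\<forall>x\<in>?G. \<exists>r. 0 < r \<and> r \<le> \<delta> / 10 \<and> cball x r \<subseteq> U \<and> c * r < measure \<sigma> (cball x r)"
  proof
    fix x assume x: "x \<in> ?G"
    obtain d where d: "d > 0" "cball x d \<subseteq> U" using U(1,2) x open_contains_cball by blast
    obtain r where "r > 0" "r < min d (\<delta> / 10)" "c * r < measure \<sigma> (cball x r)"
      using x d(1) \<delta> by (auto dest!: spec[of _ "min d (\<delta> / 10)"])
    then show "\<exists>r. 0 < r \<and> r \<le> \<delta> / 10 \<and> cball x r \<subseteq> U \<and> c * r < measure \<sigma> (cball x r)"
      using d(2) by (intro exI[of _ r]) (auto simp: subset_iff)
  qed
  from bchoice[OF this] obtain r where
    r0: "\<forall>x\<in>?G. 0 < r x \<and> r x \<le> \<delta> / 10 \<and> cball x (r x) \<subseteq> U \<and> c * r x < measure \<sigma> (cball x (r x))" ..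
  then have r: "\<And>x. x \<in> ?G \<Longrightarrow> 0 < r x" "\<And>x. x \<in> ?G \<Longrightarrow> r x \<le> \<delta> / 10"
    "\<And>x. x \<in> ?G \<Longrightarrow> cball x (r x) \<subseteq> U" "\<And>x. x \<in> ?G \<Longrightarrow> c * r x < measure \<sigma> (cball x (r x))"
    by blast+
  have sub: "?G \<subseteq> (\<Union>x\<in>?G. cball x (r x))"
  proof
    fix x assume x: "x \<in> ?G"
    show "x \<in> (\<Union>x\<in>?G. cball x (r x))" by (rule UN_I[OF x]) (use r(1)[OF x] in simp)
  qed
  have r_bound: "0 < r x \<and> r x \<le> \<delta> / 10" if "x \<in> ?G" for x using r(1,2)[OF that] by simp
  obtain C where C: "countable C" "C \<subseteq> ?G" "pairwise (\<lambda>i j. disjnt (cball i (r i)) (cball j (r j))) C"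
    "?G \<subseteq> (\<Union>i\<in>C. cball i (5 * r i))"
    by (rule Vitali_covering_lemma_cballs[where a="\<lambda>x. x" and r=r, OF sub r_bound]) (assumption, rule that)
  define I where "I = to_nat_on C ` C"
  define p where "p = from_nat_into C"
  have p: "p i \<in> C" if "i \<in> I" for i
    using that C(1) by (auto simp: I_def p_def)
  have p_inj: "p i \<noteq> p j" if "i \<in> I" "j \<in> I" "i \<noteq> j" for i j
    using that C(1) by (auto simp: I_def p_def)
  define f where "f i = (if i \<in> I then cball (p i) (5 * r (p i)) else {})" for i
  define D where "D i = (if i \<in> I then cball (p i) (r (p i)) else {})" for i
  have "disjoint_family D"
    unfolding disjoint_family_on_def
  proof (intro ballI impI)
    fix i j :: nat assume "i \<noteq> j"
    show "D i \<inter> D j = {}"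
    proof (cases "i \<in> I \<and> j \<in> I")
      case True
      then show ?thesis using p p_inj[of i j] \<open>i \<noteq> j\<close> C(3)
        by (auto simp: D_def pairwise_def disjnt_def)
    qed (auto simp: D_def)
  qed
  moreover have Dm: "D i \<in> sets \<sigma>" for i by (simp add: D_def sets)
  ultimately have sumD: "(\<Sum>i. emeasure \<sigma> (D i)) = emeasure \<sigma> (\<Union>i. D i)"
    by (intro suminf_emeasure) auto
  have "(\<Union>i. D i) \<subseteq> U" using r(3) p C(2) by (fastforce simp: D_def split: if_splits)
  then have DU: "emeasure \<sigma> (\<Union>i. D i) \<le> emeasure \<sigma> U" using U(2) by (intro emeasure_mono) (simp_all add: sets)
  have f_diam: "ennreal (diameter (f i)) \<le> ennreal (10 / c) * emeasure \<sigma> (D i)" for i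
  proof (cases "i \<in> I")
    case True
    then have "p i \<in> ?G" using p C(2) by blast
    note rp = r(1)[OF this] r(4)[OF this]
    have "diameter (f i) = (10 / c) * (c * r (p i))" using True rp(1) c by (simp add: f_def)
    also have "\<dots> \<le> (10 / c) * measure \<sigma> (D i)" using True rp(2) c by (intro mult_left_mono) (auto simp: D_def)
    finally have "ennreal (diameter (f i)) \<le> ennreal ((10 / c) * measure \<sigma> (D i))" by (rule ennreal_leI)
    then show ?thesis using c by (simp add: emeasure_eq_measure flip: ennreal_mult')
  qed (simp add: f_def)
  have "(\<Sum>i. ennreal (diameter (f i))) \<le> (\<Sum>i. ennreal (10 / c) * emeasure \<sigma> (D i))"
    by (intro suminf_le f_diam) auto
  also have "\<dots> = ennreal (10 / c) * emeasure \<sigma> (\<Union>i. D i)" by (simp add: sumD)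
  also have "\<dots> \<le> ennreal (10 / c) * ennreal (e * c / 10)"
    using DU U(3) by (intro mult_left_mono) auto
  also have "\<dots> = ennreal e" using c e by (simp flip: ennreal_mult)
  finally have "(\<Sum>i. ennreal (diameter (f i))) \<le> ennreal e" .
  moreover have "diameter (f i) \<le> \<delta>" for i
  proof (cases "i \<in> I")
    case True
    then have "p i \<in> ?G" using p C(2) by blast
    from r(1,2)[OF this] show ?thesis using True by (simp add: f_def)
  qed (use \<delta> in \<open>simp add: f_def\<close>)
  moreover have "?G \<subseteq> (\<Union>i. f i)"
  proof
    fix x assume "x \<in> ?G"
    then obtain y where y: "y \<in> C" "x \<in> cball y (5 * r y)" using C(4) by blast
    then have "to_nat_on C y \<in> I" "p (to_nat_on C y) = y" using C(1) by (auto simp: I_def p_def)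
    then show "x \<in> (\<Union>i. f i)" using y by (intro UN_I[of "to_nat_on C y"]) (simp_all add: f_def)
  qed
  moreover have "bounded (f i)" for i by (simp add: f_def)
  ultimately show "\<exists>C. ?G \<subseteq> (\<Union>i. C i) \<and> (\<forall>i. bounded (C i) \<and> diameter (C i) \<le> \<delta>) \<and>
      (\<Sum>i. ennreal (diameter (C i))) \<le> ennreal e"
    by (intro exI[of _ f]) auto
qed

section \<open>Blow-up of a signed measure\<close>

lemma has_density_borel_version:
  fixes f :: "'a \<Rightarrow> real"
  assumes "has_density L f \<kappa>"
  obtains g where "g \<in> borel_measurable L" "integrable L g" "AE x in L. f x = g x"
    "\<And>A. A \<in> sets L \<Longrightarrow> \<kappa> A = (LINT x:A|L. g x)"
proof -
  have f: "integrable (completion L) f" using assms by (simp add: has_density_def)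
  obtain g where g: "g \<in> borel_measurable L" and fg: "AE x in L. f x = g x"
    using completion_ex_borel_measurable_real[OF borel_measurable_integrable[OF f]] by blast
  have gc: "g \<in> borel_measurable (completion L)" using g by (rule measurable_completion)
  have ig: "integrable L g"
    using integrable_cong_AE_imp[OF f gc AE_completion[OF fg]] g by (simp add: integrable_completion)
  have "\<kappa> A = (LINT x:A|L. g x)" if A: "A \<in> sets L" for A
  proof -
    have "\<kappa> A = (LINT x|completion L. indicator A x *\<^sub>R f x)"
      using assms A by (simp add: has_density_def set_lebesgue_integral_def)
    also have "\<dots> = (LINT x|completion L. indicator A x *\<^sub>R g x)"
    proof (rule integral_cong_AE)
      show "(\<lambda>x. indicator A x *\<^sub>R f x) \<in> borel_measurable (completion L)" "(\<lambda>x. indicator A x *\<^sub>R g x) \<in> borel_measurable (completion L)"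
        by (intro borel_measurable_scaleR gc borel_measurable_integrable[OF f] measurable_completion[OF borel_measurable_indicator[OF A]])+
      show "AE x in completion L. indicator A x *\<^sub>R f x = indicator A x *\<^sub>R g x"
        using AE_completion[OF fg] by eventually_elim simp
    qed
    also have "\<dots> = (LINT x:A|L. g x)"
      using g A by (simp add: set_lebesgue_integral_def integral_completion)
    finally show ?thesis .
  qed
  with g ig fg show ?thesis by (rule that)
qed

locale hausdorff_base =
  fixes \<Omega> S :: "'a::euclidean_space set" and \<Lambda> :: "'a measure"
  assumes \<Omega>: "open \<Omega>" and sets_\<Lambda>: "sets \<Lambda> = sets (restrict_space borel \<Omega>)"
    and em: "\<And>A. A \<in> sets (restrict_space borel \<Omega>) \<Longrightarrow> emeasure \<Lambda> A = hausdorff1 (A \<inter> S)"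
    and fin: "hausdorff1 S < \<infinity>"
begin

lemma space_\<Lambda>: "space \<Lambda> = \<Omega>"
  using sets_eq_imp_space_eq[OF sets_\<Lambda>] by (simp add: space_restrict_space)

lemma in_sets_iff: "A \<in> sets \<Lambda> \<longleftrightarrow> A \<in> sets borel \<and> A \<subseteq> \<Omega>"
  unfolding sets_\<Lambda> by (subst sets_restrict_space_iff) (use \<Omega> in auto)

lemma finite_\<Lambda>: "finite_measure \<Lambda>"
proof (rule finite_measureI)
  have "emeasure \<Lambda> \<Omega> \<le> hausdorff1 S"
    using em[of \<Omega>] in_sets_iff[of \<Omega>] \<Omega> hausdorff1_mono[of "\<Omega> \<inter> S" S] by (auto simp: sets_\<Lambda>)
  then show "emeasure \<Lambda> (space \<Lambda>) \<noteq> \<infinity>" using fin by (auto simp: space_\<Lambda> top_unique)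
qed

sublocale finite_measure \<Lambda> by (rule finite_\<Lambda>)

lemma AE_not_null:
  assumes "hausdorff1 Z = 0"
  shows "AE x in \<Lambda>. x \<notin> Z"
proof -
  obtain B where B: "B \<in> sets borel" "Z \<subseteq> B" "hausdorff1 B = 0"
    by (rule hausdorff1_null_borel_hull[OF assms])
  have m: "B \<inter> \<Omega> \<in> sets \<Lambda>" using B \<Omega> by (simp add: in_sets_iff)
  have "emeasure \<Lambda> (B \<inter> \<Omega>) \<le> hausdorff1 B"
    using em[of "B \<inter> \<Omega>"] m hausdorff1_mono[of "B \<inter> \<Omega> \<inter> S" B] by (auto simp: sets_\<Lambda>)
  then have "B \<inter> \<Omega> \<in> null_sets \<Lambda>" using m B(3) by auto
  then have "AE x in \<Lambda>. x \<notin> B \<inter> \<Omega>" by (rule AE_not_in)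
  with AE_space show ?thesis by eventually_elim (use B(2) in \<open>auto simp: space_\<Lambda>\<close>)
qed

lemma AE_singular_density:
  assumes Q: "finite_measure Q" "sets Q = sets \<Lambda>" and N: "N \<in> null_sets \<Lambda>" "emeasure Q (\<Omega> - N) = 0"
  shows "AE x in \<Lambda>. ((\<lambda>r. measure Q (cball x r \<inter> \<Omega>) / r) \<longlongrightarrow> 0) (at_right 0)"
proof -
  interpret Q: finite_measure Q by (rule Q)
  have [measurable]: "(\<lambda>x. x) \<in> measurable Q borel"
  proof -
    have "(\<lambda>x. x) \<in> measurable (restrict_space borel \<Omega>) borel"
      by (rule measurable_restrict_space1) simp
    then show ?thesis using measurable_cong_sets[OF Q(2)[unfolded sets_\<Lambda>] refl] by blast
  qed
  have spQ: "space Q = \<Omega>" using sets_eq_imp_space_eq[OF Q(2)] space_\<Lambda> by simp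
  define \<sigma> where "\<sigma> = distr Q borel (\<lambda>x. x)"
  have \<sigma>: "finite_measure \<sigma>" "sets \<sigma> = sets borel"
    unfolding \<sigma>_def by (auto intro: Q.finite_measure_distr)
  have meas: "measure \<sigma> A = measure Q (A \<inter> \<Omega>)" "emeasure \<sigma> A = emeasure Q (A \<inter> \<Omega>)" if "A \<in> sets borel" for A
    unfolding \<sigma>_def using that by (simp_all add: measure_distr emeasure_distr spQ)
  have N': "N \<in> sets borel" "N \<subseteq> \<Omega>" using N(1) in_sets_iff[of N] by auto
  have N0: "emeasure \<sigma> (- N) = 0"
  proof -
    have "- N \<inter> \<Omega> = \<Omega> - N" by auto
    then show ?thesis using meas(2)[of "- N"] N' N(2) by simp
  qed
  define Gk where "Gk k = {x. x \<notin> N \<and> (\<forall>d>0. \<exists>r>0. r < d \<and> (1 / real (Suc k)) * r < measure \<sigma> (cball x r))}" for k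
  have "hausdorff1 (Gk k) = 0" for k
    unfolding Gk_def by (rule hausdorff1_upper_density_null[OF \<sigma> N'(1) N0]) simp
  then have "AE x in \<Lambda>. \<forall>k. x \<notin> Gk k" by (subst AE_all_countable) (auto intro: AE_not_null)
  moreover have "AE x in \<Lambda>. x \<notin> N" using N(1) by (rule AE_not_in)
  ultimately show ?thesis
  proof eventually_elim
    case (elim x)
    show ?case
    proof (rule tendstoI)
      fix e :: real assume "e > 0"
      then obtain k where k: "1 / real (Suc k) < e" using nat_approx_posE by auto
      obtain d where d: "d > 0" "\<And>r. r > 0 \<Longrightarrow> r < d \<Longrightarrow> measure \<sigma> (cball x r) \<le> (1 / real (Suc k)) * r"
        using elim unfolding Gk_def by (auto simp: not_less) (meson not_le)
      show "\<forall>\<^sub>F r in at_right 0. dist (measure Q (cball x r \<inter> \<Omega>) / r) 0 < e"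
        unfolding eventually_at_right_field
      proof (intro exI[of _ d] conjI allI impI d(1))
        fix r :: real assume r: "0 < r" "r < d"
        have "measure Q (cball x r \<inter> \<Omega>) \<le> (1 / real (Suc k)) * r" using d(2)[OF r] by (simp add: meas)
        then have "measure Q (cball x r \<inter> \<Omega>) / r \<le> 1 / real (Suc k)" using r by (simp add: divide_le_eq)
        then show "dist (measure Q (cball x r \<inter> \<Omega>) / r) 0 < e" using k r by simp
      qed
    qed
  qed
qed

definition has_blowup :: "('a set \<Rightarrow> real) \<Rightarrow> real \<Rightarrow> 'a \<Rightarrow> bool"
  where "has_blowup \<mu> k x \<longleftrightarrow>
    (\<forall>\<psi> B. (\<forall>r. \<psi> r \<in> borel_measurable borel) \<longrightarrow> (\<forall>r y. \<bar>\<psi> r y\<bar> \<le> B) \<longrightarrow> (\<forall>r y. y \<notin> ball x r \<longrightarrow> \<psi> r y = 0) \<longrightarrow>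
      ((\<lambda>r. (signed_integral (restrict_space borel \<Omega>) \<mu> (\<psi> r) - k * (LINT y|\<Lambda>. \<psi> r y)) / r) \<longlongrightarrow> 0) (at_right 0))"

lemma signed_integral_split:
  assumes \<mu>: "signed_measure (restrict_space borel \<Omega>) \<mu>"
    and dec: "lebesgue_decomposition \<Lambda> \<mu> ac s" and m: "has_density \<Lambda> m ac"
    and \<psi>: "\<psi> \<in> borel_measurable borel" "\<And>y. \<bar>\<psi> y\<bar> \<le> B"
  shows "integrable (completion \<Lambda>) (\<lambda>y. m y * \<psi> y)"
    "signed_integral (restrict_space borel \<Omega>) \<mu> \<psi> = (LINT y|completion \<Lambda>. m y * \<psi> y) +
      (integral\<^sup>L (positive_variation \<Lambda> s) \<psi> - integral\<^sup>L (positive_variation \<Lambda> (\<lambda>A. - s A)) \<psi>)"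
proof -
  let ?M = "restrict_space borel \<Omega>"
  have s: "signed_measure \<Lambda> s" using dec by (simp add: lebesgue_decomposition_def)
  have im: "integrable (completion \<Lambda>) m" using m by (simp add: has_density_def)
  obtain m' where m' [measurable]: "m' \<in> borel_measurable \<Lambda>" and im': "integrable \<Lambda> m'" and mm': "AE x in \<Lambda>. m x = m' x"
    and acm: "\<And>A. A \<in> sets \<Lambda> \<Longrightarrow> ac A = (LINT x:A|\<Lambda>. m' x)"
    by (rule has_density_borel_version[OF m]) (rule that)
  have mmc: "AE x in completion \<Lambda>. m x = m' x" using mm' by (rule AE_completion)
  have \<psi>' [measurable]: "\<psi> \<in> borel_measurable \<Lambda>"
    using measurable_restrict_space1[OF \<psi>(1), of \<Omega>] measurable_cong_sets[OF sets_\<Lambda> refl] by blast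
  have B: "B \<ge> 0" using \<psi>(2)[of undefined] by linarith
  have bd: "integrable \<Lambda> (\<lambda>y. g y * \<psi> y)" if g: "integrable \<Lambda> g" for g
  proof (rule Bochner_Integration.integrable_bound[OF integrable_mult_left[OF integrable_norm[OF g], of B]])
    show "(\<lambda>y. g y * \<psi> y) \<in> borel_measurable \<Lambda>" using g by measurable
    show "AE y in \<Lambda>. norm (g y * \<psi> y) \<le> norm (norm (g y) * B)"
      using \<psi>(2) B by (auto simp: abs_mult intro!: mult_left_mono)
  qed
  have ipsi: "integrable \<Lambda> (\<lambda>y. m' y * \<psi> y)" by (rule bd[OF im'])
  show "integrable (completion \<Lambda>) (\<lambda>y. m y * \<psi> y)"
  proof (rule integrable_cong_AE_imp[of _ "\<lambda>y. m' y * \<psi> y"])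
    show "integrable (completion \<Lambda>) (\<lambda>y. m' y * \<psi> y)" using ipsi by (simp add: integrable_completion)
    show "(\<lambda>y. m y * \<psi> y) \<in> borel_measurable (completion \<Lambda>)"
      using borel_measurable_integrable[OF im] measurable_completion[OF \<psi>'] by measurable
    show "AE y in completion \<Lambda>. m' y * \<psi> y = m y * \<psi> y" using mmc by eventually_elim simp
  qed
  have eqm: "(LINT y|completion \<Lambda>. m y * \<psi> y) = (LINT y|\<Lambda>. m' y * \<psi> y)"
  proof -
    have "(LINT y|completion \<Lambda>. m y * \<psi> y) = (LINT y|completion \<Lambda>. m' y * \<psi> y)"
    proof (rule integral_cong_AE)
      show "(\<lambda>y. m y * \<psi> y) \<in> borel_measurable (completion \<Lambda>)"
        using borel_measurable_integrable[OF im] measurable_completion[OF \<psi>'] by measurable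
      show "(\<lambda>y. m' y * \<psi> y) \<in> borel_measurable (completion \<Lambda>)" by (rule measurable_completion) measurable
      show "AE y in completion \<Lambda>. m y * \<psi> y = m' y * \<psi> y" using mmc by eventually_elim simp
    qed
    then show ?thesis by (simp add: integral_completion)
  qed
  define Pa where "Pa = density \<Lambda> (\<lambda>x. ennreal (max 0 (m' x)))"
  define Na where "Na = density \<Lambda> (\<lambda>x. ennreal (max 0 (- m' x)))"
  have dens: "finite_measure (density \<Lambda> (\<lambda>x. ennreal (max 0 (g x))))"
      "measure (density \<Lambda> (\<lambda>x. ennreal (max 0 (g x)))) A = (LINT x|\<Lambda>. max 0 (g x) * indicator A x)"
      "integral\<^sup>L (density \<Lambda> (\<lambda>x. ennreal (max 0 (g x)))) \<psi> = (LINT x|\<Lambda>. max 0 (g x) * \<psi> x)"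
    if g: "integrable \<Lambda> g" and A: "A \<in> sets \<Lambda>" for g A
  proof -
    note [measurable] = borel_measurable_integrable[OF g]
    have ig: "integrable \<Lambda> (\<lambda>x. max 0 (g x))" using g by auto
    have em: "emeasure (density \<Lambda> (\<lambda>x. ennreal (max 0 (g x)))) A = ennreal (LINT x|\<Lambda>. max 0 (g x) * indicator A x)"
      if A: "A \<in> sets \<Lambda>" for A
    proof -
      have i: "integrable \<Lambda> (\<lambda>x. max 0 (g x) * indicator A x)" using ig A by (rule integrable_real_mult_indicator[rotated])
      have "emeasure (density \<Lambda> (\<lambda>x. ennreal (max 0 (g x)))) A = (\<integral>\<^sup>+x. ennreal (max 0 (g x) * indicator A x) \<partial>\<Lambda>)"
        using A by (subst emeasure_density) (auto intro!: nn_integral_cong simp: indicator_def)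
      also have "\<dots> = ennreal (LINT x|\<Lambda>. max 0 (g x) * indicator A x)"
        by (rule nn_integral_eq_integral[OF i]) auto
      finally show ?thesis .
    qed
    show "finite_measure (density \<Lambda> (\<lambda>x. ennreal (max 0 (g x))))"
      by (rule finite_measureI) (simp add: em[OF sets.top])
    show "measure (density \<Lambda> (\<lambda>x. ennreal (max 0 (g x)))) A = (LINT x|\<Lambda>. max 0 (g x) * indicator A x)"
      unfolding measure_def em[OF A] by (simp add: integral_nonneg_AE)
    show "integral\<^sup>L (density \<Lambda> (\<lambda>x. ennreal (max 0 (g x)))) \<psi> = (LINT x|\<Lambda>. max 0 (g x) * \<psi> x)"
      by (subst integral_density) auto
  qed
  have in': "integrable \<Lambda> (\<lambda>x. - m' x)" using im' by simp
  have ac: "ac A = measure Pa A - measure Na A" if A: "A \<in> sets \<Lambda>" for A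
  proof -
    have "ac A = (LINT x|\<Lambda>. indicator A x *\<^sub>R m' x)" using acm[OF A] by (simp add: set_lebesgue_integral_def)
    also have "\<dots> = (LINT x|\<Lambda>. max 0 (m' x) * indicator A x - max 0 (- m' x) * indicator A x)"
      by (intro Bochner_Integration.integral_cong) (auto simp: indicator_def)
    also have "\<dots> = (LINT x|\<Lambda>. max 0 (m' x) * indicator A x) - (LINT x|\<Lambda>. max 0 (- m' x) * indicator A x)"
      using im' A by (intro Bochner_Integration.integral_diff integrable_real_mult_indicator) auto
    finally show ?thesis using dens(2)[OF im' A] dens(2)[OF in' A] by (simp add: Pa_def Na_def)
  qed
  have sM: "sets ?M = sets \<Lambda>" by (simp add: sets_\<Lambda>)
  note s' = signed_measure_uminus[OF s] and \<mu>' = signed_measure_uminus[OF \<mu>]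
  define Q where "Q = (\<lambda>i::nat. [positive_variation ?M \<mu>, positive_variation ?M (\<lambda>A. - \<mu> A), Pa, Na,
      positive_variation \<Lambda> s, positive_variation \<Lambda> (\<lambda>A. - s A)] ! i)"
  define c where "c = (\<lambda>i::nat. [1, - 1, - 1, 1, - 1, 1 :: real] ! i)"
  have all6: "(\<forall>i\<in>{..<6::nat}. P i) \<longleftrightarrow> P 0 \<and> P 1 \<and> P 2 \<and> P 3 \<and> P 4 \<and> P 5" for P
    by (auto simp: eval_nat_numeral lessThan_Suc)
  have sum6: "(\<Sum>i<6. h i) = h 0 + h 1 + h 2 + h 3 + h 4 + h (5::nat)" for h :: "nat \<Rightarrow> real"
    by (simp add: eval_nat_numeral)
  have "(\<Sum>i<6. c i * integral\<^sup>L (Q i) \<psi>) = 0"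
  proof (rule integral_linear_relation[OF finite_lessThan])
    have "\<forall>i\<in>{..<6::nat}. finite_measure (Q i)"
      unfolding all6 using finite_positive_variation[OF \<mu>] finite_positive_variation[OF \<mu>'] finite_positive_variation[OF s]
        finite_positive_variation[OF s'] dens(1)[OF im' sets.top] dens(1)[OF in' sets.top] by (simp add: Q_def Pa_def Na_def)
    then show "finite_measure (Q i)" if "i \<in> {..<6}" for i using that by blast
    have "\<forall>i\<in>{..<6::nat}. sets (Q i) = sets \<Lambda>"
      unfolding all6 using sets_positive_variation[OF \<mu>] sets_positive_variation[OF \<mu>'] sets_positive_variation[OF s]
        sets_positive_variation[OF s'] sM by (simp add: Q_def Pa_def Na_def)
    then show "sets (Q i) = sets \<Lambda>" if "i \<in> {..<6}" for i using that by blast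
    fix A assume A: "A \<in> sets \<Lambda>"
    have "\<mu> A = ac A + s A" using dec A by (simp add: lebesgue_decomposition_def)
    then show "(\<Sum>i<6. c i * measure (Q i) A) = 0"
      unfolding sum6
      using Jordan_decomposition[OF \<mu>, of A] Jordan_decomposition[OF s A] A sM ac[OF A]
      by (simp add: c_def Q_def)
  qed (use \<psi>(2) \<psi>' in auto)
  then have "signed_integral ?M \<mu> \<psi> = (integral\<^sup>L Pa \<psi> - integral\<^sup>L Na \<psi>) +
      (integral\<^sup>L (positive_variation \<Lambda> s) \<psi> - integral\<^sup>L (positive_variation \<Lambda> (\<lambda>A. - s A)) \<psi>)"
    unfolding sum6 by (simp add: c_def Q_def signed_integral_def)
  also have "integral\<^sup>L Pa \<psi> - integral\<^sup>L Na \<psi> = (LINT x|\<Lambda>. max 0 (m' x) * \<psi> x - max 0 (- m' x) * \<psi> x)"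
    unfolding Pa_def Na_def dens(3)[OF im' sets.top] dens(3)[OF in' sets.top]
    by (rule Bochner_Integration.integral_diff[symmetric]) (auto intro!: bd im')
  also have "\<dots> = (LINT x|\<Lambda>. m' x * \<psi> x)"
    by (intro Bochner_Integration.integral_cong) (auto simp: max_def)
  finally show "signed_integral ?M \<mu> \<psi> = (LINT y|completion \<Lambda>. m y * \<psi> y) +
      (integral\<^sup>L (positive_variation \<Lambda> s) \<psi> - integral\<^sup>L (positive_variation \<Lambda> (\<lambda>A. - s A)) \<psi>)"
    by (simp add: eqm)
qed

lemma AE_has_blowup:
  assumes \<mu>: "signed_measure (restrict_space borel \<Omega>) \<mu>"
    and dec: "lebesgue_decomposition \<Lambda> \<mu> ac s" and m: "has_density \<Lambda> m ac"
  shows "AE x in \<Lambda>. lebesgue_point \<Lambda> m x \<longrightarrow>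
    (\<forall>\<^sub>F r in at_right 0. 0 < measure \<Lambda> (ball x r \<inter> \<Omega>) \<and> measure \<Lambda> (ball x r \<inter> \<Omega>) \<le> K * r) \<longrightarrow> has_blowup \<mu> (m x) x"
proof -
  have s: "signed_measure \<Lambda> s" using dec by (simp add: lebesgue_decomposition_def)
  note s' = signed_measure_uminus[OF s]
  obtain N where N: "N \<in> null_sets \<Lambda>" "\<And>A. A \<in> sets \<Lambda> \<Longrightarrow> A \<inter> N = {} \<Longrightarrow> s A = 0"
    using dec unfolding lebesgue_decomposition_def by blast
  have \<Omega>N: "\<Omega> - N \<in> sets \<Lambda>" using N(1) space_\<Lambda> by (metis null_setsD2 sets.compl_sets)
  have im: "integrable (completion \<Lambda>) m" using m by (simp add: has_density_def)
  let ?P = "positive_variation \<Lambda> s" and ?N = "positive_variation \<Lambda> (\<lambda>A. - s A)"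
  have P0: "emeasure ?P (\<Omega> - N) = 0" "emeasure ?N (\<Omega> - N) = 0"
    by (rule positive_variation_eq_0[OF s \<Omega>N] positive_variation_eq_0[OF s' \<Omega>N]; use N(2) in force)+
  have AP: "AE x in \<Lambda>. ((\<lambda>r. measure ?P (cball x r \<inter> \<Omega>) / r) \<longlongrightarrow> 0) (at_right 0)"
    by (rule AE_singular_density[OF finite_positive_variation[OF s] sets_positive_variation[OF s] N(1) P0(1)])
  have AN: "AE x in \<Lambda>. ((\<lambda>r. measure ?N (cball x r \<inter> \<Omega>) / r) \<longlongrightarrow> 0) (at_right 0)"
    by (rule AE_singular_density[OF finite_positive_variation[OF s'] sets_positive_variation[OF s'] N(1) P0(2)])
  from AP AN show ?thesis
  proof eventually_elim
    case (elim x)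
    show ?case
    proof (intro impI)
      assume leb: "lebesgue_point \<Lambda> m x"
        and K: "\<forall>\<^sub>F r in at_right 0. 0 < measure \<Lambda> (ball x r \<inter> \<Omega>) \<and> measure \<Lambda> (ball x r \<inter> \<Omega>) \<le> K * r"
      show "has_blowup \<mu> (m x) x"
        unfolding has_blowup_def
      proof (intro allI impI)
        fix \<psi> :: "real \<Rightarrow> 'a \<Rightarrow> real" and B
        assume \<psi>: "\<forall>r. \<psi> r \<in> borel_measurable borel" "\<forall>r y. \<bar>\<psi> r y\<bar> \<le> B" "\<forall>r y. y \<notin> ball x r \<longrightarrow> \<psi> r y = 0"
        have B: "B \<ge> 0" using \<psi>(2) abs_ge_zero order_trans by blast
        have \<psi>' [measurable]: "\<psi> r \<in> borel_measurable \<Lambda>" for r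
          using measurable_restrict_space1[of "\<psi> r" borel borel \<Omega>] \<psi>(1) measurable_cong_sets[OF sets_\<Lambda> refl] by blast
        have \<psi>c: "\<psi> r \<in> borel_measurable (completion \<Lambda>)" for r by (rule measurable_completion[OF \<psi>'])
        have i\<psi>: "integrable \<Lambda> (\<psi> r)" for r
          by (rule integrable_const_bound[where B=B]) (use \<psi>(2) in auto)
        note split = signed_integral_split[OF \<mu> dec m \<psi>(1)[rule_format] \<psi>(2)[rule_format]]
        define J where "J r = (LINT y:ball x r \<inter> space \<Lambda>|completion \<Lambda>. \<bar>m y - m x\<bar>)" for r
        have bs: "ball x r \<inter> \<Omega> \<in> sets \<Lambda>" for r using \<Omega> by (simp add: in_sets_iff)
        have iJ: "integrable (completion \<Lambda>) (\<lambda>y. indicator (ball x r \<inter> space \<Lambda>) y *\<^sub>R \<bar>m y - m x\<bar>)" for r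
        proof -
          have "integrable (completion \<Lambda>) (\<lambda>y. \<bar>m y - m x\<bar>)"
            using im by (intro integrable_abs Bochner_Integration.integrable_diff) (simp_all add: integrable_completion)
          then show ?thesis using bs by (intro integrable_mult_indicator) (auto simp: space_\<Lambda>)
        qed
        have sing: "\<bar>integral\<^sup>L Q (\<psi> r)\<bar> \<le> B * measure Q (cball x r \<inter> \<Omega>)"
          if Q: "finite_measure Q" "sets Q = sets \<Lambda>" for Q r
        proof -
          interpret Q: finite_measure Q by (rule Q)
          have mQ: "\<psi> r \<in> borel_measurable Q" using \<psi>' measurable_cong_sets[OF Q(2) refl] by blast
          have cQ: "cball x r \<inter> \<Omega> \<in> sets Q" using \<Omega> by (simp add: Q(2) in_sets_iff)
          have spQ: "space Q = \<Omega>" using sets_eq_imp_space_eq[OF Q(2)] space_\<Lambda> by simp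
          have "\<bar>integral\<^sup>L Q (\<psi> r)\<bar> \<le> (LINT y|Q. \<bar>\<psi> r y\<bar>)" by (rule integral_abs_bound)
          also have "\<dots> \<le> (LINT y|Q. B * indicator (cball x r \<inter> \<Omega>) y)"
          proof (rule integral_mono)
            show "integrable Q (\<lambda>y. \<bar>\<psi> r y\<bar>)"
              by (rule Q.integrable_const_bound[where B=B]) (use \<psi>(2) mQ in auto)
            show "integrable Q (\<lambda>y. B * indicator (cball x r \<inter> \<Omega>) y)"
              using cQ by (intro integrable_mult_right integrable_real_indicator) (auto simp: Q.emeasure_eq_measure)
            fix y assume "y \<in> space Q"
            then show "\<bar>\<psi> r y\<bar> \<le> B * indicator (cball x r \<inter> \<Omega>) y"
              using \<psi>(2,3) spQ B by (cases "y \<in> ball x r") (auto simp: indicator_def)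
          qed
          also have "\<dots> = B * measure Q (cball x r \<inter> \<Omega>)" using cQ by simp
          finally show ?thesis .
        qed
        have bound: "\<bar>signed_integral (restrict_space borel \<Omega>) \<mu> (\<psi> r) - m x * (LINT y|\<Lambda>. \<psi> r y)\<bar> \<le>
            B * J r + B * measure ?P (cball x r \<inter> \<Omega>) + B * measure ?N (cball x r \<inter> \<Omega>)" for r
        proof -
          have "(LINT y|\<Lambda>. \<psi> r y) = (LINT y|completion \<Lambda>. \<psi> r y)" by (simp add: integral_completion)
          then have "(LINT y|completion \<Lambda>. m y * \<psi> r y) - m x * (LINT y|\<Lambda>. \<psi> r y) = (LINT y|completion \<Lambda>. m y * \<psi> r y - m x * \<psi> r y)"
            using split(1) i\<psi> by (simp add: integrable_completion)
          moreover have "\<bar>LINT y|completion \<Lambda>. m y * \<psi> r y - m x * \<psi> r y\<bar> \<le> B * J r"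
          proof -
            have i: "integrable (completion \<Lambda>) (\<lambda>y. m y * \<psi> r y - m x * \<psi> r y)"
              using split(1) i\<psi> by (simp add: integrable_completion)
            have "\<bar>LINT y|completion \<Lambda>. m y * \<psi> r y - m x * \<psi> r y\<bar> \<le> (LINT y|completion \<Lambda>. \<bar>m y * \<psi> r y - m x * \<psi> r y\<bar>)"
              by (rule integral_abs_bound)
            also have "\<dots> \<le> (LINT y|completion \<Lambda>. B * (indicator (ball x r \<inter> space \<Lambda>) y *\<^sub>R \<bar>m y - m x\<bar>))"
            proof (rule integral_mono)
              show "integrable (completion \<Lambda>) (\<lambda>y. \<bar>m y * \<psi> r y - m x * \<psi> r y\<bar>)" using i by simp
              show "integrable (completion \<Lambda>) (\<lambda>y. B * (indicator (ball x r \<inter> space \<Lambda>) y *\<^sub>R \<bar>m y - m x\<bar>))"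
                using iJ by (rule integrable_mult_right)
              fix y assume y: "y \<in> space (completion \<Lambda>)"
              have "\<bar>m y * \<psi> r y - m x * \<psi> r y\<bar> = \<bar>m y - m x\<bar> * \<bar>\<psi> r y\<bar>" by (simp add: abs_mult flip: left_diff_distrib)
              also have "\<dots> \<le> B * (indicator (ball x r \<inter> space \<Lambda>) y *\<^sub>R \<bar>m y - m x\<bar>)"
                using \<psi>(2)[rule_format, of r y] \<psi>(3)[rule_format, of y r] y
                by (cases "y \<in> ball x r") (auto simp: mult.commute[of B] intro: mult_left_mono)
              finally show "\<bar>m y * \<psi> r y - m x * \<psi> r y\<bar> \<le> B * (indicator (ball x r \<inter> space \<Lambda>) y *\<^sub>R \<bar>m y - m x\<bar>)" .
            qed
            also have "\<dots> = B * J r" by (simp add: J_def set_lebesgue_integral_def)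
            finally show ?thesis .
          qed
          ultimately show ?thesis
            using split(2)[of r] sing[OF finite_positive_variation[OF s] sets_positive_variation[OF s], of r]
              sing[OF finite_positive_variation[OF s'] sets_positive_variation[OF s'], of r]
            by linarith
        qed
        have J0: "((\<lambda>r. J r / r) \<longlongrightarrow> 0) (at_right 0)"
        proof (rule Lim_null_comparison)
          have J: "J r \<ge> 0" for r unfolding J_def set_lebesgue_integral_def by (intro integral_nonneg_AE) auto
          show "\<forall>\<^sub>F r in at_right 0. norm (J r / r) \<le> K * (J r / measure \<Lambda> (ball x r \<inter> space \<Lambda>))"
            using K eventually_at_right_less[of 0]
          proof (eventually_elim)
            case (elim r)
            have "J r * measure \<Lambda> (ball x r \<inter> \<Omega>) \<le> J r * (K * r)"
              using elim J by (intro mult_left_mono) auto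
            then show ?case using elim J[of r] by (simp add: space_\<Lambda> field_simps)
          qed
          have "((\<lambda>r. J r / measure \<Lambda> (ball x r \<inter> space \<Lambda>)) \<longlongrightarrow> 0) (at_right 0)"
            using leb unfolding lebesgue_point_def J_def .
          then show "((\<lambda>r. K * (J r / measure \<Lambda> (ball x r \<inter> space \<Lambda>))) \<longlongrightarrow> 0) (at_right 0)"
            by (rule tendsto_mult_right_zero)
        qed
        show "((\<lambda>r. (signed_integral (restrict_space borel \<Omega>) \<mu> (\<psi> r) - m x * (LINT y|\<Lambda>. \<psi> r y)) / r) \<longlongrightarrow> 0) (at_right 0)"
        proof (rule Lim_null_comparison)
          show "\<forall>\<^sub>F r in at_right 0. norm ((signed_integral (restrict_space borel \<Omega>) \<mu> (\<psi> r) - m x * (LINT y|\<Lambda>. \<psi> r y)) / r)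
              \<le> B * (J r / r) + B * (measure ?P (cball x r \<inter> \<Omega>) / r) + B * (measure ?N (cball x r \<inter> \<Omega>) / r)"
            using eventually_at_right_less[of 0]
          proof eventually_elim
            case (elim r)
            then show ?case using divide_right_mono[OF bound[of r], of r] by (simp add: add_divide_distrib)
          qed
          show "((\<lambda>r. B * (J r / r) + B * (measure ?P (cball x r \<inter> \<Omega>) / r) + B * (measure ?N (cball x r \<inter> \<Omega>) / r)) \<longlongrightarrow> 0) (at_right 0)"
            by (intro tendsto_add_zero tendsto_mult_right_zero J0 elim)
        qed
      qed
    qed
  qed
qed

end

section \<open>The tangential structure of the stress tensor\<close>

lemma tendsto_coefficient_0:
  fixes X Y :: "real \<Rightarrow> real"
  assumes lim: "((\<lambda>r. (k * X r + Y r) / r) \<longlongrightarrow> 0) (at_right 0)" and Y: "((\<lambda>r. Y r / r) \<longlongrightarrow> 0) (at_right 0)"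
    and c: "c > 0" "\<forall>\<^sub>F r in at_right 0. c \<le> X r / r"
  shows "k = 0"
proof (rule ccontr)
  assume k: "k \<noteq> 0"
  have "((\<lambda>r. (k * X r + Y r) / r - Y r / r) \<longlongrightarrow> 0 - 0) (at_right 0)"
    by (intro tendsto_intros lim Y)
  then have "((\<lambda>r. \<bar>k * X r / r\<bar>) \<longlongrightarrow> 0) (at_right 0)"
    by (intro tendsto_rabs_zero) (simp add: add_divide_distrib)
  then have "\<forall>\<^sub>F r in at_right 0. \<bar>k * X r / r\<bar> < \<bar>k\<bar> * c" using k c by (intro order_tendstoD) auto
  with c(2) have "\<forall>\<^sub>F r in at_right (0::real). False"
  proof eventually_elim
    case (elim r)
    have "\<bar>k\<bar> * c \<le> \<bar>k\<bar> * \<bar>X r / r\<bar>" by (rule mult_left_mono[OF order_trans[OF elim(1) abs_ge_self] abs_ge_zero])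
    then show False using elim(2) by (simp add: abs_mult abs_divide)
  qed
  then show False by simp
qed

definition cutoff :: "'a::real_inner \<Rightarrow> real \<Rightarrow> 'a \<Rightarrow> real"
  where "cutoff x r y = (if 0 < r then plus_part (r\<^sup>2 - (y - x) \<bullet> (y - x)) ^ 3 / r ^ 6 else 0)"

text \<open>Derivative in direction \<open>v\<close> of the product of \<open>cutoff x r\<close> with the linear function
  \<open>y \<mapsto> (y - x) \<bullet> n\<close>, without the term where the linear function is differentiated.\<close>

definition cutoff_error :: "'a::real_inner \<Rightarrow> 'a \<Rightarrow> 'a \<Rightarrow> real \<Rightarrow> 'a \<Rightarrow> real"
  where "cutoff_error x n v r y = (if 0 < r then
    ((y - x) \<bullet> n) * (- 6 * ((y - x) \<bullet> v) * (plus_part (r\<^sup>2 - (y - x) \<bullet> (y - x)))\<^sup>2 / r ^ 6) else 0)"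

lemma cutoff_has_derivative:
  fixes x :: "'a::euclidean_space"
  assumes "r > 0"
  shows "((\<lambda>y. ((y - x) \<bullet> n) * cutoff x r y) has_derivative
    (\<lambda>v. (v \<bullet> n) * cutoff x r y + cutoff_error x n v r y)) (at y)"
proof -
  have q: "((\<lambda>y. r\<^sup>2 - (y - x) \<bullet> (y - x)) has_derivative (\<lambda>v. - 2 * ((y - x) \<bullet> v))) (at y)"
    by (auto intro!: derivative_eq_intros simp: inner_commute)
  have c: "((\<lambda>y. plus_part (r\<^sup>2 - (y - x) \<bullet> (y - x)) ^ 3) has_derivative
      (\<lambda>v. 3 * (plus_part (r\<^sup>2 - (y - x) \<bullet> (y - x)))\<^sup>2 * (- 2 * ((y - x) \<bullet> v)))) (at y)"
    by (rule has_derivative_compose[OF q plus_part_cube_has_derivative[unfolded has_field_derivative_def]])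
  have "((\<lambda>y. ((y - x) \<bullet> n) * (plus_part (r\<^sup>2 - (y - x) \<bullet> (y - x)) ^ 3 / r ^ 6)) has_derivative
    (\<lambda>v. ((y - x) \<bullet> n) * (3 * (plus_part (r\<^sup>2 - (y - x) \<bullet> (y - x)))\<^sup>2 * (- 2 * ((y - x) \<bullet> v)) / r ^ 6)
      + (v \<bullet> n) * (plus_part (r\<^sup>2 - (y - x) \<bullet> (y - x)) ^ 3 / r ^ 6))) (at y)"
    by (rule has_derivative_mult[OF _ bounded_linear.has_derivative[OF bounded_linear_divide c]])
      (auto intro!: derivative_eq_intros)
  then show ?thesis
    using assms by (simp add: cutoff_def cutoff_error_def mult_ac add.commute)
qed

lemma continuous_on_cutoff:
  "continuous_on A (cutoff x r)" "continuous_on A (cutoff_error x n v r)"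
  unfolding cutoff_def[abs_def] cutoff_error_def[abs_def] by (cases "0 < r"; auto intro!: continuous_intros)+

lemma cutoff_measurable:
  fixes x :: "'a::euclidean_space"
  shows "cutoff x r \<in> borel_measurable borel" "cutoff_error x n v r \<in> borel_measurable borel"
  by (intro borel_measurable_continuous_onI continuous_on_cutoff)+

lemma cutoff_eq_0:
  assumes "y \<notin> ball x r"
  shows "cutoff x r y = 0" "cutoff_error x n v r y = 0"
proof -
  have "plus_part (r\<^sup>2 - (y - x) \<bullet> (y - x)) = 0" if "0 < r"
    using assms that by (simp add: plus_part_def dot_square_norm power_mono dist_norm norm_minus_commute)
  then show "cutoff x r y = 0" "cutoff_error x n v r y = 0"
    by (auto simp: cutoff_def cutoff_error_def)
qed

lemma cutoff_bounds:
  "0 \<le> cutoff x r y" "cutoff x r y \<le> 1"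
  "dist x y < r / 2 \<Longrightarrow> 27 / 64 \<le> cutoff x r y"
  "norm v = 1 \<Longrightarrow> \<bar>cutoff_error x n v r y\<bar> \<le> 6 * (\<bar>(y - x) \<bullet> n\<bar> / r)" if "0 < r"
proof -
  let ?p = "plus_part (r\<^sup>2 - (y - x) \<bullet> (y - x))"
  have p: "0 \<le> ?p" "?p \<le> r\<^sup>2" by (auto simp: plus_part_def)
  show "0 \<le> cutoff x r y" using p that by (simp add: cutoff_def)
  have "?p ^ 3 \<le> (r\<^sup>2) ^ 3" by (intro power_mono p)
  then show "cutoff x r y \<le> 1" using that by (simp add: cutoff_def divide_le_eq)
  show "27 / 64 \<le> cutoff x r y" if d: "dist x y < r / 2"
  proof -
    have "(norm (y - x))\<^sup>2 \<le> (r / 2)\<^sup>2" using d by (intro power_mono) (auto simp: dist_norm norm_minus_commute)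
    then have "3 / 4 * r\<^sup>2 \<le> ?p"
      unfolding plus_part_def by (intro max.coboundedI2) (simp add: dot_square_norm power_divide)
    then have "(3 / 4 * r\<^sup>2) ^ 3 \<le> ?p ^ 3" by (intro power_mono) auto
    then show ?thesis using \<open>0 < r\<close> by (simp add: cutoff_def le_divide_eq power_mult_distrib power_divide)
  qed
  show "\<bar>cutoff_error x n v r y\<bar> \<le> 6 * (\<bar>(y - x) \<bullet> n\<bar> / r)" if v: "norm v = 1"
  proof (cases "dist x y < r")
    case True
    have "\<bar>(y - x) \<bullet> v\<bar> \<le> norm (y - x) * norm v" by (rule Cauchy_Schwarz_ineq2)
    then have "\<bar>(y - x) \<bullet> v\<bar> \<le> r" using True v by (simp add: dist_norm norm_minus_commute)
    moreover have "?p\<^sup>2 \<le> (r\<^sup>2)\<^sup>2" by (intro power_mono p)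
    ultimately have "\<bar>(y - x) \<bullet> v\<bar> * ?p\<^sup>2 \<le> r * r ^ 4" by (intro mult_mono) auto
    also have "\<dots> = r ^ 6 / r" using \<open>0 < r\<close> by (simp add: eval_nat_numeral)
    finally have "\<bar>(y - x) \<bullet> v\<bar> * ?p\<^sup>2 / r ^ 6 \<le> 1 / r" using \<open>0 < r\<close> by (simp add: divide_le_eq)
    from mult_left_mono[OF this, of "6 * \<bar>(y - x) \<bullet> n\<bar>"] show ?thesis
      using \<open>0 < r\<close> by (simp add: cutoff_error_def abs_mult mult_ac)
  next
    case False
    then have "cutoff_error x n v r y = 0" by (intro cutoff_eq_0) simp
    then show ?thesis using \<open>0 < r\<close> by simp
  qed
qed

lemma tangent_algebra:
  fixes c s E :: real
  assumes "c\<^sup>2 + s\<^sup>2 = 1"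
    and "m11 * - s + m12 * c = E * - s" "m21 * - s + m22 * c = E * c" "m12 = m21" "m11 + m22 = 2 * E - 2 * \<Theta>"
  shows "m11 - m22 = - 2 * (c\<^sup>2 - s\<^sup>2) * \<Theta>" "m12 = - 2 * (s * c) * \<Theta>"
  using assms by algebra+

lemma (in hausdorff_base) hausdorff1_inter:
  assumes S: "S \<subseteq> \<Omega>" and A: "A \<inter> \<Omega> \<in> sets \<Lambda>"
  shows "hausdorff1 (S \<inter> A) = ennreal (measure \<Lambda> (A \<inter> \<Omega>))"
proof -
  have "A \<inter> \<Omega> \<inter> S = S \<inter> A" using S by blast
  then show ?thesis using em[of "A \<inter> \<Omega>"] A by (simp add: sets_\<Lambda> emeasure_eq_measure)
qed

lemma (in hausdorff_base) ball_in_sets: "ball x r \<inter> \<Omega> \<in> sets \<Lambda>"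
  using \<Omega> by (simp add: in_sets_iff)

lemma (in hausdorff_base) has_density_one_measure:
  assumes S: "S \<subseteq> \<Omega>" and dens: "has_density_one S x"
  shows "((\<lambda>r. measure \<Lambda> (ball x r \<inter> \<Omega>) / (2 * r)) \<longlongrightarrow> 1) (at_right 0)"
    and "\<forall>\<^sub>F r in at_right 0. 0 < measure \<Lambda> (ball x r \<inter> \<Omega>) \<and> measure \<Lambda> (ball x r \<inter> \<Omega>) \<le> 3 * r"
proof -
  have "\<forall>\<^sub>F r in at_right 0. hausdorff1 (S \<inter> ball x r) / ennreal (2 * r) = ennreal (measure \<Lambda> (ball x r \<inter> \<Omega>) / (2 * r))"
    using eventually_at_right_less[of 0] by eventually_elim (simp add: hausdorff1_inter[OF S] ball_in_sets divide_ennreal)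
  then have "((\<lambda>r. ennreal (measure \<Lambda> (ball x r \<inter> \<Omega>) / (2 * r))) \<longlongrightarrow> ennreal 1) (at_right 0)"
    using dens unfolding has_density_one_def ennreal_1 by (rule tendsto_cong[THEN iffD1])
  moreover have "\<forall>\<^sub>F r in at_right (0::real). 0 \<le> measure \<Lambda> (ball x r \<inter> \<Omega>) / (2 * r)"
    using eventually_at_right_less[of 0] by eventually_elim simp
  ultimately show lim: "((\<lambda>r. measure \<Lambda> (ball x r \<inter> \<Omega>) / (2 * r)) \<longlongrightarrow> 1) (at_right 0)"
    by (subst (asm) tendsto_ennreal_iff) auto
  have "\<forall>\<^sub>F r in at_right 0. measure \<Lambda> (ball x r \<inter> \<Omega>) / (2 * r) < 3 / 2"
    "\<forall>\<^sub>F r in at_right 0. 0 < measure \<Lambda> (ball x r \<inter> \<Omega>) / (2 * r)"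
    by (rule order_tendstoD[OF lim], simp)+
  with eventually_at_right_less[of 0]
  show "\<forall>\<^sub>F r in at_right 0. 0 < measure \<Lambda> (ball x r \<inter> \<Omega>) \<and> measure \<Lambda> (ball x r \<inter> \<Omega>) \<le> 3 * r"
    by eventually_elim (simp add: field_simps zero_less_divide_iff)
qed

lemma tangential_identity:
  fixes \<Omega> S :: "(real ^ 2) set" and e :: "2 \<Rightarrow> real ^ 2" and \<mu> :: "2 \<Rightarrow> 2 \<Rightarrow> (real ^ 2) set \<Rightarrow> real"
    and \<nu> \<zeta> :: "(real ^ 2) set \<Rightarrow> real"
  defines "I \<equiv> signed_integral (restrict_space borel \<Omega>)"
  assumes base: "hausdorff_base \<Omega> S \<Lambda>" and x: "x \<in> \<Omega>" and S: "S \<subseteq> \<Omega>"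
    and e: "\<And>i j. e i \<bullet> e j = (if i = j then 1 else 0)"
    and dens: "has_density_one S x" and tan: "approx_tangent S x (cos \<gamma> *\<^sub>R e 1 + sin \<gamma> *\<^sub>R e 2)"
    and blow: "hausdorff_base.has_blowup \<Omega> \<Lambda> \<nu> E x" "hausdorff_base.has_blowup \<Omega> \<Lambda> \<zeta> \<Theta> x"
      "\<And>i j. hausdorff_base.has_blowup \<Omega> \<Lambda> (\<mu> i j) (m i j) x"
    and stress: "\<And>\<phi> \<phi>' K i. \<lbrakk>\<And>y. (\<phi> has_derivative \<phi>' y) (at y); \<And>v. continuous_on UNIV (\<lambda>y. \<phi>' y v);
        compact K; K \<subseteq> \<Omega>; \<And>y. y \<notin> K \<Longrightarrow> \<phi> y = 0\<rbrakk> \<Longrightarrow>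
        I \<nu> (\<lambda>y. \<phi>' y (e i)) = I (\<mu> i 1) (\<lambda>y. \<phi>' y (e 1)) + I (\<mu> i 2) (\<lambda>y. \<phi>' y (e 2))"
    and trace: "\<And>\<phi> K. \<lbrakk>continuous_on UNIV \<phi>; compact K; K \<subseteq> \<Omega>; \<And>y. y \<notin> K \<Longrightarrow> \<phi> y = 0\<rbrakk> \<Longrightarrow>
        I (\<mu> 1 1) \<phi> + I (\<mu> 2 2) \<phi> = 2 * I \<nu> \<phi> - 2 * I \<zeta> \<phi>"
    and sym: "\<And>\<phi> K. \<lbrakk>continuous_on UNIV \<phi>; compact K; K \<subseteq> \<Omega>; \<And>y. y \<notin> K \<Longrightarrow> \<phi> y = 0\<rbrakk> \<Longrightarrow>
        I (\<mu> 1 2) \<phi> = I (\<mu> 2 1) \<phi>"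
  shows "m 1 1 - m 2 2 = - 2 * cos (2 * \<gamma>) * \<Theta>" "m 1 2 = - sin (2 * \<gamma>) * \<Theta>"
proof -
  interpret hausdorff_base \<Omega> S \<Lambda> by (rule base)
  define n where "n = - sin \<gamma> *\<^sub>R e 1 + cos \<gamma> *\<^sub>R e 2"
  define d where "d = cos \<gamma> *\<^sub>R e 1 + sin \<gamma> *\<^sub>R e 2"
  have en: "e 1 \<bullet> n = - sin \<gamma>" "e 2 \<bullet> n = cos \<gamma>" by (simp_all add: n_def e inner_add_right inner_diff_right)
  have ne: "norm (e i) = 1" for i using e[of i i] by (simp add: norm_eq_sqrt_inner)
  have nn: "norm n = 1"
    by (simp add: norm_eq_sqrt_inner n_def e inner_add_left inner_add_right inner_diff_left inner_diff_right flip: power2_eq_square)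
  have expand: "z - (z \<bullet> d) *\<^sub>R d = (z \<bullet> n) *\<^sub>R n" for z
  proof -
    have z: "z = (z \<bullet> e 1) *\<^sub>R e 1 + (z \<bullet> e 2) *\<^sub>R e 2"
      using orthonormal_frame_expand[OF e, of z] by (simp add: UNIV_2)
    define a b where "a = z \<bullet> e 1" and "b = z \<bullet> e 2"
    have zd: "z \<bullet> d = cos \<gamma> * a + sin \<gamma> * b" "z \<bullet> n = - sin \<gamma> * a + cos \<gamma> * b"
      by (auto simp: d_def n_def a_def b_def inner_add_right inner_diff_right)
    have sc: "sin \<gamma> * sin \<gamma> = 1 - cos \<gamma> * cos \<gamma>"
      using sin_squared_eq[of \<gamma>] by (simp add: power2_eq_square)
    have "a - (cos \<gamma> * a + sin \<gamma> * b) * cos \<gamma> = - (- sin \<gamma> * a + cos \<gamma> * b) * sin \<gamma>"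
      "b - (cos \<gamma> * a + sin \<gamma> * b) * sin \<gamma> = (- sin \<gamma> * a + cos \<gamma> * b) * cos \<gamma>"
      using sc by algebra+
    moreover have "z - (z \<bullet> d) *\<^sub>R d = (a - (cos \<gamma> * a + sin \<gamma> * b) * cos \<gamma>) *\<^sub>R e 1 + (b - (cos \<gamma> * a + sin \<gamma> * b) * sin \<gamma>) *\<^sub>R e 2"
      unfolding zd by (subst z) (simp add: d_def a_def b_def algebra_simps)
    moreover have "(- sin \<gamma> * a + cos \<gamma> * b) *\<^sub>R n
        = (- (- sin \<gamma> * a + cos \<gamma> * b) * sin \<gamma>) *\<^sub>R e 1 + ((- sin \<gamma> * a + cos \<gamma> * b) * cos \<gamma>) *\<^sub>R e 2"
      unfolding n_def by (simp only: scaleR_add_right scaleR_scaleR mult_minus_left mult_minus_right)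
    ultimately show ?thesis unfolding zd by simp
  qed
  have cone: "double_cone x d \<theta> = {y. \<bar>(y - x) \<bullet> n\<bar> \<le> tan \<theta> * \<bar>(y - x) \<bullet> d\<bar>}" for \<theta>
    unfolding double_cone_def expand by (simp add: nn)
  have nd: "norm d = 1" using tan by (simp add: approx_tangent_def d_def)
  have cone_closed: "closed (double_cone x d \<theta>)" for \<theta>
    unfolding cone by (intro closed_Collect_le continuous_intros)

  have ball_sets: "ball x r \<inter> \<Omega> \<in> sets \<Lambda>" "(ball x r - double_cone x d \<theta>) \<inter> \<Omega> \<in> sets \<Lambda>" for r \<theta>
    using \<Omega> cone_closed[of \<theta>] by (auto simp: in_sets_iff)
  note H = hausdorff1_inter[OF S]
  note dens' = has_density_one_measure(1)[OF S dens]
  have tan': "((\<lambda>r. measure \<Lambda> ((ball x r - double_cone x d \<theta>) \<inter> \<Omega>) / r) \<longlongrightarrow> 0) (at_right 0)"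
    if "0 < \<theta>" "\<theta> < pi / 2" for \<theta>
  proof -
    have "\<forall>\<^sub>F r in at_right 0. hausdorff1 (S \<inter> ball x r - double_cone x d \<theta>) / ennreal r =
        ennreal (measure \<Lambda> ((ball x r - double_cone x d \<theta>) \<inter> \<Omega>) / r)"
      using eventually_at_right_less[of 0]
      by eventually_elim (simp add: Int_Diff H[OF ball_sets(2)] divide_ennreal flip: Diff_Int_distrib)
    then have "((\<lambda>r. ennreal (measure \<Lambda> ((ball x r - double_cone x d \<theta>) \<inter> \<Omega>) / r)) \<longlongrightarrow> ennreal 0) (at_right 0)"
      unfolding ennreal_0 by (rule tendsto_cong[THEN iffD1]) (use tan that in \<open>simp add: approx_tangent_def flip: d_def\<close>)
    moreover have "\<forall>\<^sub>F r in at_right (0::real). 0 \<le> measure \<Lambda> ((ball x r - double_cone x d \<theta>) \<inter> \<Omega>) / r"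
      using eventually_at_right_less[of 0] by eventually_elim simp
    ultimately show ?thesis by (subst (asm) tendsto_ennreal_iff) auto
  qed

  define X where "X r = (LINT y|\<Lambda>. cutoff x r y)" for r
  define Y where "Y v r = (LINT y|\<Lambda>. cutoff_error x n v r y)" for v r
  define \<psi> where "\<psi> v r y = (v \<bullet> n) * cutoff x r y + cutoff_error x n v r y" for v r y
  have meas\<Lambda>: "f \<in> borel_measurable \<Lambda>" if "f \<in> borel_measurable borel" for f :: "real ^ 2 \<Rightarrow> real"
    using measurable_restrict_space1[OF that, of \<Omega>] measurable_cong_sets[OF sets_\<Lambda> refl] by blast
  have cut_le: "\<bar>cutoff x r y\<bar> \<le> 1" for r y
  proof (cases "0 < r")
    case True
    show ?thesis unfolding abs_of_nonneg[OF cutoff_bounds(1)[OF True]] by (rule cutoff_bounds(2)[OF True])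
  qed (simp add: cutoff_def)
  have err_le: "\<bar>cutoff_error x n v r y\<bar> \<le> 6" if "norm v = 1" for v r y
  proof (cases "y \<in> ball x r")
    case True
    then have r: "0 < r" by (metis ball_eq_empty empty_iff not_le)
    have "\<bar>(y - x) \<bullet> n\<bar> \<le> norm (y - x) * norm n" by (rule Cauchy_Schwarz_ineq2)
    then have "\<bar>(y - x) \<bullet> n\<bar> \<le> r" using True nn by (simp add: dist_norm norm_minus_commute)
    then have "\<bar>(y - x) \<bullet> n\<bar> / r \<le> 1" using r by (simp add: divide_le_eq)
    then show ?thesis using cutoff_bounds(4)[OF r that, of x n y] by linarith
  qed (simp add: cutoff_eq_0)
  have int_cut: "integrable \<Lambda> (cutoff x r)" for r
    by (rule integrable_const_bound[where B=1]) (use cut_le meas\<Lambda>[OF cutoff_measurable(1)] in auto)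
  have int_err: "integrable \<Lambda> (cutoff_error x n v r)" if "norm v = 1" for v r
    by (rule integrable_const_bound[where B=6]) (use err_le[OF that] meas\<Lambda>[OF cutoff_measurable(2)] in auto)
  have int_\<psi>: "(LINT y|\<Lambda>. \<psi> (e i) r y) = (e i \<bullet> n) * X r + Y (e i) r" for i r
    unfolding \<psi>_def X_def Y_def using int_cut int_err[OF ne] by simp

  have X_lower: "\<forall>\<^sub>F r in at_right 0. 27 / 128 \<le> X r / r"
  proof -
    have half: "filterlim (\<lambda>r. r / 2) (at_right 0) (at_right (0::real))"
      unfolding filterlim_at
      using eventually_at_right_less[of "0::real"] by (auto intro!: tendsto_eq_intros elim!: eventually_mono)
    have "\<forall>\<^sub>F r in at_right 0. 1 / 2 < measure \<Lambda> (ball x r \<inter> \<Omega>) / (2 * r)"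
      using dens' by (rule order_tendstoD) simp
    from eventually_compose_filterlim[OF this half] eventually_at_right_less[of 0] show ?thesis
    proof eventually_elim
      case (elim r)
      have "(LINT y|\<Lambda>. 27 / 64 * indicator (ball x (r / 2) \<inter> \<Omega>) y) \<le> X r"
        unfolding X_def
      proof (rule integral_mono)
        show "integrable \<Lambda> (\<lambda>y. 27 / 64 * indicator (ball x (r / 2) \<inter> \<Omega>) y :: real)"
          using ball_sets(1)[of "r / 2"] by (intro integrable_mult_right integrable_real_indicator) (auto simp: emeasure_eq_measure)
        show "27 / 64 * indicator (ball x (r / 2) \<inter> \<Omega>) y \<le> cutoff x r y" for y
          using cutoff_bounds(1,3)[OF elim(2), of x y] by (auto simp: indicator_def)
      qed (rule int_cut)
      then have "27 / 64 * measure \<Lambda> (ball x (r / 2) \<inter> \<Omega>) \<le> X r" using ball_sets(1)[of "r / 2"] by simp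
      moreover have "r / 2 \<le> measure \<Lambda> (ball x (r / 2) \<inter> \<Omega>)" using elim by (simp add: field_simps)
      ultimately show ?case using elim by (simp add: le_divide_eq)
    qed
  qed
  have Y_lim: "((\<lambda>r. Y v r / r) \<longlongrightarrow> 0) (at_right 0)" if v: "norm v = 1" for v
  proof (rule tendstoI)
    fix \<epsilon> :: real assume \<epsilon>: "\<epsilon> > 0"
    define \<eta> where "\<eta> = \<epsilon> / 40"
    have \<eta>: "\<eta> > 0" using \<epsilon> by (simp add: \<eta>_def)
    define \<theta> where "\<theta> = arctan \<eta>"
    have \<theta>: "0 < \<theta>" "\<theta> < pi / 2" "tan \<theta> = \<eta>" using \<eta> arctan_ubound[of \<eta>] by (auto simp: \<theta>_def tan_arctan)
    have "\<forall>\<^sub>F r in at_right 0. measure \<Lambda> ((ball x r - double_cone x d \<theta>) \<inter> \<Omega>) / r < \<eta>"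
      using tan'[OF \<theta>(1,2)] \<eta> by (rule order_tendstoD)
    with has_density_one_measure(2)[OF S dens] eventually_at_right_less[of 0]
    show "\<forall>\<^sub>F r in at_right 0. dist (Y v r / r) 0 < \<epsilon>"
    proof eventually_elim
      case (elim r)
      let ?D = "(ball x r - double_cone x d \<theta>) \<inter> \<Omega>"
      have r: "r > 0" by (rule elim)
      have iB: "integrable \<Lambda> (indicator (ball x r \<inter> \<Omega>) :: _ \<Rightarrow> real)" "integrable \<Lambda> (indicator ?D :: _ \<Rightarrow> real)"
        using ball_sets(1)[of r] ball_sets(2)[of r \<theta>] by (auto intro!: integrable_real_indicator simp: emeasure_eq_measure)
      have le: "\<bar>cutoff_error x n v r y\<bar> \<le> 6 * (\<eta> * indicator (ball x r \<inter> \<Omega>) y + indicator ?D y)" if y: "y \<in> \<Omega>" for y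
      proof (cases "y \<in> ball x r")
        case True
        show ?thesis
        proof (cases "y \<in> double_cone x d \<theta>")
          case cone': True
          have "\<bar>(y - x) \<bullet> d\<bar> \<le> norm (y - x) * norm d" by (rule Cauchy_Schwarz_ineq2)
          then have "\<bar>(y - x) \<bullet> d\<bar> \<le> r" using True nd by (simp add: dist_norm norm_minus_commute)
          then have "\<bar>(y - x) \<bullet> n\<bar> \<le> \<eta> * r"
            using cone' \<theta>(3) order_trans[OF _ mult_left_mono[OF _ less_imp_le[OF \<eta>]]] by (simp add: cone)
          then have "\<bar>(y - x) \<bullet> n\<bar> / r \<le> \<eta>" using r by (simp add: divide_le_eq)
          then show ?thesis using cutoff_bounds(4)[OF r v, of x n y] True y \<eta> cone' by simp
        next
          case False
          then show ?thesis using err_le[OF v, of r y] True y \<eta> by (auto intro: order_trans)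
        qed
      qed (simp add: cutoff_eq_0)
      have "\<bar>Y v r\<bar> \<le> (LINT y|\<Lambda>. \<bar>cutoff_error x n v r y\<bar>)" unfolding Y_def by (rule integral_abs_bound)
      also have "\<dots> \<le> (LINT y|\<Lambda>. 6 * (\<eta> * indicator (ball x r \<inter> \<Omega>) y + indicator ?D y))"
        using iB int_err[OF v] le by (intro integral_mono) (auto simp: space_\<Lambda>)
      also have "\<dots> = 6 * (\<eta> * measure \<Lambda> (ball x r \<inter> \<Omega>) + measure \<Lambda> ?D)"
        using iB ball_sets(1)[of r] ball_sets(2)[of r \<theta>] by simp
      also have "\<dots> \<le> 6 * (\<eta> * (3 * r) + \<eta> * r)"
        using elim \<eta> r by (intro mult_left_mono add_mono) (auto simp: divide_less_eq)
      also have "\<dots> < \<epsilon> * r" using \<epsilon> r by (simp add: \<eta>_def)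
      finally show ?case using r by (simp add: abs_divide divide_less_eq)
    qed
  qed

  have test: "\<forall>r. cutoff x r \<in> borel_measurable borel" "\<forall>r y. \<bar>cutoff x r y\<bar> \<le> 1" "\<forall>r y. y \<notin> ball x r \<longrightarrow> cutoff x r y = 0"
    using cutoff_measurable(1) cut_le cutoff_eq_0(1) by blast+
  have test\<psi>: "\<forall>r. \<psi> (e i) r \<in> borel_measurable borel" "\<forall>r y. \<bar>\<psi> (e i) r y\<bar> \<le> 7"
    "\<forall>r y. y \<notin> ball x r \<longrightarrow> \<psi> (e i) r y = 0" for i
  proof -
    show "\<forall>r. \<psi> (e i) r \<in> borel_measurable borel"
      unfolding \<psi>_def using cutoff_measurable[of x] by simp
    show "\<forall>r y. \<bar>\<psi> (e i) r y\<bar> \<le> 7"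
    proof (intro allI)
      fix r y
      have "\<bar>e i \<bullet> n\<bar> \<le> 1" using Cauchy_Schwarz_ineq2[of "e i" n] ne nn by simp
      then have "\<bar>(e i \<bullet> n) * cutoff x r y\<bar> \<le> 1 * 1" unfolding abs_mult by (intro mult_mono cut_le) auto
      then show "\<bar>\<psi> (e i) r y\<bar> \<le> 7" using err_le[OF ne, of i r y] by (simp add: \<psi>_def)
    qed
  qed (simp add: \<psi>_def cutoff_eq_0)
  have blow_cut: "((\<lambda>r. (I \<mu>' (cutoff x r) - k * X r) / r) \<longlongrightarrow> 0) (at_right 0)"
    and blow_\<psi>: "((\<lambda>r. (I \<mu>' (\<psi> (e i) r) - k * ((e i \<bullet> n) * X r + Y (e i) r)) / r) \<longlongrightarrow> 0) (at_right 0)"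
    if "has_blowup \<mu>' k x" for \<mu>' k i
    using that[unfolded has_blowup_def, rule_format, OF test[rule_format]]
      that[unfolded has_blowup_def, rule_format, OF test\<psi>[rule_format]]
    unfolding int_\<psi> I_def X_def by auto
  obtain r0 where r0: "r0 > 0" "cball x r0 \<subseteq> \<Omega>" using \<Omega> x open_contains_cball by blast
  have small: "\<forall>\<^sub>F r in at_right 0. 0 < r \<and> cball x r \<subseteq> \<Omega>"
    unfolding eventually_at_right_field using r0 by (intro exI[of _ r0]) (auto simp: subset_iff)
  have cut_out: "cutoff x r y = 0" if "y \<notin> cball x r" for r y using that by (intro cutoff_eq_0) simp

  have eq_i: "m i 1 * (e 1 \<bullet> n) + m i 2 * (e 2 \<bullet> n) - E * (e i \<bullet> n) = 0" for i
  proof (rule tendsto_coefficient_0[OF _ _ _ X_lower])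
    let ?Y = "\<lambda>r. m i 1 * Y (e 1) r + m i 2 * Y (e 2) r - E * Y (e i) r"
    have "((\<lambda>r. m i 1 * (Y (e 1) r / r) + m i 2 * (Y (e 2) r / r) - E * (Y (e i) r / r)) \<longlongrightarrow> m i 1 * 0 + m i 2 * 0 - E * 0) (at_right 0)"
      by (intro tendsto_intros Y_lim ne)
    then show "((\<lambda>r. ?Y r / r) \<longlongrightarrow> 0) (at_right 0)" by (simp add: add_divide_distrib diff_divide_distrib)
    have rel: "\<forall>\<^sub>F r in at_right 0. I \<nu> (\<psi> (e i) r) = I (\<mu> i 1) (\<psi> (e 1) r) + I (\<mu> i 2) (\<psi> (e 2) r)"
      using small
    proof eventually_elim
      case (elim r)
      have "I \<nu> (\<lambda>y. \<psi> (e i) r y) = I (\<mu> i 1) (\<lambda>y. \<psi> (e 1) r y) + I (\<mu> i 2) (\<lambda>y. \<psi> (e 2) r y)"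
        unfolding \<psi>_def
      proof (rule stress[where K="cball x r"])
        show "((\<lambda>y. ((y - x) \<bullet> n) * cutoff x r y) has_derivative (\<lambda>v. v \<bullet> n * cutoff x r y + cutoff_error x n v r y)) (at y)" for y
          using elim by (intro cutoff_has_derivative) simp
        show "continuous_on UNIV (\<lambda>y. v \<bullet> n * cutoff x r y + cutoff_error x n v r y)" for v
          by (intro continuous_intros continuous_on_cutoff)
      qed (use elim cut_out in auto)
      then show ?case by simp
    qed
    have "((\<lambda>r. (I \<nu> (\<psi> (e i) r) - E * ((e i \<bullet> n) * X r + Y (e i) r)) / r
        - (I (\<mu> i 1) (\<psi> (e 1) r) - m i 1 * ((e 1 \<bullet> n) * X r + Y (e 1) r)) / r
        - (I (\<mu> i 2) (\<psi> (e 2) r) - m i 2 * ((e 2 \<bullet> n) * X r + Y (e 2) r)) / r) \<longlongrightarrow> 0 - 0 - 0) (at_right 0)"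
      by (intro tendsto_intros blow_\<psi> blow)
    moreover have "\<forall>\<^sub>F r in at_right 0. (I \<nu> (\<psi> (e i) r) - E * ((e i \<bullet> n) * X r + Y (e i) r)) / r
        - (I (\<mu> i 1) (\<psi> (e 1) r) - m i 1 * ((e 1 \<bullet> n) * X r + Y (e 1) r)) / r
        - (I (\<mu> i 2) (\<psi> (e 2) r) - m i 2 * ((e 2 \<bullet> n) * X r + Y (e 2) r)) / r
        = ((m i 1 * (e 1 \<bullet> n) + m i 2 * (e 2 \<bullet> n) - E * (e i \<bullet> n)) * X r + ?Y r) / r"
      using rel by eventually_elim (simp add: diff_divide_distrib[symmetric] algebra_simps)
    ultimately have "((\<lambda>r. ((m i 1 * (e 1 \<bullet> n) + m i 2 * (e 2 \<bullet> n) - E * (e i \<bullet> n)) * X r + ?Y r) / r) \<longlongrightarrow> 0 - 0 - 0) (at_right 0)"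
      by (rule Lim_transform_eventually)
    then show "((\<lambda>r. ((m i 1 * (e 1 \<bullet> n) + m i 2 * (e 2 \<bullet> n) - E * (e i \<bullet> n)) * X r + ?Y r) / r) \<longlongrightarrow> 0) (at_right 0)"
      by simp
  qed simp
  have eq_sym: "m 1 2 - m 2 1 = 0"
  proof (rule tendsto_coefficient_0[where Y="\<lambda>_. 0", OF _ _ _ X_lower])
    have "((\<lambda>r. (I (\<mu> 2 1) (cutoff x r) - m 2 1 * X r) / r - (I (\<mu> 1 2) (cutoff x r) - m 1 2 * X r) / r) \<longlongrightarrow> 0 - 0) (at_right 0)"
      by (intro tendsto_intros blow_cut blow)
    moreover have "\<forall>\<^sub>F r in at_right 0. (I (\<mu> 2 1) (cutoff x r) - m 2 1 * X r) / r - (I (\<mu> 1 2) (cutoff x r) - m 1 2 * X r) / r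
        = ((m 1 2 - m 2 1) * X r + 0) / r"
      using small
    proof eventually_elim
      case (elim r)
      have "I (\<mu> 1 2) (cutoff x r) = I (\<mu> 2 1) (cutoff x r)"
        by (rule sym[OF continuous_on_cutoff(1) compact_cball]) (use elim cut_out in auto)
      then show ?case by (simp add: diff_divide_distrib[symmetric] algebra_simps)
    qed
    ultimately have "((\<lambda>r. ((m 1 2 - m 2 1) * X r + 0) / r) \<longlongrightarrow> 0 - 0) (at_right 0)" by (rule Lim_transform_eventually)
    then show "((\<lambda>r. ((m 1 2 - m 2 1) * X r + 0) / r) \<longlongrightarrow> 0) (at_right 0)" by simp
  qed simp_all
  have eq_trace: "m 1 1 + m 2 2 - 2 * E + 2 * \<Theta> = 0"
  proof (rule tendsto_coefficient_0[where Y="\<lambda>_. 0", OF _ _ _ X_lower])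
    have "((\<lambda>r. 2 * ((I \<nu> (cutoff x r) - E * X r) / r) - 2 * ((I \<zeta> (cutoff x r) - \<Theta> * X r) / r)
        - (I (\<mu> 1 1) (cutoff x r) - m 1 1 * X r) / r - (I (\<mu> 2 2) (cutoff x r) - m 2 2 * X r) / r) \<longlongrightarrow> 2 * 0 - 2 * 0 - 0 - 0) (at_right 0)"
      by (intro tendsto_intros blow_cut blow)
    moreover have "\<forall>\<^sub>F r in at_right 0. 2 * ((I \<nu> (cutoff x r) - E * X r) / r) - 2 * ((I \<zeta> (cutoff x r) - \<Theta> * X r) / r)
        - (I (\<mu> 1 1) (cutoff x r) - m 1 1 * X r) / r - (I (\<mu> 2 2) (cutoff x r) - m 2 2 * X r) / r
        = ((m 1 1 + m 2 2 - 2 * E + 2 * \<Theta>) * X r + 0) / r"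
      using small
    proof eventually_elim
      case (elim r)
      have t: "I (\<mu> 1 1) (cutoff x r) + I (\<mu> 2 2) (cutoff x r) = 2 * I \<nu> (cutoff x r) - 2 * I \<zeta> (cutoff x r)"
        by (rule trace[OF continuous_on_cutoff(1) compact_cball]) (use elim cut_out in auto)
      have "2 * (I \<nu> (cutoff x r) - E * X r) - 2 * (I \<zeta> (cutoff x r) - \<Theta> * X r)
        - (I (\<mu> 1 1) (cutoff x r) - m 1 1 * X r) - (I (\<mu> 2 2) (cutoff x r) - m 2 2 * X r)
        = (m 1 1 + m 2 2 - 2 * E + 2 * \<Theta>) * X r" using t by (simp add: algebra_simps)
      then show ?case by (simp add: diff_divide_distrib[symmetric])
    qed
    ultimately have "((\<lambda>r. ((m 1 1 + m 2 2 - 2 * E + 2 * \<Theta>) * X r + 0) / r) \<longlongrightarrow> 2 * 0 - 2 * 0 - 0 - 0) (at_right 0)"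
      by (rule Lim_transform_eventually)
    then show "((\<lambda>r. ((m 1 1 + m 2 2 - 2 * E + 2 * \<Theta>) * X r + 0) / r) \<longlongrightarrow> 0) (at_right 0)" by simp
  qed simp_all
  have "(cos \<gamma>)\<^sup>2 + (sin \<gamma>)\<^sup>2 = 1" by simp
  from tangent_algebra[OF this, of "m 1 1" "m 1 2" E "m 2 1" "m 2 2" \<Theta>] eq_i[of 1] eq_i[of 2] eq_sym eq_trace
  show "m 1 1 - m 2 2 = - 2 * cos (2 * \<gamma>) * \<Theta>" "m 1 2 = - sin (2 * \<gamma>) * \<Theta>"
    unfolding en by (auto simp: cos_double sin_double)
qed

section \<open>The identity between measures\<close>

lemma signed_integral_measure:
  fixes f :: "'a \<Rightarrow> real"
  assumes \<nu>: "finite_measure \<nu>" "sets \<nu> = sets M" and f: "f \<in> borel_measurable M" and B: "\<And>x. \<bar>f x\<bar> \<le> B"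
  shows "signed_integral M (measure \<nu>) f = integral\<^sup>L \<nu> f"
proof -
  have s: "signed_measure M (measure \<nu>)"
    using finite_measure.signed_measure_measure[OF \<nu>(1)] \<nu>(2) by (simp add: signed_measure_def)
  define Q where "Q i = (if i = 0 then positive_variation M (measure \<nu>)
    else if i = 1 then positive_variation M (\<lambda>A. - measure \<nu> A) else \<nu>)" for i :: nat
  define c :: "nat \<Rightarrow> real" where "c i = (if i = 0 then 1 else - 1)" for i
  have "(\<Sum>i\<in>{0, 1, 2}. c i * integral\<^sup>L (Q i) f) = 0"
  proof (rule integral_linear_relation[where M=M and B=B])
    show "finite_measure (Q i)" for i
      unfolding Q_def
      using finite_positive_variation[OF s] finite_positive_variation[OF signed_measure_uminus[OF s]] \<nu>(1) by presburger
    show "sets (Q i) = sets M" for i using s signed_measure_uminus[OF s] by (simp add: Q_def sets_positive_variation \<nu>)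
    show "(\<Sum>i\<in>{0, 1, 2}. c i * measure (Q i) A) = 0" if "A \<in> sets M" for A
      using Jordan_decomposition[OF s that] by (simp add: c_def Q_def)
  qed (use f B in auto)
  then show ?thesis by (simp add: c_def Q_def signed_integral_def)
qed

lemma compactly_supported_inI:
  assumes "compact K" "K \<subseteq> \<Omega>" "\<And>y. y \<notin> K \<Longrightarrow> \<phi> y = 0"
  shows "compactly_supported_in \<Omega> \<phi>"
proof -
  have "closure {y. \<phi> y \<noteq> 0} \<subseteq> K"
    using assms by (intro closure_minimal compact_imp_closed) auto
  then have "compact (closure {y. \<phi> y \<noteq> 0})"
    using compact_Int_closed[OF assms(1) closed_closure] by (metis Int_absorb1)
  then show ?thesis
    using \<open>closure {y. \<phi> y \<noteq> 0} \<subseteq> K\<close> assms(2) by (auto simp: compactly_supported_in_def)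
qed

lemma limit_stress_energy:
  fixes \<Omega> :: "(real ^ 2) set" and u :: "nat \<Rightarrow> real ^ 2 \<Rightarrow> real ^ 'k" and e :: "2 \<Rightarrow> real ^ 2"
  defines "I \<equiv> signed_integral (restrict_space borel \<Omega>)"
  assumes \<Omega>: "open \<Omega>" and V: "multiwell_potential V" and \<epsilon>: "\<And>n. 0 < \<epsilon> n"
    and sol: "\<And>n. H1_solution \<Omega> V (\<epsilon> n) (u n)"
    and e: "\<And>i j. e i \<bullet> e j = (if i = j then 1 else 0)"
    and \<nu>: "finite_borel_measure_on \<Omega> \<nu>" and \<zeta>: "finite_borel_measure_on \<Omega> \<zeta>"
    and nu_limit: "converges_weakly_to \<Omega> (\<lambda>n. energy_density \<Omega> V (\<epsilon> n) (u n)) \<nu>"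
    and zeta_limit: "converges_weakly_to \<Omega> (\<lambda>n x. V (u n x) / \<epsilon> n) \<zeta>"
    and mu_limit: "\<And>i j. converges_weakly_to_signed \<Omega>
      (\<lambda>n x. \<epsilon> n * (weak_deriv \<Omega> (u n) (e i) x \<bullet> weak_deriv \<Omega> (u n) (e j) x)) (\<mu> i j)"
    and K: "compact K" "K \<subseteq> \<Omega>" and supp: "\<And>y. y \<notin> K \<Longrightarrow> \<phi> y = 0"
  shows "\<lbrakk>\<And>y. (\<phi> has_derivative \<phi>' y) (at y); \<And>v. continuous_on UNIV (\<lambda>y. \<phi>' y v)\<rbrakk> \<Longrightarrow>
      I (measure \<nu>) (\<lambda>y. \<phi>' y (e i)) = I (\<mu> i 1) (\<lambda>y. \<phi>' y (e 1)) + I (\<mu> i 2) (\<lambda>y. \<phi>' y (e 2))"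
    and "continuous_on UNIV \<phi> \<Longrightarrow> I (\<mu> 1 1) \<phi> + I (\<mu> 2 2) \<phi> = 2 * I (measure \<nu>) \<phi> - 2 * I (measure \<zeta>) \<phi>"
    and "continuous_on UNIV \<phi> \<Longrightarrow> I (\<mu> 1 2) \<phi> = I (\<mu> 2 1) \<phi>"
proof -
  have I_measure: "I (measure \<kappa>) \<psi> = integral\<^sup>L \<kappa> \<psi>"
    if \<psi>: "continuous_on UNIV \<psi>" "\<And>y. y \<notin> K \<Longrightarrow> \<psi> y = 0" and \<kappa>: "finite_borel_measure_on \<Omega> \<kappa>" for \<kappa> \<psi>
  proof -
    obtain B where "B \<ge> 0" "\<And>y. \<bar>\<psi> y\<bar> \<le> B" by (rule compact_support_bounded[OF \<psi>(1) K(1) \<psi>(2)]) blast+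
    then show ?thesis
      unfolding I_def using \<kappa> \<psi>(1)
      by (intro signed_integral_measure[where B=B] measurable_restrict_space1 borel_measurable_continuous_onI)
        (auto simp: finite_borel_measure_on_def)
  qed
  have lim: "(\<lambda>n. LINT x:\<Omega>|lebesgue. \<psi> x * energy_density \<Omega> V (\<epsilon> n) (u n) x) \<longlonglongrightarrow> I (measure \<nu>) \<psi>"
      "(\<lambda>n. LINT x:\<Omega>|lebesgue. \<psi> x * (V (u n x) / \<epsilon> n)) \<longlonglongrightarrow> I (measure \<zeta>) \<psi>"
      "(\<lambda>n. LINT x:\<Omega>|lebesgue. \<psi> x * (\<epsilon> n * (weak_deriv \<Omega> (u n) (e i) x \<bullet> weak_deriv \<Omega> (u n) (e j) x))) \<longlonglongrightarrow> I (\<mu> i j) \<psi>"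
    if \<psi>: "continuous_on UNIV \<psi>" "\<And>y. y \<notin> K \<Longrightarrow> \<psi> y = 0" for \<psi> i j
  proof -
    have c: "compactly_supported_in \<Omega> \<psi>" by (rule compactly_supported_inI[OF K]) (rule \<psi>(2))
    have "I (measure \<nu>) \<psi> = integral\<^sup>L \<nu> \<psi>" "I (measure \<zeta>) \<psi> = integral\<^sup>L \<zeta> \<psi>"
      by (rule I_measure[OF \<psi>(1)]; use \<psi>(2) \<nu> \<zeta> in blast)+
    then show "(\<lambda>n. LINT x:\<Omega>|lebesgue. \<psi> x * energy_density \<Omega> V (\<epsilon> n) (u n) x) \<longlonglongrightarrow> I (measure \<nu>) \<psi>"
      "(\<lambda>n. LINT x:\<Omega>|lebesgue. \<psi> x * (V (u n x) / \<epsilon> n)) \<longlonglongrightarrow> I (measure \<zeta>) \<psi>"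
      using nu_limit zeta_limit \<psi>(1) c by (simp_all add: converges_weakly_to_def)
    show "(\<lambda>n. LINT x:\<Omega>|lebesgue. \<psi> x * (\<epsilon> n * (weak_deriv \<Omega> (u n) (e i) x \<bullet> weak_deriv \<Omega> (u n) (e j) x))) \<longlonglongrightarrow> I (\<mu> i j) \<psi>"
      using mu_limit[of i j] \<psi>(1) c by (simp add: converges_weakly_to_signed_def I_def)
  qed
  show "I (measure \<nu>) (\<lambda>y. \<phi>' y (e i)) = I (\<mu> i 1) (\<lambda>y. \<phi>' y (e 1)) + I (\<mu> i 2) (\<lambda>y. \<phi>' y (e 2))"
    if \<phi>': "\<And>y. (\<phi> has_derivative \<phi>' y) (at y)" "\<And>v. continuous_on UNIV (\<lambda>y. \<phi>' y v)"
  proof -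
    have z: "\<phi>' y v = 0" if "y \<notin> K" for y v
      by (rule has_derivative_zero_outside[OF \<phi>'(1), of "- K"])
        (use that K supp in \<open>auto simp: open_Compl compact_imp_closed\<close>)
    have eq: "(LINT x:\<Omega>|lebesgue. \<phi>' x (e i) * energy_density \<Omega> V (\<epsilon> n) (u n) x) =
        (\<Sum>j\<in>UNIV. LINT x:\<Omega>|lebesgue. \<phi>' x (e j) * (\<epsilon> n * (weak_deriv \<Omega> (u n) (e i) x \<bullet> weak_deriv \<Omega> (u n) (e j) x)))" for n
      by (rule stress_energy_identity(1)[where \<phi>=\<phi> and \<phi>'=\<phi>', OF \<Omega> V sol \<epsilon> e K]) (use supp \<phi>' in auto)
    have "(\<lambda>n. \<Sum>j\<in>UNIV. LINT x:\<Omega>|lebesgue. \<phi>' x (e j) * (\<epsilon> n * (weak_deriv \<Omega> (u n) (e i) x \<bullet> weak_deriv \<Omega> (u n) (e j) x)))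
        \<longlonglongrightarrow> (\<Sum>j\<in>UNIV. I (\<mu> i j) (\<lambda>y. \<phi>' y (e j)))"
      by (intro tendsto_sum lim) (auto simp: \<phi>' z)
    moreover have "(\<lambda>n. LINT x:\<Omega>|lebesgue. \<phi>' x (e i) * energy_density \<Omega> V (\<epsilon> n) (u n) x) \<longlonglongrightarrow> I (measure \<nu>) (\<lambda>y. \<phi>' y (e i))"
      by (intro lim) (auto simp: \<phi>' z)
    ultimately have "I (measure \<nu>) (\<lambda>y. \<phi>' y (e i)) = (\<Sum>j\<in>UNIV. I (\<mu> i j) (\<lambda>y. \<phi>' y (e j)))"
      unfolding eq by (rule LIMSEQ_unique[rotated])
    then show ?thesis by (simp add: UNIV_2)
  qed
  assume \<phi>: "continuous_on UNIV \<phi>"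
  have eq: "(\<Sum>j\<in>UNIV. LINT x:\<Omega>|lebesgue. \<phi> x * (\<epsilon> n * (weak_deriv \<Omega> (u n) (e j) x \<bullet> weak_deriv \<Omega> (u n) (e j) x))) =
      2 * (LINT x:\<Omega>|lebesgue. \<phi> x * energy_density \<Omega> V (\<epsilon> n) (u n) x) - 2 * (LINT x:\<Omega>|lebesgue. \<phi> x * (V (u n x) / \<epsilon> n))" for n
    by (rule stress_energy_identity(2)[OF \<Omega> V sol \<epsilon> e K]) (use supp \<phi> in auto)
  have "(\<lambda>n. \<Sum>j\<in>UNIV. LINT x:\<Omega>|lebesgue. \<phi> x * (\<epsilon> n * (weak_deriv \<Omega> (u n) (e j) x \<bullet> weak_deriv \<Omega> (u n) (e j) x)))
      \<longlonglongrightarrow> (\<Sum>j\<in>UNIV. I (\<mu> j j) \<phi>)"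
    by (intro tendsto_sum lim \<phi> supp)
  moreover have "(\<lambda>n. 2 * (LINT x:\<Omega>|lebesgue. \<phi> x * energy_density \<Omega> V (\<epsilon> n) (u n) x)
      - 2 * (LINT x:\<Omega>|lebesgue. \<phi> x * (V (u n x) / \<epsilon> n))) \<longlonglongrightarrow> 2 * I (measure \<nu>) \<phi> - 2 * I (measure \<zeta>) \<phi>"
    by (intro tendsto_intros lim \<phi> supp)
  ultimately have "(\<Sum>j\<in>UNIV. I (\<mu> j j) \<phi>) = 2 * I (measure \<nu>) \<phi> - 2 * I (measure \<zeta>) \<phi>"
    unfolding eq by (rule LIMSEQ_unique)
  then show "I (\<mu> 1 1) \<phi> + I (\<mu> 2 2) \<phi> = 2 * I (measure \<nu>) \<phi> - 2 * I (measure \<zeta>) \<phi>" by (simp add: UNIV_2)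
  from lim(3)[OF \<phi> supp, of 1 2] lim(3)[OF \<phi> supp, of 2 1] show "I (\<mu> 1 2) \<phi> = I (\<mu> 2 1) \<phi>"
    by (simp add: inner_commute LIMSEQ_unique)
qed

lemma borel_measurable_completion_AE:
  assumes f: "f \<in> borel_measurable M" and ae: "AE x in M. f x = g x"
  shows "g \<in> borel_measurable (completion M)"
proof (rule measurableI)
  fix B :: "'b set" assume B: "B \<in> sets borel"
  have "f -` B \<inter> space M \<in> sets (completion M)" using f B by (auto intro: measurable_sets)
  then show "g -` B \<inter> space (completion M) \<in> sets (completion M)"
    by (rule completion.in_sets_AE[rotated]) (use AE_completion[OF ae] AE_space in \<open>auto elim: eventually_elim2\<close>)
qed simp

lemma has_density_quotient:
  fixes g \<Theta> w :: "'a \<Rightarrow> real"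
  assumes Z: "finite_measure Z" "sets Z = sets L" and d: "has_density L \<Theta> (measure Z)"
    and w: "has_density L w \<kappa>" and ae: "AE x in L. w x = g x * \<Theta> x"
  shows "has_density Z g \<kappa>"
proof -
  interpret Z: finite_measure Z by (rule Z)
  obtain f where f: "f \<in> borel_measurable L" "integrable L f" "AE x in L. \<Theta> x = f x"
    "\<And>A. A \<in> sets L \<Longrightarrow> measure Z A = (LINT x:A|L. f x)"
    by (rule has_density_borel_version[OF d]) (rule that)
  obtain v where v: "v \<in> borel_measurable L" "integrable L v" "AE x in L. w x = v x"
    "\<And>A. A \<in> sets L \<Longrightarrow> \<kappa> A = (LINT x:A|L. v x)"
    by (rule has_density_borel_version[OF w]) (rule that)
  note [measurable] = f(1) v(1)
  have f0: "AE x in L. 0 \<le> f x"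
  proof -
    define N where "N = {x \<in> space L. f x < 0}"
    have N [measurable]: "N \<in> sets L" unfolding N_def by measurable
    have i: "integrable L (\<lambda>x. - (indicator N x * f x))"
      using integrable_mult_indicator[OF N f(2)] by simp
    have nn: "AE x in L. 0 \<le> - (indicator N x * f x)" by (auto simp: N_def indicator_def)
    have "(LINT x|L. - (indicator N x * f x)) \<le> 0"
      using f(4)[OF N] measure_nonneg[of Z N] by (simp add: set_lebesgue_integral_def)
    then have "(LINT x|L. - (indicator N x * f x)) = 0" using integral_nonneg_AE[OF nn] by linarith
    then have "AE x in L. - (indicator N x * f x) = 0" using integral_nonneg_eq_0_iff_AE[OF i nn] by simp
    with AE_space show ?thesis by eventually_elim (auto simp: N_def indicator_def split: if_splits)
  qed
  have Zd: "Z = density L (\<lambda>x. ennreal (f x))"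
  proof (rule measure_eqI)
    fix A assume "A \<in> sets Z"
    then have A [measurable]: "A \<in> sets L" by (simp add: Z)
    have "emeasure Z A = ennreal (LINT x|L. f x * indicator A x)"
      by (simp add: Z.emeasure_eq_measure f(4)[OF A] set_lebesgue_integral_def mult.commute)
    also have "\<dots> = (\<integral>\<^sup>+x. ennreal (f x * indicator A x) \<partial>L)"
      using f0 integrable_real_mult_indicator[OF A f(2)]
      by (intro nn_integral_eq_integral[symmetric]) (auto elim!: eventually_mono simp: mult.commute)
    also have "\<dots> = emeasure (density L (\<lambda>x. ennreal (f x))) A"
      using A by (subst emeasure_density) (auto intro!: nn_integral_cong simp: indicator_def)
    finally show "emeasure Z A = emeasure (density L (\<lambda>x. ennreal (f x))) A" .
  qed (simp add: Z)
  define h where "h x = v x / f x" for x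
  have h [measurable]: "h \<in> borel_measurable L" unfolding h_def by measurable
  have hZ [measurable]: "h \<in> borel_measurable Z" using h measurable_cong_sets[OF Z(2) refl] by blast
  have gh: "AE x in Z. h x = g x"
    unfolding Zd using f(3) v(3) ae by (subst AE_density) (auto simp: h_def elim: eventually_elim2)
  have fh: "AE x in L. f x * h x = v x"
    using f(3) v(3) ae by eventually_elim (auto simp: h_def)
  have ih: "integrable Z h"
  proof -
    have "integrable L (\<lambda>x. f x *\<^sub>R h x)"
      using v(2) by (rule integrable_cong_AE_imp) (use fh in \<open>auto elim: eventually_mono\<close>)
    then show ?thesis unfolding Zd using f0 by (subst integrable_density) auto
  qed
  have gm: "g \<in> borel_measurable (completion Z)" by (rule borel_measurable_completion_AE[OF hZ gh])
  show ?thesis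
    unfolding has_density_def
  proof (intro conjI ballI)
    show "integrable (completion Z) g"
      using ih by (intro integrable_cong_AE_imp[OF _ gm AE_completion[OF gh]]) (simp add: integrable_completion)
    fix A assume "A \<in> sets Z"
    then have AZ [measurable]: "A \<in> sets Z" and A [measurable]: "A \<in> sets L" by (simp_all add: Z)
    have "(LINT x:A|completion Z. g x) = (LINT x|completion Z. indicator A x *\<^sub>R h x)"
      unfolding set_lebesgue_integral_def
    proof (rule integral_cong_AE)
      show "(\<lambda>x. indicator A x *\<^sub>R g x) \<in> borel_measurable (completion Z)"
        by (intro borel_measurable_scaleR gm measurable_completion[OF borel_measurable_indicator[OF AZ]])
      show "(\<lambda>x. indicator A x *\<^sub>R h x) \<in> borel_measurable (completion Z)"
        by (rule measurable_completion) measurable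
      show "AE x in completion Z. indicator A x *\<^sub>R g x = indicator A x *\<^sub>R h x"
        using AE_completion[OF gh] by eventually_elim simp
    qed
    also have "\<dots> = (LINT x|Z. indicator A x *\<^sub>R h x)" by (rule integral_completion) measurable
    also have "\<dots> = (LINT x|L. f x *\<^sub>R (indicator A x *\<^sub>R h x))"
      unfolding Zd by (rule integral_density) (use f0 in auto)
    also have "\<dots> = (LINT x:A|L. v x)"
      unfolding set_lebesgue_integral_def by (rule integral_cong_AE) (use fh in \<open>auto elim: eventually_mono\<close>)
    finally show "\<kappa> A = (LINT x:A|completion Z. g x)" using v(4)[OF A] by simp
  qed
qed

lemma has_density_linear:
  fixes f g :: "'a \<Rightarrow> real"
  assumes "has_density M f \<kappa>" "has_density M g \<xi>"
  shows "has_density M (\<lambda>x. a * f x + b * g x) (\<lambda>A. a * \<kappa> A + b * \<xi> A)"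
    and "has_density M (\<lambda>x. complex_of_real (f x) + \<i> * complex_of_real (g x))
      (\<lambda>A. complex_of_real (\<kappa> A) + \<i> * complex_of_real (\<xi> A))"
proof -
  have i: "integrable (completion M) f" "integrable (completion M) g"
    and eq: "\<kappa> A = (LINT x:A|completion M. f x)" "\<xi> A = (LINT x:A|completion M. g x)" if "A \<in> sets M" for A
    using assms that by (auto simp: has_density_def)
  have iA: "set_integrable (completion M) A f" "set_integrable (completion M) A g" if "A \<in> sets M" for A
    unfolding set_integrable_def using that by (intro integrable_mult_indicator i; simp)+
  show "has_density M (\<lambda>x. a * f x + b * g x) (\<lambda>A. a * \<kappa> A + b * \<xi> A)"
    using i[OF sets.empty_sets] eq iA by (auto simp: has_density_def set_integral_add)
  show "has_density M (\<lambda>x. complex_of_real (f x) + \<i> * complex_of_real (g x))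
      (\<lambda>A. complex_of_real (\<kappa> A) + \<i> * complex_of_real (\<xi> A))"
    unfolding has_density_def
  proof (intro conjI ballI)
    show "integrable (completion M) (\<lambda>x. complex_of_real (f x) + \<i> * complex_of_real (g x))"
      using i[OF sets.empty_sets] by (intro Bochner_Integration.integrable_add integrable_mult_right integrable_of_real)
    fix A assume A: "A \<in> sets M"
    have "set_integrable (completion M) A (\<lambda>x. complex_of_real (f x))" "set_integrable (completion M) A (\<lambda>x. complex_of_real (g x))"
      using iA[OF A] by (simp_all add: set_integrable_def scaleR_conv_of_real complex_of_real_integrable_eq flip: of_real_mult)
    then have "(LINT x:A|completion M. complex_of_real (f x) + \<i> * complex_of_real (g x))
      = (LINT x:A|completion M. complex_of_real (f x)) + (LINT x:A|completion M. \<i> * complex_of_real (g x))"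
      by (intro set_integral_add) (auto intro!: set_integrable_mult_right)
    then show "complex_of_real (\<kappa> A) + \<i> * complex_of_real (\<xi> A)
      = (LINT x:A|completion M. complex_of_real (f x) + \<i> * complex_of_real (g x))"
      by (simp add: eq[OF A] set_integral_complex_of_real)
  qed
qed

theorem lemma2:
  fixes \<Omega> :: "(real ^ 2) set"
    and V :: "real ^ 'k \<Rightarrow> real"
    and M0 \<eta>1 :: real
    and \<epsilon> :: "nat \<Rightarrow> real"
    and u :: "nat \<Rightarrow> real ^ 2 \<Rightarrow> real ^ 'k"
    and e :: "2 \<Rightarrow> real ^ 2"
    and \<nu> \<nu>ac \<nu>s \<zeta> \<zeta>ac \<zeta>s \<Lambda> :: "(real ^ 2) measure"
    and \<mu> \<mu>ac \<mu>s :: "2 \<Rightarrow> 2 \<Rightarrow> (real ^ 2) set \<Rightarrow> real"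
    and ee \<Theta> \<gamma> :: "real ^ 2 \<Rightarrow> real"
    and m :: "2 \<Rightarrow> 2 \<Rightarrow> real ^ 2 \<Rightarrow> real"
    and S A B C E :: "(real ^ 2) set"
    and t :: "real ^ 2 \<Rightarrow> real ^ 2"
  assumes domain: "smooth_bounded_domain \<Omega>"
    and potential: "multiwell_potential V"
    and M0: "M0 > 0"
    and eps: "\<And>n. 0 < \<epsilon> n" "\<And>n. \<epsilon> n \<le> 1" "\<epsilon> \<longlonglongrightarrow> 0"
    and solution: "\<And>n. H1_solution \<Omega> V (\<epsilon> n) (u n)"
    and energy_bound: "\<And>n. energy \<Omega> V (\<epsilon> n) (u n) \<le> ennreal M0"
    and orthonormal: "\<And>i j. e i \<bullet> e j = (if i = j then 1 else 0)"
    and measures: "finite_borel_measure_on \<Omega> \<nu>" "finite_borel_measure_on \<Omega> \<zeta>"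
      "\<And>i j. signed_measure (restrict_space borel \<Omega>) (\<mu> i j)"
    and nu_limit: "converges_weakly_to \<Omega> (\<lambda>n. energy_density \<Omega> V (\<epsilon> n) (u n)) \<nu>"
    and zeta_limit: "converges_weakly_to \<Omega> (\<lambda>n x. V (u n x) / \<epsilon> n) \<zeta>"
    and mu_limit: "\<And>i j. converges_weakly_to_signed \<Omega>
      (\<lambda>n x. \<epsilon> n * (weak_deriv \<Omega> (u n) (e i) x \<bullet> weak_deriv \<Omega> (u n) (e j) x)) (\<mu> i j)"
    and clearing: "\<eta>1 > 0" "clearing_out \<Omega> V \<eta>1"
    and S_eq: "S = concentration_set \<Omega> \<nu> \<eta>1"
    and S_props: "closedin (top_of_set \<Omega>) S" "rectifiable1 S" "hausdorff1 S < \<infinity>"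
      "emeasure \<nu> (\<Omega> - S) = 0"
    and Lambda_eq: "\<Lambda> = hausdorff1_restricted \<Omega> S"
    and parts: "finite_borel_measure_on \<Omega> \<nu>ac" "finite_borel_measure_on \<Omega> \<nu>s"
      "finite_borel_measure_on \<Omega> \<zeta>ac" "finite_borel_measure_on \<Omega> \<zeta>s"
    and decompositions: "lebesgue_decomposition \<Lambda> (measure \<nu>) (measure \<nu>ac) (measure \<nu>s)"
      "lebesgue_decomposition \<Lambda> (measure \<zeta>) (measure \<zeta>ac) (measure \<zeta>s)"
      "\<And>i j. lebesgue_decomposition \<Lambda> (\<mu> i j) (\<mu>ac i j) (\<mu>s i j)"
    and densities: "has_density \<Lambda> ee (measure \<nu>ac)" "has_density \<Lambda> \<Theta> (measure \<zeta>ac)"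
      "\<And>i j. has_density \<Lambda> (m i j) (\<mu>ac i j)"
    and A_props: "A \<subseteq> S" "hausdorff1 A = 0"
      "\<And>x. x \<in> S - A \<Longrightarrow> has_density_one S x" "\<And>x. x \<in> S - A \<Longrightarrow> approx_tangent S x (t x)"
    and B_props: "B \<subseteq> S" "hausdorff1 B = 0"
      "vanishes_on \<Lambda> (measure \<nu>s) (S - B)" "vanishes_on \<Lambda> (measure \<zeta>s) (S - B)"
      "\<And>i j. vanishes_on \<Lambda> (\<mu>s i j) (S - B)"
    and C_eq: "C = S - {x. lebesgue_point \<Lambda> \<Theta> x \<and> lebesgue_point \<Lambda> ee x \<and>
      (\<forall>i j. lebesgue_point \<Lambda> (m i j) x)}"
    and E_props: "E = A \<union> B \<union> C" "hausdorff1 E = 0"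
    and angle: "\<And>x. x \<in> S - E \<Longrightarrow> \<gamma> x \<in> {- pi / 2..pi / 2}"
      "\<And>x. x \<in> S - E \<Longrightarrow> t x = cos (\<gamma> x) *\<^sub>R e 1 + sin (\<gamma> x) *\<^sub>R e 2"
  defines "\<omega>ac \<equiv> \<lambda>X. complex_of_real (\<mu>ac 1 1 X - \<mu>ac 2 2 X) - 2 * \<i> * complex_of_real (\<mu>ac 1 2 X)"
  shows "has_density \<zeta>ac (\<lambda>x. - 2 * exp (- 2 * \<i> * complex_of_real (\<gamma> x))) \<omega>ac \<and>
    has_density \<zeta>ac
      (\<lambda>x. - 2 * (complex_of_real (cos (2 * \<gamma> x)) - \<i> * complex_of_real (sin (2 * \<gamma> x)))) \<omega>ac"
proof -
  have \<Omega>: "open \<Omega>" using domain by (simp add: smooth_bounded_domain_def)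
  have S_sub: "S \<subseteq> \<Omega>" and "openin (top_of_set \<Omega>) (\<Omega> - S)"
    using S_props(1) by (auto simp: closedin_def)
  then have "open (\<Omega> - S)" using \<Omega> by (simp add: openin_open_eq)
  then have S_compl: "\<Omega> - S \<in> sets (restrict_space borel \<Omega>)"
    using \<Omega> by (subst sets_restrict_space_iff) auto
  have sets_\<Lambda>: "sets \<Lambda> = sets (restrict_space borel \<Omega>)"
    unfolding Lambda_eq by (rule sets_hausdorff1_restricted)
  have signed: "signed_measure (restrict_space borel \<Omega>) (measure \<nu>)" "signed_measure (restrict_space borel \<Omega>) (measure \<zeta>)"
    using measures(1,2) finite_measure.signed_measure_measure[of \<nu>] finite_measure.signed_measure_measure[of \<zeta>]
    by (simp_all add: finite_borel_measure_on_def signed_measure_def)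
  have "AE x in \<Lambda>. m 1 1 x - m 2 2 x = - 2 * cos (2 * \<gamma> x) * \<Theta> x \<and> m 1 2 x = - sin (2 * \<gamma> x) * \<Theta> x"
    using emeasure_hausdorff1_restricted_cases[of \<Omega> S]
  proof
    assume "\<forall>A. emeasure (hausdorff1_restricted \<Omega> S) A = 0"
    then have "space \<Lambda> \<in> null_sets \<Lambda>" by (auto simp: Lambda_eq null_sets_def)
    then show ?thesis by (rule AE_I') auto
  next
    assume em: "\<forall>A\<in>sets (restrict_space borel \<Omega>). emeasure (hausdorff1_restricted \<Omega> S) A = hausdorff1 (A \<inter> S)"
    interpret hausdorff_base \<Omega> S \<Lambda>
      by standard (use \<Omega> sets_\<Lambda> em S_props(3) in \<open>auto simp: Lambda_eq\<close>)
    have "emeasure \<Lambda> (\<Omega> - S) = 0" using em S_compl by (auto simp: Lambda_eq hausdorff1_empty Int_commute[of _ S])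
    then have "\<Omega> - S \<in> null_sets \<Lambda>" using S_compl sets_\<Lambda> by auto
    then have AE_S: "AE x in \<Lambda>. x \<notin> \<Omega> - S" by (rule AE_not_in)
    have AE_\<mu>: "AE x in \<Lambda>. \<forall>i j. lebesgue_point \<Lambda> (m i j) x \<longrightarrow>
        (\<forall>\<^sub>F r in at_right 0. 0 < measure \<Lambda> (ball x r \<inter> \<Omega>) \<and> measure \<Lambda> (ball x r \<inter> \<Omega>) \<le> 3 * r) \<longrightarrow> has_blowup (\<mu> i j) (m i j x) x"
      unfolding AE_all_countable by (intro allI AE_has_blowup[OF measures(3) decompositions(3) densities(3)])
    from AE_space AE_S AE_not_null[OF E_props(2)] AE_\<mu>
      AE_has_blowup[OF signed(1) decompositions(1) densities(1), of 3]
      AE_has_blowup[OF signed(2) decompositions(2) densities(2), of 3]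
    show ?thesis
    proof eventually_elim
      case (elim x)
      then have x: "x \<in> \<Omega>" "x \<in> S - E" "x \<in> S - A"
        and leb: "lebesgue_point \<Lambda> \<Theta> x" "lebesgue_point \<Lambda> ee x" "\<And>i j. lebesgue_point \<Lambda> (m i j) x"
        using E_props(1) C_eq by (auto simp: space_\<Lambda>)
      note dens = A_props(3)[OF x(3)]
      note ev = has_density_one_measure(2)[OF S_sub dens]
      have tan: "approx_tangent S x (cos (\<gamma> x) *\<^sub>R e 1 + sin (\<gamma> x) *\<^sub>R e 2)"
        using A_props(4)[OF x(3)] unfolding angle(2)[OF x(2)] .
      have blow: "has_blowup (measure \<nu>) (ee x) x" "has_blowup (measure \<zeta>) (\<Theta> x) x" "has_blowup (\<mu> i j) (m i j x) x" for i j
        using elim leb ev by auto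
      note lim = limit_stress_energy[OF \<Omega> potential eps(1) solution _ measures(1,2) nu_limit zeta_limit mu_limit]
      let ?I = "signed_integral (restrict_space borel \<Omega>)"
      have stress: "?I (measure \<nu>) (\<lambda>y. \<phi>' y (e i)) = ?I (\<mu> i 1) (\<lambda>y. \<phi>' y (e 1)) + ?I (\<mu> i 2) (\<lambda>y. \<phi>' y (e 2))"
        if "\<And>y. (\<phi> has_derivative \<phi>' y) (at y)" "\<And>v. continuous_on UNIV (\<lambda>y. \<phi>' y v)"
          "compact K" "K \<subseteq> \<Omega>" "\<And>y. y \<notin> K \<Longrightarrow> \<phi> y = 0" for \<phi> \<phi>' K i
        by (rule lim(1)[where \<phi>=\<phi> and K=K]) (use orthonormal that in auto)
      have trace: "?I (\<mu> 1 1) \<phi> + ?I (\<mu> 2 2) \<phi> = 2 * ?I (measure \<nu>) \<phi> - 2 * ?I (measure \<zeta>) \<phi>"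
        and comm: "?I (\<mu> 1 2) \<phi> = ?I (\<mu> 2 1) \<phi>"
        if "continuous_on UNIV \<phi>" "compact K" "K \<subseteq> \<Omega>" "\<And>y. y \<notin> K \<Longrightarrow> \<phi> y = 0" for \<phi> K
        by (rule lim(2,3)[where K=K]; use orthonormal that in auto)+
      have "m 1 1 x - m 2 2 x = - 2 * cos (2 * \<gamma> x) * \<Theta> x" "m 1 2 x = - sin (2 * \<gamma> x) * \<Theta> x"
        by (rule tangential_identity[where \<Omega>=\<Omega> and S=S and \<Lambda>=\<Lambda> and x=x and e=e and \<gamma>="\<gamma> x" and \<mu>=\<mu> and \<nu>="measure \<nu>"
            and \<zeta>="measure \<zeta>" and E="ee x" and \<Theta>="\<Theta> x" and m="\<lambda>i j. m i j x"];
          fact hausdorff_base_axioms x(1) S_sub orthonormal dens tan blow stress trace comm)+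
      then show ?case by simp
    qed
  qed
  then have AE1: "AE x in \<Lambda>. 1 * m 1 1 x + - 1 * m 2 2 x = (- 2 * cos (2 * \<gamma> x)) * \<Theta> x"
    and AE2: "AE x in \<Lambda>. - 2 * m 1 2 x + 0 * m 1 2 x = (2 * sin (2 * \<gamma> x)) * \<Theta> x"
    by (eventually_elim, simp)+
  have \<zeta>ac: "finite_measure \<zeta>ac" "sets \<zeta>ac = sets \<Lambda>"
    using parts(3) sets_\<Lambda> by (simp_all add: finite_borel_measure_on_def)
  have "has_density \<zeta>ac (\<lambda>x. - 2 * cos (2 * \<gamma> x)) (\<lambda>X. 1 * \<mu>ac 1 1 X + - 1 * \<mu>ac 2 2 X)"
    by (rule has_density_quotient[OF \<zeta>ac densities(2) has_density_linear(1)[OF densities(3) densities(3)] AE1])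
  moreover have "has_density \<zeta>ac (\<lambda>x. 2 * sin (2 * \<gamma> x)) (\<lambda>X. - 2 * \<mu>ac 1 2 X + 0 * \<mu>ac 1 2 X)"
    by (rule has_density_quotient[OF \<zeta>ac densities(2) has_density_linear(1)[OF densities(3) densities(3)] AE2])
  ultimately have "has_density \<zeta>ac (\<lambda>x. complex_of_real (- 2 * cos (2 * \<gamma> x)) + \<i> * complex_of_real (2 * sin (2 * \<gamma> x)))
      (\<lambda>X. complex_of_real (1 * \<mu>ac 1 1 X + - 1 * \<mu>ac 2 2 X) + \<i> * complex_of_real (- 2 * \<mu>ac 1 2 X + 0 * \<mu>ac 1 2 X))"
    by (rule has_density_linear(2))
  moreover have "(\<lambda>X. complex_of_real (1 * \<mu>ac 1 1 X + - 1 * \<mu>ac 2 2 X) + \<i> * complex_of_real (- 2 * \<mu>ac 1 2 X + 0 * \<mu>ac 1 2 X)) = \<omega>ac"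
    by (simp add: \<omega>ac_def fun_eq_iff)
  moreover have "(\<lambda>x. complex_of_real (- 2 * cos (2 * \<gamma> x)) + \<i> * complex_of_real (2 * sin (2 * \<gamma> x)))
      = (\<lambda>x. - 2 * (complex_of_real (cos (2 * \<gamma> x)) - \<i> * complex_of_real (sin (2 * \<gamma> x))))"
    by (simp add: fun_eq_iff algebra_simps)
  ultimately have res: "has_density \<zeta>ac
      (\<lambda>x. - 2 * (complex_of_real (cos (2 * \<gamma> x)) - \<i> * complex_of_real (sin (2 * \<gamma> x)))) \<omega>ac" by simp
  moreover have "exp (- 2 * \<i> * complex_of_real y) = complex_of_real (cos (2 * y)) - \<i> * complex_of_real (sin (2 * y))" for y
    using cis_conv_exp[of "- (2 * y)"] by (simp add: cis.code complex_eq_iff mult_ac)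
  ultimately show ?thesis by simp
qed

end
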